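(* Let $F$ be a global function field with exact constant field $\mathbb{F}_q$ and let $n$ be a positive integer coprime to $q$. Let $E'|F$ be an abelian extension containing an intermediate field $F'$ such that $F'|F$ is a constant field extension and $\mu_n\subseteq F'$, and let $\mathfrak{m}$ be an effective divisor of $F$ such that $E'|F$ is unramified outside $\mathfrak{m}$. Suppose that $E'|F'$ is cyclic of degree dividing $n$. Let $D\in\mathcal{D}_{\mathfrak{m}}(F)$. Then $A_{E'|F}(D)$ is described by the following expression. There is an extension $\sigma$ of the Frobenius automorphism $\varphi$ to $E'$ and $y\in E'$ such that $y^n\in F'_{n,\mathfrak{m}}$ and $y^n$ is coprime to $\mathrm{Con}_{F'|F}(D)$. Let $h=\sigma^{-1}(y)^q\,y^{-1}$. Then $h\in F'^\times$ is coprime to $\mathrm{Con}_{F'|F}(D)$ and $$A_{E'|F}(D)=\tau_D\circ\sigma^{\deg D}.$$ Here $\tau_D\in\mathrm{Gal}(E'|F')$ is defined by $$\tau_D(y)\,y^{-1}=h(\mathrm{Con}_{F'|F}(D))\in\mu_n,$$ where $h(\mathrm{Con}_{F'|F}(D))$ is the evaluation of the function $h$ at the divisor $\mathrm{Con}_{F'|F}(D)$.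
   Context: A global function field is the function field of an irreducible smooth projective curve over a finite field. All extensions are finite, separable and inside a fixed algebraic closure $\bar F$; $\mu_n$ is the group of $n$-th roots of unity in $\bar F$. $\mathrm{Con}_{F'|F}$ is the conorm of divisors. A function and a divisor are coprime if the support of the principal divisor of the function is disjoint from the support of the divisor. $E'|F$ is unramified outside $\mathfrak{m}$ if it is unramified at all places of $F$ outside $\mathrm{supp}(\mathfrak{m})$. $\mathcal{D}_{\mathfrak{m}}(F)$ is the group of divisors of $F$ with support disjoint from $\mathrm{supp}(\mathfrak{m})$. For a place $\mathfrak{p}$ of $F$ unramified in $E'$, $\sigma_{\mathfrak{p}}\in\mathrm{Gal}(E'|F)$ is the unique automorphism with $\sigma_{\mathfrak{p}}(x)\equiv x^{q^{\deg\mathfrak{p}}}\bmod\mathfrak{q}$ for all $x\in\mathcal{O}_{\mathfrak{q}}$ (the valuation ring of $\mathfrak{q}$) and all places $\mathfrak{q}$ of $E'$ above $\mathfrak{p}$; the Artin map is $A_{E'|F}:\mathcal{D}_{\mathfrak{m}}(F)\to\mathrm{Gal}(E'|F)$, $D\mapsto\prod_{\mathfrak{p}}\sigma_{\mathfrak{p}}^{\mathrm{ord}_{\mathfrak{p}}(D)}$. Frobenius automorphism: if $\mathbb{F}_{q^r}$ is the exact constant field of the constant field extension $F'$ of $F$, then $\varphi\in\mathrm{Gal}(F'|F)$ is the unique element restricting to $x\mapsto x^q$ on $\mathbb{F}_{q^r}$. Generalized Selmer group: $F'_{n,\mathfrak{m}}=\{f\in F'^\times \mid \mathrm{ord}_{\mathfrak{p}}(f)\equiv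 0\bmod n$ for all places $\mathfrak{p}$ of $F'$ not lying above a place in $\mathrm{supp}(\mathfrak{m})\}$. Evaluation: for $f\in F'^\times$ coprime to a divisor $G$ of $F'$, $f(G)=\prod_{\mathfrak{p}\in\mathrm{supp}(G)}\mathrm{N}_{F'_{\mathfrak{p}}|\mathbb{F}_{q^r}}(f_{\mathfrak{p}})^{\mathrm{ord}_{\mathfrak{p}}(G)}$, where $F'_{\mathfrak{p}}=\mathcal{O}_{\mathfrak{p}}/\mathfrak{p}$ is the residue field, $f_{\mathfrak{p}}$ the image of $f$ in it, and $\mathrm{N}$ the field norm. *)

theory Defs
  imports "HOL-Algebra.Algebra" "HOL-Algebra.Algebraic_Closure_Type" "HOL-Algebra.Bij"
    "HOL-Number_Theory.Cong"
begin

section \<open>Fields inside a fixed ambient field\<close>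

text \<open>
  The ambient field (in applications an algebraic closure of the base field) is a type of class
  field, viewed as a ring structure by the library function \<open>ring_of_type_algebra\<close>.
  All fields, valuation rings etc. are subsets of it; \<open>sub K\<close> is the ring structure on \<open>K\<close>.
\<close>

abbreviation \<Omega> :: "'a::field ring" where
  "\<Omega> \<equiv> ring_of_type_algebra"

abbreviation sub :: "'a::field set \<Rightarrow> 'a ring" where
  "sub K \<equiv> \<Omega>\<lparr>carrier := K\<rparr>"

definition roots_of_unity :: "nat \<Rightarrow> 'a::field set" where
  "roots_of_unity n = {z. z ^ n = 1}"

text \<open>
  Automorphisms of \<open>L\<close> are extensional functions on the carrier of \<open>L\<close>; the group operation of
  \<open>BijGroup\<close> is composition, \<open>g \<otimes> f = g \<circ> f\<close>.
\<close>

definition gal_group :: "('r, 'm) ring_scheme \<Rightarrow> 'r set \<Rightarrow> ('r \<Rightarrow> 'r) monoid" where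
  "gal_group L K = (BijGroup (carrier L))
     \<lparr>carrier := {g \<in> Bij (carrier L). g \<in> ring_hom L L \<and> (\<forall>x\<in>K. g x = x)}\<rparr>"

abbreviation Gal :: "'a::field set \<Rightarrow> 'a set \<Rightarrow> ('a \<Rightarrow> 'a) monoid" where
  "Gal E F \<equiv> gal_group (sub E) F"

definition galois_extension :: "'a::field set \<Rightarrow> 'a set \<Rightarrow> bool" where
  "galois_extension E F \<longleftrightarrow> subfield E \<Omega> \<and> subfield F \<Omega> \<and> F \<subseteq> E \<and>
     ring.finite_dimension \<Omega> F E \<and> {x \<in> E. \<forall>g\<in>carrier (Gal E F). g x = x} = F"

definition abelian_extension :: "'a::field set \<Rightarrow> 'a set \<Rightarrow> bool" where
  "abelian_extension E F \<longleftrightarrow> galois_extension E F \<and> comm_group (Gal E F)"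

definition cyclic_extension :: "'a::field set \<Rightarrow> 'a set \<Rightarrow> bool" where
  "cyclic_extension E F \<longleftrightarrow> galois_extension E F \<and> cyclic_group (Gal E F)"

text \<open>
  The norm of a finite Galois extension \<open>L\<close> of \<open>K\<close>, as the product of the conjugates.
  It is only used for extensions of finite fields, which are always Galois.
\<close>

definition field_norm :: "('r, 'm) ring_scheme \<Rightarrow> 'r set \<Rightarrow> 'r \<Rightarrow> 'r" where
  "field_norm L K x = finprod L (\<lambda>g. g x) (carrier (gal_group L K))"


section \<open>Global function fields\<close>

text \<open>
  \<open>F\<close> is an algebraic function field of one variable over the finite field \<open>k\<close>: a finite
  extension of a rational function field \<open>k(x)\<close>. These are exactly the function fields of
  irreducible smooth projective curves over \<open>k\<close>; \<open>k\<close> need not yet be the exact constant field.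
\<close>

definition global_function_field :: "'a::field set \<Rightarrow> 'a set \<Rightarrow> bool" where
  "global_function_field k F \<longleftrightarrow> subfield k \<Omega> \<and> finite k \<and> subfield F \<Omega> \<and> k \<subseteq> F \<and>
     (\<exists>x\<in>F. (ring.transcendental \<Omega> over k) x \<and>
        ring.finite_dimension \<Omega> (generate_field \<Omega> (insert x k)) F)"

definition exact_const_field :: "'a::field set \<Rightarrow> 'a set \<Rightarrow> 'a set" where
  "exact_const_field k K = {z \<in> K. (ring.algebraic \<Omega> over k) z}"

definition const_field_extension :: "'a::field set \<Rightarrow> 'a set \<Rightarrow> 'a set \<Rightarrow> bool" where
  "const_field_extension k F F' \<longleftrightarrow>
     (\<exists>l. subfield l \<Omega> \<and> k \<subseteq> l \<and> (\<forall>z\<in>l. (ring.algebraic \<Omega> over k) z) \<and>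
        F' = generate_field \<Omega> (F \<union> l))"

definition frobenius_aut :: "'a::field set \<Rightarrow> 'a set \<Rightarrow> 'a set \<Rightarrow> 'a \<Rightarrow> 'a" where
  "frobenius_aut k F F' = (THE \<phi>. \<phi> \<in> carrier (Gal F' F) \<and>
     (\<forall>x\<in>exact_const_field k F'. \<phi> x = x ^ card k))"


section \<open>Places\<close>

text \<open>
  A place of \<open>K\<close> is represented by its valuation ring. Over a finite field of constants, every
  valuation ring contains all constants, since nonzero constants are roots of unity.
\<close>

definition places :: "'a::field set \<Rightarrow> 'a set set" where
  "places K = {\<O>. subring \<O> \<Omega> \<and> \<O> \<subset> K \<and> (\<forall>z\<in>K. z \<in> \<O> \<or> inverse z \<in> \<O>)}"

definition max_ideal :: "'a::field set \<Rightarrow> 'a set" where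
  "max_ideal \<O> = \<O> - Units (sub \<O>)"

text \<open>The normalized discrete valuation: write \<open>f = t\<^sup>m u\<close> with a uniformizer \<open>t\<close> and a unit \<open>u\<close>.\<close>

definition ord_at :: "'a::field set \<Rightarrow> 'a \<Rightarrow> int" where
  "ord_at \<O> f = (THE m. \<exists>t\<in>\<O>. max_ideal \<O> = (\<lambda>x. t * x) ` \<O> \<and>
     (\<exists>u\<in>Units (sub \<O>). f = t powi m * u))"

definition residue_field :: "'a::field set \<Rightarrow> 'a set ring" where
  "residue_field \<O> = sub \<O> Quot max_ideal \<O>"

definition residue :: "'a::field set \<Rightarrow> 'a \<Rightarrow> 'a set" where
  "residue \<O> f = max_ideal \<O> +>\<^bsub>sub \<O>\<^esub> f"

definition place_degree :: "'a::field set \<Rightarrow> 'a set \<Rightarrow> nat" where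
  "place_degree k \<O> =
     ring.dim (residue_field \<O>) (residue \<O> ` k) (carrier (residue_field \<O>))"

definition places_above :: "'a::field set \<Rightarrow> 'a set \<Rightarrow> 'a set \<Rightarrow> 'a set set" where
  "places_above F E \<pp> = {\<qq> \<in> places E. \<qq> \<inter> F = \<pp>}"

definition ramification_index :: "'a::field set \<Rightarrow> 'a set \<Rightarrow> 'a set \<Rightarrow> int" where
  "ramification_index F \<qq> \<pp> = (THE e. \<forall>x\<in>F - {0}. ord_at \<qq> x = e * ord_at \<pp> x)"

definition unramified_at :: "'a::field set \<Rightarrow> 'a set \<Rightarrow> 'a set \<Rightarrow> bool" where
  "unramified_at F E \<pp> \<longleftrightarrow> (\<forall>\<qq>\<in>places_above F E \<pp>. ramification_index F \<qq> \<pp> = 1)"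


section \<open>Divisors\<close>

text \<open>
  Divisors are elements of the free abelian group on the places; \<open>Poly_Mapping.lookup D \<pp>\<close> is
  the order of \<open>D\<close> at \<open>\<pp>\<close> and \<open>Poly_Mapping.keys D\<close> is the support of \<open>D\<close>.
\<close>

abbreviation divisors :: "'a::field set \<Rightarrow> ('a set \<Rightarrow>\<^sub>0 int) set" where
  "divisors K \<equiv> carrier (free_Abelian_group (places K))"

definition effective :: "('b \<Rightarrow>\<^sub>0 int) \<Rightarrow> bool" where
  "effective D \<longleftrightarrow> (\<forall>\<pp>. Poly_Mapping.lookup D \<pp> \<ge> 0)"

definition divisors_prime_to :: "'a::field set \<Rightarrow> ('a set \<Rightarrow>\<^sub>0 int) \<Rightarrow> ('a set \<Rightarrow>\<^sub>0 int) set" where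
  "divisors_prime_to K \<mm> =
     {D \<in> divisors K. Poly_Mapping.keys D \<inter> Poly_Mapping.keys \<mm> = {}}"

definition div_degree :: "'a::field set \<Rightarrow> ('a set \<Rightarrow>\<^sub>0 int) \<Rightarrow> int" where
  "div_degree k D =
     (\<Sum>\<pp>\<in>Poly_Mapping.keys D. Poly_Mapping.lookup D \<pp> * int (place_degree k \<pp>))"

definition conorm :: "'a::field set \<Rightarrow> 'a set \<Rightarrow> ('a set \<Rightarrow>\<^sub>0 int) \<Rightarrow> ('a set \<Rightarrow>\<^sub>0 int)" where
  "conorm F F' = frag_extend (\<lambda>\<pp>. \<Sum>\<qq>\<in>places_above F F' \<pp>.
     frag_cmul (ramification_index F \<qq> \<pp>) (frag_of \<qq>))"

definition principal_support :: "'a::field set \<Rightarrow> 'a \<Rightarrow> 'a set set" where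
  "principal_support K f = {\<pp> \<in> places K. ord_at \<pp> f \<noteq> 0}"

definition coprime_to_div :: "'a::field set \<Rightarrow> 'a \<Rightarrow> ('a set \<Rightarrow>\<^sub>0 int) \<Rightarrow> bool" where
  "coprime_to_div K f G \<longleftrightarrow> principal_support K f \<inter> Poly_Mapping.keys G = {}"

text \<open>
  The norm of a residue class is an element of the image of the constant field \<open>C\<close> in the residue
  field; \<open>residue_norm\<close> is the constant in \<open>C\<close> itself, along the isomorphism of \<open>C\<close> onto its image.
\<close>

definition residue_norm :: "'a::field set \<Rightarrow> 'a set \<Rightarrow> 'a \<Rightarrow> 'a" where
  "residue_norm C \<O> f = (THE c. c \<in> C \<and>
     residue \<O> c = field_norm (residue_field \<O>) (residue \<O> ` C) (residue \<O> f))"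

definition eval_at_div :: "'a::field set \<Rightarrow> 'a \<Rightarrow> ('a set \<Rightarrow>\<^sub>0 int) \<Rightarrow> 'a" where
  "eval_at_div C f G =
     (\<Prod>\<pp>\<in>Poly_Mapping.keys G. residue_norm C \<pp> f powi Poly_Mapping.lookup G \<pp>)"

definition selmer :: "nat \<Rightarrow> 'a::field set \<Rightarrow> ('a set \<Rightarrow>\<^sub>0 int) \<Rightarrow> 'a set \<Rightarrow> 'a set" where
  "selmer n F \<mm> F' = {f \<in> F' - {0}. \<forall>\<qq>\<in>places F'.
     (\<forall>\<pp>\<in>Poly_Mapping.keys \<mm>. \<qq> \<notin> places_above F F' \<pp>) \<longrightarrow> [ord_at \<qq> f = 0] (mod int n)}"


section \<open>The Artin map\<close>

definition artin_symbol :: "'a::field set \<Rightarrow> 'a set \<Rightarrow> 'a set \<Rightarrow> 'a set \<Rightarrow> 'a \<Rightarrow> 'a" where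
  "artin_symbol k F E \<pp> = (THE s. s \<in> carrier (Gal E F) \<and>
     (\<forall>\<qq>\<in>places_above F E \<pp>. \<forall>x\<in>\<qq>.
        s x - x ^ (card k ^ place_degree k \<pp>) \<in> max_ideal \<qq>))"

definition artin_map :: "'a::field set \<Rightarrow> 'a set \<Rightarrow> 'a set \<Rightarrow> ('a set \<Rightarrow>\<^sub>0 int) \<Rightarrow> 'a \<Rightarrow> 'a" where
  "artin_map k F E D = finprod (Gal E F)
     (\<lambda>\<pp>. artin_symbol k F E \<pp> [^]\<^bsub>Gal E F\<^esub> Poly_Mapping.lookup D \<pp>)
     (Poly_Mapping.keys D)"

end

theory Submission
  imports Defs
begin

text \<open>
  Let \<open>\<psi> = \<sigma>\<^sup>-\<^sup>1\<close> and let \<open>y\<close> be a Kummer generator of \<open>E'|F'\<close>, rescaled by an element of \<open>F'\<close> to be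
  a unit at all places above \<open>D\<close>. For a place \<open>P\<close> of degree \<open>d\<close> in the support of \<open>D\<close>, the
  automorphism \<open>\<tau> = \<sigma>\<^sub>P \<psi>\<^sup>d\<close> fixes \<open>F'\<close>, so \<open>\<tau>(y) = \<omega> y\<close> with a constant \<open>\<omega>\<close>. Modulo a place above
  \<open>P\<close>, \<open>\<omega>\<close> is \<open>\<psi>\<^sup>d(y)\<close> to the power \<open>q\<^sup>d\<close>, divided by \<open>y\<close>. This quotient telescopes to the product
  over \<open>i < d\<close> of \<open>\<psi>\<^sup>i(h)\<close> to the power \<open>q\<^sup>i\<close>, which is congruent to the product of the residue norms
  of \<open>h\<close> over the places of \<open>F'\<close> above \<open>P\<close>, because those places are the conjugates of one of them
  under powers of \<open>\<psi>\<close>. Both sides are constants, so they agree. The theorem follows by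
  multiplicativity in \<open>D\<close>.

  A place is only given as a proper valuation ring. Over a finite constant field a counting argument
  shows that it is discrete with finite residue field; places are extended by Chevalley's argument
  and the existence of Frobenius elements comes from transitivity of the Galois group.
\<close>

section \<open>Subfields and valuation rings\<close>

text \<open>Residue fields of different places have no common ambient field, so every identity is
  carried as a congruence modulo a maximal ideal and becomes an equation only between constants,
  where a difference lying in a maximal ideal must vanish. The Frobenius of F' over F is global. It
  is compared with a place P of degree d by writing integral elements in coordinates over the
  constants C of F', using traces and the characters of the group of nonzero constants. This yields
  the splitting of P: with r = [C : k] there are gcd d r places of F' above P, permuted cyclically
  by \<sigma>, each of residue degree lcm d r over k. The d telescoping factors are indexed by i + r
  * j mod d, where i < gcd d r runs through the places and j < d / gcd d r through the conjugates
  inside one residue norm. So a single product of length d contains all residue norms at once. The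
  exponent q in h compensates for \<psi>: an automorphism over F' that multiplies y by \<omega>
  multiplies \<psi> y by \<psi> \<omega>, whose q-th power is \<omega> again, so h is fixed.\<close>

lemma Omega_simps [simp]:
  "carrier (\<Omega> :: 'a::field ring) = UNIV"
  "x \<otimes>\<^bsub>(\<Omega> :: 'a::field ring)\<^esub> y = x * y"
  "x \<oplus>\<^bsub>(\<Omega> :: 'a::field ring)\<^esub> y = x + y"
  "\<one>\<^bsub>(\<Omega> :: 'a::field ring)\<^esub> = 1"
  "\<zero>\<^bsub>(\<Omega> :: 'a::field ring)\<^esub> = 0"
  by (simp_all add: ring_of_type_algebra_def)

lemma Omega_field: "Ring.field (\<Omega> :: 'a::field ring)"
  by (rule field_from_type_algebra)

lemma Omega_ring: "ring (\<Omega> :: 'a::field ring)"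
  by (rule ring_from_type_algebra)

lemma Omega_a_inv [simp]: "\<ominus>\<^bsub>(\<Omega> :: 'a::field ring)\<^esub> x = - x"
proof -
  interpret ring "\<Omega> :: 'a ring" by (rule Omega_ring)
  show ?thesis by (rule minus_equality) auto
qed

lemma Omega_m_inv [simp]: "x \<noteq> 0 \<Longrightarrow> inv\<^bsub>(\<Omega> :: 'a::field ring)\<^esub> x = inverse x"
proof -
  assume "x \<noteq> 0"
  interpret Ring.field "\<Omega> :: 'a ring" by (rule Omega_field)
  show ?thesis by (rule comm_inv_char) (use \<open>x \<noteq> 0\<close> in auto)
qed

lemma subring_OmegaD:
  assumes "subring K (\<Omega> :: 'a::field ring)"
  shows "0 \<in> K" "1 \<in> K" "x \<in> K \<Longrightarrow> - x \<in> K"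
    "x \<in> K \<Longrightarrow> y \<in> K \<Longrightarrow> x + y \<in> K" "x \<in> K \<Longrightarrow> y \<in> K \<Longrightarrow> x * y \<in> K"
    "x \<in> K \<Longrightarrow> y \<in> K \<Longrightarrow> x - y \<in> K" "x \<in> K \<Longrightarrow> x ^ n \<in> K"
proof -
  interpret ring "\<Omega> :: 'a ring" by (rule Omega_ring)
  show *: "0 \<in> K" "1 \<in> K" "\<And>x. x \<in> K \<Longrightarrow> - x \<in> K"
    "\<And>x y. x \<in> K \<Longrightarrow> y \<in> K \<Longrightarrow> x + y \<in> K" "\<And>x y. x \<in> K \<Longrightarrow> y \<in> K \<Longrightarrow> x * y \<in> K"
    using subringE[OF assms] by auto
  show "x \<in> K \<Longrightarrow> y \<in> K \<Longrightarrow> x - y \<in> K" using *(3,4) by (metis diff_conv_add_uminus)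
  show "x \<in> K \<Longrightarrow> x ^ n \<in> K" by (induction n) (use * in auto)
qed

lemma subring_OmegaI:
  assumes "1 \<in> K" "\<And>x y. x \<in> K \<Longrightarrow> y \<in> K \<Longrightarrow> x - y \<in> K" "\<And>x y. x \<in> K \<Longrightarrow> y \<in> K \<Longrightarrow> x * y \<in> K"
  shows "subring K (\<Omega> :: 'a::field ring)"
proof -
  interpret ring "\<Omega> :: 'a ring" by (rule Omega_ring)
  have 0: "0 \<in> K" using assms(1,2) by (metis diff_self)
  have m: "- x \<in> K" if "x \<in> K" for x using assms(2)[OF 0 that] by simp
  show ?thesis
    by (rule subringI) (use assms m in \<open>auto, metis diff_minus_eq_add\<close>)
qed

lemma subfield_OmegaD:
  assumes "subfield K (\<Omega> :: 'a::field ring)"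
  shows "0 \<in> K" "1 \<in> K" "x \<in> K \<Longrightarrow> - x \<in> K"
    "x \<in> K \<Longrightarrow> y \<in> K \<Longrightarrow> x + y \<in> K" "x \<in> K \<Longrightarrow> y \<in> K \<Longrightarrow> x * y \<in> K"
    "x \<in> K \<Longrightarrow> y \<in> K \<Longrightarrow> x - y \<in> K" "x \<in> K \<Longrightarrow> x ^ n \<in> K"
    "x \<in> K \<Longrightarrow> inverse x \<in> K" "x \<in> K \<Longrightarrow> y \<in> K \<Longrightarrow> x / y \<in> K"
    "x \<in> K \<Longrightarrow> x powi m \<in> K"
proof -
  interpret Ring.field "\<Omega> :: 'a ring" by (rule Omega_field)
  note r = subring_OmegaD[OF subfieldE(1)[OF assms]]
  show "0 \<in> K" "1 \<in> K" "x \<in> K \<Longrightarrow> - x \<in> K"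
    "x \<in> K \<Longrightarrow> y \<in> K \<Longrightarrow> x + y \<in> K" "x \<in> K \<Longrightarrow> y \<in> K \<Longrightarrow> x * y \<in> K"
    "x \<in> K \<Longrightarrow> y \<in> K \<Longrightarrow> x - y \<in> K" "x \<in> K \<Longrightarrow> x ^ n \<in> K"
    by (auto intro: r)
  show i: "\<And>x. x \<in> K \<Longrightarrow> inverse x \<in> K"
  proof -
    fix x assume x: "x \<in> K" show "inverse x \<in> K"
    proof (cases "x = 0")
      case False
      then show ?thesis using subfield_m_inv(1)[OF assms, of x] x by simp
    qed (use x in auto)
  qed
  show "x \<in> K \<Longrightarrow> y \<in> K \<Longrightarrow> x / y \<in> K"
    unfolding divide_inverse by (auto intro: i r)
  show "x \<in> K \<Longrightarrow> x powi m \<in> K"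
    unfolding power_int_def by (auto intro: i r)
qed

lemma subfield_OmegaI:
  assumes "1 \<in> K" "\<And>x y. x \<in> K \<Longrightarrow> y \<in> K \<Longrightarrow> x - y \<in> K" "\<And>x y. x \<in> K \<Longrightarrow> y \<in> K \<Longrightarrow> x * y \<in> K"
    "\<And>x. x \<in> K \<Longrightarrow> x \<noteq> 0 \<Longrightarrow> inverse x \<in> K"
  shows "subfield K (\<Omega> :: 'a::field ring)"
proof -
  interpret Ring.field "\<Omega> :: 'a ring" by (rule Omega_field)
  have s: "subring K \<Omega>" by (rule subring_OmegaI) (use assms in auto)
  interpret subcring K \<Omega> by (rule subcringI[OF s]) (auto simp: mult.commute)
  show ?thesis
  proof (rule subfieldI)
    show "subcring K \<Omega>" ..
    have "x \<in> Units (sub K)" if "x \<in> K" "x \<noteq> 0" for x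
      using that assms(4)[OF that] by (auto simp: Units_def intro!: bexI[of _ "inverse x"])
    moreover have "Units (sub K) \<subseteq> K - {0}"
      by (auto simp: Units_def)
    ultimately show "Units (sub K) = K - {\<zero>\<^bsub>\<Omega>\<^esub>}"
      by (simp, blast)
  qed
qed

lemma sum_in_subring:
  assumes "subring K (\<Omega> :: 'a::field ring)" "\<And>i. i \<in> I \<Longrightarrow> f i \<in> K"
  shows "sum f I \<in> K" "prod f I \<in> K"
proof -
  show "sum f I \<in> K"
    using assms(2) by (induction I rule: infinite_finite_induct) (simp_all add: subring_OmegaD[OF assms(1)])
  show "prod f I \<in> K"
    using assms(2) by (induction I rule: infinite_finite_induct) (simp_all add: subring_OmegaD[OF assms(1)])
qed

lemma subfield_imp_subring: "subfield K (\<Omega> :: 'a::field ring) \<Longrightarrow> subring K \<Omega>"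
proof -
  assume "subfield K (\<Omega> :: 'a::field ring)"
  interpret Ring.field "\<Omega> :: 'a ring" by (rule Omega_field)
  show ?thesis by (rule subfieldE(1)) fact
qed

lemma sum_in_subfield:
  assumes "subfield K (\<Omega> :: 'a::field ring)" "\<And>i. i \<in> I \<Longrightarrow> f i \<in> K"
  shows "sum f I \<in> K" "prod f I \<in> K"
  using sum_in_subring[OF subfield_imp_subring[OF assms(1)]] assms(2) by blast+

section \<open>Valuation rings and congruences modulo their maximal ideals\<close>

lemma Units_sub:
  assumes "subring R (\<Omega> :: 'a::field ring)"
  shows "Units (sub R) = {x \<in> R. x \<noteq> 0 \<and> inverse x \<in> R}"
  using inverse_unique by (force simp: Units_def)

lemma max_ideal_iff:
  assumes "subring R (\<Omega> :: 'a::field ring)"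
  shows "x \<in> max_ideal R \<longleftrightarrow> x \<in> R \<and> (x = 0 \<or> inverse x \<notin> R)"
  by (auto simp: max_ideal_def Units_sub[OF assms])

text \<open>Only a proper valuation ring of K is assumed; discreteness and the presence of the
  constants are derived later. Congruences \<open>a - b \<in> M\<close> mostly replace computation
  in the residue field.\<close>

locale val_ring =
  fixes K R :: "'a::field set"
  assumes sfK: "subfield K \<Omega>" and pl: "R \<in> places K"
begin

lemma sr: "subring R \<Omega>" and ssub: "R \<subset> K" and tot: "z \<in> K \<Longrightarrow> z \<notin> R \<Longrightarrow> inverse z \<in> R"
  using pl by (auto simp: places_def)

lemma RK: "x \<in> R \<Longrightarrow> x \<in> K" using ssub by auto

lemmas Kc = subfield_OmegaD[OF sfK]
lemmas Rc = subring_OmegaD[OF sr]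
lemmas Rsum = sum_in_subring[OF sr]

abbreviation "M \<equiv> max_ideal R"

lemmas M_iff = max_ideal_iff[OF sr]
lemmas U_iff = Units_sub[OF sr]

lemma MR: "x \<in> M \<Longrightarrow> x \<in> R" by (simp add: M_iff)

lemma M_zero: "0 \<in> M" by (simp add: M_iff Rc)

lemma M_one: "1 \<notin> M" by (simp add: M_iff Rc)

lemma M_mult: "x \<in> M \<Longrightarrow> y \<in> R \<Longrightarrow> x * y \<in> M"
proof -
  assume a: "x \<in> M" "y \<in> R"
  show ?thesis
  proof (rule ccontr)
    assume "x * y \<notin> M"
    then have n: "x * y \<noteq> 0" "inverse (x * y) \<in> R" using a by (auto simp: M_iff Rc)
    then have "y * inverse (x * y) \<in> R" using a by (auto intro: Rc)
    moreover have "y * inverse (x * y) = inverse x" using n by (simp add: field_simps)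
    ultimately have "inverse x \<in> R" by metis
    then show False using a n by (auto simp: M_iff)
  qed
qed

lemma M_mult2: "x \<in> R \<Longrightarrow> y \<in> M \<Longrightarrow> x * y \<in> M"
  using M_mult[of y x] by (simp add: mult.commute)

text \<open>Of two nonzero elements one divides the other in R, so the sum is a multiple of the one
  that divides.\<close>

lemma M_add: assumes "x \<in> M" "y \<in> M" shows "x + y \<in> M"
proof (cases "x = 0 \<or> y = 0")
  case False
  have *: "a + b \<in> M" if "a \<in> M" "b \<in> M" "a \<noteq> 0" "b \<noteq> 0" "b / a \<in> R" for a b
  proof -
    have "a + b = a * (1 + b / a)" using that by (simp add: field_simps)
    moreover have "a * (1 + b / a) \<in> M" using that by (intro M_mult Rc) auto
    ultimately show ?thesis by simp
  qed
  have "x / y \<in> R \<or> y / x \<in> R"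
    using tot[of "x / y"] Kc(9)[of x y] assms by (auto dest!: MR RK)
  then show ?thesis using *[of x y] *[of y x] False assms by (auto simp: add.commute)
qed (use assms in auto)

lemma M_minus: "x \<in> M \<Longrightarrow> - x \<in> M"
  using M_mult[of x "-1"] by (auto intro: Rc)

lemma M_diff: "x \<in> M \<Longrightarrow> y \<in> M \<Longrightarrow> x - y \<in> M"
  using M_add[of x "- y"] M_minus[of y] by simp

lemma M_diff_sym: "x - y \<in> M \<Longrightarrow> y - x \<in> M"
  using M_minus[of "x - y"] by simp

lemma M_diff_trans: "x - y \<in> M \<Longrightarrow> y - z \<in> M \<Longrightarrow> x - z \<in> M"
  using M_add[of "x - y" "y - z"] by simp

lemma M_sum: "(\<And>i. i \<in> I \<Longrightarrow> f i \<in> M) \<Longrightarrow> sum f I \<in> M"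
  by (induction I rule: infinite_finite_induct) (auto intro: M_zero M_add)

lemma M_prime: "x \<in> R \<Longrightarrow> y \<in> R \<Longrightarrow> x * y \<in> M \<Longrightarrow> x \<in> M \<or> y \<in> M"
  by (auto simp: M_iff Rc)

lemma M_prime_prod: "finite I \<Longrightarrow> (\<And>i. i \<in> I \<Longrightarrow> f i \<in> R) \<Longrightarrow> prod f I \<in> M \<Longrightarrow> \<exists>i\<in>I. f i \<in> M"
proof (induction I rule: finite_induct)
  case empty then show ?case by (simp add: M_one)
next
  case (insert a I)
  have "prod f I \<in> R" using insert by (intro Rsum) auto
  then show ?case using insert M_prime[of "f a" "prod f I"] by auto
qed

lemma cong_mult: "a - b \<in> M \<Longrightarrow> c - d \<in> M \<Longrightarrow> b \<in> R \<Longrightarrow> c \<in> R \<Longrightarrow> a * c - b * d \<in> M"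
proof -
  assume a: "a - b \<in> M" "c - d \<in> M" "b \<in> R" "c \<in> R"
  have "a * c - b * d = (a - b) * c + b * (c - d)" by (simp add: algebra_simps)
  then show ?thesis using M_mult[of "a - b" c] M_mult2[of b "c - d"] M_add a by simp
qed

lemma cong_R: "a - b \<in> M \<Longrightarrow> b \<in> R \<Longrightarrow> a \<in> R"
  using Rc(4)[of "a - b" b] MR by auto

lemma cong_power: "a - b \<in> M \<Longrightarrow> b \<in> R \<Longrightarrow> a ^ n - b ^ n \<in> M"
proof (induction n)
  case 0 then show ?case by (simp add: M_zero)
next
  case (Suc n)
  have "a \<in> R" using cong_R Suc by blast
  then show ?case using Suc cong_mult[of a b "a ^ n" "b ^ n"] by (auto intro: Rc)
qed

lemma cong_prod: "(\<And>i. i \<in> I \<Longrightarrow> f i - g i \<in> M) \<Longrightarrow> (\<And>i. i \<in> I \<Longrightarrow> g i \<in> R) \<Longrightarrow> prod f I - prod g I \<in> M"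
proof (induction I rule: infinite_finite_induct)
  case (insert a I)
  have "prod f I \<in> R" using insert cong_R by (intro Rsum) auto
  then show ?case using insert by (auto intro!: cong_mult)
qed (auto simp: M_zero)

lemma cong_sum: "(\<And>i. i \<in> I \<Longrightarrow> f i - g i \<in> M) \<Longrightarrow> sum f I - sum g I \<in> M"
  unfolding sum_subtractf[symmetric] by (rule M_sum)

lemma unit_not_M: "x \<in> R \<Longrightarrow> x \<notin> M \<longleftrightarrow> x \<in> Units (sub R)"
  by (auto simp: max_ideal_def)

lemma unit_inv: "x \<in> R \<Longrightarrow> x \<notin> M \<Longrightarrow> inverse x \<in> R"
  by (auto simp: M_iff)

lemma inv_M: "x \<in> K \<Longrightarrow> x \<notin> R \<Longrightarrow> inverse x \<in> M"
  using tot[of x] by (auto simp: M_iff)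

lemma ex_M: "\<exists>x\<in>M. x \<noteq> 0"
proof -
  obtain x where "x \<in> K" "x \<notin> R" using ssub by auto
  then show ?thesis using inv_M[of x] Rc(1) by (intro bexI[of _ "inverse x"]) auto
qed

text \<open>Valuation rings are integrally closed; for a root of unity this is visible directly,
  since x is the power n - 1 of its own inverse.\<close>

lemma rootof1_in: "x \<in> K \<Longrightarrow> x ^ n = 1 \<Longrightarrow> n > 0 \<Longrightarrow> x \<in> R"
proof (rule ccontr)
  assume a: "x \<in> K" "x ^ n = 1" "n > 0" "x \<notin> R"
  then have "inverse x \<in> R" using tot by auto
  then have "inverse x ^ (n - 1) \<in> R" by (rule Rc)
  moreover have "inverse x ^ (n - 1) * inverse x ^ 1 = 1"
    unfolding power_add[symmetric] using a by (simp add: power_inverse)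
  then have "inverse x ^ (n - 1) = x" using a by (auto simp: field_simps)
  ultimately show False using a by simp
qed

end

section \<open>Discrete valuation rings and the order function\<close>

locale dval_ring = val_ring +
  assumes dv: "\<exists>t\<in>R. M = (\<lambda>x. t * x) ` R \<and> (\<forall>f\<in>K - {0}. \<exists>m. \<exists>u\<in>Units (sub R). f = t powi m * u)"
begin

text \<open>One uniformizer that serves both the principal maximal ideal and the factorization of
  all nonzero elements of K. The assumption \<open>dv\<close> is discharged for every place of a
  function field by \<open>place_dval_ring\<close>.\<close>

definition "t0 = (SOME t. t \<in> R \<and> M = (\<lambda>x. t * x) ` R \<and> (\<forall>f\<in>K - {0}. \<exists>m. \<exists>u\<in>Units (sub R). f = t powi m * u))"

lemma t0: "t0 \<in> R" "M = (\<lambda>x. t0 * x) ` R" "f \<in> K \<Longrightarrow> f \<noteq> 0 \<Longrightarrow> \<exists>m. \<exists>u\<in>Units (sub R). f = t0 powi m * u"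
  using someI_ex[of "\<lambda>t. t \<in> R \<and> M = (\<lambda>x. t * x) ` R \<and> (\<forall>f\<in>K - {0}. \<exists>m. \<exists>u\<in>Units (sub R). f = t powi m * u)"] dv
  unfolding t0_def[symmetric] by auto

lemma t0_M: "t0 \<in> M" unfolding t0(2) using Rc(2) by (auto intro!: image_eqI[of _ _ 1])

lemma gen_nonzero: "M = (\<lambda>x. t * x) ` R \<Longrightarrow> t \<noteq> 0"
  using ex_M by auto

lemma t0_nz: "t0 \<noteq> 0" using gen_nonzero t0(2) by blast

lemma Uc: "u \<in> Units (sub R) \<Longrightarrow> w \<in> Units (sub R) \<Longrightarrow> u * w \<in> Units (sub R)"
    "u \<in> Units (sub R) \<Longrightarrow> inverse u \<in> Units (sub R)"  "u \<in> Units (sub R) \<Longrightarrow> u powi m \<in> Units (sub R)"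
  by (auto simp: U_iff power_int_def Rc power_inverse[symmetric])

lemma powi_unit_eq:
  assumes "t0 powi m * u = t0 powi l * w" "u \<in> Units (sub R)" "w \<in> Units (sub R)"
  shows "m = l"
proof -
  have *: False if "t0 powi m * u = t0 powi l * w" "u \<in> Units (sub R)" "w \<in> Units (sub R)" "m < l" for m l u w
  proof -
    have "u = t0 powi (l - m) * w" using that(1) t0_nz by (simp add: power_int_diff field_simps)
    also have "t0 powi (l - m) = t0 * t0 powi (l - m - 1)"
      using t0_nz by (simp add: power_int_diff)
    also have "t0 powi (l - m - 1) = t0 ^ nat (l - m - 1)"
      using that(4) by (simp add: power_int_def)
    finally have "u \<in> M" using that t0_M t0(1) by (auto simp: U_iff mult.assoc intro!: M_mult Rc)
    then show False using that by (auto simp: M_iff U_iff)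
  qed
  show ?thesis using *[of m u l w] *[of l w m u] assms by (metis linorder_neqE)
qed

lemma gen_t0: assumes "t \<in> R" "M = (\<lambda>x. t * x) ` R" shows "\<exists>w\<in>Units (sub R). t = t0 * w"
proof -
  have "t \<in> M" unfolding assms(2) using Rc(2) by (auto intro!: image_eqI[of _ _ 1])
  then obtain w where w: "w \<in> R" "t = t0 * w" using t0(2) by auto
  obtain w' where w': "w' \<in> R" "t0 = t * w'" using t0_M assms(2) by auto
  have "t0 * (w * w') = t0 * 1" using w w' by (simp add: mult.assoc[symmetric])
  then have "w * w' = 1" using t0_nz mult_cancel_left by blast
  then have "w' = inverse w" "w \<noteq> 0" by (auto simp: inverse_unique)
  then show ?thesis using w w' by (auto simp: U_iff)
qed

text \<open>\<open>ord_at\<close> hides the uniformizer under the description operator, so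
  uniqueness has to hold across any two generators of M. Both are rewritten through
  \<open>t0\<close>, from which they differ by units.\<close>

lemma ord_eqI:
  assumes "t \<in> R" "M = (\<lambda>x. t * x) ` R" "u \<in> Units (sub R)" "f = t powi m * u"
  shows "ord_at R f = m"
  unfolding ord_at_def
proof (rule the_equality)
  show "\<exists>t\<in>R. M = (*) t ` R \<and> (\<exists>u\<in>Units (sub R). f = t powi m * u)" using assms by blast
  fix l assume "\<exists>t\<in>R. M = (*) t ` R \<and> (\<exists>u\<in>Units (sub R). f = t powi l * u)"
  then obtain s w where s: "s \<in> R" "M = (*) s ` R" "w \<in> Units (sub R)" "f = s powi l * w" by blast
  obtain a where a: "a \<in> Units (sub R)" "t = t0 * a" using gen_t0 assms by blast
  obtain b where b: "b \<in> Units (sub R)" "s = t0 * b" using gen_t0 s by blast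
  have "t0 powi m * (a powi m * u) = t0 powi l * (b powi l * w)"
    using assms(4) s(4) a b by (simp add: power_int_mult_distrib mult.assoc)
  then show "l = m" using powi_unit_eq a b assms s Uc by metis
qed

lemma ord_t0: "u \<in> Units (sub R) \<Longrightarrow> ord_at R (t0 powi m * u) = m"
  using ord_eqI t0 by blast

lemma ord_ex: "f \<in> K \<Longrightarrow> f \<noteq> 0 \<Longrightarrow> \<exists>u\<in>Units (sub R). f = t0 powi (ord_at R f) * u"
  using t0(3)[of f] ord_t0 by metis

lemma ord_mult: "f \<in> K \<Longrightarrow> f \<noteq> 0 \<Longrightarrow> g \<in> K \<Longrightarrow> g \<noteq> 0 \<Longrightarrow> ord_at R (f * g) = ord_at R f + ord_at R g"
proof -
  assume a: "f \<in> K" "f \<noteq> 0" "g \<in> K" "g \<noteq> 0"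
  obtain u where u: "u\<in>Units (sub R)" "f = t0 powi (ord_at R f) * u" using ord_ex a by blast
  obtain w where w: "w\<in>Units (sub R)" "g = t0 powi (ord_at R g) * w" using ord_ex a by blast
  have "f * g = t0 powi (ord_at R f + ord_at R g) * (u * w)"
    by (subst u(2), subst w(2)) (simp add: power_int_add t0_nz)
  then show ?thesis using ord_t0[OF Uc(1)[OF u(1) w(1)]] by metis
qed

lemma ord_unit: "u \<in> Units (sub R) \<Longrightarrow> ord_at R u = 0"
  using ord_t0[of u 0] by simp

lemma ord_one: "ord_at R 1 = 0" by (rule ord_unit) (auto simp: U_iff Rc)

lemma ord_inverse: "f \<in> K \<Longrightarrow> f \<noteq> 0 \<Longrightarrow> ord_at R (inverse f) = - ord_at R f"
  using ord_mult[of f "inverse f"] ord_one by (simp add: Kc)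

lemma ord_div: "f \<in> K \<Longrightarrow> f \<noteq> 0 \<Longrightarrow> g \<in> K \<Longrightarrow> g \<noteq> 0 \<Longrightarrow> ord_at R (f / g) = ord_at R f - ord_at R g"
  using ord_mult[of f "inverse g"] ord_inverse[of g] by (simp add: Kc divide_inverse)

lemma ord_power: "f \<in> K \<Longrightarrow> f \<noteq> 0 \<Longrightarrow> ord_at R (f ^ n) = int n * ord_at R f"
  by (induction n) (auto simp: ord_one ord_mult Kc algebra_simps)

lemma ord_powi: "f \<in> K \<Longrightarrow> f \<noteq> 0 \<Longrightarrow> ord_at R (f powi n) = n * ord_at R f"
  by (auto simp: power_int_def ord_power ord_inverse Kc)

lemma ord_t0': "ord_at R t0 = 1" using ord_t0[of 1 1] by (auto simp: U_iff Rc)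

lemma R_iff: "f \<in> K \<Longrightarrow> f \<noteq> 0 \<Longrightarrow> f \<in> R \<longleftrightarrow> ord_at R f \<ge> 0"
  and M_iff_ord: "f \<in> K \<Longrightarrow> f \<noteq> 0 \<Longrightarrow> f \<in> M \<longleftrightarrow> ord_at R f > 0"
proof -
  assume a: "f \<in> K" "f \<noteq> 0"
  obtain u where u: "u\<in>Units (sub R)" "f = t0 powi (ord_at R f) * u" using ord_ex a by blast
  have u': "u \<in> R" "u \<notin> M" using u(1) by (auto simp: U_iff M_iff)
  have pos: "t0 powi m * u \<in> M" if "m > 0" "u \<in> R" for m u
  proof -
    have "t0 powi m * u = t0 * (t0 ^ (nat m - 1) * u)"
      using that by (cases "nat m") (simp_all add: power_int_def)
    moreover have "t0 * (t0 ^ (nat m - 1) * u) \<in> M" by (intro M_mult Rc t0_M t0(1) that)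
    ultimately show ?thesis by (simp only:)
  qed
  have neg: "f \<notin> R" if "ord_at R f < 0"
  proof
    assume "f \<in> R"
    then have "t0 powi (- ord_at R f) * f \<in> M" using pos that by auto
    also have "t0 powi (- ord_at R f) * f = u" using u(2) t0_nz
      by (metis add.left_inverse mult.assoc mult_1 power_int_add power_int_0_right)
    finally show False using u' by simp
  qed
  have "f \<in> M" if "ord_at R f > 0" using pos[OF that u'(1)] u(2) by simp
  moreover have "f \<notin> M \<and> f \<in> R" if "ord_at R f = 0" using u' u(2) that by simp
  moreover have "f \<notin> M" if "ord_at R f < 0" using neg[OF that] MR by blast
  moreover consider "ord_at R f < 0" | "ord_at R f = 0" | "ord_at R f > 0" by linarith
  then have "(f \<in> R \<longleftrightarrow> ord_at R f \<ge> 0) \<and> (f \<in> M \<longleftrightarrow> ord_at R f > 0)"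
    using neg MR calculation by cases auto
  then show "f \<in> R \<longleftrightarrow> ord_at R f \<ge> 0" "f \<in> M \<longleftrightarrow> ord_at R f > 0" by auto
qed

lemma ord_add: "f \<in> K \<Longrightarrow> g \<in> K \<Longrightarrow> f \<noteq> 0 \<Longrightarrow> g \<noteq> 0 \<Longrightarrow> f + g \<noteq> 0 \<Longrightarrow> ord_at R (f + g) \<ge> min (ord_at R f) (ord_at R g)"
proof -
  have *: "ord_at R (f + g) \<ge> ord_at R f" if "f \<in> K" "g \<in> K" "f \<noteq> 0" "g \<noteq> 0" "f + g \<noteq> 0" "ord_at R f \<le> ord_at R g" for f g
  proof -
    have "g / f \<in> R" using that by (subst R_iff) (auto simp: ord_div Kc)
    then have "1 + g / f \<in> R" by (intro Rc)
    moreover have e: "f + g = f * (1 + g / f)" using that by (simp add: field_simps)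
    ultimately show ?thesis using that by (subst e, subst ord_mult) (auto simp: R_iff[symmetric] Kc)
  qed
  assume "f \<in> K" "g \<in> K" "f \<noteq> 0" "g \<noteq> 0" "f + g \<noteq> 0"
  then show ?thesis using *[of f g] *[of g f] by (auto simp: add.commute min_def)
qed

definition "V m = {f \<in> K. f = 0 \<or> ord_at R f \<ge> m}"

lemma V_zero: "0 \<in> V m" by (simp add: V_def Kc)

lemma V_add: "f \<in> V m \<Longrightarrow> g \<in> V m \<Longrightarrow> f + g \<in> V m"
proof (cases "f = 0 \<or> g = 0 \<or> f + g = 0")
  case False
  then show "f \<in> V m \<Longrightarrow> g \<in> V m \<Longrightarrow> f + g \<in> V m"
    using ord_add[of f g] by (auto simp: V_def Kc min_le_iff_disj)
qed (auto simp: V_def Kc)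

lemma V_minus: "f \<in> V m \<Longrightarrow> - f \<in> V m"
  using ord_mult[of "-1" f] ord_unit[of "-1"] by (auto simp: V_def Kc U_iff Rc)

lemma V_sum: "(\<And>i. i \<in> I \<Longrightarrow> f i \<in> V m) \<Longrightarrow> sum f I \<in> V m"
  by (induction I rule: infinite_finite_induct) (auto intro!: V_add V_zero)

lemma V_mult: "f \<in> V m \<Longrightarrow> g \<in> V n \<Longrightarrow> f * g \<in> V (m + n)"
  by (auto simp: V_def Kc ord_mult)

lemma V_mono: "f \<in> V m \<Longrightarrow> n \<le> m \<Longrightarrow> f \<in> V n" by (auto simp: V_def)

lemma V_0: "f \<in> V 0 \<longleftrightarrow> f \<in> R"
  using R_iff[of f] RK[of f] Rc(1) by (cases "f = 0") (auto simp: V_def Kc)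

lemma V_1: "f \<in> V 1 \<longleftrightarrow> f \<in> M"
  using M_iff_ord[of f] RK[of f] MR[of f] M_zero by (cases "f = 0") (auto simp: V_def Kc)

text \<open>Strict triangle equality: g = f (1 + (g - f) / f), and the second factor is a unit,
  being 1 plus an element of M. It reads off the order of an approximated element.\<close>

lemma ord_cong: assumes "f \<in> K" "f \<noteq> 0" "g - f \<in> V m" "m > ord_at R f" shows "g \<noteq> 0" "ord_at R g = ord_at R f"
proof -
  have gf: "g - f \<in> K" using assms by (auto simp: V_def)
  show "g \<noteq> 0" using assms ord_mult[of "-1" f] ord_unit[of "-1"] by (auto simp: V_def Kc U_iff Rc)
  have e: "g = f * (1 + (g - f) / f)" using assms by (simp add: field_simps)
  have q: "(g - f) / f \<in> M"
  proof (cases "g = f")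
    case False
    then show ?thesis using assms by (subst M_iff_ord) (auto simp: ord_div Kc gf V_def)
  qed (auto simp: M_zero)
  have "1 + (g - f) / f \<notin> M" using M_diff[OF _ q, of "1 + (g - f) / f"] M_one by auto
  moreover have "1 + (g - f) / f \<in> R" using q by (intro Rc MR)
  ultimately have o: "ord_at R (1 + (g - f) / f) = 0" "1 + (g - f) / f \<noteq> 0" by (auto simp: unit_not_M ord_unit U_iff)
  then show "ord_at R g = ord_at R f"
    using \<open>1 + (g - f) / f \<in> R\<close> assms by (subst e, subst ord_mult) (auto dest: RK)
qed

text \<open>An element outside R has negative order and its powers cancel any pole, so adjoining it
  to R gives all of K. Consequently places can be identified by a mere inclusion.\<close>

lemma R_maximal: assumes "S \<in> places K" "R \<subseteq> S" shows "S = R"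
proof (rule ccontr)
  assume "S \<noteq> R"
  then obtain s where s: "s \<in> S" "s \<notin> R" using assms by auto
  have sS: "subring S \<Omega>" "S \<subset> K" using assms by (auto simp: places_def)
  note Sc = subring_OmegaD[OF sS(1)]
  have sK: "s \<in> K" "s \<noteq> 0" using s sS Rc by auto
  have n: "ord_at R s < 0" using s sK R_iff by auto
  have "K \<subseteq> S"
  proof
    fix z assume z: "z \<in> K"
    show "z \<in> S"
    proof (cases "z = 0")
      case False
      define m where "m = nat \<bar>ord_at R z\<bar>"
      have "ord_at R (z * inverse s ^ m) = ord_at R z + - (int m * ord_at R s)"
        using z False sK by (subst ord_mult) (auto simp: Kc ord_power ord_inverse)
      moreover have "int m \<le> - (int m * ord_at R s)" using n mult_left_mono[of 1 "- ord_at R s" "int m"] by simp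
      ultimately have "ord_at R (z * inverse s ^ m) \<ge> 0" unfolding m_def by linarith
      then have "z * inverse s ^ m \<in> R" using z False sK by (subst R_iff) (auto simp: Kc)
      then have 1: "z * inverse s ^ m \<in> S" using assms(2) by blast
      have "(z * inverse s ^ m) * s ^ m \<in> S" by (rule Sc(5)[OF 1 Sc(7)[OF s(1)]])
      moreover have "(z * inverse s ^ m) * s ^ m = z" using sK by (simp add: power_mult_distrib[symmetric] mult.assoc)
      ultimately show ?thesis by simp
    qed (auto simp: Sc)
  qed
  then show False using sS by auto
qed

end

section \<open>Places of function fields\<close>

text \<open>Polynomials of the ambient type with coefficients confined to a set, so that evaluation,
  degree and composition are those of \<open>poly\<close> and only closure properties remain to be
  shown.\<close>

definition kpol :: "'a::field set \<Rightarrow> 'a poly set" where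
  "kpol k = {p. \<forall>i. coeff p i \<in> k}"

lemma kpolD: "p \<in> kpol k \<Longrightarrow> coeff p i \<in> k"
  by (simp add: kpol_def)

lemma kpol_clos:
  assumes k: "subring k (\<Omega> :: 'a::field ring)"
  shows "0 \<in> kpol k" "1 \<in> kpol k" "p \<in> kpol k \<Longrightarrow> - p \<in> kpol k"
    "p \<in> kpol k \<Longrightarrow> r \<in> kpol k \<Longrightarrow> p + r \<in> kpol k" "p \<in> kpol k \<Longrightarrow> r \<in> kpol k \<Longrightarrow> p - r \<in> kpol k"
    "p \<in> kpol k \<Longrightarrow> r \<in> kpol k \<Longrightarrow> p * r \<in> kpol k"
    "c \<in> k \<Longrightarrow> monom c n \<in> kpol k" "c \<in> k \<Longrightarrow> p \<in> kpol k \<Longrightarrow> pCons c p \<in> kpol k"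
  using subring_OmegaD[OF k]
  by (auto simp: kpol_def coeff_mult coeff_pCons split: nat.split intro!: sum_in_subring[OF k])

lemma kpol_sum:
  assumes k: "subring k (\<Omega> :: 'a::field ring)" "\<And>i. i \<in> I \<Longrightarrow> f i \<in> kpol k"
  shows "sum f I \<in> kpol k" "prod f I \<in> kpol k"
proof -
  show "sum f I \<in> kpol k" using assms(2)
    by (induction I rule: infinite_finite_induct) (auto intro: kpol_clos[OF k(1)])
  show "prod f I \<in> kpol k" using assms(2)
    by (induction I rule: infinite_finite_induct) (auto intro: kpol_clos[OF k(1)])
qed

lemma kpol_reflect:
  assumes "subring k (\<Omega> :: 'a::field ring)" "p \<in> kpol k" shows "reflect_poly p \<in> kpol k"
  using assms by (auto simp: kpol_def coeff_reflect_poly subring_OmegaD)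

lemma kpol_pcompose:
  assumes k: "subring k (\<Omega> :: 'a::field ring)" shows "p \<in> kpol k \<Longrightarrow> b \<in> kpol k \<Longrightarrow> pcompose p b \<in> kpol k"
proof (induction p)
  case (pCons a p)
  have "a \<in> k" using kpolD[OF pCons(3), of 0] by simp
  moreover have "coeff p i \<in> k" for i using kpolD[OF pCons(3), of "Suc i"] by simp
  then have "p \<in> kpol k" by (simp add: kpol_def)
  ultimately show ?case using pCons
    by (auto simp: pcompose_pCons intro!: kpol_clos[OF k])
qed (auto intro: kpol_clos[OF k])

lemma poly_in_subring:
  assumes "subring S (\<Omega> :: 'a::field ring)" "p \<in> kpol S" "z \<in> S" shows "poly p z \<in> S"
  unfolding poly_altdef
  using assms by (auto intro!: sum_in_subring subring_OmegaD[OF assms(1)] kpolD)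

lemma kpol_mono: "p \<in> kpol k \<Longrightarrow> k \<subseteq> l \<Longrightarrow> p \<in> kpol l"
  by (auto simp: kpol_def)

section \<open>Counting over a finite constant field\<close>

lemma finite_subfield_power:
  assumes "subfield k (\<Omega> :: 'a::field ring)" "finite k" "c \<in> k"
  shows "c \<noteq> 0 \<Longrightarrow> c ^ (card k - 1) = 1" "c ^ card k = c" "card k \<ge> 2"
proof -
  note kc = subfield_OmegaD[OF assms(1)]
  have "{0,1} \<subseteq> k" using kc by auto
  then have "card {0,1::'a} \<le> card k" using assms(2) card_mono by blast
  then show 2: "card k \<ge> 2" by simp
  show 1: "c ^ (card k - 1) = 1" if "c \<noteq> 0"
  proof -
    have "bij_betw ((*) c) (k - {0}) (k - {0})"
      by (rule bij_betw_byWitness[where f' = "\<lambda>x. x / c"]) (use that assms(3) in \<open>auto intro: kc\<close>)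
    then have "(\<Prod>a\<in>k - {0}. c * a) = \<Prod>(k - {0})"
      using prod.reindex_bij_betw[of "(*) c" "k - {0}" "k - {0}" "\<lambda>x. x"] by simp
    then have "c ^ card (k - {0}) * \<Prod>(k - {0}) = 1 * \<Prod>(k - {0})"
      by (simp add: prod.distrib)
    moreover have "\<Prod>(k - {0}) \<noteq> 0" using assms(2) by simp
    ultimately have "c ^ card (k - {0}) = 1" using mult_right_cancel by blast
    then show ?thesis using kc(1) assms(2) by simp
  qed
  show "c ^ card k = c"
  proof (cases "c = 0")
    case False
    have "c ^ card k = c ^ (card k - 1) * c" using 2 by (metis Suc_diff_1 mult.commute order_less_le_trans pos2 power_Suc)
    then show ?thesis using 1 False by simp
  qed (use 2 in auto)
qed

text \<open>A finite box of polynomials, from which source and target of the pigeonhole map in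
  \<open>ff_relation\<close> are built.\<close>

definition bpol :: "'a::field set \<Rightarrow> nat \<Rightarrow> 'a poly set" where
  "bpol k A = {p \<in> kpol k. degree p \<le> A}"

lemma card_bpol:
  assumes "finite (k :: 'a::field set)" "0 \<in> k"
  shows "finite (bpol k A)" "card (bpol k A) = card k ^ (A + 1)"
proof -
  let ?F = "\<lambda>f. (\<Sum>i\<le>A. monom (f i) i)"
  have c: "coeff (?F f) i = (if i \<le> A then f i else 0)" for f :: "nat \<Rightarrow> 'a" and i
    by (simp add: coeff_sum)
  have "bij_betw (\<lambda>p. restrict (coeff p) {..A}) (bpol k A) (PiE {..A} (\<lambda>_. k))"
  proof (rule bij_betw_byWitness[where f' = ?F])
    show "\<forall>p\<in>bpol k A. ?F (restrict (coeff p) {..A}) = p"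
      by (intro ballI poly_eqI) (auto simp: c bpol_def coeff_eq_0)
    show "\<forall>f\<in>{..A} \<rightarrow>\<^sub>E k. restrict (coeff (?F f)) {..A} = f"
      by (auto simp: c fun_eq_iff restrict_def PiE_def extensional_def)
    show "(\<lambda>p. restrict (coeff p) {..A}) ` bpol k A \<subseteq> {..A} \<rightarrow>\<^sub>E k"
      by (auto simp: bpol_def kpol_def PiE_def extensional_def restrict_def)
    show "?F ` ({..A} \<rightarrow>\<^sub>E k) \<subseteq> bpol k A"
      using assms by (auto simp: bpol_def kpol_def c PiE_iff intro!: degree_le)
  qed
  moreover have "finite ({..A} \<rightarrow>\<^sub>E k)" using assms by (intro finite_PiE) auto
  moreover have "card ({..A} \<rightarrow>\<^sub>E k) = card k ^ (A + 1)" by (simp add: card_PiE)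
  ultimately show "finite (bpol k A)" "card (bpol k A) = card k ^ (A + 1)"
    by (auto simp: bij_betw_same_card bij_betw_finite)
qed

text \<open>K is spanned over k(x) by the first N values of W, with denominators cleared by c. The W
  j need not lie in K and may be dependent, so a subfield of K that contains x inherits the same
  data.\<close>

definition ff_gen :: "'a::field set \<Rightarrow> 'a set \<Rightarrow> 'a \<Rightarrow> nat \<Rightarrow> (nat \<Rightarrow> 'a) \<Rightarrow> bool" where
  "ff_gen k K x N W \<longleftrightarrow> x \<in> K \<and> (\<forall>p\<in>kpol k. p \<noteq> 0 \<longrightarrow> poly p x \<noteq> 0) \<and>
     (\<forall>z\<in>K. \<exists>c\<in>kpol k. \<exists>P. c \<noteq> 0 \<and> (\<forall>j<N. P j \<in> kpol k) \<and>
        poly c x * z = (\<Sum>j<N. poly (P j) x * W j))"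

lemma ff_genD:
  assumes "ff_gen k K x N W" "z \<in> K"
  shows "\<exists>c P. c \<in> kpol k \<and> c \<noteq> 0 \<and> (\<forall>j<N. P j \<in> kpol k) \<and>
     poly c x * z = (\<Sum>j<N. poly (P j) x * W j)"
  using assms unfolding ff_gen_def by blast

definition fun_field :: "'a::field set \<Rightarrow> 'a set \<Rightarrow> bool" where
  "fun_field k K \<longleftrightarrow> subfield k \<Omega> \<and> finite k \<and> subfield K \<Omega> \<and> k \<subseteq> K \<and> (\<exists>x N W. ff_gen k K x N W)"

text \<open>Reversing coefficients turns a polynomial in x into a power of x times a polynomial in
  1/x. Since a valuation ring contains x or its inverse, x may later be assumed integral.\<close>

lemma ff_gen_inverse:
  assumes k: "subring k (\<Omega> :: 'a::field ring)" and K: "subfield K \<Omega>" and g: "ff_gen k K x N W"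
  shows "ff_gen k K (inverse x) N W"
proof -
  note kc = subring_OmegaD[OF k]
  have x: "x \<in> K" "\<And>p. p \<in> kpol k \<Longrightarrow> p \<noteq> 0 \<Longrightarrow> poly p x \<noteq> 0" using g by (auto simp: ff_gen_def)
  have "monom 1 1 \<in> kpol k" "monom (1::'a) 1 \<noteq> 0" by (auto intro!: kpol_clos[OF k] kc)
  then have x0: "x \<noteq> 0" using x(2)[of "monom 1 1"] by (auto simp: poly_monom)
  have "poly p (inverse x) \<noteq> 0" if "p \<in> kpol k" "p \<noteq> 0" for p
    using x(2)[OF kpol_reflect[OF k that(1)]] that x0 by (auto simp: poly_reflect_poly_nz)
  moreover have "\<exists>c\<in>kpol k. \<exists>P. c \<noteq> 0 \<and> (\<forall>j<N. P j \<in> kpol k) \<and>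
        poly c (inverse x) * z = (\<Sum>j<N. poly (P j) (inverse x) * W j)" if z: "z \<in> K" for z
  proof -
    obtain c P where c: "c \<in> kpol k" "c \<noteq> 0" "\<And>j. j < N \<Longrightarrow> P j \<in> kpol k"
      "poly c x * z = (\<Sum>j<N. poly (P j) x * W j)"
      using ff_genD[OF g z] by blast
    define B where "B = degree c + (\<Sum>j<N. degree (P j))"
    \<comment> \<open>The factor \<open>monom 1 (B - degree p)\<close> pads every reversal to the
      common exponent B, so that the whole relation is multiplied by one power of the inverse of
      x.\<close>
    define rv where "rv p = monom 1 (B - degree p) * reflect_poly p" for p :: "'a poly"
    have rv: "poly (rv p) (inverse x) = inverse x ^ B * poly p x" if "degree p \<le> B" for p
    proof -
      have "inverse x ^ B = inverse x ^ (B - degree p) * inverse x ^ degree p"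
        using that by (simp add: power_add[symmetric])
      then show ?thesis using x0 by (simp add: rv_def poly_monom poly_reflect_poly_nz)
    qed
    have rvk: "rv p \<in> kpol k" if "p \<in> kpol k" for p
      unfolding rv_def by (intro kpol_clos[OF k] kpol_reflect[OF k] kc that)
    have dP: "degree (P j) \<le> B" if "j < N" for j
      unfolding B_def using member_le_sum[of j "{..<N}" "\<lambda>j. degree (P j)"] that by simp
    have "poly (rv c) (inverse x) * z = inverse x ^ B * (poly c x * z)"
      by (subst rv) (auto simp: B_def)
    also have "\<dots> = (\<Sum>j<N. poly (rv (P j)) (inverse x) * W j)"
      unfolding c(4) sum_distrib_left by (intro sum.cong) (auto simp: rv[OF dP])
    finally show ?thesis using c rvk
      by (intro bexI[of _ "rv c"] exI[of _ "\<lambda>j. rv (P j)"]) (auto simp: rv_def)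
  qed
  ultimately show ?thesis using x(1) K by (auto simp: ff_gen_def subfield_OmegaD)
qed

lemma ff_gen_common_denom:
  assumes k: "subring k (\<Omega> :: 'a::field ring)" and g: "ff_gen k K x N W" and z: "\<And>i. i < m \<Longrightarrow> z i \<in> K"
  shows "\<exists>c\<in>kpol k. \<exists>Q. c \<noteq> 0 \<and> (\<forall>i<m. \<forall>j<N. Q i j \<in> kpol k) \<and>
     (\<forall>i<(m::nat). poly c x * z i = (\<Sum>j<N. poly (Q i j) x * W j))"
proof -
  define G where "G i f \<longleftrightarrow> fst f \<in> kpol k \<and> fst f \<noteq> 0 \<and> (\<forall>j<N. snd f j \<in> kpol k) \<and>
        poly (fst f) x * z i = (\<Sum>j<N. poly (snd f j) x * W j)" for i f
  have "\<exists>f. G i f" if i: "i < m" for i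
  proof -
    obtain c P where "c \<in> kpol k" "c \<noteq> 0" "\<forall>j<N. P j \<in> kpol k"
      "poly c x * z i = (\<Sum>j<N. poly (P j) x * W j)" using ff_genD[OF g z[OF i]] by blast
    then show ?thesis unfolding G_def by (intro exI[of _ "(c, P)"]) simp
  qed
  then obtain f where f: "\<And>i. i < m \<Longrightarrow> G i (f i)" by metis
  define c P where "c i = fst (f i)" and "P i = snd (f i)" for i
  have c: "\<And>i. i < m \<Longrightarrow> c i \<in> kpol k" "\<And>i. i < m \<Longrightarrow> c i \<noteq> 0"
    "\<And>i j. i < m \<Longrightarrow> j < N \<Longrightarrow> P i j \<in> kpol k"
    "\<And>i. i < m \<Longrightarrow> poly (c i) x * z i = (\<Sum>j<N. poly (P i j) x * W j)"
    using f unfolding G_def c_def P_def by blast+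
  define C where "C = (\<Prod>i<m. c i)"
  define Q where "Q i j = (\<Prod>l\<in>{..<m} - {i}. c l) * P i j" for i j
  have "C \<in> kpol k" unfolding C_def using c by (intro kpol_sum[OF k]) auto
  moreover have "C \<noteq> 0" unfolding C_def using c by auto
  moreover have "Q i j \<in> kpol k" if "i < m" "j < N" for i j
    unfolding Q_def using c that by (intro kpol_clos[OF k] kpol_sum[OF k]) auto
  moreover have "poly C x * z i = (\<Sum>j<N. poly (Q i j) x * W j)" if i: "i < m" for i
  proof -
    have "C = (\<Prod>l\<in>{..<m} - {i}. c l) * c i" unfolding C_def using i
      by (subst prod.remove[of _ i]) (auto simp: mult.commute)
    then have "poly C x * z i = poly (\<Prod>l\<in>{..<m} - {i}. c l) x * (poly (c i) x * z i)" by (simp add: mult.assoc)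
    then show ?thesis unfolding c(4)[OF i] sum_distrib_left Q_def by (simp add: mult.assoc)
  qed
  ultimately show ?thesis by blast
qed

text \<open>A pigeonhole argument in the style of Siegel's lemma: families of coefficient
  polynomials of degree at most A are mapped to the N coordinates of the resulting combination.
  There are more families than values, and the difference of two colliding families is a nontrivial
  relation.\<close>

lemma ff_relation:
  assumes k: "subfield k (\<Omega> :: 'a::field ring)" "finite k" and g: "ff_gen k K x N W"
    and b: "b \<in> kpol k" "degree b \<le> \<delta>" and z: "\<And>i. i < N * \<delta> + 1 \<Longrightarrow> z i \<in> K"
  shows "\<exists>P. (\<forall>i<N * \<delta> + 1. P i \<in> kpol k) \<and> (\<exists>i<N * \<delta> + 1. P i \<noteq> 0) \<and>
     (\<Sum>i<N * \<delta> + 1. poly (P i) (poly b x) * z i) = 0"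
proof -
  define m where "m = N * \<delta> + 1"
  note sk = subfield_imp_subring[OF k(1)]
  note kc = subring_OmegaD[OF sk]
  obtain c Q where c: "c \<in> kpol k" "c \<noteq> 0" "\<And>i j. i < m \<Longrightarrow> j < N \<Longrightarrow> Q i j \<in> kpol k"
    and cz: "\<And>i. i < m \<Longrightarrow> poly c x * z i = (\<Sum>j<N. poly (Q i j) x * W j)"
    using ff_gen_common_denom[OF sk g, of m z] z[folded m_def] by blast
  define B where "B = (\<Sum>i<m. \<Sum>j<N. degree (Q i j))"
  have B: "degree (Q i j) \<le> B" if "i < m" "j < N" for i j
  proof -
    have "degree (Q i j) \<le> (\<Sum>j<N. degree (Q i j))" using that member_le_sum[of j "{..<N}" "\<lambda>j. degree (Q i j)"] by simp
    also have "\<dots> \<le> B" unfolding B_def using that member_le_sum[of i "{..<m}" "\<lambda>i. \<Sum>j<N. degree (Q i j)"] by simp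
    finally show ?thesis .
  qed
  \<comment> \<open>With this A the source exponent (A + 1)(N\<delta> + 1) exceeds the target
    exponent (B + \<delta>A + 1)N by exactly N\<delta> + 1.\<close>
  define A where "A = N * (B + 1)"
  define T where "T = PiE {..<m} (\<lambda>_. bpol k A)"
  define T' where "T' = PiE {..<N} (\<lambda>_. bpol k (B + \<delta> * A))"
  define \<Phi> where "\<Phi> P = restrict (\<lambda>j. \<Sum>i<m. pcompose (P i) b * Q i j) {..<N}" for P
  have fb: "finite (bpol k A')" "card (bpol k A') = card k ^ (A' + 1)" for A'
    using card_bpol[OF k(2) kc(1)] by auto
  have cT: "card T = card k ^ ((A + 1) * m)" "card T' = card k ^ ((B + \<delta> * A + 1) * N)"
    unfolding T_def T'_def by (simp_all add: card_PiE fb power_mult[symmetric] prod_constant del: power_Suc)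
  have fT': "finite T'" unfolding T'_def by (intro finite_PiE) (auto simp: fb)
  have "(B + \<delta> * A + 1) * N < (A + 1) * m"
    unfolding m_def A_def by (simp add: algebra_simps)
  then have "card T' < card T" unfolding cT
    using finite_subfield_power(3)[OF k kc(1)] by (intro power_strict_increasing) auto
  moreover have "\<Phi> ` T \<subseteq> T'"
  proof
    fix y assume "y \<in> \<Phi> ` T"
    then obtain P where P: "P \<in> T" "y = \<Phi> P" by auto
    have "(\<Sum>i<m. pcompose (P i) b * Q i j) \<in> bpol k (B + \<delta> * A)" if "j < N" for j
    proof -
      have Pi: "P i \<in> kpol k" "degree (P i) \<le> A" if "i < m" for i
        using P(1) that unfolding T_def bpol_def by (auto dest!: PiE_mem)
      have "degree (pcompose (P i) b * Q i j) \<le> B + \<delta> * A" if "i < m" for i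
      proof -
        have "degree (pcompose (P i) b * Q i j) \<le> degree (pcompose (P i) b) + degree (Q i j)"
          by (rule degree_mult_le)
        also have "\<dots> \<le> degree (P i) * degree b + degree (Q i j)" by (simp add: degree_pcompose)
        also have "\<dots> \<le> A * \<delta> + B" using Pi that B \<open>j < N\<close> b by (intro add_mono mult_mono) auto
        finally show ?thesis by (simp add: algebra_simps)
      qed
      then show ?thesis unfolding bpol_def using that Pi c b
        by (auto intro!: kpol_sum[OF sk] kpol_clos[OF sk] kpol_pcompose[OF sk] degree_sum_le)
    qed
    then show "y \<in> T'" unfolding P(2) \<Phi>_def T'_def by auto
  qed
  ultimately have "\<not> inj_on \<Phi> T"
    using card_inj_on_le[OF _ _ fT'] by (metis linorder_not_less)
  then obtain P P' where P: "P \<in> T" "P' \<in> T" "P \<noteq> P'" "\<Phi> P = \<Phi> P'" by (auto simp: inj_on_def)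
  define D where "D i = P i - P' i" for i
  have "\<exists>i<m. D i \<noteq> 0" using P(1-3) unfolding T_def D_def by (metis PiE_ext lessThan_iff right_minus_eq)
  moreover have Dk: "D i \<in> kpol k" if "i < m" for i
    using P(1,2) that unfolding D_def T_def bpol_def by (auto dest!: PiE_mem intro!: kpol_clos[OF sk])
  moreover have "(\<Sum>i<m. poly (D i) (poly b x) * z i) = 0"
  proof -
    have z0: "(\<Sum>i<m. pcompose (D i) b * Q i j) = 0" if "j < N" for j
      using fun_cong[OF P(4), of j] that unfolding \<Phi>_def D_def
      by (simp add: pcompose_diff left_diff_distrib sum_subtractf)
    have "poly c x * (\<Sum>i<m. poly (D i) (poly b x) * z i) = (\<Sum>i<m. poly (D i) (poly b x) * (poly c x * z i))"
      by (simp add: sum_distrib_left algebra_simps)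
    also have "\<dots> = (\<Sum>i<m. \<Sum>j<N. poly (pcompose (D i) b * Q i j) x * W j)"
    proof (rule sum.cong)
      fix i assume "i \<in> {..<m}"
      then show "poly (D i) (poly b x) * (poly c x * z i) = (\<Sum>j<N. poly (pcompose (D i) b * Q i j) x * W j)"
        by (simp only: cz lessThan_iff sum_distrib_left) (simp add: poly_pcompose mult.assoc)
    qed simp
    also have "\<dots> = (\<Sum>j<N. poly (\<Sum>i<m. pcompose (D i) b * Q i j) x * W j)"
      by (subst sum.swap) (simp add: poly_sum sum_distrib_right)
    also have "\<dots> = 0" by (intro sum.neutral) (auto simp: z0)
    finally show ?thesis using g c(1,2) by (auto simp: ff_gen_def)
  qed
  ultimately show ?thesis unfolding m_def by blast
qed

text \<open>A relation whose constant coefficients all vanish is divisible by t = b(x), which is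
  nonzero; dividing lowers the total degree. The constant coefficients that finally survive give a
  nontrivial linear relation over k modulo t.\<close>

lemma ff_relation_normalized:
  assumes k: "subfield k (\<Omega> :: 'a::field ring)" "finite k" and g: "ff_gen k K x N W"
    and b: "b \<in> kpol k" "degree b \<le> \<delta>" "poly b x \<noteq> 0" and z: "\<And>i. i < N * \<delta> + 1 \<Longrightarrow> z i \<in> K"
  shows "\<exists>P. (\<forall>i<N * \<delta> + 1. P i \<in> kpol k) \<and> (\<exists>i<N * \<delta> + 1. coeff (P i) 0 \<noteq> 0) \<and>
     (\<Sum>i<N * \<delta> + 1. poly (P i) (poly b x) * z i) = 0"
proof -
  define m where "m = N * \<delta> + 1"
  define t where "t = poly b x"
  have "\<exists>P. (\<forall>i<m. P i \<in> kpol k) \<and> (\<exists>i<m. coeff (P i) 0 \<noteq> 0) \<and> (\<Sum>i<m. poly (P i) t * z i) = 0"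
    if "\<forall>i<m. P i \<in> kpol k" "\<exists>i<m. P i \<noteq> 0" "(\<Sum>i<m. poly (P i) t * z i) = 0" for P
    using that
  proof (induction "\<Sum>i<m. degree (P i)" arbitrary: P rule: less_induct)
    case less
    show ?case
    proof (cases "\<exists>i<m. coeff (P i) 0 \<noteq> 0")
      case False
      define P' where "P' i = poly_shift 1 (P i)" for i
      have e: "P i = pCons 0 (P' i)" if "i < m" for i
        using False that unfolding P'_def by (intro poly_eqI) (auto simp: coeff_pCons coeff_poly_shift split: nat.split)
      have "degree (P' i) \<le> degree (P i)" if "i < m" for i using e[OF that] by (cases "P' i = 0") auto
      moreover obtain i0 where i0: "i0 < m" "P i0 \<noteq> 0" using less by auto
      then have "degree (P' i0) < degree (P i0)" using e[OF i0(1)] by auto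
      ultimately have "(\<Sum>i<m. degree (P' i)) < (\<Sum>i<m. degree (P i))"
        using i0 by (intro sum_strict_mono_ex1) auto
      moreover have "\<forall>i<m. P' i \<in> kpol k" using less(2) unfolding P'_def by (auto simp: kpol_def coeff_poly_shift)
      moreover have "\<exists>i<m. P' i \<noteq> 0" using i0 e by (metis pCons_0_0)
      moreover have "t * (\<Sum>i<m. poly (P' i) t * z i) = (\<Sum>i<m. poly (P i) t * z i)"
        unfolding sum_distrib_left by (intro sum.cong) (auto simp: e)
      then have "(\<Sum>i<m. poly (P' i) t * z i) = 0" using less b(3) unfolding t_def by simp
      ultimately show ?thesis using less(1) by blast
    qed (use less in blast)
  qed
  moreover have "\<exists>P. (\<forall>i<N * \<delta> + 1. P i \<in> kpol k) \<and> (\<exists>i<N * \<delta> + 1. P i \<noteq> 0) \<and>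
     (\<Sum>i<N * \<delta> + 1. poly (P i) (poly b x) * z i) = 0"
    by (rule ff_relation[OF k g b(1,2)]) (use z in auto)
  ultimately show ?thesis unfolding m_def t_def by blast
qed

text \<open>Some nonzero t = b(x) is a multiple of f. By the normalized relation at most
  \<open>N * degree b\<close> elements of R are independent over k modulo t R, so the finitely many
  combinations of a maximal independent family represent R modulo t, hence modulo f.\<close>

lemma (in val_ring) finite_quotient_aux:
  assumes k: "subfield k \<Omega>" "finite k" "k \<subseteq> K" and g: "ff_gen k K x N W" and x: "x \<in> R" and f: "f \<in> M" "f \<noteq> 0"
  shows "\<exists>S. finite S \<and> S \<subseteq> R \<and> (\<forall>z\<in>R. \<exists>s\<in>S. \<exists>r\<in>R. z - s = f * r)"
proof -
  note sk = subfield_imp_subring[OF k(1)]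
  note kc = subfield_OmegaD[OF k(1)]
  have kR: "k \<subseteq> R"
  proof
    fix c assume "c \<in> k"
    then show "c \<in> R" using finite_subfield_power(1,3)[OF k(1,2) \<open>c \<in> k\<close>] k(3) Rc(1)
      by (cases "c = 0") (auto intro: rootof1_in[of c "card k - 1"])
  qed
  have pR: "poly p y \<in> R" if "p \<in> kpol k" "y \<in> R" for p y
    using poly_in_subring[OF sr kpol_mono[OF that(1) kR] that(2)] .
  have fR: "f \<in> R" "f \<in> K" using f MR RK by auto
  \<comment> \<open>A relation between the powers of f over k[x] yields a nonzero polynomial in x divisible by f.\<close>
  obtain b r where b: "b \<in> kpol k" "poly b x \<noteq> 0" "r \<in> R" "poly b x = f * r"
  proof -
    have X: "[:0, 1:] \<in> kpol k" "degree [:0, 1::'a:] \<le> 1" by (auto intro!: kpol_clos[OF sk] kc)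
    obtain P where P: "\<And>i. i < N * 1 + 1 \<Longrightarrow> P i \<in> kpol k" "\<exists>i<N * 1 + 1. P i \<noteq> 0"
      "(\<Sum>i<N * 1 + 1. poly (P i) (poly [:0, 1:] x) * f ^ i) = 0"
      using ff_relation[OF k(1,2) g X, of "\<lambda>i. f ^ i"] fR by (auto simp: Kc)
    \<comment> \<open>After cancelling the lowest occurring power of f, the relation says that the
      polynomial P i0 at x is a multiple of f.\<close>
    define i0 where "i0 = (LEAST i. i < N * 1 + 1 \<and> P i \<noteq> 0)"
    have i0: "i0 < N * 1 + 1" "P i0 \<noteq> 0" using LeastI_ex[OF P(2)] unfolding i0_def by auto
    have least: "P i = 0" if "i < i0" for i
    proof (rule ccontr)
      assume "P i \<noteq> 0"
      then have "i < N * 1 + 1 \<and> P i \<noteq> 0" using that i0 by auto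
      from Least_le[of "\<lambda>i. i < N * 1 + 1 \<and> P i \<noteq> 0", OF this] that show False unfolding i0_def by auto
    qed
    define r where "r = - (\<Sum>i\<in>{i0<..<N+1}. poly (P i) x * f ^ (i - i0 - 1))"
    have "r \<in> R" unfolding r_def using P(1) x fR by (intro Rc Rsum pR) auto
    moreover have "poly (P i0) x = f * r"
    proof -
      have "0 = (\<Sum>i<N + 1. poly (P i) x * f ^ i)" using P(3) by simp
      also have "\<dots> = (\<Sum>i\<in>{i0..<N+1}. poly (P i) x * f ^ i)"
        by (rule sum.mono_neutral_right) (auto simp: least)
      also have "{i0..<N+1} = insert i0 {i0<..<N+1}" using i0(1) by auto
      also have "(\<Sum>i\<in>\<dots>. poly (P i) x * f ^ i) = poly (P i0) x * f ^ i0 + (\<Sum>i\<in>{i0<..<N+1}. poly (P i) x * f ^ i)"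
        by (subst sum.insert) auto
      also have "(\<Sum>i\<in>{i0<..<N+1}. poly (P i) x * f ^ i) = f ^ i0 * (f * (- r))"
        unfolding r_def minus_minus sum_distrib_left
      proof (rule sum.cong)
        fix i assume "i \<in> {i0<..<N+1}"
        then have "i = i0 + (1 + (i - i0 - 1))" by simp
        then have "f ^ i = f ^ i0 * (f * f ^ (i - i0 - 1))" by (metis power_add power_one_right)
        then show "poly (P i) x * f ^ i = f ^ i0 * (f * (poly (P i) x * f ^ (i - i0 - 1)))" by simp
      qed simp
      also have "poly (P i0) x * f ^ i0 + f ^ i0 * (f * (- r)) = f ^ i0 * (poly (P i0) x - f * r)"
        by (simp add: algebra_simps)
      finally have "f ^ i0 * (poly (P i0) x - f * r) = 0" by (rule sym)
      then have "poly (P i0) x - f * r = 0" using f(2) by (metis mult_eq_0_iff power_not_zero)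
      then show ?thesis by (simp only: right_minus_eq)
    qed
    moreover have "poly (P i0) x \<noteq> 0" using g i0 P(1)[of i0] unfolding ff_gen_def by simp
    ultimately show ?thesis using that P(1)[OF i0(1)] by blast
  qed
  define t where "t = poly b x"
  have tR: "t \<in> R" unfolding t_def by (intro pR b x)
  define m where "m = N * degree b + 1"
  \<comment> \<open>Linear independence over k of the first l elements modulo the ideal t R.\<close>
  define indep where "indep l z \<longleftrightarrow> (\<forall>i<l. z i \<in> R) \<and>
     (\<forall>c. (\<forall>i<l. c i \<in> k) \<longrightarrow> (\<exists>r\<in>R. (\<Sum>i<l. c i * z i) = t * r) \<longrightarrow> (\<forall>i<l. c i = 0))" for l :: nat and z
  have indepD: "c i = 0" if "indep l z" "\<forall>i<l. c i \<in> k" "\<exists>r\<in>R. (\<Sum>i<l. c i * z i) = t * r" "i < l" for l z c i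
    using conjunct2[OF that(1)[unfolded indep_def], THEN spec[of _ c]] that(2-) by simp
  have dep: "\<not> indep m z" for z
  proof
    assume i: "indep m z"
    then have zR: "z i \<in> R" if "i < m" for i using that by (auto simp: indep_def)
    obtain P where P: "\<And>i. i < m \<Longrightarrow> P i \<in> kpol k" "\<exists>i<m. coeff (P i) 0 \<noteq> 0"
      "(\<Sum>i<m. poly (P i) t * z i) = 0"
      using ff_relation_normalized[OF k(1,2) g b(1) order_refl b(2), of z] zR RK unfolding m_def t_def by blast
    define P' where "P' i = poly_shift 1 (P i)" for i
    have e: "P i = pCons (coeff (P i) 0) (P' i)" for i
      unfolding P'_def by (intro poly_eqI) (auto simp: coeff_pCons coeff_poly_shift split: nat.split)
    have e2: "poly (P i) t = coeff (P i) 0 + t * poly (P' i) t" for i by (subst e) simp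
    have "P' i \<in> kpol k" if "i < m" for i using P(1)[OF that] unfolding P'_def by (auto simp: kpol_def coeff_poly_shift)
    then have "(\<Sum>i<m. poly (P' i) t * z i) \<in> R" using zR tR by (intro Rsum Rc pR) auto
    moreover have "(\<Sum>i<m. coeff (P i) 0 * z i) = t * - (\<Sum>i<m. poly (P' i) t * z i)"
      proof -
      have "(\<Sum>i<m. poly (P i) t * z i) = (\<Sum>i<m. coeff (P i) 0 * z i + t * (poly (P' i) t * z i))"
        by (intro sum.cong refl) (simp add: e2[of _] distrib_right mult.assoc)
      also have "\<dots> = (\<Sum>i<m. coeff (P i) 0 * z i) + t * (\<Sum>i<m. poly (P' i) t * z i)"
        by (simp only: sum.distrib sum_distrib_left)
      finally show ?thesis using P(3) by (simp add: eq_neg_iff_add_eq_0)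
    qed
    ultimately have "\<exists>r\<in>R. (\<Sum>i<m. coeff (P i) 0 * z i) = t * r" using Rc(3) by blast
    moreover have "\<forall>i<m. coeff (P i) 0 \<in> k" using P(1) kpolD by blast
    ultimately show False using indepD[OF i, of "\<lambda>i. coeff (P i) 0"] P(2) by blast
  qed
  have sub: "indep l z" if "indep l' z" "l \<le> l'" for l l' z
    unfolding indep_def
  proof (intro conjI allI impI)
    fix i assume "i < l" then show "z i \<in> R" using that by (auto simp: indep_def)
  next
    fix c i assume c: "\<forall>i<l. c i \<in> k" "\<exists>r\<in>R. (\<Sum>i<l. c i * z i) = t * r" "i < l"
    define c' where "c' i = (if i < l then c i else 0)" for i
    have "(\<Sum>i<l'. c' i * z i) = (\<Sum>i<l. c i * z i)"
      by (rule sum.mono_neutral_cong_right) (use that in \<open>auto simp: c'_def\<close>)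
    moreover have "\<forall>i<l'. c' i \<in> k" using c by (auto simp: c'_def kc)
    ultimately have "c' i = 0" using indepD[OF that(1), of c' i] c that(2) by simp
    then show "c i = 0" using c by (auto simp: c'_def)
  qed
  have "\<exists>z. indep 0 z" by (auto simp: indep_def)
  then have ex0: "(\<lambda>l. \<exists>z. indep l z) 0" .
  have bnd: "l \<le> m" if iz: "\<exists>z. indep l z" for l
  proof (rule ccontr)
    assume "\<not> l \<le> m"
    then show False using iz dep sub[of l _ m] by auto
  qed
  define l where "l = (GREATEST l. \<exists>z. indep l z)"
  have "\<exists>z. indep l z" unfolding l_def by (rule GreatestI_nat[where P = "\<lambda>l. \<exists>z. indep l z", OF ex0 bnd])
  then obtain z where lz: "indep l z" by blast
  have mx: "l' \<le> l" if "\<exists>z. indep l' z" for l'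
    unfolding l_def by (rule Greatest_le_nat[where P = "\<lambda>l. \<exists>z. indep l z", OF that bnd])
  define S where "S = (\<lambda>c. \<Sum>i<l. c i * z i) ` PiE {..<l} (\<lambda>_. k)"
  have "finite S" unfolding S_def by (intro finite_imageI finite_PiE) (use k in auto)
  moreover have "S \<subseteq> R" using lz kR unfolding S_def indep_def by (auto intro!: Rsum Rc dest!: PiE_mem)
  moreover have "\<exists>s\<in>S. \<exists>r\<in>R. y - s = f * r" if y: "y \<in> R" for y
  proof -
    \<comment> \<open>Appending y to a family of maximal length destroys independence. The
      coefficient of y cannot vanish, so y is solved for modulo t.\<close>
    define z' where "z' i = (if i < l then z i else y)" for i
    have "\<not> indep (Suc l) z'" using mx by fastforce
    moreover have "\<forall>i<Suc l. z' i \<in> R" using lz y by (auto simp: z'_def indep_def)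
    ultimately obtain c r where c: "\<forall>i<Suc l. c i \<in> k" "r \<in> R" "(\<Sum>i<Suc l. c i * z' i) = t * r"
      "\<exists>i<Suc l. c i \<noteq> 0" unfolding indep_def by blast
    have s: "(\<Sum>i<l. c i * z i) + c l * y = t * r"
    proof -
      have "(\<Sum>i<l. c i * z' i) = (\<Sum>i<l. c i * z i)" by (intro sum.cong) (auto simp: z'_def)
      then show ?thesis using c(3) by (simp add: z'_def)
    qed
    have cl: "c l \<noteq> 0"
    proof
      assume "c l = 0"
      then have "(\<Sum>i<l. c i * z i) = t * r" using s by simp
      moreover have "\<forall>i<l. c i \<in> k" using c by auto
      ultimately have "\<forall>i<l. c i = 0" using indepD[OF lz, of c] c(2) by blast
      then show False using c(4) \<open>c l = 0\<close> by (auto simp: less_Suc_eq)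
    qed
    define s where "s = (\<Sum>i<l. restrict (\<lambda>i. - c i / c l) {..<l} i * z i)"
    have "s \<in> S" unfolding S_def s_def by (intro imageI) (use c in \<open>auto intro!: kc split: if_splits\<close>)
    moreover have "s = - (\<Sum>i<l. c i * z i) / c l" unfolding s_def
      by (simp add: sum_divide_distrib sum_negf)
    then have "y - s = t * r / c l" using s cl by (simp add: field_simps)
    moreover have "inverse (c l) \<in> R" using c(1) kR kc(8) by blast
    obtain r' where r': "r' \<in> R" "t = f * r'" using b unfolding t_def by blast
    have "t * r / c l = f * (r' * r * inverse (c l))" using r' by (simp add: divide_inverse)
    moreover have "r' * r * inverse (c l) \<in> R" by (intro Rc r' c) fact
    ultimately show ?thesis by metis
  qed
  ultimately show ?thesis by blast
qed

lemma (in val_ring) finite_quotient: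
  assumes "fun_field k K" "f \<in> M" "f \<noteq> 0"
  shows "\<exists>S. finite S \<and> S \<subseteq> R \<and> (\<forall>z\<in>R. \<exists>s\<in>S. \<exists>r\<in>R. z - s = f * r)"
proof -
  obtain x N W where k: "subfield k \<Omega>" "finite k" "k \<subseteq> K" "ff_gen k K x N W" using assms by (auto simp: fun_field_def)
  show ?thesis
  proof (cases "x \<in> R")
    case False
    then have "inverse x \<in> R" using tot k(4) by (auto simp: ff_gen_def)
    then show ?thesis using finite_quotient_aux[OF k(1-3) ff_gen_inverse[OF subfield_imp_subring[OF k(1)] sfK k(4)] _ assms(2,3)] by blast
  qed (use finite_quotient_aux[OF k _ assms(2,3)] in blast)
qed

section \<open>Discreteness of the places of a function field\<close>

lemma (in val_ring) ex_divides_all: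
  assumes "finite A" "A \<noteq> {}" "A \<subseteq> R"
  shows "\<exists>a\<in>A. \<forall>b\<in>A. \<exists>r\<in>R. b = a * r"
  using assms
proof (induction A rule: finite_ne_induct)
  case (singleton x)
  then show ?case using Rc(2) by (auto intro!: bexI[of _ 1])
next
  case (insert x A)
  then obtain a where a: "a \<in> A" "\<forall>b\<in>A. \<exists>r\<in>R. b = a * r" by auto
  have "a \<in> R" "x \<in> R" using insert a by auto
  show ?case
  proof (cases "\<exists>r\<in>R. x = a * r")
    case True then show ?thesis using a by auto
  next
    case False
    then have "x \<noteq> 0" using Rc(1) by force
    have "a \<noteq> 0 \<Longrightarrow> x / a \<notin> R" using False by force
    then have "a / x \<in> R" using tot[of "x / a"] \<open>a \<in> R\<close> \<open>x \<in> R\<close> RK Kc(9) Rc(1) by (cases "a = 0") auto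
    then have "\<exists>r\<in>R. a = x * r" using \<open>x \<noteq> 0\<close> by (intro bexI[of _ "a / x"]) auto
    then obtain r where r: "r \<in> R" "a = x * r" by blast
    have "\<exists>r\<in>R. b = x * r" if bA: "b \<in> insert x A" for b
    proof (cases "b = x")
      case True then show ?thesis using Rc(2) by (intro bexI[of _ 1]) auto
    next
      case False
      then obtain r' where "r' \<in> R" "b = a * r'" using bspec[OF a(2), of b] bA False by blast
      then show ?thesis using r Rc(5)[of r r'] by (intro bexI[of _ "r * r'"]) auto
    qed
    then show ?thesis by blast
  qed
qed

text \<open>Finiteness of the quotients R / f R is used twice. It produces a generator t of M, as
  the element dividing finitely many others; and it makes two powers of t agree modulo any nonzero f
  in M, so that f divides a power of t up to a unit and is itself a power of t up to a unit.\<close>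

theorem place_dval_ring:
  assumes "fun_field k K" "R \<in> places K"
  shows "dval_ring K R"
proof -
  have sK: "subfield K \<Omega>" using assms by (auto simp: fun_field_def)
  interpret val_ring K R using sK assms by (simp add: val_ring_def)
  obtain f where f: "f \<in> M" "f \<noteq> 0" using ex_M by blast
  obtain S where S: "finite S" "S \<subseteq> R" "\<And>z. z \<in> R \<Longrightarrow> \<exists>s\<in>S. \<exists>r\<in>R. z - s = f * r"
    using finite_quotient[OF assms(1) f] by blast
  \<comment> \<open>Every element of M is congruent modulo f to a representative that lies in M, so
    an element of A dividing all of A generates M.\<close>
  define A where "A = insert f (S \<inter> M)"
  obtain t where t: "t \<in> A" "\<And>b. b \<in> A \<Longrightarrow> \<exists>r\<in>R. b = t * r"
  proof -
    have "finite A" "A \<noteq> {}" "A \<subseteq> R" using S f MR unfolding A_def by auto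
    then show ?thesis using ex_divides_all[of A] that by blast
  qed
  have tM: "t \<in> M" using t f by (auto simp: A_def)
  have Mt: "M = (\<lambda>x. t * x) ` R"
  proof
    show "(\<lambda>x. t * x) ` R \<subseteq> M" using tM M_mult by auto
    show "M \<subseteq> (\<lambda>x. t * x) ` R"
    proof
      fix z assume z: "z \<in> M"
      obtain s r where s: "s \<in> S" "r \<in> R" "z - s = f * r" using S(3) MR[OF z] by blast
      have "s = z - f * r" using s(3) by (simp add: algebra_simps)
      then have "s \<in> M" using z f s M_diff M_mult by auto
      obtain r1 where r1: "r1 \<in> R" "s = t * r1" using t(2)[of s] s \<open>s \<in> M\<close> by (auto simp: A_def)
      obtain r2 where r2: "r2 \<in> R" "f = t * r2" using t(2)[of f] by (auto simp: A_def)
      have "z = t * (r1 + r2 * r)" using s(3) r1(2) r2(2) by (simp add: algebra_simps)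
      then show "z \<in> (\<lambda>x. t * x) ` R" using Rc r1 r2 s by auto
    qed
  qed
  have t0: "t \<noteq> 0" using Mt f by auto
  have tR: "t \<in> R" using tM MR by auto
  \<comment> \<open>A divisor of a power of t is a power of t times a unit: factors t are stripped
    as long as it lies in M.\<close>
  have div: "\<exists>m::nat. \<exists>u\<in>Units (sub R). f = t ^ m * u" if "f \<in> R" "r \<in> R" "f * r = t ^ i" for f r i
    using that
  proof (induction i arbitrary: f)
    case 0
    then have "f \<in> Units (sub R)" by (auto simp: U_iff inverse_unique)
    then show ?case by (intro exI[of _ 0]) auto
  next
    case (Suc i)
    show ?case
    proof (cases "f \<in> M")
      case True
      then obtain f' where f': "f' \<in> R" "f = t * f'" using Mt by auto
      then have "f' * r = t ^ i" using Suc(4) t0 by simp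
      then obtain m u where u: "u \<in> Units (sub R)" "f' = t ^ m * u" using Suc(1)[OF f'(1) Suc(3)] by blast
      then show ?thesis using f' by (intro exI[of _ "Suc m"] bexI[of _ u]) auto
    next
      case False
      then have "f \<in> Units (sub R)" using Suc unit_not_M by auto
      then show ?thesis by (intro exI[of _ 0]) auto
    qed
  qed
  have fact: "\<exists>m::nat. \<exists>u\<in>Units (sub R). f = t ^ m * u" if f: "f \<in> R" "f \<noteq> 0" for f
  proof (cases "f \<in> M")
    case True
    obtain S where S: "finite S" "S \<subseteq> R" "\<And>z. z \<in> R \<Longrightarrow> \<exists>s\<in>S. \<exists>r\<in>R. z - s = f * r"
      using finite_quotient[OF assms(1) True f(2)] by blast
    have "\<exists>s. s \<in> S \<and> (\<exists>r\<in>R. t ^ i - s = f * r)" for i using S(3)[OF Rc(7)[OF tR, of i]] by blast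
    then obtain s where s: "\<And>i. s i \<in> S \<and> (\<exists>r\<in>R. t ^ i - s i = f * r)" by metis
    \<comment> \<open>Infinitely many exponents but finitely many classes modulo f: two powers of t
      collide, and 1 - t^(j - i) is a unit.\<close>
    have "\<not> inj s" using s S(1) by (metis finite_subset image_subsetI infinite_UNIV_nat finite_imageD)
    then obtain i j where ij: "i < j" "s i = s j" unfolding inj_def by (metis linorder_neqE_nat)
    obtain r1 r2 where r: "r1 \<in> R" "r2 \<in> R" "t ^ i - s i = f * r1" "t ^ j - s j = f * r2" using s by metis
    have "t ^ j = t ^ i * t ^ (j - i)" using ij by (simp add: power_add[symmetric])
    moreover have "t ^ i - t ^ j = (t ^ i - s i) - (t ^ j - s j)" using ij(2) by simp
    then have "t ^ i - t ^ j = f * (r1 - r2)" using r by (simp only: right_diff_distrib)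
    ultimately have e: "t ^ i * (1 - t ^ (j - i)) = f * (r1 - r2)" by (simp add: right_diff_distrib)
    have "t ^ (j - i) = t * t ^ (j - i - 1)" using ij by (metis power_eq_if zero_less_diff less_numeral_extra(3))
    then have "t ^ (j - i) \<in> M" using M_mult[OF tM Rc(7)[OF tR]] by simp
    then have "1 - t ^ (j - i) \<notin> M" using M_add M_one by (metis diff_add_cancel)
    moreover have "1 - t ^ (j - i) \<in> R" by (intro Rc tR)
    ultimately have u: "inverse (1 - t ^ (j - i)) \<in> R" "1 - t ^ (j - i) \<noteq> 0" using unit_inv M_zero by force+
    have "f * ((r1 - r2) * inverse (1 - t ^ (j - i))) = t ^ i" using e u(2) by (simp add: field_simps)
    moreover have "(r1 - r2) * inverse (1 - t ^ (j - i)) \<in> R" by (intro Rc r u)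
    ultimately show ?thesis using div f by blast
  next
    case False
    then have "f \<in> Units (sub R)" using f unit_not_M by auto
    then show ?thesis by (intro exI[of _ 0]) auto
  qed
  have "\<exists>m::int. \<exists>u\<in>Units (sub R). f = t powi m * u" if f: "f \<in> K" "f \<noteq> 0" for f
  proof (cases "f \<in> R")
    case True
    then obtain m u where u: "u \<in> Units (sub R)" "f = t ^ m * u" using fact f by blast
    then show ?thesis by (intro exI[of _ "int m"] bexI[of _ u]) auto
  next
    case False
    then obtain m u where u: "u \<in> Units (sub R)" "inverse f = t ^ m * u" using fact[of "inverse f"] f tot by auto
    then have "f = inverse (t ^ m * u)" by (metis inverse_inverse_eq)
    then have "f = t powi (- int m) * inverse u" by (simp add: power_int_minus)
    moreover have "inverse u \<in> Units (sub R)" using u(1) by (auto simp: U_iff)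
    ultimately show ?thesis by blast
  qed
  then have "\<forall>f\<in>K - {0}. \<exists>m. \<exists>u\<in>Units (sub R). f = t powi m * u" by blast
  then have "dval_ring_axioms K R" unfolding dval_ring_axioms_def using tR Mt by blast
  then show ?thesis by (intro dval_ring.intro val_ring_axioms)
qed

lemma (in val_ring) finite_residues:
  assumes "fun_field k K"
  shows "\<exists>S. finite S \<and> S \<subseteq> R \<and> (\<forall>z\<in>R. \<exists>s\<in>S. z - s \<in> M)"
proof -
  obtain f where f: "f \<in> M" "f \<noteq> 0" using ex_M by blast
  then show ?thesis using finite_quotient[OF assms f] M_mult by metis
qed

section \<open>Extension of places and weak approximation\<close>

definition adjoin :: "'a::field set \<Rightarrow> 'a \<Rightarrow> 'a set" where
  "adjoin S z = (\<lambda>p. poly p z) ` kpol S"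

lemma adjoin_props:
  assumes S: "subring S (\<Omega> :: 'a::field ring)"
  shows "subring (adjoin S z) \<Omega>" "S \<subseteq> adjoin S z" "z \<in> adjoin S z"
    "subring T \<Omega> \<Longrightarrow> S \<subseteq> T \<Longrightarrow> z \<in> T \<Longrightarrow> adjoin S z \<subseteq> T"
proof -
  note Sc = subring_OmegaD[OF S]
  note pc = kpol_clos[OF S]
  show "subring (adjoin S z) \<Omega>"
  proof (rule subring_OmegaI)
    show "1 \<in> adjoin S z" unfolding adjoin_def using pc(2) by (auto intro!: image_eqI[of _ _ 1])
    fix x y assume "x \<in> adjoin S z" "y \<in> adjoin S z"
    then obtain p r where "p \<in> kpol S" "r \<in> kpol S" "x = poly p z" "y = poly r z" by (auto simp: adjoin_def)
    then show "x - y \<in> adjoin S z" "x * y \<in> adjoin S z"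
      unfolding adjoin_def using pc(5,6)[of p r]
      by (metis image_eqI poly_diff, metis image_eqI poly_mult)
  qed
  show "S \<subseteq> adjoin S z"
  proof
    fix c assume "c \<in> S"
    then have "monom c 0 \<in> kpol S" by (rule pc)
    then show "c \<in> adjoin S z" unfolding adjoin_def by (auto intro!: image_eqI[of _ _ "monom c 0"] simp: poly_monom)
  qed
  have "monom 1 1 \<in> kpol S" by (intro pc Sc)
  then show "z \<in> adjoin S z" unfolding adjoin_def by (auto intro!: image_eqI[of _ _ "monom 1 1"] simp: poly_monom)
  show "subring T \<Omega> \<Longrightarrow> S \<subseteq> T \<Longrightarrow> z \<in> T \<Longrightarrow> adjoin S z \<subseteq> T"
    unfolding adjoin_def using poly_in_subring[of T _ z] kpol_mono[of _ S T] by blast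
qed

lemma subring_Union_chain:
  assumes "C \<noteq> {}" "\<And>S. S \<in> C \<Longrightarrow> subring S (\<Omega> :: 'a::field ring)"
    and "\<And>S T. S \<in> C \<Longrightarrow> T \<in> C \<Longrightarrow> S \<subseteq> T \<or> T \<subseteq> S"
  shows "subring (\<Union>C) \<Omega>"
proof (rule subring_OmegaI)
  show "1 \<in> \<Union>C" using assms(1,2) subring_OmegaD(2) by blast
  fix x y assume "x \<in> \<Union>C" "y \<in> \<Union>C"
  then obtain S T where "S \<in> C" "T \<in> C" "x \<in> S" "y \<in> T" by blast
  then obtain U where "U \<in> C" "x \<in> U" "y \<in> U" using assms(3)[of S T] by blast
  then show "x - y \<in> \<Union>C" "x * y \<in> \<Union>C"
    using subring_OmegaD(5,6)[OF assms(2), of U x y] by blast+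
qed

text \<open>The core of Chevalley's argument. Hypothesis \<open>mx\<close> expresses maximality
  among subrings avoiding the inverse of t: every z outside S satisfies 1 = t r(z) with r over S. If
  z and its inverse were both outside, then of the two relations of minimal degree the one of larger
  degree could be lowered with the help of the other.\<close>

lemma maximal_subring_valuation:
  assumes S: "subring S (\<Omega> :: 'a::field ring)" and t: "t \<in> S" "t \<noteq> 0" "inverse t \<notin> S"
    and mx: "\<And>z. z \<in> K \<Longrightarrow> z \<notin> S \<Longrightarrow> inverse t \<in> adjoin S z"
    and K: "subfield K \<Omega>" "S \<subseteq> K" and z: "z \<in> K"
  shows "z \<in> S \<or> inverse z \<in> S"
proof (rule ccontr)
  note Sc = subring_OmegaD[OF S]
  note pc = kpol_clos[OF S]
  assume neg: "\<not> (z \<in> S \<or> inverse z \<in> S)"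
  then have z0: "z \<noteq> 0" using Sc(1) by auto
  define good where "good z r \<longleftrightarrow> r \<in> kpol S \<and> t * poly r z = 1" for z r
  have ex: "\<exists>r. good w r" if w: "w \<in> K" "w \<notin> S" for w
  proof -
    obtain r where "r \<in> kpol S" "inverse t = poly r w" using mx[OF w] by (auto simp: adjoin_def)
    then show ?thesis using t unfolding good_def by (intro exI[of _ r]) (metis right_inverse)
  qed
  \<comment> \<open>t behaves like an element of the Jacobson radical of S: were 1 - t b not
    invertible in S, a relation for its inverse, multiplied by a power of u, would place the inverse
    of t in S, because powers of u are congruent to 1 modulo t S.\<close>
  have unit: "inverse (1 - t * b) \<in> S" "1 - t * b \<noteq> 0" if b: "b \<in> S" for b
  proof -
    show nz: "1 - t * b \<noteq> 0"
    proof
      assume "1 - t * b = 0"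
      then have "inverse t = b" by (simp add: inverse_unique)
      then show False using t b by simp
    qed
    define u where "u = 1 - t * b"
    have uS: "u \<in> S" unfolding u_def by (intro Sc b t)
    show "inverse (1 - t * b) \<in> S"
    proof (rule ccontr)
      assume "inverse (1 - t * b) \<notin> S"
      then have "inverse u \<notin> S" "inverse u \<in> K" using subfield_OmegaD(8)[OF K(1)] K(2) uS by (auto simp: u_def)
      then obtain r where r: "r \<in> kpol S" "t * poly r (inverse u) = 1" using ex unfolding good_def by blast
      define k where "k = degree r"
      have pw: "\<exists>c\<in>S. u ^ i = 1 - t * c" for i
      proof (induction i)
        case 0 then show ?case using Sc(1) by (intro bexI[of _ 0]) auto
      next
        case (Suc i)
        then obtain c where c: "c \<in> S" "u ^ i = 1 - t * c" by blast
        then have "u ^ Suc i = (1 - t * b) * (1 - t * c)" by (simp add: u_def)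
        also have "\<dots> = 1 - t * (c + b - t * b * c)" by (simp add: algebra_simps)
        finally have "u ^ Suc i = 1 - t * (c + b - t * b * c)" .
        moreover have "c + b - t * b * c \<in> S" by (intro Sc c b t)
        ultimately show ?case by blast
      qed
      obtain c where c: "c \<in> S" "u ^ k = 1 - t * c" using pw by blast
      define a where "a = (\<Sum>i\<le>k. coeff r i * u ^ (k - i))"
      have aS: "a \<in> S" unfolding a_def using r kpolD by (intro sum_in_subring[OF S] Sc uS) blast
      have "u ^ k * poly r (inverse u) = a"
        unfolding a_def poly_altdef k_def[symmetric] sum_distrib_left
      proof (rule sum.cong)
        fix i assume "i \<in> {..k}"
        then have "u ^ k = u ^ (k - i) * u ^ i" by (simp add: power_add[symmetric])
        moreover have "u ^ i * inverse u ^ i = 1" using nz by (simp add: power_mult_distrib[symmetric] u_def)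
        ultimately show "u ^ k * (coeff r i * inverse u ^ i) = coeff r i * u ^ (k - i)"
          by (simp add: algebra_simps)
      qed simp
      moreover have "inverse t = poly r (inverse u)" using r(2) by (rule inverse_unique)
      ultimately have "(1 - t * c) * inverse t = a" using c by simp
      then have "inverse t = a + c" using t(2) by (simp add: field_simps)
      then show False using t(3) Sc(4)[OF aS c(1)] by simp
    qed
  qed
  have red: "\<exists>r'. good w r' \<and> degree r' < degree r"
    if r: "good w r" and s: "good (inverse w) s" and w: "w \<noteq> 0" "w \<notin> S" and d: "degree s \<le> degree r" for w r s
  proof -
    define n where "n = degree r"
    have n0: "n > 0"
    proof (rule ccontr)
      assume "\<not> n > 0"
      then have "degree r = 0" by (simp add: n_def)
      then obtain a where "r = [:a:]" by (rule degree_eq_zeroE)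
      then have "a \<in> S" "t * a = 1" using r kpolD[of r S 0] by (auto simp: good_def)
      then show False using t(3) by (simp add: inverse_unique)
    qed
    define u where "u = 1 - t * coeff s 0"
    have sS: "coeff s i \<in> S" "coeff r i \<in> S" for i using s r kpolD by (auto simp: good_def)
    have u: "inverse u \<in> S" "u \<noteq> 0" using unit[OF sS(1)] by (auto simp: u_def)
    define m where "m = degree s"
    have usum: "u = t * (\<Sum>j\<in>{1..m}. coeff s j * inverse w ^ j)"
    proof -
      have "1 = t * (\<Sum>j\<le>m. coeff s j * inverse w ^ j)" using s unfolding good_def m_def poly_altdef by simp
      also have "{..m} = insert 0 {1..m}" by auto
      also have "(\<Sum>j\<in>\<dots>. coeff s j * inverse w ^ j) = coeff s 0 + (\<Sum>j\<in>{1..m}. coeff s j * inverse w ^ j)"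
        by (subst sum.insert) auto
      finally show ?thesis unfolding u_def by (simp add: algebra_simps)
    qed
    define a where "a = coeff r n * inverse u"
    have aS: "a \<in> S" unfolding a_def by (intro Sc sS u)
    \<comment> \<open>The leading term of r is traded for lower powers of w: multiplying the formula
      \<open>usum\<close> for u by a w^n gives \<open>coeff r n * w ^ n\<close> on one side, and m
      \<le> n keeps all exponents on the other side nonnegative.\<close>
    define r' where "r' = (\<Sum>i<n. monom (coeff r i) i) + (\<Sum>j\<in>{1..m}. monom (a * t * coeff s j) (n - j))"
    have "r' \<in> kpol S" unfolding r'_def
      by (intro pc kpol_sum[OF S] sS Sc aS t)
    moreover have "degree r' < n"
    proof -
      have "degree (\<Sum>i<n. monom (coeff r i) i) \<le> n - 1"
        by (intro degree_sum_le) (use n0 in \<open>auto intro: order.trans[OF degree_monom_le]\<close>)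
      moreover have "degree (\<Sum>j\<in>{1..m}. monom (a * t * coeff s j) (n - j)) \<le> n - 1"
        by (intro degree_sum_le) (use n0 in \<open>auto intro: order.trans[OF degree_monom_le]\<close>)
      ultimately have "degree r' \<le> n - 1" unfolding r'_def by (rule degree_add_le)
      then show ?thesis using n0 by simp
    qed
    moreover have "poly r' w = poly r w"
    proof -
      have e1: "poly (\<Sum>i<n. monom (coeff r i) i) w = (\<Sum>i<n. coeff r i * w ^ i)"
        by (simp add: poly_sum poly_monom)
      have "poly (\<Sum>j\<in>{1..m}. monom (a * t * coeff s j) (n - j)) w = (\<Sum>j\<in>{1..m}. a * t * coeff s j * w ^ (n - j))"
        by (simp add: poly_sum poly_monom)
      also have "\<dots> = a * w ^ n * (t * (\<Sum>j\<in>{1..m}. coeff s j * inverse w ^ j))"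
        unfolding sum_distrib_left
      proof (rule sum.cong)
        fix j assume "j \<in> {1..m}"
        then have "j \<le> n" using d by (auto simp: m_def n_def)
        then have "w ^ n = w ^ (n - j) * w ^ j" by (simp add: power_add[symmetric])
        moreover have "w ^ j * inverse w ^ j = 1" using w by (simp add: power_mult_distrib[symmetric])
        ultimately show "a * t * coeff s j * w ^ (n - j) = a * w ^ n * (t * (coeff s j * inverse w ^ j))"
          by (simp add: algebra_simps)
      qed simp
      also have "\<dots> = a * w ^ n * u" by (simp only: usum[symmetric])
      also have "\<dots> = coeff r n * w ^ n" unfolding a_def using u by (simp add: field_simps)
      finally have "poly r' w = (\<Sum>i<Suc n. coeff r i * w ^ i)" unfolding r'_def using e1 by simp
      then show ?thesis unfolding poly_altdef n_def lessThan_Suc_atMost .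
    qed
    ultimately show ?thesis using r unfolding good_def n_def by auto
  qed
  define r where "r = (ARG_MIN degree r. good z r)"
  define s where "s = (ARG_MIN degree s. good (inverse z) s)"
  have "inverse z \<in> K" using subfield_OmegaD(8)[OF K(1) z] .
  obtain r0 s0 where rs0: "good z r0" "good (inverse z) s0" using ex[of z] ex[of "inverse z"] neg z \<open>inverse z \<in> K\<close> by blast
  have r: "good z r" "\<And>r'. good z r' \<Longrightarrow> degree r \<le> degree r'"
    using arg_min_nat_lemma[of "good z" r0 degree] rs0 unfolding r_def by auto
  have s: "good (inverse z) s" "\<And>r'. good (inverse z) r' \<Longrightarrow> degree s \<le> degree r'"
    using arg_min_nat_lemma[of "good (inverse z)" s0 degree] rs0 unfolding s_def by auto
  show False
  proof (cases "degree s \<le> degree r")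
    case True
    then show ?thesis using red[OF r(1) s(1) z0 _ True] r(2) neg by (meson linorder_not_less)
  next
    case False
    then show ?thesis using red[OF s(1), of r] s(2) neg r(1) z0 by (auto simp: not_le[symmetric])
  qed
qed

text \<open>Zorn's lemma for subrings avoiding the inverse of t: the avoided element keeps the
  maximal ring proper, and maximality makes it a valuation ring.\<close>

theorem ex_place_over_subring:
  assumes K: "subfield K (\<Omega> :: 'a::field ring)" and R0: "subring R0 \<Omega>" "R0 \<subseteq> K"
    and t: "t \<in> R0" "t \<noteq> 0" "inverse t \<notin> R0"
  shows "\<exists>R\<in>places K. R0 \<subseteq> R \<and> inverse t \<notin> R"
proof -
  define \<A> where "\<A> = {S. subring S \<Omega> \<and> R0 \<subseteq> S \<and> S \<subseteq> K \<and> inverse t \<notin> S}"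
  have "\<exists>M\<in>\<A>. \<forall>U\<in>\<A>. M \<subseteq> U \<longrightarrow> U = M"
  proof (rule subset_Zorn_nonempty)
    show "\<A> \<noteq> {}" using R0 t by (auto simp: \<A>_def)
    fix C assume C: "C \<noteq> {}" "subset.chain \<A> C"
    have "subring (\<Union>C) \<Omega>"
      by (rule subring_Union_chain) (use C in \<open>auto simp: subset.chain_def \<A>_def\<close>)
    then show "\<Union>C \<in> \<A>" using C unfolding \<A>_def subset.chain_def by blast
  qed
  then obtain S where S: "S \<in> \<A>" "\<And>U. U \<in> \<A> \<Longrightarrow> S \<subseteq> U \<Longrightarrow> U = S" by blast
  have sS: "subring S \<Omega>" "R0 \<subseteq> S" "S \<subseteq> K" "inverse t \<notin> S" using S by (auto simp: \<A>_def)
  have mx: "inverse t \<in> adjoin S z" if z: "z \<in> K" "z \<notin> S" for z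
  proof (rule ccontr)
    assume "inverse t \<notin> adjoin S z"
    then have "adjoin S z \<in> \<A>"
      using adjoin_props(1-3)[OF sS(1), of z] adjoin_props(4)[OF sS(1) subfield_imp_subring[OF K] sS(3) z(1)] sS
      by (auto simp: \<A>_def)
    then have "adjoin S z = S" using S(2) adjoin_props(2)[OF sS(1)] by blast
    then show False using adjoin_props(3)[OF sS(1), of z] z by auto
  qed
  have "z \<in> S \<or> inverse z \<in> S" if "z \<in> K" for z
    by (rule maximal_subring_valuation[OF sS(1) _ t(2) sS(4) mx K sS(3) that]) (use t sS in auto)
  moreover have "inverse t \<in> K" using t R0 K by (auto intro: subfield_OmegaD)
  ultimately have "S \<in> places K" using sS by (auto simp: places_def)
  then show ?thesis using sS by blast
qed

section \<open>Weak approximation for finitely many places\<close>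

locale finite_places =
  fixes K :: "'a::field set" and S :: "'a set set"
  assumes finS: "finite S" and dvS: "\<And>R. R \<in> S \<Longrightarrow> dval_ring K R" and SK: "subfield K (\<Omega> :: 'a ring)"
begin

lemmas Kc = subfield_OmegaD[OF SK]

text \<open>By maximality neither ring contains the other. Elements a and b, each lying in one ring
  and missing from the other, have a quotient with a pole at one place and a zero at the
  other.\<close>

lemma separate_two:
  assumes "R \<in> S" "R' \<in> S" "R \<noteq> R'"
  shows "\<exists>w\<in>K. w \<noteq> 0 \<and> ord_at R w < 0 \<and> ord_at R' w > 0"
proof -
  interpret A: dval_ring K R by (rule dvS) fact
  interpret B: dval_ring K R' by (rule dvS) fact
  obtain a where a: "a \<in> R" "a \<notin> R'" using B.pl A.R_maximal[of R'] assms by auto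
  obtain b where b: "b \<in> R'" "b \<notin> R" using A.pl B.R_maximal[of R] assms by auto
  have nz: "a \<noteq> 0" "b \<noteq> 0" "a \<in> K" "b \<in> K" using a b A.Rc(1) B.Rc(1) A.RK B.RK by auto
  have "ord_at R (b / a) < 0"
    using nz a b A.R_iff[of a] A.R_iff[of b] by (simp add: A.ord_div)
  moreover have "ord_at R' (b / a) > 0"
    using nz a b B.R_iff[of a] B.R_iff[of b] by (simp add: B.ord_div)
  ultimately show ?thesis using nz by (intro bexI[of _ "b / a"]) (auto intro: Kc)
qed

text \<open>Induction on the set T of places to be separated from R. If w handles T but not the new
  place R', it is combined with a function z that separates R from R' alone.\<close>

lemma separate:
  assumes R: "R \<in> S"
  shows "\<exists>w\<in>K. w \<noteq> 0 \<and> ord_at R w < 0 \<and> (\<forall>R'\<in>S - {R}. ord_at R' w > 0)"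
proof -
  interpret A: dval_ring K R by (rule dvS) fact
  have "\<exists>w\<in>K. w \<noteq> 0 \<and> ord_at R w < 0 \<and> (\<forall>R'\<in>T. ord_at R' w > 0)" if "T \<subseteq> S - {R}" for T
    using finite_subset[OF that] finS that
  proof (induction T rule: infinite_finite_induct)
    case empty
    have "ord_at R (inverse A.t0) = -1" using A.ord_t0' A.t0_nz A.t0(1) A.RK by (simp add: A.ord_inverse)
    then show ?case using A.t0_nz A.t0(1) A.RK by (intro bexI[of _ "inverse A.t0"]) (auto intro: Kc)
  next
    case (insert R' T)
    then obtain w where w: "w \<in> K" "w \<noteq> 0" "ord_at R w < 0" "\<And>Q. Q \<in> T \<Longrightarrow> ord_at Q w > 0" by auto
    obtain z where z: "z \<in> K" "z \<noteq> 0" "ord_at R z < 0" "ord_at R' z > 0"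
      using separate_two[of R R'] R insert by auto
    have R': "R' \<in> S" "R' \<noteq> R" using insert by auto
    interpret B: dval_ring K R' by (rule dvS) fact
    \<comment> \<open>Large enough for m times a positive order of w to outweigh the order of z
      everywhere on T.\<close>
    define m where "m = 1 + nat (\<Sum>Q\<in>T. \<bar>ord_at Q z\<bar>)"
    have TS: "Q \<in> S" if "Q \<in> T" for Q using that insert by auto
    have m: "int m * ord_at Q w + ord_at Q z > 0" if Q: "Q \<in> T" for Q
    proof -
      have "\<bar>ord_at Q z\<bar> \<le> (\<Sum>Q\<in>T. \<bar>ord_at Q z\<bar>)"
        using Q insert member_le_sum[of Q T "\<lambda>Q. \<bar>ord_at Q z\<bar>"] by auto
      then have "int m > \<bar>ord_at Q z\<bar>" unfolding m_def by linarith
      moreover have "int m * ord_at Q w \<ge> int m * 1" using w(4)[OF Q] by (intro mult_left_mono) auto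
      ultimately show ?thesis by linarith
    qed
    have wm: "w ^ m \<in> K" "w ^ m \<noteq> 0" using w by (auto intro: Kc)
    have "m > 0" unfolding m_def by simp
    then have m0: "int m > 0" by simp
    have mneg: "int m * ord_at R w < 0" using w(3) m0 by (intro mult_pos_neg)
    consider "ord_at R' w > 0" | "ord_at R' w = 0" | "ord_at R' w < 0" by linarith
    then show ?case
    proof cases
      case 1 then show ?thesis using w by (intro bexI[of _ w]) auto
    next
      case 2
      have "ord_at Q (w ^ m * z) > 0" if Q: "Q \<in> insert R' T" for Q
      proof -
        interpret C: dval_ring K Q using Q R' TS by (auto intro: dvS)
        have "ord_at Q (w ^ m * z) = int m * ord_at Q w + ord_at Q z"
          using w z wm by (simp add: C.ord_mult C.ord_power)
        then show ?thesis using Q m 2 z by auto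
      qed
      moreover have "ord_at R (w ^ m * z) < 0"
        using w z wm mneg by (simp add: A.ord_mult A.ord_power)
      ultimately show ?thesis using w z wm by (intro bexI[of _ "w ^ m * z"]) (auto intro: Kc)
    next
      case 3
      have m3: "int m * ord_at R' w < 0" using 3 m0 by (intro mult_pos_neg)
      have big: "1 + w ^ m \<noteq> 0 \<and> ord_at Q (1 + w ^ m) = int m * ord_at Q w"
        if "Q \<in> S" "int m * ord_at Q w < 0" for Q
      proof -
        interpret C: dval_ring K Q by (rule dvS) fact
        have "(1 + w ^ m) - w ^ m \<in> C.V 0" by (simp add: C.V_0 C.Rc)
        then show ?thesis using C.ord_cong[of "w ^ m" "1 + w ^ m" 0] wm w that by (auto simp: C.ord_power)
      qed
      have n1: "1 + w ^ m \<noteq> 0" "1 + w ^ m \<in> K" using big[OF R] mneg wm by (auto intro: Kc)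
      \<comment> \<open>At poles of w the quotient w^m / (1 + w^m) is a unit, so v has the order of
        z there; at zeros of w it has the order of w^m z.\<close>
      define v where "v = w ^ m / (1 + w ^ m) * z"
      have ov: "ord_at Q v = int m * ord_at Q w - ord_at Q (1 + w ^ m) + ord_at Q z" if "Q \<in> S" for Q
      proof -
        interpret C: dval_ring K Q by (rule dvS) fact
        show ?thesis unfolding v_def using n1 wm z w by (simp add: C.ord_mult C.ord_div C.ord_power Kc)
      qed
      have "ord_at Q v > 0" if Q: "Q \<in> T" for Q
      proof -
        interpret C: dval_ring K Q using Q TS by (auto intro: dvS)
        have "int m * ord_at Q w > 0" using w(4)[OF Q] m0 by simp
        then have "ord_at Q (w ^ m) \<ge> 1" using C.ord_power[OF w(1,2), of m] by linarith
        then have "(1 + w ^ m) - 1 \<in> C.V 1" using wm by (simp add: C.V_def)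
        then have "ord_at Q (1 + w ^ m) = 0" using C.ord_cong[of 1 "1 + w ^ m" 1] by (simp add: C.ord_one Kc)
        then show ?thesis using ov m Q TS by simp
      qed
      moreover have "ord_at R' v > 0" using ov[OF R'(1)] big[OF R'(1) m3] z by simp
      moreover have "ord_at R v < 0" using ov[OF R] big[OF R mneg] z by simp
      moreover have "v \<in> K" "v \<noteq> 0" unfolding v_def using n1 wm z by (auto intro: Kc)
      ultimately show ?thesis by (intro bexI[of _ v]) auto
    qed
  qed (use finS in \<open>auto dest: finite_subset\<close>)
  then show ?thesis by blast
qed

text \<open>The function w^m / (1 + w^m) approaches 1 at a pole of w and 0 at a zero of w as m
  grows.\<close>

lemma approx_one:
  assumes R: "R \<in> S"
  shows "\<exists>e\<in>K. e - 1 \<in> dval_ring.V K R L \<and> (\<forall>R'\<in>S - {R}. e \<in> dval_ring.V K R' L)"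
proof -
  interpret A: dval_ring K R by (rule dvS) fact
  obtain w where w: "w \<in> K" "w \<noteq> 0" "ord_at R w < 0" "\<And>R'. R' \<in> S - {R} \<Longrightarrow> ord_at R' w > 0"
    using separate[OF R] by blast
  define m where "m = nat L + 1"
  have m0: "int m > 0" by (simp add: m_def)
  have wm: "w ^ m \<in> K" "w ^ m \<noteq> 0" using w by (auto intro: Kc)
  have mneg: "int m * ord_at R w \<le> - int m" using w(3) mult_left_mono[of "ord_at R w" "-1" "int m"] by simp
  have "(1 + w ^ m) - w ^ m \<in> A.V 0" by (simp add: A.V_0 A.Rc)
  then have n1: "1 + w ^ m \<noteq> 0" and oR: "ord_at R (1 + w ^ m) = int m * ord_at R w"
    using A.ord_cong[of "w ^ m" "1 + w ^ m" 0] wm mneg A.ord_power[OF w(1,2), of m] m0 by auto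
  have n1K: "1 + w ^ m \<in> K" using wm by (auto intro: Kc)
  define e where "e = w ^ m / (1 + w ^ m)"
  have e1: "e - 1 = - inverse (1 + w ^ m)" unfolding e_def using n1 by (simp add: field_simps)
  have "inverse (1 + w ^ m) \<in> A.V L" unfolding A.V_def using n1 n1K oR mneg
    by (auto simp: A.ord_inverse Kc m_def)
  then have "e - 1 \<in> A.V L" unfolding e1 by (rule A.V_minus)
  moreover have "e \<in> dval_ring.V K R' L" if R': "R' \<in> S - {R}" for R'
  proof -
    interpret C: dval_ring K R' using R' by (auto intro: dvS)
    have pos: "int m * ord_at R' w \<ge> int m" using w(4)[OF R'] mult_left_mono[of 1 "ord_at R' w" "int m"] by simp
    have "ord_at R' (w ^ m) \<ge> 1" using pos m0 C.ord_power[OF w(1,2), of m] by linarith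
    then have "(1 + w ^ m) - 1 \<in> C.V 1" using wm by (simp add: C.V_def)
    then have "ord_at R' (1 + w ^ m) = 0" using C.ord_cong[of 1 "1 + w ^ m" 1] by (simp add: C.ord_one Kc)
    then have "ord_at R' e = int m * ord_at R' w" unfolding e_def using wm w n1 n1K by (simp add: C.ord_div C.ord_power)
    moreover have "int m \<ge> L" unfolding m_def by simp
    ultimately have "ord_at R' e \<ge> L" using pos by linarith
    moreover have "e \<in> K" unfolding e_def using wm n1K by (auto intro: Kc)
    ultimately show ?thesis by (simp add: C.V_def)
  qed
  moreover have "e \<in> K" unfolding e_def using wm n1K by (auto intro: Kc)
  ultimately show ?thesis by blast
qed

theorem weak_approximation:
  assumes a: "\<And>R. R \<in> S \<Longrightarrow> a R \<in> K"
  shows "\<exists>x\<in>K. \<forall>R\<in>S. x - a R \<in> dval_ring.V K R L"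
proof -
  \<comment> \<open>The precision of the approximate idempotents e R must survive multiplication by
    values a R' that may have poles at R.\<close>
  define B where "B = \<bar>L\<bar> + (\<Sum>R\<in>S. \<Sum>R'\<in>S. \<bar>ord_at R (a R')\<bar>)"
  have B: "\<bar>L\<bar> + \<bar>ord_at R (a R')\<bar> \<le> B" if "R \<in> S" "R' \<in> S" for R R'
  proof -
    have "\<bar>ord_at R (a R')\<bar> \<le> (\<Sum>R'\<in>S. \<bar>ord_at R (a R')\<bar>)"
      using that finS member_le_sum[of R' S "\<lambda>R'. \<bar>ord_at R (a R')\<bar>"] by auto
    also have "\<dots> \<le> (\<Sum>R\<in>S. \<Sum>R'\<in>S. \<bar>ord_at R (a R')\<bar>)"
      using that finS member_le_sum[of R S "\<lambda>R. \<Sum>R'\<in>S. \<bar>ord_at R (a R')\<bar>"] by (auto intro: sum_nonneg)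
    finally show ?thesis unfolding B_def by simp
  qed
  obtain e where e: "\<And>R. R \<in> S \<Longrightarrow> e R \<in> K" "\<And>R. R \<in> S \<Longrightarrow> e R - 1 \<in> dval_ring.V K R B"
    "\<And>R R'. R \<in> S \<Longrightarrow> R' \<in> S \<Longrightarrow> R' \<noteq> R \<Longrightarrow> e R \<in> dval_ring.V K R' B"
    using approx_one[of _ B] by (metis DiffI singletonD)
  define x where "x = (\<Sum>R\<in>S. a R * e R)"
  have "x \<in> K" unfolding x_def using e a by (intro sum_in_subfield[OF SK] Kc) auto
  moreover have "x - a R \<in> dval_ring.V K R L" if R: "R \<in> S" for R
  proof -
    interpret A: dval_ring K R by (rule dvS) fact
    have *: "a R' * z \<in> A.V L" if "R' \<in> S" "z \<in> A.V B" for R' z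
    proof (cases "a R' = 0")
      case False
      have "a R' \<in> A.V (ord_at R (a R'))" using a that by (simp add: A.V_def)
      from A.V_mult[OF this that(2)] show ?thesis
        by (rule A.V_mono) (use B[OF R that(1)] in linarith)
    qed (simp add: A.V_zero)
    have "x = a R * e R + (\<Sum>R'\<in>S - {R}. a R' * e R')" unfolding x_def by (rule sum.remove[OF finS R])
    then have x: "x - a R = a R * (e R - 1) + (\<Sum>R'\<in>S - {R}. a R' * e R')" by (simp add: algebra_simps)
    show ?thesis unfolding x using e R by (intro A.V_add A.V_sum *) auto
  qed
  ultimately show ?thesis by blast
qed

end

section \<open>Algebraicity and spans expressed by ordinary polynomials and sums\<close>

lemma Omega_nat_pow [simp]: "x [^]\<^bsub>(\<Omega> :: 'a::field ring)\<^esub> (n::nat) = x ^ n"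
  by (induction n) (simp_all add: nat_pow_def ring_of_type_algebra_def mult.commute)

text \<open>Polynomials of the algebra library are coefficient lists with the leading coefficient
  first, hence the reversal.\<close>

lemma eval_Omega: "ring.eval (\<Omega> :: 'a::field ring) xs x = poly (Poly (rev xs)) x"
proof -
  interpret ring "\<Omega> :: 'a ring" by (rule Omega_ring)
  show ?thesis
    by (induction xs) (simp_all add: Poly_snoc poly_monom algebra_simps)
qed

lemma algebraic_iff:
  assumes K: "subring K (\<Omega> :: 'a::field ring)"
  shows "(ring.algebraic \<Omega> over K) x \<longleftrightarrow> (\<exists>p\<in>kpol K. p \<noteq> 0 \<and> poly p x = 0)"
proof -
  interpret Ring.field "\<Omega> :: 'a ring" by (rule Omega_field)
  show ?thesis
  proof
    assume "(algebraic over K) x"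
    then obtain p where p: "p \<in> carrier (K[X]\<^bsub>\<Omega>\<^esub>)" "p \<noteq> []" "eval p x = \<zero>\<^bsub>\<Omega>\<^esub>"
      by (rule algebraicE[OF K, rotated]) auto
    then have pp: "polynomial\<^bsub>\<Omega>\<^esub> K p" by (simp add: univ_poly_carrier)
    then have pK: "set p \<subseteq> K" "hd p \<noteq> 0" using p(2) by (auto simp: polynomial_def)
    define P where "P = Poly (rev p)"
    have "P \<in> kpol K" unfolding P_def kpol_def coeff_Poly_eq nth_default_def
      using pK subring_OmegaD(1)[OF K] by (auto simp: nth_default_def rev_nth)
    moreover have "P \<noteq> 0"
    proof -
      obtain a r where "p = a # r" using p(2) by (cases p) auto
      then have "Polynomial.coeff P (length r) \<noteq> 0" using pK unfolding P_def coeff_Poly_eq nth_default_def by (simp add: nth_append)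
      then show ?thesis by auto
    qed
    moreover have "poly P x = 0" using p(3) by (simp add: eval_Omega P_def)
    ultimately show "\<exists>p\<in>kpol K. p \<noteq> 0 \<and> poly p x = 0" by blast
  next
    assume "\<exists>p\<in>kpol K. p \<noteq> 0 \<and> poly p x = 0"
    then obtain p where p: "p \<in> kpol K" "p \<noteq> 0" "poly p x = 0" by blast
    have "set (coeffs p) \<subseteq> K" using p(1) by (auto simp: coeffs_def kpol_def)
    then have "polynomial\<^bsub>\<Omega>\<^esub> K (rev (coeffs p))" using p(2)
      by (auto simp: polynomial_def hd_rev last_coeffs_eq_coeff_degree)
    then show "(algebraic over K) x"
      using p by (intro algebraicI[of "rev (coeffs p)"]) (auto simp: univ_poly_carrier eval_Omega)
  qed
qed

lemma alg_closure_root: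
  assumes "algebraic_closure (\<Omega> :: 'a::field ring) F" "degree (p :: 'a poly) > 0"
  shows "\<exists>z. poly p z = 0"
proof -
  interpret algebraic_closure "\<Omega> :: 'a ring" F by fact
  define l where "l = rev (coeffs p)"
  have "p \<noteq> 0" using assms by auto
  then have "polynomial\<^bsub>\<Omega>\<^esub> (carrier \<Omega>) l" unfolding l_def
    by (auto simp: polynomial_def hd_rev last_coeffs_eq_coeff_degree)
  then have l: "l \<in> carrier (poly_ring \<Omega>)" by (simp add: univ_poly_carrier)
  have "size (roots l) = length l - 1" using roots_over_carrier[OF l] by (simp add: splitted_def)
  also have "\<dots> > 0" using assms(2) \<open>p \<noteq> 0\<close> by (simp add: l_def length_coeffs_degree)
  finally have "roots l \<noteq> {#}" by auto
  then obtain a where "a \<in># roots l" by auto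
  then have "eval l a = 0" using roots_mem_iff_is_root[OF l] by (simp add: is_root_def)
  then show ?thesis unfolding l_def eval_Omega by auto
qed

lemma combine_Omega:
  "length Ks = length Us \<Longrightarrow> ring.combine (\<Omega> :: 'a::field ring) Ks Us = (\<Sum>i<length Us. Ks ! i * Us ! i)"
proof -
  interpret ring "\<Omega> :: 'a ring" by (rule Omega_ring)
  show "length Ks = length Us \<Longrightarrow> combine Ks Us = (\<Sum>i<length Us. Ks ! i * Us ! i)"
    by (induction Ks Us rule: list_induct2) (auto simp: sum.lessThan_Suc_shift simp del: sum.lessThan_Suc)
qed

lemma Span_Omega:
  assumes "subfield K (\<Omega> :: 'a::field ring)"
  shows "ring.Span \<Omega> K Us = {z. \<exists>c. (\<forall>i<length Us. c i \<in> K) \<and> z = (\<Sum>i<length Us. c i * Us ! i)}"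
proof -
  interpret Ring.field "\<Omega> :: 'a ring" by (rule Omega_field)
  have "Span K Us = {combine Ks Us | Ks. length Ks = length Us \<and> set Ks \<subseteq> K}"
    by (rule Span_eq_combine_set_length_version[OF assms]) auto
  also have "\<dots> = {z. \<exists>c. (\<forall>i<length Us. c i \<in> K) \<and> z = (\<Sum>i<length Us. c i * Us ! i)}" (is "?A = ?B")
  proof (intro Set.set_eqI iffI)
    fix z assume "z \<in> ?A"
    then obtain Ks where Ks: "length Ks = length Us" "set Ks \<subseteq> K" "z = combine Ks Us" by blast
    then show "z \<in> ?B" using combine_Omega[OF Ks(1)]
      by (auto intro!: exI[of _ "\<lambda>i. Ks ! i"] simp: subset_iff)
  next
    fix z assume "z \<in> ?B"
    then obtain c where c: "\<forall>i<length Us. c i \<in> K" "z = (\<Sum>i<length Us. c i * Us ! i)" by blast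
    define Ks where "Ks = map c [0..<length Us]"
    have l: "length Ks = length Us" by (simp add: Ks_def)
    moreover have "z = combine Ks Us" unfolding combine_Omega[OF l] c(2)
      by (intro sum.cong) (auto simp: Ks_def)
    moreover have "set Ks \<subseteq> K" using c(1) by (auto simp: Ks_def)
    ultimately show "z \<in> ?A" by blast
  qed
  finally show ?thesis .
qed

lemma finite_dimension_span:
  assumes "subfield K (\<Omega> :: 'a::field ring)" "ring.finite_dimension \<Omega> K E"
  shows "\<exists>n W. (\<forall>i<(n::nat). W i \<in> E) \<and> (\<forall>z\<in>E. \<exists>c. (\<forall>i<n. c i \<in> K) \<and> z = (\<Sum>i<n. c i * W i))"
proof -
  interpret Ring.field "\<Omega> :: 'a ring" by (rule Omega_field)
  obtain n where "dimension n K E" using assms(2) by blast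
  then obtain Us where Us: "length Us = n" "Span K Us = E" using exists_base[OF assms(1)] by blast
  note S = Span_Omega[OF assms(1), of Us, unfolded Us(2)]
  note kc = subfield_OmegaD[OF assms(1)]
  have "Us ! i \<in> E" if "i < n" for i
    unfolding S using that Us(1) kc
    by (auto intro!: exI[of _ "\<lambda>j. if j = i then 1 else 0"] simp: if_distrib[of "\<lambda>x. x * _"] sum.delta' cong: if_cong)
  moreover have "\<exists>c. (\<forall>i<n. c i \<in> K) \<and> z = (\<Sum>i<n. c i * Us ! i)" if "z \<in> E" for z
    using that Us(1) unfolding S by auto
  ultimately show ?thesis by blast
qed

text \<open>The fractions form a subfield containing x and k, and the generated field is the least
  one. Since x may be algebraic, nonvanishing is required of the denominator at x and not of the
  polynomial.\<close>

lemma generate_field_subset_fractions: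
  assumes k: "subfield k (\<Omega> :: 'a::field ring)" and z: "z \<in> generate_field \<Omega> (insert x k)"
  shows "\<exists>p\<in>kpol k. \<exists>r\<in>kpol k. poly r x \<noteq> 0 \<and> z = poly p x / poly r x"
proof -
  interpret Ring.field "\<Omega> :: 'a ring" by (rule Omega_field)
  note sk = subfield_imp_subring[OF k]
  note pc = kpol_clos[OF sk]
  note kc = subfield_OmegaD[OF k]
  define T where "T = {poly p x / poly r x | p r. p \<in> kpol k \<and> r \<in> kpol k \<and> poly r x \<noteq> 0}"
  have TI: "poly p x / poly r x \<in> T" if "p \<in> kpol k" "r \<in> kpol k" "poly r x \<noteq> 0" for p r
    unfolding T_def using that by blast
  have "subfield T \<Omega>"
  proof (rule subfield_OmegaI)
    show "1 \<in> T" using TI[of 1 1] pc by simp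
    fix a b assume "a \<in> T" "b \<in> T"
    then obtain p r p' r' where *: "p \<in> kpol k" "r \<in> kpol k" "poly r x \<noteq> 0" "p' \<in> kpol k" "r' \<in> kpol k" "poly r' x \<noteq> 0"
      "a = poly p x / poly r x" "b = poly p' x / poly r' x" unfolding T_def by blast
    have "a - b = poly (p * r' - p' * r) x / poly (r * r') x" "a * b = poly (p * p') x / poly (r * r') x"
      using *(3,6) unfolding *(7,8) by (simp_all add: field_simps)
    then show "a - b \<in> T" "a * b \<in> T" using TI[of "p * r' - p' * r" "r * r'"] TI[of "p * p'" "r * r'"] * pc by auto
  next
    fix a assume "a \<in> T" "a \<noteq> 0"
    then obtain p r where *: "p \<in> kpol k" "r \<in> kpol k" "poly r x \<noteq> 0" "a = poly p x / poly r x" unfolding T_def by blast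
    then show "inverse a \<in> T" using TI[of r p] \<open>a \<noteq> 0\<close> by auto
  qed
  moreover have "c \<in> T" if "c \<in> k" for c using TI[of "Polynomial.monom c 0" 1] pc(7)[OF that, of 0] pc(2) by (simp add: poly_monom)
  moreover have "x \<in> T" using TI[of "Polynomial.monom 1 1" 1] pc(7)[OF kc(2), of 1] pc(2) by (simp add: poly_monom)
  ultimately have "generate_field \<Omega> (insert x k) \<subseteq> T"
    by (intro generate_field_min_subfield1) auto
  then show ?thesis using z unfolding T_def by blast
qed

lemma ff_gen_of_finite_dimension:
  assumes k: "subfield k (\<Omega> :: 'a::field ring)" and x: "x \<in> E" "(ring.transcendental \<Omega> over k) x"
    and fd: "ring.finite_dimension \<Omega> (generate_field \<Omega> (insert x k)) E"
  shows "\<exists>N W. ff_gen k E x N W"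
proof -
  interpret Ring.field "\<Omega> :: 'a ring" by (rule Omega_field)
  note sk = subfield_imp_subring[OF k]
  note pc = kpol_clos[OF sk]
  have sg: "subfield (generate_field \<Omega> (insert x k)) \<Omega>" by (rule generate_field_is_subfield) auto
  obtain N W where W: "\<And>z. z \<in> E \<Longrightarrow> \<exists>c. (\<forall>i<(N::nat). c i \<in> generate_field \<Omega> (insert x k)) \<and> z = (\<Sum>i<N. c i * W i)"
    using finite_dimension_span[OF sg fd] by blast
  have "\<not> (algebraic over k) x" using x(2) by (simp add: over_def)
  then have tr: "\<forall>p\<in>kpol k. p \<noteq> 0 \<longrightarrow> poly p x \<noteq> 0" using algebraic_iff[OF sk, of x] by blast
  have "\<exists>c\<in>kpol k. \<exists>P. c \<noteq> 0 \<and> (\<forall>j<N. P j \<in> kpol k) \<and> poly c x * z = (\<Sum>j<N. poly (P j) x * W j)"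
    if z: "z \<in> E" for z
  proof -
    obtain c where c: "\<And>i. i < N \<Longrightarrow> c i \<in> generate_field \<Omega> (insert x k)" "z = (\<Sum>i<N. c i * W i)" using W[OF z] by blast
    have "\<exists>f. i < N \<longrightarrow> fst f \<in> kpol k \<and> snd f \<in> kpol k \<and> poly (snd f) x \<noteq> 0 \<and> c i = poly (fst f) x / poly (snd f) x" for i
      using generate_field_subset_fractions[OF k c(1), of i] by (cases "i < N") auto
    then obtain f where f: "\<And>i. i < N \<Longrightarrow> fst (f i) \<in> kpol k" "\<And>i. i < N \<Longrightarrow> snd (f i) \<in> kpol k"
      "\<And>i. i < N \<Longrightarrow> poly (snd (f i)) x \<noteq> 0" "\<And>i. i < N \<Longrightarrow> c i = poly (fst (f i)) x / poly (snd (f i)) x" by metis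
    define d where "d = (\<Prod>i<N. snd (f i))"
    define P where "P j = fst (f j) * (\<Prod>i\<in>{..<N} - {j}. snd (f i))" for j
    have "d \<in> kpol k" unfolding d_def using f by (intro kpol_sum[OF sk]) auto
    moreover have "poly d x \<noteq> 0" unfolding d_def poly_prod using f by auto
    moreover have "P j \<in> kpol k" if "j < N" for j unfolding P_def using f that by (intro pc kpol_sum[OF sk]) auto
    moreover have "poly d x * z = (\<Sum>j<N. poly (P j) x * W j)"
      unfolding c(2) sum_distrib_left
    proof (rule sum.cong)
      fix j assume j: "j \<in> {..<N}"
      have "poly d x = poly (snd (f j)) x * poly (\<Prod>i\<in>{..<N} - {j}. snd (f i)) x"
        unfolding d_def using j by (subst prod.remove[of _ j]) auto
      then show "poly d x * (c j * W j) = poly (P j) x * W j"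
        using j f(3,4)[of j] by (simp add: P_def)
    qed simp
    ultimately show ?thesis by (intro bexI[of _ d] exI[of _ P]) auto
  qed
  then show ?thesis unfolding ff_gen_def using x(1) tr by blast
qed

text \<open>No extensionality is demanded, so that one function can act as an automorphism of a
  field and also of its stable subfields. \<open>gal_carrier_iff\<close> translates to and from the
  Galois group.\<close>

definition aut_on :: "'a::field set \<Rightarrow> ('a \<Rightarrow> 'a) \<Rightarrow> bool" where
  "aut_on E g \<longleftrightarrow> bij_betw g E E \<and> (\<forall>x\<in>E. \<forall>y\<in>E. g (x + y) = g x + g y) \<and>
     (\<forall>x\<in>E. \<forall>y\<in>E. g (x * y) = g x * g y)"

lemma aut_onD:
  assumes g: "aut_on E g" and E: "subfield E (\<Omega> :: 'a::field ring)"
  shows "x \<in> E \<Longrightarrow> g x \<in> E" "x \<in> E \<Longrightarrow> y \<in> E \<Longrightarrow> g (x + y) = g x + g y"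
    "x \<in> E \<Longrightarrow> y \<in> E \<Longrightarrow> g (x * y) = g x * g y" "g 0 = 0" "g 1 = 1"
    "x \<in> E \<Longrightarrow> g (- x) = - g x" "x \<in> E \<Longrightarrow> y \<in> E \<Longrightarrow> g (x - y) = g x - g y"
    "x \<in> E \<Longrightarrow> g (x ^ n) = g x ^ n" "x \<in> E \<Longrightarrow> g (inverse x) = inverse (g x)"
    "x \<in> E \<Longrightarrow> y \<in> E \<Longrightarrow> g x = g y \<longleftrightarrow> x = y" "x \<in> E \<Longrightarrow> g x = 0 \<longleftrightarrow> x = 0"
    "x \<in> E \<Longrightarrow> y \<in> E \<Longrightarrow> g (x / y) = g x / g y" "y \<in> E \<Longrightarrow> \<exists>x\<in>E. g x = y"
    "x \<in> E \<Longrightarrow> g (x powi m) = g x powi m"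
proof -
  note c = subfield_OmegaD[OF E]
  show 1: "\<And>x. x \<in> E \<Longrightarrow> g x \<in> E" using g by (auto simp: aut_on_def bij_betw_def)
  show a: "\<And>x y. x \<in> E \<Longrightarrow> y \<in> E \<Longrightarrow> g (x + y) = g x + g y" using g by (auto simp: aut_on_def)
  show m: "\<And>x y. x \<in> E \<Longrightarrow> y \<in> E \<Longrightarrow> g (x * y) = g x * g y" using g by (auto simp: aut_on_def)
  show inj: "\<And>x y. x \<in> E \<Longrightarrow> y \<in> E \<Longrightarrow> g x = g y \<longleftrightarrow> x = y" using g by (auto simp: aut_on_def bij_betw_def inj_on_def)
  show z: "g 0 = 0" using a[of 0 0] c(1) by (metis add_0 add_cancel_right_right)
  show z2: "\<And>x. x \<in> E \<Longrightarrow> g x = 0 \<longleftrightarrow> x = 0" using inj c(1) z by metis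
  have "g 1 \<noteq> 0" using z2 c(2) by simp
  then show o: "g 1 = 1" using m[of 1 1] c(2) by simp
  show mi: "\<And>x. x \<in> E \<Longrightarrow> g (- x) = - g x" using a[of _ "- _"] z c(3) by (metis add.right_inverse add_eq_0_iff)
  show "\<And>x y. x \<in> E \<Longrightarrow> y \<in> E \<Longrightarrow> g (x - y) = g x - g y" using a mi c(3) by (metis diff_conv_add_uminus)
  show p: "\<And>x n. x \<in> E \<Longrightarrow> g (x ^ n) = g x ^ n" for n
  proof -
    fix x and n :: nat assume x: "x \<in> E" show "g (x ^ n) = g x ^ n"
      by (induction n) (simp_all add: o m x c)
  qed
  show i: "\<And>x. x \<in> E \<Longrightarrow> g (inverse x) = inverse (g x)"
  proof -
    fix x assume x: "x \<in> E" show "g (inverse x) = inverse (g x)"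
    proof (cases "x = 0")
      case False
      then have "g x * g (inverse x) = 1" using m[of x "inverse x"] x c o by simp
      then show ?thesis by (metis inverse_unique)
    qed (simp add: z)
  qed
  show "\<And>x y. x \<in> E \<Longrightarrow> y \<in> E \<Longrightarrow> g (x / y) = g x / g y" unfolding divide_inverse using m i c by simp
  show "y \<in> E \<Longrightarrow> \<exists>x\<in>E. g x = y" using g by (metis aut_on_def bij_betw_def imageE)
  show "x \<in> E \<Longrightarrow> g (x powi m) = g x powi m" unfolding power_int_def using p i c by simp
qed

lemma aut_on_sum:
  assumes g: "aut_on E g" and E: "subfield E (\<Omega> :: 'a::field ring)" and f: "\<And>i. i \<in> I \<Longrightarrow> f i \<in> E"
  shows "g (sum f I) = (\<Sum>i\<in>I. g (f i))" "g (prod f I) = (\<Prod>i\<in>I. g (f i))"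
proof -
  show "g (sum f I) = (\<Sum>i\<in>I. g (f i))" using f
    by (induction I rule: infinite_finite_induct) (auto simp: aut_onD[OF g E] sum_in_subfield[OF E])
  show "g (prod f I) = (\<Prod>i\<in>I. g (f i))" using f
    by (induction I rule: infinite_finite_induct) (auto simp: aut_onD[OF g E] sum_in_subfield[OF E])
qed

lemma aut_on_poly:
  assumes g: "aut_on E g" and E: "subfield E (\<Omega> :: 'a::field ring)" and F: "\<And>x. x \<in> F \<Longrightarrow> g x = x" "F \<subseteq> E"
    and p: "p \<in> kpol F" and z: "z \<in> E"
  shows "g (poly p z) = poly p (g z)"
proof -
  have c: "coeff p i \<in> E" "g (coeff p i) = coeff p i" for i using kpolD[OF p] F by auto
  show ?thesis unfolding poly_altdef
    by (subst aut_on_sum[OF g E]) (auto simp: aut_onD[OF g E] c z subfield_OmegaD[OF E])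
qed

lemma map_poly_aut_mult:
  assumes g: "aut_on E g" and E: "subfield E (\<Omega> :: 'a::field ring)" and p: "p \<in> kpol E" "r \<in> kpol E"
  shows "map_poly g (p * r) = map_poly g p * map_poly g r"
proof (rule poly_eqI)
  note c = aut_onD[OF g E]
  note s = subfield_OmegaD[OF E]
  fix n
  have "g (\<Sum>i\<le>n. coeff p i * coeff r (n - i)) = (\<Sum>i\<le>n. g (coeff p i) * g (coeff r (n - i)))"
    by (subst aut_on_sum[OF g E]) (auto simp: c s kpolD[OF p(1)] kpolD[OF p(2)])
  then show "coeff (map_poly g (p * r)) n = coeff (map_poly g p * map_poly g r) n"
    by (simp add: coeff_map_poly c coeff_mult)
qed

lemma map_poly_aut_add:
  assumes g: "aut_on E g" and E: "subfield E (\<Omega> :: 'a::field ring)" and p: "p \<in> kpol E" "r \<in> kpol E"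
  shows "map_poly g (p + r) = map_poly g p + map_poly g r"
  by (rule poly_eqI) (simp add: coeff_map_poly aut_onD[OF g E] kpolD[OF p(1)] kpolD[OF p(2)])

lemma map_poly_aut_prod:
  assumes g: "aut_on E g" and E: "subfield E (\<Omega> :: 'a::field ring)" and p: "\<And>i. i \<in> I \<Longrightarrow> f i \<in> kpol E"
  shows "map_poly g (prod f I) = (\<Prod>i\<in>I. map_poly g (f i))" "map_poly g (sum f I) = (\<Sum>i\<in>I. map_poly g (f i))"
proof -
  note sE = subfield_imp_subring[OF E]
  show "map_poly g (prod f I) = (\<Prod>i\<in>I. map_poly g (f i))" using p
    by (induction I rule: infinite_finite_induct)
       (auto simp: aut_onD[OF g E] map_poly_aut_mult[OF g E] kpol_sum[OF sE])
  show "map_poly g (sum f I) = (\<Sum>i\<in>I. map_poly g (f i))" using p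
    by (induction I rule: infinite_finite_induct)
       (auto simp: aut_onD[OF g E] map_poly_aut_add[OF g E] kpol_sum[OF sE])
qed

section \<open>Galois groups\<close>

lemma gal_carrier_iff:
  assumes E: "subfield E (\<Omega> :: 'a::field ring)"
  shows "g \<in> carrier (Gal E F) \<longleftrightarrow> g \<in> extensional E \<and> aut_on E g \<and> (\<forall>x\<in>F. g x = x)"
proof
  assume "g \<in> carrier (Gal E F)"
  then have g: "g \<in> extensional E" "bij_betw g E E" "g \<in> ring_hom (sub E) (sub E)" "\<forall>x\<in>F. g x = x"
    by (auto simp: gal_group_def Bij_def)
  then show "g \<in> extensional E \<and> aut_on E g \<and> (\<forall>x\<in>F. g x = x)"
    by (auto simp: aut_on_def ring_hom_def)
next
  assume "g \<in> extensional E \<and> aut_on E g \<and> (\<forall>x\<in>F. g x = x)"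
  then have g: "g \<in> extensional E" "aut_on E g" "\<forall>x\<in>F. g x = x" by auto
  have "g \<in> ring_hom (sub E) (sub E)"
    by (rule ring_hom_memI) (auto simp: aut_onD[OF g(2) E])
  then show "g \<in> carrier (Gal E F)"
    using g by (auto simp: gal_group_def Bij_def aut_on_def)
qed

locale gal_ext =
  fixes E F :: "'a::field set"
  assumes gal: "galois_extension E F"
begin

abbreviation "G \<equiv> carrier (Gal E F)"

lemma sfE: "subfield E \<Omega>" and sfF: "subfield F \<Omega>" and FE: "F \<subseteq> E" and fd: "ring.finite_dimension \<Omega> F E"
  and fixF: "x \<in> E \<Longrightarrow> (\<And>g. g \<in> G \<Longrightarrow> g x = x) \<Longrightarrow> x \<in> F"
  using gal unfolding galois_extension_def by auto

lemmas Ec = subfield_OmegaD[OF sfE]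
lemmas Fc = subfield_OmegaD[OF sfF]
lemmas G_iff = gal_carrier_iff[OF sfE]

lemma G_aut: "g \<in> G \<Longrightarrow> aut_on E g" by (simp add: G_iff)
lemma G_fix: "g \<in> G \<Longrightarrow> x \<in> F \<Longrightarrow> g x = x" by (simp add: G_iff)
lemmas Gc = aut_onD[OF G_aut sfE]
lemma FE': "x \<in> F \<Longrightarrow> x \<in> E" using FE by auto

lemma G_ext: "g \<in> G \<Longrightarrow> h \<in> G \<Longrightarrow> (\<And>x. x \<in> E \<Longrightarrow> g x = h x) \<Longrightarrow> g = h"
  by (rule extensionalityI[of _ E]) (auto simp: G_iff)

lemma G_mult: "g \<in> G \<Longrightarrow> h \<in> G \<Longrightarrow> g \<otimes>\<^bsub>Gal E F\<^esub> h = compose E g h"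
  by (auto simp: gal_group_def BijGroup_def)

lemma G_mult_app: "g \<in> G \<Longrightarrow> h \<in> G \<Longrightarrow> x \<in> E \<Longrightarrow> (g \<otimes>\<^bsub>Gal E F\<^esub> h) x = g (h x)"
  by (simp add: G_mult compose_def)

lemma one_app: "x \<in> E \<Longrightarrow> \<one>\<^bsub>Gal E F\<^esub> x = x"
  by (simp add: gal_group_def BijGroup_def)

lemma gal_group: "group (Gal E F)"
proof -
  have mult_closed: "g \<otimes>\<^bsub>Gal E F\<^esub> h \<in> G" if gh: "g \<in> G" "h \<in> G" for g h
  proof -
  have "bij_betw (compose E g h) E E" using gh by (auto simp: G_iff aut_on_def bij_betw_compose)
  then have "aut_on E (compose E g h)" using gh unfolding aut_on_def
    by (auto simp: compose_def Gc Ec)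
  then show "g \<otimes>\<^bsub>Gal E F\<^esub> h \<in> G" unfolding G_mult[OF gh] G_iff
    using gh by (auto simp: compose_def FE' G_fix)
  qed
  show ?thesis
  proof (rule groupI)
  have "aut_on E (\<lambda>x\<in>E. x)" by (auto simp: aut_on_def Ec bij_betw_def inj_on_def)
  then show "\<one>\<^bsub>Gal E F\<^esub> \<in> G" using FE by (subst G_iff) (auto simp: gal_group_def BijGroup_def)
next
  fix g assume g: "g \<in> G"
  define h where "h = restrict (inv_into E g) E"
  have b: "bij_betw g E E" using g by (auto simp: G_iff aut_on_def)
  have hE: "h y \<in> E \<and> g (h y) = y" if "y \<in> E" for y
    unfolding h_def using that b by (auto simp: bij_betw_def inv_into_into f_inv_into_f)
  have hg: "h (g x) = x" if "x \<in> E" for x unfolding h_def using that b g by (auto simp: bij_betw_def Gc)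
  have "bij_betw h E E \<longleftrightarrow> bij_betw (inv_into E g) E E" by (rule bij_betw_cong) (simp add: h_def)
  then have "bij_betw h E E" using bij_betw_inv_into[OF b] by simp
  moreover have "h (x + y) = h x + h y" "h (x * y) = h x * h y" if "x \<in> E" "y \<in> E" for x y
    using hg[of "h x + h y"] hg[of "h x * h y"] hE that g by (auto simp: Gc Ec)
  ultimately have "aut_on E h" by (auto simp: aut_on_def)
  moreover have "h x = x" if "x \<in> F" for x using hg[of x] that g by (simp add: FE' G_fix)
  ultimately have hG: "h \<in> G" unfolding G_iff h_def by auto
  have "h \<otimes>\<^bsub>Gal E F\<^esub> g = \<one>\<^bsub>Gal E F\<^esub>"
    unfolding G_mult[OF hG g] by (auto simp: compose_def hg fun_eq_iff gal_group_def BijGroup_def restrict_def)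
  then show "\<exists>h\<in>G. h \<otimes>\<^bsub>Gal E F\<^esub> g = \<one>\<^bsub>Gal E F\<^esub>" using hG by blast
  next
    fix x y z assume xyz: "x \<in> G" "y \<in> G" "z \<in> G"
    show "x \<otimes>\<^bsub>Gal E F\<^esub> y \<otimes>\<^bsub>Gal E F\<^esub> z = x \<otimes>\<^bsub>Gal E F\<^esub> (y \<otimes>\<^bsub>Gal E F\<^esub> z)"
      by (rule G_ext) (use xyz mult_closed in \<open>auto simp: G_mult_app Gc\<close>)
  next
    fix x assume x: "x \<in> G"
    show "\<one>\<^bsub>Gal E F\<^esub> \<otimes>\<^bsub>Gal E F\<^esub> x = x"
      using x by (auto simp: gal_group_def BijGroup_def compose_def fun_eq_iff Bij_def bij_betw_def extensional_def)
  qed (rule mult_closed)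
qed

sublocale Gr: group "Gal E F" by (rule gal_group)

lemma inv_app: "g \<in> G \<Longrightarrow> x \<in> E \<Longrightarrow> (inv\<^bsub>Gal E F\<^esub> g) (g x) = x" "g \<in> G \<Longrightarrow> x \<in> E \<Longrightarrow> g ((inv\<^bsub>Gal E F\<^esub> g) x) = x"
  using G_mult_app[of "inv\<^bsub>Gal E F\<^esub> g" g x] G_mult_app[of g "inv\<^bsub>Gal E F\<^esub> g" x] one_app by auto

lemma pow_app: "g \<in> G \<Longrightarrow> x \<in> E \<Longrightarrow> (g [^]\<^bsub>Gal E F\<^esub> (n::nat)) x = (g ^^ n) x"
proof (induction n arbitrary: x)
  case (Suc n)
  have "(g [^]\<^bsub>Gal E F\<^esub> Suc n) x = (g [^]\<^bsub>Gal E F\<^esub> n) (g x)"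
    using Suc by (simp add: G_mult_app)
  then show ?case using Suc by (simp add: Gc funpow_swap1)
qed (simp add: one_app)

lemma span: "\<exists>n W. (\<forall>i<(n::nat). W i \<in> E) \<and> (\<forall>z\<in>E. \<exists>c. (\<forall>i<n. c i \<in> F) \<and> z = (\<Sum>i<n. c i * W i))"
  by (rule finite_dimension_span[OF sfF fd])

lemma algebraic_over_F: "x \<in> E \<Longrightarrow> \<exists>p\<in>kpol F. p \<noteq> 0 \<and> poly p x = 0"
proof -
  interpret Ring.field "\<Omega> :: 'a ring" by (rule Omega_field)
  assume "x \<in> E"
  then have "(algebraic over F) x"
    by (rule finite_dimension_imp_algebraic[OF sfF subfield_imp_subring[OF sfE] fd])
  then show ?thesis by (simp only: algebraic_iff[OF subfield_imp_subring[OF sfF]])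
qed

text \<open>An automorphism is determined by its values on a finite spanning family, and each value
  is a root of a fixed nonzero polynomial over F.\<close>

lemma finite_G: "finite G"
proof -
  obtain n W where W: "\<And>i. i < (n::nat) \<Longrightarrow> W i \<in> E"
    "\<And>z. z \<in> E \<Longrightarrow> \<exists>c. (\<forall>i<n. c i \<in> F) \<and> z = (\<Sum>i<n. c i * W i)" using span by blast
  have "\<exists>p. i < n \<longrightarrow> p \<in> kpol F \<and> p \<noteq> 0 \<and> poly p (W i) = 0" for i using algebraic_over_F[OF W(1), of i] by blast
  then obtain p where p: "\<And>i. i < n \<Longrightarrow> p i \<in> kpol F" "\<And>i. i < n \<Longrightarrow> p i \<noteq> 0" "\<And>i. i < n \<Longrightarrow> poly (p i) (W i) = 0" by metis
  define \<Phi> where "\<Phi> g = restrict (\<lambda>i. g (W i)) {..<n}" for g :: "'a \<Rightarrow> 'a"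
  have "\<Phi> ` G \<subseteq> PiE {..<n} (\<lambda>i. {z. poly (p i) z = 0})"
  proof
    fix y assume "y \<in> \<Phi> ` G"
    then obtain g where g: "g \<in> G" "y = \<Phi> g" by auto
    have "poly (p i) (g (W i)) = 0" if "i < n" for i
      using aut_on_poly[OF G_aut[OF g(1)] sfE _ FE p(1)[OF that] W(1)[OF that]] G_fix[OF g(1)] p(3)[OF that] Gc(4)[OF g(1)] by simp
    then show "y \<in> PiE {..<n} (\<lambda>i. {z. poly (p i) z = 0})" unfolding g(2) \<Phi>_def by auto
  qed
  moreover have "finite (PiE {..<n} (\<lambda>i. {z. poly (p i) z = 0}))"
    by (intro finite_PiE) (auto intro!: poly_roots_finite p)
  ultimately have "finite (\<Phi> ` G)" by (rule finite_subset)
  moreover have "inj_on \<Phi> G"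
  proof (rule inj_onI)
    fix g h assume gh: "g \<in> G" "h \<in> G" "\<Phi> g = \<Phi> h"
    have e: "g (W i) = h (W i)" if "i < n" for i using fun_cong[OF gh(3), of i] that by (simp add: \<Phi>_def)
    show "g = h"
    proof (rule G_ext[OF gh(1,2)])
      fix x assume "x \<in> E"
      then obtain c where c: "\<And>i. i < n \<Longrightarrow> c i \<in> F" "x = (\<Sum>i<n. c i * W i)" using W(2) by blast
      have "u x = (\<Sum>i<n. c i * u (W i))" if "u \<in> G" for u
        unfolding c(2) using that c(1) W(1)
        by (subst aut_on_sum[OF G_aut sfE]) (auto simp: Gc FE' G_fix Ec intro!: sum.cong)
      note u = this
      have "(\<Sum>i<n. c i * g (W i)) = (\<Sum>i<n. c i * h (W i))" by (intro sum.cong) (auto simp: e)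
      then show "g x = h x" using u[OF gh(1)] u[OF gh(2)] by simp
    qed
  qed
  ultimately show ?thesis by (rule finite_imageD)
qed

section \<open>Orbit polynomials, primitive elements, degrees and Kummer generators\<close>

lemma reindex_G: "h \<in> G \<Longrightarrow> bij_betw (\<lambda>g. h \<otimes>\<^bsub>Gal E F\<^esub> g) G G"
  by (rule bij_betw_byWitness[where f' = "\<lambda>g. inv\<^bsub>Gal E F\<^esub> h \<otimes>\<^bsub>Gal E F\<^esub> g"])
     (auto simp: Gr.m_assoc[symmetric])

lemma inv_poly_in_F: "p \<in> kpol E \<Longrightarrow> (\<And>g. g \<in> G \<Longrightarrow> map_poly g p = p) \<Longrightarrow> p \<in> kpol F"
proof -
  assume p: "p \<in> kpol E" "\<And>g. g \<in> G \<Longrightarrow> map_poly g p = p"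
  have "coeff p i \<in> F" for i
  proof (rule fixF)
    show "coeff p i \<in> E" using p kpolD by blast
    fix g assume g: "g \<in> G"
    have "g (coeff p i) = coeff (map_poly g p) i" by (simp add: coeff_map_poly Gc g)
    then show "g (coeff p i) = coeff p i" by (simp add: p g)
  qed
  then show ?thesis by (simp add: kpol_def)
qed

text \<open>In effect the characteristic polynomial: conjugates are counted once for each group
  element, which makes the coefficients visibly invariant.\<close>

definition "orbit_poly \<alpha> = (\<Prod>g\<in>G. [:- g \<alpha>, 1:])"

lemma map_lin: "h \<in> G \<Longrightarrow> a \<in> E \<Longrightarrow> map_poly h [:- a, 1:] = [:- h a, 1:]"
  by (rule poly_eqI) (auto simp: coeff_map_poly Gc coeff_pCons split: nat.split)

lemma orbit_poly_E: "\<alpha> \<in> E \<Longrightarrow> orbit_poly \<alpha> \<in> kpol E"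
  unfolding orbit_poly_def
  by (intro kpol_sum[OF subfield_imp_subring[OF sfE]] kpol_clos[OF subfield_imp_subring[OF sfE]]) (auto simp: Gc Ec)

lemma orbit_poly_F: "\<alpha> \<in> E \<Longrightarrow> orbit_poly \<alpha> \<in> kpol F"
proof (rule inv_poly_in_F[OF orbit_poly_E])
  fix h assume a: "\<alpha> \<in> E" and h: "h \<in> G"
  note sE = subfield_imp_subring[OF sfE]
  have "map_poly h (orbit_poly \<alpha>) = (\<Prod>g\<in>G. [:- h (g \<alpha>), 1:])"
    unfolding orbit_poly_def
    by (subst map_poly_aut_prod[OF G_aut[OF h] sfE])
       (auto intro!: kpol_clos[OF sE] prod.cong simp: Gc Ec a h map_lin simp del: map_poly_pCons)
  also have "\<dots> = (\<Prod>g\<in>G. [:- (h \<otimes>\<^bsub>Gal E F\<^esub> g) \<alpha>, 1:])" by (intro prod.cong) (auto simp: G_mult_app a h)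
  also have "\<dots> = orbit_poly \<alpha>" unfolding orbit_poly_def
    by (rule prod.reindex_bij_betw[OF reindex_G[OF h]])
  finally show "map_poly h (orbit_poly \<alpha>) = orbit_poly \<alpha>" .
qed

lemma poly_orbit: "poly (orbit_poly \<alpha>) z = (\<Prod>g\<in>G. z - g \<alpha>)"
  by (simp add: orbit_poly_def poly_prod)

lemma orbit_root: "\<alpha> \<in> E \<Longrightarrow> poly (orbit_poly \<alpha>) \<alpha> = 0"
  unfolding poly_orbit using finite_G one_app[of \<alpha>] by (auto intro!: prod_zero bexI[of _ "\<one>\<^bsub>Gal E F\<^esub>"])

text \<open>The line \<alpha> + c \<beta> with c in F meets the fixed set of each relevant h in at
  most one point, and F is infinite, so some c avoids all of them.\<close>

lemma ex_moved_by_all: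
  assumes inf: "infinite F" and H: "H \<subseteq> G" "\<one>\<^bsub>Gal E F\<^esub> \<notin> H"
  shows "\<exists>\<alpha>\<in>E. \<forall>g\<in>H. g \<alpha> \<noteq> \<alpha>"
proof -
  have "finite H" using H finite_G finite_subset by blast
  then show ?thesis using H
  proof (induction H rule: finite_induct)
    case empty then show ?case using Ec(1) by auto
  next
    case (insert g H)
    then obtain \<alpha> where \<alpha>: "\<alpha> \<in> E" "\<And>h. h \<in> H \<Longrightarrow> h \<alpha> \<noteq> \<alpha>" by auto
    have "g \<noteq> \<one>\<^bsub>Gal E F\<^esub>" "g \<in> G" using insert by auto
    then obtain \<beta> where \<beta>: "\<beta> \<in> E" "g \<beta> \<noteq> \<beta>" using G_ext[of g "\<one>\<^bsub>Gal E F\<^esub>"] one_app by fastforce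
    define bad where "bad h = {c \<in> F. h (\<alpha> + c * \<beta>) = \<alpha> + c * \<beta>}" for h
    have "finite (bad h)" if h: "h \<in> insert g H" for h
    proof -
      have hG: "h \<in> G" using h insert by auto
      have e: "h (\<alpha> + c * \<beta>) = \<alpha> + c * \<beta> \<longleftrightarrow> (h \<alpha> - \<alpha>) + c * (h \<beta> - \<beta>) = 0" if "c \<in> F" for c
      proof -
        have "h (\<alpha> + c * \<beta>) = h \<alpha> + c * h \<beta>" using that hG \<alpha> \<beta> by (simp add: Gc Ec FE' G_fix)
        then have "h (\<alpha> + c * \<beta>) - (\<alpha> + c * \<beta>) = (h \<alpha> - \<alpha>) + c * (h \<beta> - \<beta>)" by (simp add: algebra_simps)
        then show ?thesis by (metis right_minus_eq)
      qed
      have "c = c'" if "c \<in> bad h" "c' \<in> bad h" for c c'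
      proof -
        have e1: "(h \<alpha> - \<alpha>) + c * (h \<beta> - \<beta>) = 0" and e2: "(h \<alpha> - \<alpha>) + c' * (h \<beta> - \<beta>) = 0"
          using that e unfolding bad_def by auto
        have "h \<beta> \<noteq> \<beta>"
        proof
          assume "h \<beta> = \<beta>"
          then have "h \<alpha> = \<alpha>" "h \<noteq> g" using e1 \<beta> by auto
          then show False using h \<alpha>(2) by blast
        qed
        moreover have "(c - c') * (h \<beta> - \<beta>) = ((h \<alpha> - \<alpha>) + c * (h \<beta> - \<beta>)) - ((h \<alpha> - \<alpha>) + c' * (h \<beta> - \<beta>))"
          by (simp add: algebra_simps)
        then have "(c - c') * (h \<beta> - \<beta>) = 0" unfolding e1 e2 by simp
        ultimately show ?thesis by simp
      qed
      then have "bad h = {} \<or> (\<exists>c. bad h = {c})" by blast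
      then show ?thesis by auto
    qed
    then have "finite (\<Union>h\<in>insert g H. bad h)" using insert(1) by blast
    then obtain c where c: "c \<in> F" "c \<notin> (\<Union>h\<in>insert g H. bad h)" using inf by (meson finite_subset subsetI)
    then have "h (\<alpha> + c * \<beta>) \<noteq> \<alpha> + c * \<beta>" if "h \<in> insert g H" for h using that unfolding bad_def by blast
    then show ?case using \<alpha> \<beta> c by (intro bexI[of _ "\<alpha> + c * \<beta>"]) (auto intro: Ec FE')
  qed
qed

text \<open>Primitive in the sense that the conjugates are pairwise distinct; that the powers of
  such an element span E comes out in \<open>dim_eq_card\<close>.\<close>

lemma primitive_element:
  assumes "infinite F" shows "\<exists>\<alpha>\<in>E. inj_on (\<lambda>g. g \<alpha>) G"
proof -
  obtain \<alpha> where a: "\<alpha> \<in> E" "\<And>g. g \<in> G \<Longrightarrow> g \<noteq> \<one>\<^bsub>Gal E F\<^esub> \<Longrightarrow> g \<alpha> \<noteq> \<alpha>"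
    using ex_moved_by_all[OF assms, of "G - {\<one>\<^bsub>Gal E F\<^esub>}"] by auto
  have "g = h" if "g \<in> G" "h \<in> G" "g \<alpha> = h \<alpha>" for g h
  proof -
    have "(inv\<^bsub>Gal E F\<^esub> h \<otimes>\<^bsub>Gal E F\<^esub> g) \<alpha> = \<alpha>" using that a(1) inv_app(1)[OF that(2) a(1)] by (simp add: G_mult_app)
    then have "inv\<^bsub>Gal E F\<^esub> h \<otimes>\<^bsub>Gal E F\<^esub> g = \<one>\<^bsub>Gal E F\<^esub>" using a(2)[of "inv\<^bsub>Gal E F\<^esub> h \<otimes>\<^bsub>Gal E F\<^esub> g"] that by auto
    then show ?thesis using that by (metis Gr.inv_equality Gr.inv_inv Gr.inv_closed)
  qed
  then show ?thesis using a(1) by (auto simp: inj_on_def)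
qed

text \<open>The powers of a primitive element below |G| are independent, because a relation would
  have all |G| conjugates as roots, and they span by interpolation. The equality links
  \<open>ring.dim\<close>, in which the degree hypothesis of the theorem is phrased, with the group
  order needed for Kummer theory.\<close>

theorem dim_eq_card:
  assumes inf: "infinite F" shows "ring.dim \<Omega> F E = card G"
proof -
  interpret \<Omega>: Ring.field "\<Omega> :: 'a ring" by (rule Omega_field)
  note sE = subfield_imp_subring[OF sfE]
  note pc = kpol_clos[OF sE]
  obtain \<alpha> where \<alpha>: "\<alpha> \<in> E" "inj_on (\<lambda>g. g \<alpha>) G" using primitive_element[OF inf] by blast
  define d where "d = card G"
  have d0: "d > 0" unfolding d_def using finite_G Gr.one_closed by (auto simp: card_gt_0_iff)
  define Us where "Us = map (\<lambda>i. \<alpha> ^ i) [0..<d]"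
  have lU: "length Us = d" by (simp add: Us_def)
  have nU: "Us ! i = \<alpha> ^ i" if "i < d" for i using that by (simp add: Us_def)
  have zero: "c i = 0" if c: "\<And>i. i < d \<Longrightarrow> c i \<in> F" "(\<Sum>i<d. c i * \<alpha> ^ i) = 0" "i < d" for c i
  proof -
    define p where "p = (\<Sum>i<d. monom (c i) i)"
    have cp: "coeff p i = (if i < d then c i else 0)" for i unfolding p_def by (simp add: coeff_sum)
    have pF: "p \<in> kpol F" using c(1) Fc(1) by (auto simp: kpol_def cp)
    have "poly p \<alpha> = 0" unfolding p_def using c(2) by (simp add: poly_sum poly_monom)
    then have "poly p (g \<alpha>) = 0" if "g \<in> G" for g
      using aut_on_poly[OF G_aut[OF that] sfE _ FE pF \<alpha>(1)] G_fix[OF that] Gc(4)[OF that] by simp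
    then have sub: "(\<lambda>g. g \<alpha>) ` G \<subseteq> {z. poly p z = 0}" by auto
    have "p = 0"
    proof (rule ccontr)
      assume p0: "p \<noteq> 0"
      have "d = card ((\<lambda>g. g \<alpha>) ` G)" unfolding d_def using card_image[OF \<alpha>(2)] by simp
      also have "\<dots> \<le> card {z. poly p z = 0}" using sub p0 by (intro card_mono poly_roots_finite)
      also have "\<dots> \<le> degree p" using p0 by (rule card_poly_roots_bound)
      also have "\<dots> < d" using d0 by (intro degree_lessI) (auto simp: cp)
      finally show False by simp
    qed
    then show ?thesis using cp[of i] that(3) by simp
  qed
  have "\<Omega>.independent F Us"
  proof (rule \<Omega>.trivial_combine_imp_independent[OF sfF])
    fix Ks assume Ks: "set Ks \<subseteq> F" "\<Omega>.combine Ks Us = \<zero>\<^bsub>\<Omega>\<^esub>"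
    \<comment> \<open>\<open>combine\<close> accepts coefficient lists of any length, so the list is
      padded with zeros and cut to length d.\<close>
    define Ks' where "Ks' = take d (Ks @ replicate d 0)"
    have l: "length Ks' = length Us" by (simp add: Ks'_def lU)
    have "\<Omega>.combine Ks' Us = \<Omega>.combine (Ks @ replicate d 0) Us"
      unfolding Ks'_def using \<Omega>.combine_take[of Us "Ks @ replicate d 0"] lU by simp
    also have "\<dots> = \<Omega>.combine Ks Us" using \<Omega>.combine_append_replicate[of Us Ks d] by simp
    finally have "(\<Sum>i<d. Ks' ! i * \<alpha> ^ i) = 0" using Ks(2) combine_Omega[OF l] lU nU by simp
    moreover have "Ks' ! i \<in> F" if "i < d" for i
    proof -
      have "Ks' ! i \<in> set Ks'" using that l lU by simp
      then show ?thesis using Ks(1) Fc(1) unfolding Ks'_def by (auto dest!: in_set_takeD)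
    qed
    ultimately have "\<And>i. i < d \<Longrightarrow> Ks' ! i = 0" using zero[of "\<lambda>i. Ks' ! i"] by blast
    then have "set Ks' \<subseteq> {0}" using l lU by (auto simp: in_set_conv_nth)
    moreover have "set (take d Ks) \<subseteq> set Ks'" unfolding Ks'_def by auto
    ultimately show "set (take (length Us) Ks) \<subseteq> {\<zero>\<^bsub>\<Omega>\<^esub>}" using lU by simp
  qed auto
  then have "\<Omega>.dimension d F (\<Omega>.Span F Us)" using \<Omega>.dimension_independent[of F Us] lU by simp
  moreover have "\<Omega>.Span F Us = E"
  proof (intro equalityI subsetI)
    fix z assume "z \<in> \<Omega>.Span F Us"
    then obtain c where "\<forall>i<d. c i \<in> F" "z = (\<Sum>i<d. c i * Us ! i)" unfolding Span_Omega[OF sfF] lU by blast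
    moreover have "c i * Us ! i \<in> E" if "i < d" for i
      unfolding nU[OF that] by (intro Ec(5) Ec(7) FE' \<alpha>(1)) (use calculation(1) that in blast)
    ultimately show "z \<in> E" by (auto intro!: sum_in_subfield(1)[OF sfE])
  next
    fix z assume z: "z \<in> E"
    \<comment> \<open>Lagrange interpolation of z through the conjugates of the primitive element has invariant coefficients.\<close>
    define den where "den g = (\<Prod>h\<in>G - {g}. g \<alpha> - h \<alpha>)" for g
    define P where "P = (\<Sum>g\<in>G. smult (g z / den g) (\<Prod>h\<in>G - {g}. [:- h \<alpha>, 1:]))"
    have den0: "den g \<noteq> 0" if "g \<in> G" for g unfolding den_def using finite_G \<alpha>(2) that by (auto simp: inj_on_def)
    have denE: "den g \<in> E" if "g \<in> G" for g unfolding den_def using that \<alpha> by (intro sum_in_subfield[OF sfE]) (auto simp: Gc Ec)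
    have linE: "(\<Prod>h\<in>G - {g}. [:- h \<alpha>, 1:]) \<in> kpol E" for g using \<alpha> by (intro kpol_sum[OF sE] pc) (auto simp: Gc Ec)
    have smE: "smult c p \<in> kpol E" if "c \<in> E" "p \<in> kpol E" for c p using that by (auto simp: kpol_def Ec)
    have tE: "smult (g z / den g) (\<Prod>h\<in>G - {g}. [:- h \<alpha>, 1:]) \<in> kpol E" if "g \<in> G" for g
      using that z denE linE by (intro smE) (auto simp: Gc Ec)
    have PE: "P \<in> kpol E" unfolding P_def using tE by (intro kpol_sum[OF sE])
    have map_sm: "map_poly u (smult c p) = smult (u c) (map_poly u p)" if "u \<in> G" "c \<in> E" "p \<in> kpol E" for u c p
      by (rule poly_eqI) (simp add: coeff_map_poly Gc that kpolD[OF that(3)])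
    have "map_poly u P = P" if u: "u \<in> G" for u
    proof -
      have b: "bij_betw (\<lambda>h. u \<otimes>\<^bsub>Gal E F\<^esub> h) (G - {g}) (G - {u \<otimes>\<^bsub>Gal E F\<^esub> g})" if "g \<in> G" for g
        using reindex_G[OF u] that by (auto simp: bij_betw_def inj_on_def)
      have ud: "u (den g) = den (u \<otimes>\<^bsub>Gal E F\<^esub> g)" if g: "g \<in> G" for g
      proof -
        have "u (den g) = (\<Prod>h\<in>G - {g}. (u \<otimes>\<^bsub>Gal E F\<^esub> g) \<alpha> - (u \<otimes>\<^bsub>Gal E F\<^esub> h) \<alpha>)"
          unfolding den_def using g u \<alpha> by (subst aut_on_sum[OF G_aut sfE]) (auto simp: Gc Ec G_mult_app intro!: prod.cong)
        also have "\<dots> = den (u \<otimes>\<^bsub>Gal E F\<^esub> g)" unfolding den_def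
          by (rule prod.reindex_bij_betw[OF b[OF g], of "\<lambda>h. (u \<otimes>\<^bsub>Gal E F\<^esub> g) \<alpha> - h \<alpha>"])
        finally show ?thesis .
      qed
      have up: "map_poly u (\<Prod>h\<in>G - {g}. [:- h \<alpha>, 1:]) = (\<Prod>h\<in>G - {u \<otimes>\<^bsub>Gal E F\<^esub> g}. [:- h \<alpha>, 1:])" if g: "g \<in> G" for g
      proof -
        have "map_poly u (\<Prod>h\<in>G - {g}. [:- h \<alpha>, 1:]) = (\<Prod>h\<in>G - {g}. [:- (u \<otimes>\<^bsub>Gal E F\<^esub> h) \<alpha>, 1:])"
          using u \<alpha> by (subst map_poly_aut_prod[OF G_aut sfE])
            (auto intro!: pc prod.cong simp: Gc Ec G_mult_app map_lin simp del: map_poly_pCons)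
        also have "\<dots> = (\<Prod>h\<in>G - {u \<otimes>\<^bsub>Gal E F\<^esub> g}. [:- h \<alpha>, 1:])"
          by (rule prod.reindex_bij_betw[OF b[OF g], of "\<lambda>h. [:- h \<alpha>, 1:]"])
        finally show ?thesis .
      qed
      have "map_poly u P = (\<Sum>g\<in>G. smult ((u \<otimes>\<^bsub>Gal E F\<^esub> g) z / den (u \<otimes>\<^bsub>Gal E F\<^esub> g)) (\<Prod>h\<in>G - {u \<otimes>\<^bsub>Gal E F\<^esub> g}. [:- h \<alpha>, 1:]))"
        unfolding P_def using u z denE linE tE
        by (subst map_poly_aut_prod(2)[OF G_aut sfE]) (auto intro!: sum.cong simp: map_sm Gc Ec ud up G_mult_app)
      also have "\<dots> = P" unfolding P_def
        by (rule sum.reindex_bij_betw[OF reindex_G[OF u], of "\<lambda>g. smult (g z / den g) (\<Prod>h\<in>G - {g}. [:- h \<alpha>, 1:])"])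
      finally show ?thesis .
    qed
    then have PF: "P \<in> kpol F" by (rule inv_poly_in_F[OF PE])
    have degP: "degree P < d"
    proof -
      have "degree (\<Prod>h\<in>G - {g}. [:- h \<alpha>, 1:]) \<le> d - 1" if "g \<in> G" for g
      proof -
        have "degree (\<Prod>h\<in>G - {g}. [:- h \<alpha>, 1:]) \<le> (\<Sum>h\<in>G - {g}. degree [:- h \<alpha>, 1:])"
          using degree_prod_sum_le[of "G - {g}" "\<lambda>h. [:- h \<alpha>, 1:]"] finite_G by (simp add: o_def)
        also have "\<dots> = d - 1" unfolding d_def using that finite_G by simp
        finally show ?thesis .
      qed
      then have "degree P \<le> d - 1" unfolding P_def using finite_G
        by (intro degree_sum_le) (auto intro: order.trans[OF degree_smult_le])
      then show ?thesis using d0 by simp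
    qed
    have "poly P \<alpha> = z"
    proof -
      let ?e = "\<one>\<^bsub>Gal E F\<^esub>"
      have "poly P \<alpha> = (\<Sum>g\<in>G. g z / den g * (\<Prod>h\<in>G - {g}. \<alpha> - h \<alpha>))"
        unfolding P_def by (simp add: poly_sum poly_prod)
      also have "\<dots> = (\<Sum>g\<in>{?e}. g z / den g * (\<Prod>h\<in>G - {g}. \<alpha> - h \<alpha>))"
      proof (rule sum.mono_neutral_right)
        show "\<forall>g\<in>G - {?e}. g z / den g * (\<Prod>h\<in>G - {g}. \<alpha> - h \<alpha>) = 0"
        proof
          fix g assume "g \<in> G - {?e}"
          then have "?e \<in> G - {g}" by auto
          moreover have "\<alpha> - ?e \<alpha> = 0" using one_app \<alpha>(1) by simp
          ultimately have "(\<Prod>h\<in>G - {g}. \<alpha> - h \<alpha>) = 0" using finite_G by (meson finite_Diff prod_zero)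
          then show "g z / den g * (\<Prod>h\<in>G - {g}. \<alpha> - h \<alpha>) = 0" by simp
        qed
      qed (use finite_G in auto)
      also have "\<dots> = z" using den0[of ?e] one_app \<alpha>(1) z by (simp add: den_def)
      finally show ?thesis .
    qed
    moreover have "poly P \<alpha> = (\<Sum>i<d. coeff P i * \<alpha> ^ i)"
      unfolding poly_altdef using degP by (intro sum.mono_neutral_left) (auto simp: coeff_eq_0)
    ultimately show "z \<in> \<Omega>.Span F Us" unfolding Span_Omega[OF sfF] lU
      using kpolD[OF PF] nU by (auto intro!: exI[of _ "coeff P"])
  qed
  ultimately have "\<Omega>.dimension d F E" by simp
  from \<Omega>.dimI[OF sfF this] show ?thesis unfolding d_def over_def .
qed

text \<open>The Lagrange resolvent of a suitable \<beta> is multiplied by \<zeta> under the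
  generator s. As \<zeta> has exact order |G|, the multiplier determines the automorphism; this
  later makes \<tau> unique.\<close>

theorem kummer_generator:
  assumes inf: "infinite F" and cyc: "cyclic_group (Gal E F)"
    and \<zeta>: "\<zeta> \<in> F" "\<zeta> ^ card G = 1" "\<And>i. 0 < i \<Longrightarrow> i < card G \<Longrightarrow> \<zeta> ^ i \<noteq> 1"
  shows "\<exists>y\<in>E. y \<noteq> 0 \<and> (\<forall>g\<in>G. \<exists>i. g y = \<zeta> ^ i * y) \<and> (\<forall>g\<in>G. g y = y \<longrightarrow> g = \<one>\<^bsub>Gal E F\<^esub>)"
proof -
  define d where "d = card G"
  obtain s where s: "s \<in> G" "G = range (\<lambda>n::int. s [^]\<^bsub>Gal E F\<^esub> n)" using cyc Gr.cyclic_group by blast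
  have sd: "s [^]\<^bsub>Gal E F\<^esub> d = \<one>\<^bsub>Gal E F\<^esub>" unfolding d_def using Gr.pow_order_eq_1[OF s(1)] by (simp add: Coset.order_def)
  have d0: "d > 0" unfolding d_def using finite_G Gr.one_closed by (auto simp: card_gt_0_iff)
  have Gp: "\<exists>i<d. g = s [^]\<^bsub>Gal E F\<^esub> i" if gG: "g \<in> G" for g
  proof -
    obtain n :: int where n: "g = s [^]\<^bsub>Gal E F\<^esub> n" using gG s(2) by blast
    define i where "i = nat (n mod int d)"
    have "n = int i + int d * (n div int d)" using d0 by (simp add: i_def)
    then have "g = s [^]\<^bsub>Gal E F\<^esub> int i \<otimes>\<^bsub>Gal E F\<^esub> (s [^]\<^bsub>Gal E F\<^esub> int d) [^]\<^bsub>Gal E F\<^esub> (n div int d)"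
      unfolding n using s(1) by (metis Gr.int_pow_mult Gr.int_pow_pow)
    also have "\<dots> = s [^]\<^bsub>Gal E F\<^esub> i" using sd s(1) by (simp add: int_pow_int)
    finally show ?thesis using d0 by (intro exI[of _ i]) (auto simp: i_def nat_less_iff)
  qed
  have inj: "inj_on (\<lambda>i. s [^]\<^bsub>Gal E F\<^esub> i) {..<d}"
  proof (rule eq_card_imp_inj_on)
    have "(\<lambda>i. s [^]\<^bsub>Gal E F\<^esub> i) ` {..<d} = G" using Gp s(1) by (auto simp: image_iff)
    then show "card ((\<lambda>i. s [^]\<^bsub>Gal E F\<^esub> i) ` {..<d}) = card {..<d}" by (simp add: d_def)
  qed simp
  obtain \<alpha> where \<alpha>: "\<alpha> \<in> E" "inj_on (\<lambda>g. g \<alpha>) G" using primitive_element[OF inf] by blast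
  define sp where "sp i = s [^]\<^bsub>Gal E F\<^esub> (i::nat)" for i
  have spG: "sp i \<in> G" for i unfolding sp_def using s(1) by simp
  define res where "res \<beta> = (\<Sum>i<d. inverse \<zeta> ^ i * sp i \<beta>)" for \<beta>
  have "\<zeta> \<noteq> 0" using \<zeta>(2) d0 by (auto simp: d_def zero_power)
  have "\<exists>j. res (\<alpha> ^ j) \<noteq> 0"
  proof (rule ccontr)
    assume "\<not> (\<exists>j. res (\<alpha> ^ j) \<noteq> 0)"
    then have z: "res (\<alpha> ^ j) = 0" for j by blast
    \<comment> \<open>If the resolvent killed all powers of \<alpha>, then by linearity the weighted
      sum of the values P(s^i \<alpha>) would vanish for every polynomial P. This P vanishes at all
      conjugates except \<alpha> itself, leaving a single nonzero term.\<close>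
    define P where "P = (\<Prod>i\<in>{1..<d}. [:- sp i \<alpha>, 1:])"
    have "(\<Sum>i<d. inverse \<zeta> ^ i * poly P (sp i \<alpha>)) = (\<Sum>i<d. \<Sum>j\<le>degree P. coeff P j * (inverse \<zeta> ^ i * sp i (\<alpha> ^ j)))"
      unfolding poly_altdef sum_distrib_left using spG \<alpha>(1) by (intro sum.cong) (auto simp: Gc)
    also have "\<dots> = (\<Sum>j\<le>degree P. coeff P j * res (\<alpha> ^ j))"
      unfolding res_def sum_distrib_left by (rule sum.swap)
    also have "\<dots> = 0" by (simp add: z)
    finally have "(\<Sum>i<d. inverse \<zeta> ^ i * poly P (sp i \<alpha>)) = 0" .
    moreover have "(\<Sum>i<d. inverse \<zeta> ^ i * poly P (sp i \<alpha>)) = (\<Sum>i\<in>{0}. inverse \<zeta> ^ i * poly P (sp i \<alpha>))"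
    proof (rule sum.mono_neutral_right)
      show "\<forall>i\<in>{..<d} - {0}. inverse \<zeta> ^ i * poly P (sp i \<alpha>) = 0"
      proof
        fix i assume "i \<in> {..<d} - {0}"
        then have "poly P (sp i \<alpha>) = 0" unfolding P_def poly_prod by (intro prod_zero) (auto intro!: bexI[of _ i])
        then show "inverse \<zeta> ^ i * poly P (sp i \<alpha>) = 0" by simp
      qed
    qed (use d0 in auto)
    ultimately have "poly P (sp 0 \<alpha>) = 0" by simp
    then obtain i where i: "i \<in> {1..<d}" "sp 0 \<alpha> = sp i \<alpha>" unfolding P_def poly_prod by auto
    then have "sp 0 = sp i" using \<alpha>(2) spG by (auto simp: inj_on_def)
    then show False using inj i(1) d0 unfolding sp_def inj_on_def by fastforce
  qed
  then obtain \<beta> where \<beta>: "\<beta> \<in> E" "res \<beta> \<noteq> 0" using \<alpha>(1) Ec(7) by blast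
  define y where "y = res \<beta>"
  have iF: "inverse \<zeta> ^ i \<in> F" for i using \<zeta>(1) by (intro Fc)
  have yE: "y \<in> E" unfolding y_def res_def by (intro sum_in_subfield(1)[OF sfE] Ec(5) FE'[OF iF]) (use spG \<beta> in \<open>auto simp: Gc\<close>)
  define a where "a i = inverse \<zeta> ^ i * sp i \<beta>" for i
  \<comment> \<open>The summands have period d, so shifting the index by one does not change the
    resolvent.\<close>
  have ad: "a d = a 0" unfolding a_def sp_def using sd \<zeta>(2) by (simp add: d_def power_inverse)
  have sy: "s y = \<zeta> * y"
  proof -
    have "s y = (\<Sum>i<d. s (a i))" unfolding y_def res_def a_def
      using spG \<beta> iF by (subst aut_on_sum[OF G_aut[OF s(1)] sfE]) (auto simp: Gc Ec FE')
    also have "\<dots> = (\<Sum>i<d. \<zeta> * a (Suc i))"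
    proof (rule sum.cong)
      fix i
      have "s (sp i \<beta>) = sp (Suc i) \<beta>" unfolding sp_def using s(1) \<beta>(1)
        by (subst pow_app, simp_all)+
      then have "s (a i) = inverse \<zeta> ^ i * sp (Suc i) \<beta>"
        unfolding a_def using s(1) spG \<beta> iF by (simp add: Gc FE' G_fix)
      then show "s (a i) = \<zeta> * a (Suc i)" unfolding a_def using \<open>\<zeta> \<noteq> 0\<close> by simp
    qed simp
    also have "\<dots> = \<zeta> * (\<Sum>i<d. a (Suc i))" by (simp add: sum_distrib_left)
    also have "(\<Sum>i<d. a (Suc i)) = (\<Sum>i<d. a i)"
      using sum.lessThan_Suc_shift[of a d] sum.lessThan_Suc[of a d] ad by simp
    finally show ?thesis unfolding y_def res_def a_def .
  qed
  have spy: "sp i y = \<zeta> ^ i * y" for i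
  proof (induction i)
    case (Suc i)
    have "sp (Suc i) y = s (sp i y)" unfolding sp_def using s(1) yE by (subst pow_app, simp_all)+
    also have "\<dots> = \<zeta> ^ Suc i * y" using Suc s(1) \<zeta>(1) yE sy by (simp add: Gc G_fix FE' Ec)
    finally show ?case .
  qed (simp add: sp_def one_app yE)
  have y0: "y \<noteq> 0" using \<beta> y_def by simp
  have "\<exists>i. g y = \<zeta> ^ i * y" if "g \<in> G" for g using Gp[OF that] spy unfolding sp_def by blast
  moreover have "g = \<one>\<^bsub>Gal E F\<^esub>" if g: "g \<in> G" "g y = y" for g
  proof -
    obtain i where i: "i < d" "g = sp i" using Gp[OF g(1)] unfolding sp_def by blast
    then have "\<zeta> ^ i = 1" using spy[of i] g(2) y0 by simp
    then have "i = 0" using \<zeta>(3)[of i] i(1) by (cases i) (auto simp: d_def)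
    then show ?thesis using i by (simp add: sp_def)
  qed
  ultimately show ?thesis using yE y0 by blast
qed

end

section \<open>Cardinalities of finite vector spaces and additivity of power maps\<close>

lemma (in ring) card_of_dimension:
  assumes "dimension n K E" "subfield K R" "finite K"
  shows "finite E \<and> card E = card K ^ n"
  using assms
proof (induction n K E rule: dimension.induct)
  case (Suc_dim v E n K)
  note sp = space_subgroup_props[OF \<open>subfield K R\<close> \<open>dimension n K E\<close>]
  have KR: "K \<subseteq> carrier R" using subfieldE(3)[OF \<open>subfield K R\<close>] .
  note Kp = subringE[OF subfieldE(1)[OF \<open>subfield K R\<close>]]
  have "bij_betw (\<lambda>(k, e). k \<otimes> v \<oplus> e) (K \<times> E) (line_extension K v E)"
    unfolding bij_betw_def
  proof
    show "(\<lambda>(k, e). k \<otimes> v \<oplus> e) ` (K \<times> E) = line_extension K v E"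
      by (auto simp: line_extension_mem_iff image_iff) blast
    show "inj_on (\<lambda>(k, e). k \<otimes> v \<oplus> e) (K \<times> E)"
    proof (rule inj_onI, clarify)
      fix k e k' e' assume a: "k \<in> K" "e \<in> E" "k' \<in> K" "e' \<in> E" "k \<otimes> v \<oplus> e = k' \<otimes> v \<oplus> e'"
      have c: "k \<in> carrier R" "k' \<in> carrier R" "e \<in> carrier R" "e' \<in> carrier R" using a KR sp(1) by auto
      have "(k \<ominus> k') \<otimes> v = (k \<otimes> v \<oplus> e) \<ominus> (k' \<otimes> v \<oplus> e') \<oplus> (e' \<ominus> e)"
        using c \<open>v \<in> carrier R\<close> by algebra
      also have "\<dots> = e' \<ominus> e" using a(5) c \<open>v \<in> carrier R\<close> by algebra
      finally have d: "(k \<ominus> k') \<otimes> v \<in> E" using a sp by (simp add: a_minus_def)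
      have "k = k'"
      proof (rule ccontr)
        assume "k \<noteq> k'"
        then have "k \<ominus> k' \<noteq> \<zero>" using r_right_minus_eq c by blast
        moreover have "k \<ominus> k' \<in> K" unfolding a_minus_def by (intro Kp(7) Kp(5) a)
        ultimately have "k \<ominus> k' \<in> K - {\<zero>}" by blast
        then have "v \<in> E" using sp(6) d \<open>v \<in> carrier R\<close> by blast
        then show False using \<open>v \<notin> E\<close> by simp
      qed
      then show "k = k' \<and> e = e'" using a(5) c \<open>v \<in> carrier R\<close> by simp
    qed
  qed
  then have "card (line_extension K v E) = card (K \<times> E)" "finite (line_extension K v E) = finite (K \<times> E)"
    by (auto simp: bij_betw_same_card bij_betw_finite)
  then show ?case using Suc_dim by (simp add: card_cartesian_product)
qed auto

lemma (in ring) finite_dimension_of_finite: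
  assumes "subfield K R" "finite (carrier R)"
  shows "finite_dimension K (carrier R)" "card (carrier R) = card K ^ dim K (carrier R)"
proof -
  obtain Us where Us: "set Us = carrier R" using assms(2) finite_list by blast
  have "Span K Us = carrier R"
    using Span_in_carrier[of K Us] Span_base_incl[OF assms(1), of Us] Us subfieldE(3)[OF assms(1)] by auto
  then show f: "finite_dimension K (carrier R)" using Span_finite_dimension[OF assms(1), of Us] Us by simp
  have "finite K" using assms subfieldE(3)[OF assms(1)] finite_subset by blast
  then show "card (carrier R) = card K ^ dim K (carrier R)"
    using card_of_dimension[OF finite_dimensionE[OF assms(1) f] assms(1)] by (simp add: over_def)
qed

lemma finite_subring_subfield:
  assumes "subring P (\<Omega> :: 'a::field ring)" "finite P" shows "subfield P \<Omega>"
proof (rule subfield_OmegaI)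
  note c = subring_OmegaD[OF assms(1)]
  fix x assume x: "x \<in> P" "x \<noteq> 0"
  have "inj_on ((*) x) P" using x by (auto simp: inj_on_def)
  moreover have "(*) x ` P \<subseteq> P" using x c by auto
  ultimately have "(*) x ` P = P" using assms(2) by (simp add: endo_inj_surj)
  then obtain y where "y \<in> P" "x * y = 1" using c(2) by (metis imageE)
  then show "inverse x \<in> P" by (metis inverse_unique)
qed (use subring_OmegaD[OF assms(1)] in auto)

text \<open>Finiteness of k forces positive characteristic; the multiples of 1 then form a subfield
  with CHAR elements, over which k is a vector space.\<close>

lemma finite_subfield_card:
  assumes k: "subfield k (\<Omega> :: 'a::field ring)" "finite k"
  shows "Factorial_Ring.prime CHAR('a)" "\<exists>s. card k = CHAR('a) ^ s"
proof -
  note kc = subfield_OmegaD[OF k(1)]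
  have nk: "of_nat n \<in> k" for n by (induction n) (auto intro: kc)
  have "\<not> inj (of_nat :: nat \<Rightarrow> 'a)" using nk k(2) by (metis finite_subset image_subsetI infinite_UNIV_nat finite_imageD)
  then obtain i j where ij: "i < j" "of_nat i = (of_nat j :: 'a)" unfolding inj_def by (metis linorder_neqE_nat)
  then have "of_nat (j - i) = (0 :: 'a)" by (simp add: of_nat_diff)
  then have p0: "CHAR('a) > 0" using ij(1) CHAR_pos_iff[where ?'a = 'a] zero_less_diff by blast
  then show pr: "Factorial_Ring.prime CHAR('a)" by (rule prime_CHAR_semidom)
  define P where "P = (of_nat ` {..<CHAR('a)} :: 'a set)"
  have inP: "of_nat n \<in> P" for n
  proof -
    have "(of_nat n :: 'a) = of_nat (CHAR('a) * (n div CHAR('a)) + n mod CHAR('a))" by simp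
    also have "\<dots> = of_nat (n mod CHAR('a))" by (simp only: of_nat_add of_nat_mult of_nat_CHAR) simp
    finally show ?thesis unfolding P_def using p0 by auto
  qed
  have "inj_on (of_nat :: nat \<Rightarrow> 'a) {..<CHAR('a)}"
  proof (rule linorder_inj_onI)
    fix x y assume xy: "x < y" "x \<in> {..<CHAR('a)}" "y \<in> {..<CHAR('a)}"
    show "of_nat x \<noteq> (of_nat y :: 'a)"
    proof
      assume "of_nat x = (of_nat y :: 'a)"
      then have "of_nat (y - x) = (0 :: 'a)" using xy by (simp add: of_nat_diff)
      then have "CHAR('a) dvd y - x" by (simp only: of_nat_eq_0_iff_char_dvd)
      then have "CHAR('a) \<le> y - x" using xy by (intro dvd_imp_le) auto
      then show False using xy by simp
    qed
  qed auto
  then have cP: "card P = CHAR('a)" unfolding P_def by (simp add: card_image)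
  have "subring P \<Omega>"
  proof (rule subring_OmegaI)
    show "1 \<in> P" using inP[of 1] by simp
    fix x y assume "x \<in> P" "y \<in> P"
    then obtain i j where ij: "x = of_nat i" "y = of_nat j" by (auto simp: P_def)
    show "x * y \<in> P" unfolding ij of_nat_mult[symmetric] by (rule inP)
    have "x - y = of_nat (i + (CHAR('a) - 1) * j)"
      unfolding ij of_nat_add of_nat_mult using p0 by (simp add: of_nat_diff)
    then show "x - y \<in> P" by (simp only: inP)
  qed
  then have sP: "subfield P \<Omega>" by (rule finite_subring_subfield) (simp add: P_def)
  interpret O: Ring.field "\<Omega> :: 'a ring" by (rule Omega_field)
  have "Ring.field (sub k)" using O.subfield_iff(2)[OF k(1)] .
  then interpret kk: Ring.field "sub k" .
  have "Ring.field (sub P)" using O.subfield_iff(2)[OF sP] .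
  then have "subfield P (sub k)" by (intro kk.subfield_iff(1)) (auto simp: P_def nk)
  then have "card (carrier (sub k)) = card P ^ kk.dim P (carrier (sub k))"
    by (rule kk.finite_dimension_of_finite(2)) (use k in auto)
  then show "\<exists>s. card k = CHAR('a) ^ s" using cP by auto
qed

lemma frob_add:
  assumes k: "subfield k (\<Omega> :: 'a::field ring)" "finite k"
  shows "(x + y :: 'a) ^ (card k ^ m) = x ^ (card k ^ m) + y ^ (card k ^ m)"
    "(\<Sum>i\<in>I. f i :: 'a) ^ (card k ^ m) = (\<Sum>i\<in>I. f i ^ (card k ^ m))"
proof -
  obtain s where s: "card k = CHAR('a) ^ s" using finite_subfield_card[OF k] by blast
  have "card k ^ m = CHAR('a) ^ (s * m)" unfolding s power_mult ..
  then show "(x + y :: 'a) ^ (card k ^ m) = x ^ (card k ^ m) + y ^ (card k ^ m)"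
    "(\<Sum>i\<in>I. f i :: 'a) ^ (card k ^ m) = (\<Sum>i\<in>I. f i ^ (card k ^ m))"
    using freshmans_dream'[OF finite_subfield_card(1)[OF k]] freshmans_dream_sum'[OF finite_subfield_card(1)[OF k]] by blast+
qed

section \<open>Residue fields\<close>

context val_ring
begin

lemma residue_set: "residue R x = (\<lambda>m. m + x) ` M"
  by (auto simp: residue_def a_r_coset_def')

lemma residue_eq_iff: "x \<in> R \<Longrightarrow> y \<in> R \<Longrightarrow> residue R x = residue R y \<longleftrightarrow> x - y \<in> M"
proof
  assume "residue R x = residue R y"
  moreover have "x \<in> residue R x" unfolding residue_set using M_zero by force
  ultimately obtain m where "m \<in> M" "x = m + y" unfolding residue_set by blast
  then show "x - y \<in> M" by simp
next
  assume d: "x - y \<in> M"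
  have *: "(\<lambda>m. m + x) ` M \<subseteq> (\<lambda>m. m + y) ` M" if "x - y \<in> M" for x y
  proof
    fix z assume "z \<in> (\<lambda>m. m + x) ` M"
    then obtain m where "m \<in> M" "z = (m + (x - y)) + y" by auto
    then show "z \<in> (\<lambda>m. m + y) ` M" using M_add that by blast
  qed
  show "residue R x = residue R y" unfolding residue_set using *[OF d] *[OF M_diff_sym[OF d]] by blast
qed

lemma sub_cring: "cring (sub R)"
proof -
  interpret cring "\<Omega> :: 'a ring" by (rule cring_from_type_algebra)
  interpret sub: ring "sub R" by (rule subring_is_ring[OF sr])
  show ?thesis by unfold_locales (auto simp: mult.commute)
qed

lemma M_ideal: "ideal M (sub R)"
proof -
  interpret cring "sub R" by (rule sub_cring)
  show ?thesis
  proof (rule idealI)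
    show "subgroup M (add_monoid (sub R))"
    proof (rule group.subgroupI)
      show "group (add_monoid (sub R))" by (rule a_group)
      show "M \<noteq> {}" using M_zero by auto
      fix a assume a: "a \<in> M"
      have "inv\<^bsub>add_monoid (sub R)\<^esub> a = - a"
        by (rule group.inv_equality[OF a_group]) (use a MR M_minus in auto)
      then show "inv\<^bsub>add_monoid (sub R)\<^esub> a \<in> M" using a M_minus by simp
    qed (auto simp: MR M_add)
  qed (auto simp: M_mult M_mult2 ring_axioms)
qed

lemma residue_ops:
  assumes "x \<in> R" "y \<in> R"
  shows "residue R x \<in> carrier (residue_field R)"
    "residue R x \<otimes>\<^bsub>residue_field R\<^esub> residue R y = residue R (x * y)"
    "residue R x \<oplus>\<^bsub>residue_field R\<^esub> residue R y = residue R (x + y)"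
    "\<one>\<^bsub>residue_field R\<^esub> = residue R 1" "\<zero>\<^bsub>residue_field R\<^esub> = residue R 0"
proof -
  interpret ideal M "sub R" by (rule M_ideal)
  note h = ring_hom_memE[OF rcos_ring_hom]
  show "residue R x \<in> carrier (residue_field R)"
    "residue R x \<otimes>\<^bsub>residue_field R\<^esub> residue R y = residue R (x * y)"
    "residue R x \<oplus>\<^bsub>residue_field R\<^esub> residue R y = residue R (x + y)"
    "\<one>\<^bsub>residue_field R\<^esub> = residue R 1"
    using h(1)[of x] h(2)[of x y] h(3)[of x y] h(4) assms unfolding residue_def residue_field_def by auto
  have "\<zero>\<^bsub>residue_field R\<^esub> = M" by (simp add: residue_field_def FactRing_def)
  then show "\<zero>\<^bsub>residue_field R\<^esub> = residue R 0" by (simp add: residue_set)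
qed

lemma residue_carrier: "carrier (residue_field R) = residue R ` R"
  by (auto simp: residue_field_def FactRing_def A_RCOSETS_def' residue_def)

lemma residue_field_field: "Ring.field (residue_field R)"
proof -
  interpret i: ideal M "sub R" by (rule M_ideal)
  interpret cring "residue_field R"
    unfolding residue_field_def by (rule i.quotient_is_cring[OF sub_cring])
  show ?thesis
  proof (rule cring_fieldI2)
    show "\<zero>\<^bsub>residue_field R\<^esub> \<noteq> \<one>\<^bsub>residue_field R\<^esub>"
      using residue_ops(4,5)[OF Rc(1,1)] residue_eq_iff[of 1 0] Rc M_one by auto
    fix a assume a: "a \<in> carrier (residue_field R)" "a \<noteq> \<zero>\<^bsub>residue_field R\<^esub>"
    then obtain x where x: "x \<in> R" "a = residue R x" by (auto simp: residue_carrier)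
    then have "x \<notin> M" using a(2) residue_ops(5)[OF Rc(1,1)] residue_eq_iff[of x 0] Rc by auto
    then have i: "inverse x \<in> R" "x \<noteq> 0" using unit_inv x M_zero by auto
    then have "a \<otimes>\<^bsub>residue_field R\<^esub> residue R (inverse x) = \<one>\<^bsub>residue_field R\<^esub>"
      using x residue_ops(2)[of x "inverse x"] residue_ops(4)[OF Rc(1,1)] by simp
    then show "\<exists>b\<in>carrier (residue_field R). a \<otimes>\<^bsub>residue_field R\<^esub> b = \<one>\<^bsub>residue_field R\<^esub>"
      using residue_ops(1)[OF i(1) i(1)] by blast
  qed
qed

lemma residue_pow: "x \<in> R \<Longrightarrow> residue R x [^]\<^bsub>residue_field R\<^esub> (n::nat) = residue R (x ^ n)"
proof -
  interpret Ring.field "residue_field R" by (rule residue_field_field)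
  show "x \<in> R \<Longrightarrow> ?thesis"
    by (induction n) (auto simp: residue_ops(4)[OF Rc(1,1)] residue_ops(2) Rc mult.commute)
qed

definition "rcard = card (carrier (residue_field R))"

lemma residue_finite:
  assumes "fun_field k K" shows "finite (carrier (residue_field R))"
proof -
  obtain S where S: "finite S" "S \<subseteq> R" "\<And>z. z \<in> R \<Longrightarrow> \<exists>s\<in>S. z - s \<in> M" using finite_residues[OF assms] by blast
  have "residue R ` R \<subseteq> residue R ` S"
  proof
    fix y assume "y \<in> residue R ` R"
    then obtain z where z: "z \<in> R" "y = residue R z" by auto
    then obtain s where "s \<in> S" "z - s \<in> M" using S(3) by blast
    then show "y \<in> residue R ` S" using z S(2) residue_eq_iff[of z s] by auto
  qed
  then show ?thesis unfolding residue_carrier using S(1) finite_surj by blast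
qed

text \<open>The multiplicative group of a finite field is cyclic. The formulation with
  representatives in R allows later arguments to stay with congruences.\<close>

lemma residue_generator:
  assumes "fun_field k K"
  shows "\<exists>\<gamma>\<in>R - M. \<forall>x\<in>R - M. \<exists>i. x - \<gamma> ^ i \<in> M"
proof -
  interpret Ring.field "residue_field R" by (rule residue_field_field)
  obtain a where a: "a \<in> carrier (Multiplicative_Group.mult_of (residue_field R))"
    "carrier (Multiplicative_Group.mult_of (residue_field R)) = {a [^]\<^bsub>residue_field R\<^esub> i | i::nat. i \<in> UNIV}"
    by (rule bexE[OF finite_field_mult_group_has_gen[OF residue_finite[OF assms]]])
  have nz: "x \<notin> M \<longleftrightarrow> residue R x \<noteq> \<zero>\<^bsub>residue_field R\<^esub>" if "x \<in> R" for x
    using residue_ops(5)[OF Rc(1,1)] residue_eq_iff[of x 0] Rc that by auto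
  obtain \<gamma> where g: "\<gamma> \<in> R" "a = residue R \<gamma>" using a(1) by (auto simp: residue_carrier)
  moreover have "\<gamma> \<notin> M" using nz g a(1) by auto
  moreover have "\<exists>i. x - \<gamma> ^ i \<in> M" if x: "x \<in> R - M" for x
  proof -
    have "residue R x \<in> carrier (Multiplicative_Group.mult_of (residue_field R))" using x nz residue_ops(1) by auto
    then obtain i where "residue R x = a [^]\<^bsub>residue_field R\<^esub> (i::nat)" using a(2) by auto
    then show ?thesis using g x residue_pow residue_eq_iff[of x "\<gamma> ^ i"] Rc by auto
  qed
  ultimately show ?thesis by blast
qed

text \<open>Fermat's little theorem for the residue field, pulled back to congruences modulo
  M.\<close>

lemma cong_rcard:
  assumes "fun_field k K" "x \<in> R" shows "x ^ rcard - x \<in> M" "x \<notin> M \<Longrightarrow> x ^ (rcard - 1) - 1 \<in> M" "rcard \<ge> 2"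
proof -
  interpret Ring.field "residue_field R" by (rule residue_field_field)
  have fin: "finite (carrier (residue_field R))" by (rule residue_finite[OF assms(1)])
  have "{\<zero>\<^bsub>residue_field R\<^esub>, \<one>\<^bsub>residue_field R\<^esub>} \<subseteq> carrier (residue_field R)" by auto
  then have "card {\<zero>\<^bsub>residue_field R\<^esub>, \<one>\<^bsub>residue_field R\<^esub>} \<le> rcard" unfolding rcard_def by (intro card_mono fin)
  then show 2: "rcard \<ge> 2" by simp
  show 1: "x ^ (rcard - 1) - 1 \<in> M" if "x \<notin> M"
  proof -
    have "residue R x \<noteq> \<zero>\<^bsub>residue_field R\<^esub>"
      using residue_ops(5)[OF Rc(1,1)] residue_eq_iff[of x 0] Rc that assms by auto
    then have c: "residue R x \<in> carrier (Multiplicative_Group.mult_of (residue_field R))" using residue_ops(1) assms by auto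
    have "Coset.order (Multiplicative_Group.mult_of (residue_field R)) = rcard - 1"
      unfolding rcard_def Coset.order_def using fin by simp
    then have "residue R x [^]\<^bsub>residue_field R\<^esub> (rcard - 1) = \<one>\<^bsub>residue_field R\<^esub>"
      using group.pow_order_eq_1[OF field_mult_group c] by (simp add: Multiplicative_Group.nat_pow_mult_of)
    then show ?thesis using residue_pow assms residue_ops(4)[OF Rc(1,1)] residue_eq_iff[of "x ^ (rcard - 1)" 1] Rc by auto
  qed
  show "x ^ rcard - x \<in> M"
  proof (cases "x \<in> M")
    case True
    moreover have "x ^ rcard = x * x ^ (rcard - 1)" using 2 by (cases rcard) auto
    ultimately have "x ^ rcard \<in> M" using M_mult[OF _ Rc(7)[OF assms(2), of "rcard - 1"]] by simp
    then show ?thesis using True M_diff by blast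
  next
    case False
    have "x * (x ^ (rcard - 1) - 1) = x ^ rcard - x"
      using 2 by (cases rcard) (auto simp: right_diff_distrib)
    then show ?thesis using M_mult2[OF assms(2) 1[OF False]] by simp
  qed
qed

end

section \<open>Places in extensions\<close>

text \<open>If R contained K, an element z of L outside R would satisfy an equation over K. Divided
  by z^n, the equation exhibits the leading coefficient as an element of M, although nonzero
  elements of K would be units of R.\<close>

lemma place_restrict:
  assumes L: "subfield L (\<Omega> :: 'a::field ring)" and K: "subfield K \<Omega>" "K \<subseteq> L"
    and alg: "\<And>z. z \<in> L \<Longrightarrow> \<exists>p\<in>kpol K. p \<noteq> 0 \<and> poly p z = 0" and R: "R \<in> places L"
  shows "R \<inter> K \<in> places K" "x \<in> K \<Longrightarrow> x \<in> max_ideal R \<longleftrightarrow> x \<in> max_ideal (R \<inter> K)"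
proof -
  interpret val_ring L R using L R by (simp add: val_ring_def)
  note Kc' = subfield_OmegaD[OF K(1)]
  have sR: "subring (R \<inter> K) \<Omega>"
    by (rule subring_OmegaI) (auto intro: Rc Kc')
  have "R \<inter> K \<noteq> K"
  proof
    assume "R \<inter> K = K"
    then have KR: "K \<subseteq> R" by auto
    obtain z where z: "z \<in> L" "z \<notin> R" using ssub by auto
    then obtain p where p: "p \<in> kpol K" "p \<noteq> 0" "poly p z = 0" using alg by blast
    define n where "n = degree p"
    have iz: "inverse z \<in> M" "z \<noteq> 0" using inv_M z Rc by auto
    have "coeff p n + (\<Sum>i<n. coeff p i * inverse z ^ (n - i)) = inverse z ^ n * poly p z"
    proof -
      have "inverse z ^ n * poly p z = (\<Sum>i\<le>n. coeff p i * inverse z ^ (n - i))"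
        unfolding poly_altdef n_def[symmetric] sum_distrib_left
      proof (rule sum.cong)
        fix i assume "i \<in> {..n}"
        then have "inverse z ^ n = inverse z ^ (n - i) * inverse z ^ i" by (simp add: power_add[symmetric])
        moreover have "inverse z ^ i * z ^ i = 1" using iz by (simp add: power_mult_distrib[symmetric])
        ultimately show "inverse z ^ n * (coeff p i * z ^ i) = coeff p i * inverse z ^ (n - i)" by (simp add: algebra_simps)
      qed simp
      then show ?thesis by (simp add: lessThan_Suc_atMost[symmetric] add.commute)
    qed
    then have "coeff p n = - (\<Sum>i<n. coeff p i * inverse z ^ (n - i))" using p(3) by (simp add: eq_neg_iff_add_eq_0)
    moreover have "coeff p i * inverse z ^ (n - i) \<in> M" if "i < n" for i
    proof -
      have "inverse z ^ (n - i) = inverse z * inverse z ^ (n - i - 1)" using that by (metis power_eq_if zero_less_diff less_numeral_extra(3))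
      then have "inverse z ^ (n - i) \<in> M" using M_mult[OF iz(1) Rc(7)[OF MR[OF iz(1)]]] by simp
      then show ?thesis using M_mult2 KR kpolD[OF p(1)] by blast
    qed
    then have "(\<Sum>i<n. coeff p i * inverse z ^ (n - i)) \<in> M" by (intro M_sum) auto
    ultimately have "coeff p n \<in> M" using M_minus by simp
    moreover have "coeff p n \<in> K" "coeff p n \<noteq> 0" using kpolD[OF p(1)] p(2) by (auto simp: n_def)
    ultimately show False using KR Kc'(8) by (auto simp: M_iff)
  qed
  moreover have "z \<in> R \<inter> K \<or> inverse z \<in> R \<inter> K" if "z \<in> K" for z
    using tot[of z] that K Kc'(8) by auto
  ultimately show "R \<inter> K \<in> places K" using sR by (auto simp: places_def)
  show "x \<in> K \<Longrightarrow> x \<in> max_ideal R \<longleftrightarrow> x \<in> max_ideal (R \<inter> K)"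
    unfolding M_iff max_ideal_iff[OF sR] using Kc'(8) by auto
qed

text \<open>Chevalley's argument is applied to the ring P itself, avoiding the inverse of its
  uniformizer. The place obtained restricts to a ring containing P, which equals P by
  maximality.\<close>

lemma ex_place_above:
  assumes K: "fun_field k (K :: 'a::field set)" and L: "subfield L (\<Omega> :: 'a ring)" "K \<subseteq> L"
    and alg: "\<And>z. z \<in> L \<Longrightarrow> \<exists>p\<in>kpol K. p \<noteq> 0 \<and> poly p z = 0" and P: "P \<in> places K"
  shows "\<exists>R. R \<in> places_above K L P"
proof -
  have sK: "subfield K \<Omega>" using K by (auto simp: fun_field_def)
  interpret P: dval_ring K P by (rule place_dval_ring[OF K P])
  have "inverse P.t0 \<notin> P" using P.t0_M P.t0_nz by (auto simp: P.M_iff)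
  then obtain R where R: "R \<in> places L" "P \<subseteq> R"
    using ex_place_over_subring[OF L(1) P.sr _ P.t0(1) P.t0_nz] P.ssub L(2) by blast
  have "R \<inter> K \<in> places K" by (rule place_restrict[OF L(1) sK L(2) alg R(1)])
  then have "R \<inter> K = P" using P.R_maximal[of "R \<inter> K"] R(2) P.ssub by blast
  then show ?thesis using R by (auto simp: places_above_def)
qed

text \<open>Dividing x by the right power of t leaves a unit of P, hence a unit of R. So the order
  of one uniformizer of P at R is the index sought by the description operator in
  \<open>ramification_index\<close>.\<close>

lemma ramification_index_eq:
  assumes "dval_ring K P" "dval_ring L R" "R \<inter> K = P" "K \<subseteq> L" "t \<in> K" "t \<noteq> 0" "ord_at P t = 1"
  shows "ramification_index K R P = ord_at R t" "x \<in> K \<Longrightarrow> x \<noteq> 0 \<Longrightarrow> ord_at R x = ord_at R t * ord_at P x"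
proof -
  interpret P: dval_ring K P by fact
  interpret R: dval_ring L R by fact
  have *: "ord_at R x = ord_at R t * ord_at P x" if x: "x \<in> K" "x \<noteq> 0" for x
  proof -
    define u where "u = x * inverse (t powi ord_at P x)"
    have tp: "t powi ord_at P x \<in> K" "t powi ord_at P x \<noteq> 0" using assms by (auto intro: P.Kc)
    have uK: "u \<in> K" "u \<noteq> 0" unfolding u_def using x tp by (auto intro: P.Kc)
    have "ord_at P u = 0" unfolding u_def using x tp assms(5-7)
      by (simp add: P.ord_mult P.ord_inverse P.ord_powi P.Kc)
    then have "u \<in> P" "inverse u \<in> P" using uK P.R_iff[of u] P.R_iff[of "inverse u"] P.ord_inverse[of u] by (auto intro: P.Kc)
    then have "u \<in> Units (sub R)" using assms(3) uK by (auto simp: R.U_iff)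
    then have ou: "ord_at R u = 0" by (rule R.ord_unit)
    have "x = u * t powi ord_at P x" unfolding u_def using tp by simp
    then have "ord_at R x = ord_at R u + ord_at R (t powi ord_at P x)"
      using R.ord_mult[of u "t powi ord_at P x"] uK tp assms(4) by auto
    then show ?thesis using ou R.ord_powi[of t] assms by auto
  qed
  then show "x \<in> K \<Longrightarrow> x \<noteq> 0 \<Longrightarrow> ord_at R x = ord_at R t * ord_at P x" .
  show "ramification_index K R P = ord_at R t"
    unfolding ramification_index_def
  proof (rule the_equality)
    show "\<forall>x\<in>K - {0}. ord_at R x = ord_at R t * ord_at P x" using * by blast
    fix e assume "\<forall>x\<in>K - {0}. ord_at R x = e * ord_at P x"
    then show "e = ord_at R t" using assms(5-7) by force
  qed
qed

lemma image_place:
  assumes g: "aut_on L g" and L: "subfield L (\<Omega> :: 'a::field ring)" and R: "R \<in> places L"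
  shows "g ` R \<in> places L" "max_ideal (g ` R) = g ` max_ideal R"
    "x \<in> L \<Longrightarrow> g x \<in> g ` R \<longleftrightarrow> x \<in> R" "x \<in> L \<Longrightarrow> g x \<in> max_ideal (g ` R) \<longleftrightarrow> x \<in> max_ideal R"
proof -
  interpret val_ring L R using L R by (simp add: val_ring_def)
  note gc = aut_onD[OF g L]
  show iff: "g x \<in> g ` R \<longleftrightarrow> x \<in> R" if "x \<in> L" for x
    using gc(10) that RK by (metis imageE imageI)
  have sg: "subring (g ` R) \<Omega>"
  proof (rule subring_OmegaI)
    show "1 \<in> g ` R" using Rc(2) gc(5) by (metis imageI)
    fix x y assume "x \<in> g ` R" "y \<in> g ` R"
    then obtain a b where "a \<in> R" "b \<in> R" "x = g a" "y = g b" by blast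
    then show "x - y \<in> g ` R" "x * y \<in> g ` R"
      using gc(7)[of a b] gc(3)[of a b] RK Rc(5,6)[of a b] by (metis imageI)+
  qed
  have "g ` R \<subseteq> L" using gc(1) RK by auto
  moreover obtain z where "z \<in> L" "z \<notin> R" using ssub by auto
  then have "g z \<in> L" "g z \<notin> g ` R" using gc(1) iff by auto
  moreover have "y \<in> g ` R \<or> inverse y \<in> g ` R" if y: "y \<in> L" for y
  proof -
    obtain x where x: "x \<in> L" "g x = y" using gc(13) y by blast
    then show ?thesis using tot[of x] iff[of x] iff[of "inverse x"] gc(9)[of x] Kc(8) by auto
  qed
  ultimately show pl: "g ` R \<in> places L" using sg by (auto simp: places_def)
  show iff2: "g x \<in> max_ideal (g ` R) \<longleftrightarrow> x \<in> max_ideal R" if "x \<in> L" for x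
    unfolding max_ideal_iff[OF sg] M_iff using iff[OF that] iff[of "inverse x"] gc(9,11) Kc(8) that by metis
  show "max_ideal (g ` R) = g ` max_ideal R"
  proof (intro equalityI subsetI)
    fix y assume y: "y \<in> max_ideal (g ` R)"
    then have "y \<in> g ` R" using max_ideal_iff[OF sg] by blast
    then obtain x where "x \<in> R" "y = g x" by auto
    then show "y \<in> g ` max_ideal R" using iff2 RK y by blast
  next
    fix y assume "y \<in> g ` max_ideal R"
    then show "y \<in> max_ideal (g ` R)" using iff2 MR RK by blast
  qed
qed

section \<open>The action of the Galois group on places\<close>

locale gal_places = gal_ext +
  fixes k assumes ffE: "fun_field k E" and ffF: "fun_field k F"
begin

lemma dvE: "R \<in> places E \<Longrightarrow> dval_ring E R" by (rule place_dval_ring[OF ffE])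
lemma dvF: "R \<in> places F \<Longrightarrow> dval_ring F R" by (rule place_dval_ring[OF ffF])

lemma restrict_place: "R \<in> places E \<Longrightarrow> R \<inter> F \<in> places F"
  "R \<in> places E \<Longrightarrow> x \<in> F \<Longrightarrow> x \<in> max_ideal R \<longleftrightarrow> x \<in> max_ideal (R \<inter> F)"
  using place_restrict[OF sfE sfF FE algebraic_over_F] by auto

lemma above_ex: "P \<in> places F \<Longrightarrow> \<exists>R. R \<in> places_above F E P"
  by (rule ex_place_above[OF ffF sfE FE algebraic_over_F])

lemma above_iff: "R \<in> places_above F E P \<longleftrightarrow> R \<in> places E \<and> R \<inter> F = P"
  by (auto simp: places_above_def)

lemma image_above: "g \<in> G \<Longrightarrow> R \<in> places_above F E P \<Longrightarrow> g ` R \<in> places_above F E P"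
proof -
  assume g: "g \<in> G" and R: "R \<in> places_above F E P"
  have "g ` R \<in> places E" using image_place[OF G_aut[OF g] sfE] R by (auto simp: above_iff)
  moreover have "x \<in> g ` R \<longleftrightarrow> x \<in> R" if "x \<in> F" for x
    using image_place(3)[OF G_aut[OF g] sfE, of R x] R that G_fix[OF g that] FE by (auto simp: above_iff)
  ultimately show ?thesis using R by (auto simp: above_iff)
qed

lemma image_image: "g \<in> G \<Longrightarrow> h \<in> G \<Longrightarrow> R \<subseteq> E \<Longrightarrow> g ` h ` R = (g \<otimes>\<^bsub>Gal E F\<^esub> h) ` R"
  by (force simp: G_mult_app image_iff subset_iff)

text \<open>If the orbits of Q1 and Q2 were disjoint, an element congruent to 1 along the first and
  to 0 along the second would have a norm in F that is congruent to 1 modulo Q1 and to 0 modulo Q2,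
  although both places restrict to P.\<close>

lemma transitive:
  assumes "Q1 \<in> places_above F E P" "Q2 \<in> places_above F E P"
  shows "\<exists>g\<in>G. g ` Q1 = Q2"
proof (rule ccontr)
  assume no: "\<not> (\<exists>g\<in>G. g ` Q1 = Q2)"
  have QE: "Q1 \<in> places E" "Q2 \<in> places E" "Q1 \<subseteq> E" "Q2 \<subseteq> E" using assms by (auto simp: above_iff places_def)
  define S where "S = (\<lambda>g. g ` Q1) ` G \<union> (\<lambda>g. g ` Q2) ` G"
  have SA: "R \<in> places_above F E P" if "R \<in> S" for R using that image_above assms by (auto simp: S_def)
  interpret finite_places E S
    by (rule finite_places.intro) (use finite_G sfE SA dvE in \<open>auto simp: S_def above_iff\<close>)
  have disj: "g ` Q1 \<noteq> h ` Q2" if "g \<in> G" "h \<in> G" for g h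
  proof
    assume e: "g ` Q1 = h ` Q2"
    have "(inv\<^bsub>Gal E F\<^esub> h) ` g ` Q1 = (inv\<^bsub>Gal E F\<^esub> h) ` h ` Q2" using e by simp
    also have "\<dots> = (\<lambda>x. x) ` Q2" using inv_app(1)[OF that(2)] QE(4) by (force simp: image_iff)
    finally have "(inv\<^bsub>Gal E F\<^esub> h \<otimes>\<^bsub>Gal E F\<^esub> g) ` Q1 = Q2" using image_image[of "inv\<^bsub>Gal E F\<^esub> h" g Q1] that QE by simp
    then show False using no that by blast
  qed
  define a where "a R = (if R \<in> (\<lambda>g. g ` Q1) ` G then 1 else 0 :: 'a)" for R
  obtain x where x: "x \<in> E" "\<And>R. R \<in> S \<Longrightarrow> x - a R \<in> dval_ring.V E R 1"
  proof -
    have "a R \<in> E" for R using Ec(1,2) by (auto simp: a_def)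
    then show ?thesis using weak_approximation[of a 1] that by blast
  qed
  have x1: "x - 1 \<in> max_ideal (g ` Q1)" if "g \<in> G" for g
  proof -
    have "g ` Q1 \<in> S" using that by (auto simp: S_def)
    then interpret R: dval_ring E "g ` Q1" using SA dvE by (auto simp: above_iff)
    show ?thesis using x(2)[OF \<open>g ` Q1 \<in> S\<close>] that by (auto simp: a_def R.V_1)
  qed
  have x2: "x \<in> max_ideal (g ` Q2)" if "g \<in> G" for g
  proof -
    have "g ` Q2 \<in> S" using that by (auto simp: S_def)
    then interpret R: dval_ring E "g ` Q2" using SA dvE by (auto simp: above_iff)
    have "g ` Q2 \<notin> (\<lambda>g. g ` Q1) ` G" using disj that by blast
    then show ?thesis using x(2)[OF \<open>g ` Q2 \<in> S\<close>] by (simp add: a_def R.V_1)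
  qed
  define N where "N = (\<Prod>g\<in>G. g x)"
  have "N \<in> F"
  proof (rule fixF)
    show "N \<in> E" unfolding N_def using x by (intro sum_in_subfield[OF sfE]) (auto simp: Gc)
    fix h assume h: "h \<in> G"
    have "h N = (\<Prod>g\<in>G. (h \<otimes>\<^bsub>Gal E F\<^esub> g) x)"
      unfolding N_def using h x by (subst aut_on_sum[OF G_aut sfE]) (auto simp: Gc G_mult_app)
    also have "\<dots> = N" unfolding N_def by (rule prod.reindex_bij_betw[OF reindex_G[OF h]])
    finally show "h N = N" .
  qed
  interpret A: dval_ring E Q1 using QE dvE by auto
  interpret B: dval_ring E Q2 using QE dvE by auto
  \<comment> \<open>Membership of g z in the maximal ideal of Q is membership of z in that of the
    translate of Q by the inverse of g. So control of x along whole orbits controls every factor of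
    the norm at one place.\<close>
  have shift: "g z \<in> max_ideal Q" if "g \<in> G" "z \<in> E" "z \<in> max_ideal ((inv\<^bsub>Gal E F\<^esub> g) ` Q)" "Q \<in> places E" for g z Q
  proof -
    have "(inv\<^bsub>Gal E F\<^esub> g) ` Q \<in> places E" using image_place(1)[OF G_aut sfE] that by auto
    then have "g z \<in> max_ideal (g ` (inv\<^bsub>Gal E F\<^esub> g) ` Q)"
      using image_place(4)[OF G_aut[OF that(1)] sfE _ that(2)] that(3) by blast
    moreover have "Q \<subseteq> E" using that(4) by (auto simp: places_def)
    then have "(\<lambda>x. g ((inv\<^bsub>Gal E F\<^esub> g) x)) ` Q = (\<lambda>x. x) ` Q" by (intro image_cong refl inv_app(2)[OF that(1)]) blast
    then have "g ` (inv\<^bsub>Gal E F\<^esub> g) ` Q = Q" by (simp add: Set.image_image)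
    ultimately show ?thesis by simp
  qed
  have "N \<in> max_ideal Q2"
  proof -
    have g2: "g x \<in> max_ideal Q2" if "g \<in> G" for g using shift[OF that x(1) _ QE(2)] x2 that by simp
    have "N = \<one>\<^bsub>Gal E F\<^esub> x * (\<Prod>g\<in>G - {\<one>\<^bsub>Gal E F\<^esub>}. g x)" unfolding N_def using finite_G by (intro prod.remove) auto
    moreover have "(\<Prod>g\<in>G - {\<one>\<^bsub>Gal E F\<^esub>}. g x) \<in> Q2" using g2 by (intro B.Rsum B.MR) auto
    ultimately show ?thesis using B.M_mult[OF g2[OF Gr.one_closed]] by simp
  qed
  then have "N \<in> max_ideal (Q2 \<inter> F)" using restrict_place(2)[OF QE(2) \<open>N \<in> F\<close>] by simp
  then have "N \<in> max_ideal (Q1 \<inter> F)" using assms by (auto simp: above_iff)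
  then have "N \<in> max_ideal Q1" using restrict_place(2)[OF QE(1) \<open>N \<in> F\<close>] by simp
  moreover have "N - 1 \<in> max_ideal Q1"
  proof -
    have "g x - 1 \<in> max_ideal Q1" if "g \<in> G" for g
    proof -
      have "g (x - 1) \<in> max_ideal Q1" using shift[OF that _ _ QE(1), of "x - 1"] x1[of "inv\<^bsub>Gal E F\<^esub> g"] that x(1) Ec by auto
      then show ?thesis using that x Ec by (simp add: Gc)
    qed
    then have "(\<Prod>g\<in>G. g x) - (\<Prod>g\<in>G. 1) \<in> max_ideal Q1" by (intro A.cong_prod A.Rc) auto
    then show ?thesis by (simp add: N_def)
  qed
  ultimately have "N - (N - 1) \<in> max_ideal Q1" by (rule A.M_diff)
  then show False using A.M_one by simp
qed

lemma finite_above: "finite (places_above F E P)"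
proof (cases "places_above F E P = {}")
  case False
  then obtain Q where "Q \<in> places_above F E P" by blast
  then have "places_above F E P \<subseteq> (\<lambda>g. g ` Q) ` G" using transitive by blast
  then show ?thesis using finite_G finite_subset by blast
qed auto

lemma unramified_uniformizer:
  assumes P: "P \<in> places F" "unramified_at F E P" and t: "t \<in> F" "t \<noteq> 0" "ord_at P t = 1"
    and Q: "Q \<in> places_above F E P"
  shows "ord_at Q t = 1" "x \<in> F \<Longrightarrow> x \<noteq> 0 \<Longrightarrow> ord_at Q x = ord_at P x"
proof -
  have d: "dval_ring F P" "dval_ring E Q" "Q \<inter> F = P" using dvE dvF P Q by (auto simp: above_iff)
  show 1: "ord_at Q t = 1" using ramification_index_eq(1)[OF d FE t] P(2) Q by (auto simp: unramified_at_def)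
  show "x \<in> F \<Longrightarrow> x \<noteq> 0 \<Longrightarrow> ord_at Q x = ord_at P x"
    using ramification_index_eq(2)[OF d FE t, of x] 1 by simp
qed

end

section \<open>Galois groups of finite fields\<close>

text \<open>An automorphism is determined by the image of a generator of the multiplicative group.
  That image is a root of the minimal polynomial over K, whose degree is at most e by counting the
  elements of the simple extension.\<close>

lemma (in Ring.field) card_gal_group_le:
  assumes fin: "finite (carrier R)" and K: "subfield K R" and c: "card (carrier R) = card K ^ e" and k2: "card K \<ge> 2"
  shows "finite (carrier (gal_group R K)) \<and> card (carrier (gal_group R K)) \<le> e"
proof -
  obtain \<gamma> where g: "\<gamma> \<in> carrier (Multiplicative_Group.mult_of R)"
    "carrier (Multiplicative_Group.mult_of R) = {\<gamma> [^] i | i::nat. i \<in> UNIV}"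
    by (rule bexE[OF finite_field_mult_group_has_gen[OF fin]])
  have gR: "\<gamma> \<in> carrier R" using g by auto
  have fK: "finite K" using fin subfieldE(3)[OF K] finite_subset by blast
  have alg: "(algebraic over K) \<gamma>"
    by (rule finite_dimension_imp_algebraic[OF K carrier_is_subring finite_dimension_of_finite(1)[OF K fin] gR])
  define p where "p = Irr K \<gamma>"
  note I = IrrE[OF K gR alg, folded p_def]
  have sE: "simple_extension K \<gamma> \<subseteq> carrier R"
    using simple_extension_in_carrier[OF subfieldE(3)[OF K] gR] .
  have "card (simple_extension K \<gamma>) = card K ^ (length p - 1)"
    using card_of_dimension[OF dimension_simple_extension[OF K gR alg] K fK] by (simp add: p_def)
  moreover have "card (simple_extension K \<gamma>) \<le> card (carrier R)" using sE fin by (rule card_mono[rotated])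
  ultimately have "card K ^ (length p - 1) \<le> card K ^ e" using c by simp
  then have de: "(length p - 1) \<le> e" using k2 power_increasing_iff[of "card K" "(length p - 1)" e] by simp
  have pc: "p \<in> carrier (poly_ring R)"
    using carrier_polynomial[OF subfieldE(1)[OF K]] I(1) by (simp add: univ_poly_carrier[symmetric])
  have p0: "p \<noteq> []" using I(2) unfolding ring_irreducible_def by (auto simp: univ_poly_zero)
  have pK: "set p \<subseteq> K" using I(1) polynomial_incl unfolding univ_poly_carrier[symmetric] by blast
  have root: "h \<gamma> \<in> set_mset (roots p)" if h: "h \<in> carrier (gal_group R K)" for h
  proof -
    have hh: "h \<in> ring_hom R R" "\<And>x. x \<in> K \<Longrightarrow> h x = x" using h by (auto simp: gal_group_def)
    interpret h: ring_hom_ring R R h by (rule ring_hom_ringI2[OF ring_axioms ring_axioms hh(1)])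
    have "set p \<subseteq> carrier R" using pK subfieldE(3)[OF K] by blast
    then have "h (eval p \<gamma>) = eval (map h p) (h \<gamma>)" using h.eval_hom'[OF gR] by blast
    moreover have "map h p = p" using pK hh(2) by (intro map_idI) auto
    ultimately have "eval p (h \<gamma>) = \<zero>" using I(4) by simp
    then have "is_root p (h \<gamma>)" using p0 h.hom_closed[OF gR] by (simp add: is_root_def)
    then show ?thesis using roots_mem_iff_is_root[OF pc] by blast
  qed
  have inj: "inj_on (\<lambda>h. h \<gamma>) (carrier (gal_group R K))"
  proof (rule inj_onI)
    fix h h' assume a: "h \<in> carrier (gal_group R K)" "h' \<in> carrier (gal_group R K)" "h \<gamma> = h' \<gamma>"
    have hh: "h \<in> ring_hom R R" "h' \<in> ring_hom R R" "h \<in> extensional (carrier R)" "h' \<in> extensional (carrier R)"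
      using a by (auto simp: gal_group_def Bij_def)
    interpret h: ring_hom_ring R R h by (rule ring_hom_ringI2[OF ring_axioms ring_axioms hh(1)])
    interpret h': ring_hom_ring R R h' by (rule ring_hom_ringI2[OF ring_axioms ring_axioms hh(2)])
    show "h = h'"
    proof (rule extensionalityI[OF hh(3,4)])
      fix x assume x: "x \<in> carrier R"
      show "h x = h' x"
      proof (cases "x = \<zero>")
        case False
        then have "x \<in> carrier (Multiplicative_Group.mult_of R)" using x by simp
        then obtain i :: nat where "x = \<gamma> [^] i" using g(2) by auto
        then show ?thesis using a(3) gR by (simp add: h.hom_nat_pow h'.hom_nat_pow)
      qed simp
    qed
  qed
  have sub: "(\<lambda>h. h \<gamma>) ` carrier (gal_group R K) \<subseteq> set_mset (roots p)" using root by auto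
  then have f: "finite ((\<lambda>h. h \<gamma>) ` carrier (gal_group R K))" using finite_subset finite_set_mset by blast
  have "card (carrier (gal_group R K)) = card ((\<lambda>h. h \<gamma>) ` carrier (gal_group R K))" using card_image[OF inj] by simp
  also have "\<dots> \<le> card (set_mset (roots p))" by (rule card_mono[OF finite_set_mset sub])
  also have "\<dots> \<le> size (roots p)" unfolding size_multiset_overloaded_eq
    using sum_mono[of "set_mset (roots p)" "\<lambda>_. 1" "count (roots p)"] by (simp add: Suc_le_eq)
  also have "\<dots> \<le> (length p - 1)" by (rule size_roots_le_degree[OF pc])
  finally show ?thesis using de finite_imageD[OF f inj] by simp
qed

text \<open>The polynomial X^(card C) - X has at most card C roots, and all elements of C are among
  them. Membership in a finite constant field can thus be tested by a power map.\<close>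

lemma finite_subfield_roots:
  assumes C: "subfield C (\<Omega> :: 'a::field ring)" "finite C" shows "C = {z. z ^ card C = z}"
proof (rule card_subset_eq)
  define p :: "'a poly" where "p = monom 1 (card C) - monom 1 1"
  have n2: "card C \<ge> 2" using finite_subfield_power(3)[OF C] subfield_OmegaD(1)[OF C(1)] by blast
  then have "coeff p (card C) = 1" by (simp add: p_def)
  then have p0: "p \<noteq> 0" by auto
  have e: "{z::'a. z ^ card C = z} = {z. poly p z = 0}" by (simp add: p_def poly_monom)
  show f: "finite {z::'a. z ^ card C = z}" unfolding e by (rule poly_roots_finite[OF p0])
  show sub: "C \<subseteq> {z::'a. z ^ card C = z}" using finite_subfield_power(2)[OF C] by blast
  have "degree p \<le> card C" unfolding p_def using n2
    by (intro degree_diff_le) (auto intro: order.trans[OF degree_monom_le])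
  then have "card {z::'a. z ^ card C = z} \<le> card C"
    unfolding e using card_poly_roots_bound[OF p0] by simp
  then show "card C = card {z::'a. z ^ card C = z}" using card_mono[OF f sub] by simp
qed

lemma finite_subfield_generator:
  assumes C: "subfield C (\<Omega> :: 'a::field ring)" "finite C"
  shows "\<exists>\<gamma>\<in>C. \<gamma> \<noteq> 0 \<and> (\<forall>x\<in>C. x \<noteq> 0 \<longrightarrow> (\<exists>i. x = \<gamma> ^ i)) \<and> (\<forall>i. \<gamma> ^ i = 1 \<longleftrightarrow> (card C - 1) dvd i)"
proof -
  interpret O: Ring.field "\<Omega> :: 'a ring" by (rule Omega_field)
  interpret kk: Ring.field "sub C" using O.subfield_iff(2)[OF C(1)] .
  note Cc = subfield_OmegaD[OF C(1)]
  have pw: "x [^]\<^bsub>sub C\<^esub> (i::nat) = x ^ i" for x i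
    by (induction i) (simp_all add: mult.commute)
  have "finite (carrier (sub C))" using C by simp
  then obtain \<gamma> where g: "\<gamma> \<in> carrier (Multiplicative_Group.mult_of (sub C))"
    "carrier (Multiplicative_Group.mult_of (sub C)) = {\<gamma> [^]\<^bsub>sub C\<^esub> i | i::nat. i \<in> UNIV}"
    by (rule bexE[OF kk.finite_field_mult_group_has_gen])
  have g1: "\<gamma> \<in> C" "\<gamma> \<noteq> 0" using g(1) by auto
  have gen: "\<exists>i. x = \<gamma> ^ i" if "x \<in> C" "x \<noteq> 0" for x
  proof -
    have "x \<in> carrier (Multiplicative_Group.mult_of (sub C))" using that by simp
    then show ?thesis unfolding g(2) pw by auto
  qed
  define N where "N = card C - 1"
  have N0: "N > 0" using finite_subfield_power(3)[OF C Cc(1)] by (simp add: N_def)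
  have gN: "\<gamma> ^ N = 1" unfolding N_def using finite_subfield_power(1)[OF C g1] .
  \<comment> \<open>Otherwise \<gamma> would have a smaller exponent m, and its powers could fill at
    most m of the N nonzero elements.\<close>
  have "N dvd i" if i: "\<gamma> ^ i = 1" for i
  proof (rule ccontr)
    assume nd: "\<not> N dvd i"
    define m where "m = i mod N"
    have m: "0 < m" "m < N" using nd N0 by (auto simp: m_def mod_eq_0_iff_dvd[symmetric])
    have "\<gamma> ^ i = \<gamma> ^ (N * (i div N) + m)" by (simp add: m_def)
    then have gm: "\<gamma> ^ m = 1" using i gN by (simp add: power_add power_mult)
    have "C - {0} \<subseteq> (\<lambda>j. \<gamma> ^ j) ` {..<m}"
    proof
      fix x assume "x \<in> C - {0}"
      then obtain j where "x = \<gamma> ^ j" using gen by blast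
      also have "\<dots> = \<gamma> ^ (m * (j div m) + j mod m)" by simp
      also have "\<dots> = \<gamma> ^ (j mod m)" by (simp only: power_add power_mult gm) simp
      finally show "x \<in> (\<lambda>j. \<gamma> ^ j) ` {..<m}" using m by auto
    qed
    then have "card (C - {0}) \<le> m" using surj_card_le[of "{..<m}" "C - {0}"] by simp
    then show False using m C Cc(1) by (simp add: N_def)
  qed
  then have "\<gamma> ^ i = 1 \<longleftrightarrow> N dvd i" for i using gN by (auto simp: dvd_def power_mult)
  then show ?thesis using g1 gen unfolding N_def by blast
qed

context val_ring
begin

text \<open>Nonzero constants are roots of unity, hence units of every place, and no two distinct
  constants are congruent.\<close>

lemma const_in:
  assumes C: "subfield C \<Omega>" "finite C" "C \<subseteq> K"
  shows "C \<subseteq> R" "c \<in> C \<Longrightarrow> c \<in> M \<Longrightarrow> c = 0" "inj_on (residue R) C"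
    "subfield (residue R ` C) (residue_field R)" "card (residue R ` C) = card C"
proof -
  note Cc = subfield_OmegaD[OF C(1)]
  show CR: "C \<subseteq> R"
  proof
    fix c assume "c \<in> C"
    then show "c \<in> R" using finite_subfield_power(1,3)[OF C(1,2) \<open>c \<in> C\<close>] C(3) Rc(1)
      by (cases "c = 0") (auto intro: rootof1_in[of c "card C - 1"])
  qed
  show z: "c = 0" if "c \<in> C" "c \<in> M" for c using that CR Cc(8) by (auto simp: M_iff)
  show inj: "inj_on (residue R) C"
  proof (rule inj_onI)
    fix x y assume a: "x \<in> C" "y \<in> C" "residue R x = residue R y"
    then have "x - y \<in> M" using residue_eq_iff CR by blast
    then show "x = y" using z[of "x - y"] a Cc by auto
  qed
  then show "card (residue R ` C) = card C" by (rule card_image)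
  interpret rf: Ring.field "residue_field R" by (rule residue_field_field)
  interpret O: Ring.field "\<Omega> :: 'a ring" by (rule Omega_field)
  have sc: "ring (sub R)" using sub_cring cring.axioms(1) by blast
  interpret i: ideal M "sub R" by (rule M_ideal)
  interpret h: ring_hom_ring "sub R" "residue_field R" "residue R"
    unfolding residue_field_def residue_def[abs_def] by (rule i.rcos_ring_hom_ring)
  have "Ring.field (sub C)" using O.subfield_iff(2)[OF C(1)] .
  then have "subfield C (sub R)" by (intro ring.subfield_iff(1)[OF sc]) (use CR in auto)
  moreover have "\<one>\<^bsub>residue_field R\<^esub> \<noteq> \<zero>\<^bsub>residue_field R\<^esub>" by (rule rf.one_not_zero)
  ultimately show "subfield (residue R ` C) (residue_field R)"
    by (rule h.img_is_subfield(2))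
qed

lemma rcard_eq:
  assumes ff: "fun_field k K" and C: "subfield C \<Omega>" "finite C" "C \<subseteq> K"
  shows "rcard = card C ^ ring.dim (residue_field R) (residue R ` C) (carrier (residue_field R))"
proof -
  interpret rf: Ring.field "residue_field R" by (rule residue_field_field)
  show ?thesis unfolding rcard_def
    using rf.finite_dimension_of_finite(2)[OF const_in(4)[OF C] residue_finite[OF ff]] const_in(5)[OF C] by simp
qed

lemma rcard_place_degree:
  assumes "fun_field k K" shows "rcard = card k ^ place_degree k R"
  unfolding place_degree_def using rcard_eq[OF assms] assms by (auto simp: fun_field_def)

lemma rcard_exponent_pos:
  assumes ff: "fun_field k K" and "rcard = q ^ e" shows "e > 0"
  using cong_rcard(3)[OF ff Rc(1)] assms(2) by (cases e) auto

text \<open>The first e iterates of the power map are distinct automorphisms, and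
  \<open>card_gal_group_le\<close> leaves room for no others. This turns the norm, defined through
  the Galois group, into an explicit product of powers.\<close>

lemma residue_frobenius:
  assumes ff: "fun_field k K" and C: "subfield C \<Omega>" "finite C" "C \<subseteq> K" and e: "rcard = card C ^ e"
  defines "fr \<equiv> \<lambda>j. restrict (\<lambda>a. a [^]\<^bsub>residue_field R\<^esub> (card C ^ j)) (carrier (residue_field R))"
  shows "carrier (gal_group (residue_field R) (residue R ` C)) = fr ` {..<e}" "inj_on fr {..<e}"
proof -
  interpret rf: Ring.field "residue_field R" by (rule residue_field_field)
  note Cc = subfield_OmegaD[OF C(1)]
  define Q where "Q = card C"
  have Q2: "Q \<ge> 2" unfolding Q_def using finite_subfield_power(3)[OF C(1,2) Cc(1)] .
  have fin: "finite (carrier (residue_field R))" by (rule residue_finite[OF ff])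
  have CR: "C \<subseteq> R" by (rule const_in[OF C])
  have frr: "fr j (residue R x) = residue R (x ^ (Q ^ j))" if "x \<in> R" for j x
    unfolding fr_def Q_def using that residue_ops(1)[OF that that] by (simp add: residue_pow)
  have sub: "fr j \<in> carrier (gal_group (residue_field R) (residue R ` C))" for j
  proof -
    have hom: "fr j \<in> ring_hom (residue_field R) (residue_field R)"
    proof (rule ring_hom_memI)
      fix a b assume "a \<in> carrier (residue_field R)" "b \<in> carrier (residue_field R)"
      then obtain x y where xy: "x \<in> R" "y \<in> R" "a = residue R x" "b = residue R y" by (auto simp: residue_carrier)
      then show "fr j a \<in> carrier (residue_field R)" using frr residue_ops(1) Rc by auto
      show "fr j (a \<otimes>\<^bsub>residue_field R\<^esub> b) = fr j a \<otimes>\<^bsub>residue_field R\<^esub> fr j b"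
        unfolding xy using xy(1,2) by (simp add: residue_ops(2) frr Rc power_mult_distrib)
      show "fr j (a \<oplus>\<^bsub>residue_field R\<^esub> b) = fr j a \<oplus>\<^bsub>residue_field R\<^esub> fr j b"
        unfolding xy using xy(1,2) frob_add(1)[OF C(1,2)] by (simp add: residue_ops(3) frr Rc Q_def)
    next
      show "fr j \<one>\<^bsub>residue_field R\<^esub> = \<one>\<^bsub>residue_field R\<^esub>"
        unfolding residue_ops(4)[OF Rc(1,1)] using frr Rc by simp
    qed
    interpret h: ring_hom_ring "residue_field R" "residue_field R" "fr j"
      by (rule ring_hom_ringI2[OF rf.ring_axioms rf.ring_axioms hom])
    have "inj_on (fr j) (carrier (residue_field R))"
      by (rule non_trivial_field_hom_is_inj[OF hom rf.field_axioms rf.field_axioms])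
    moreover have "fr j ` carrier (residue_field R) \<subseteq> carrier (residue_field R)" using h.hom_closed by auto
    ultimately have "bij_betw (fr j) (carrier (residue_field R)) (carrier (residue_field R))"
      unfolding bij_betw_def using endo_inj_surj[OF fin] by blast
    moreover have "fr j (residue R c) = residue R c" if c: "c \<in> C" for c
    proof -
      have "c ^ (Q ^ j) = c"
        by (induction j) (auto simp: power_mult Q_def finite_subfield_power(2)[OF C(1,2) c] mult.commute)
      then show ?thesis using frr[of c] c CR by auto
    qed
    ultimately show ?thesis using hom by (auto simp: gal_group_def Bij_def fr_def)
  qed
  show inj: "inj_on fr {..<e}"
  proof (rule linorder_inj_onI)
    fix i j assume ij: "i < j" "i \<in> {..<e}" "j \<in> {..<e}"
    show "fr i \<noteq> fr j"
    proof
      assume eq: "fr i = fr j"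
      \<comment> \<open>Otherwise every residue class would be a root of a polynomial of degree less than their number.\<close>
      have "a [^]\<^bsub>residue_field R\<^esub> (Q ^ j - Q ^ i) = \<one>\<^bsub>residue_field R\<^esub>"
        if a: "a \<in> carrier (residue_field R)" "a \<noteq> \<zero>\<^bsub>residue_field R\<^esub>" for a
      proof -
        obtain x where x: "x \<in> R" "a = residue R x" using a by (auto simp: residue_carrier)
        have nM: "x \<notin> M" using a x residue_ops(5)[OF Rc(1,1)] residue_eq_iff[of x 0] Rc by auto
        have "residue R (x ^ (Q ^ i)) = residue R (x ^ (Q ^ j))" using fun_cong[OF eq, of a] frr x by simp
        then have "x ^ (Q ^ i) - x ^ (Q ^ j) \<in> M" using residue_eq_iff x Rc by auto
        moreover have "x ^ (Q ^ j) = x ^ (Q ^ i) * x ^ (Q ^ j - Q ^ i)"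
          using ij Q2 by (simp add: power_add[symmetric] power_increasing)
        then have "x ^ (Q ^ i) - x ^ (Q ^ j) = x ^ (Q ^ i) * (1 - x ^ (Q ^ j - Q ^ i))" by (simp add: right_diff_distrib)
        ultimately have "x ^ (Q ^ i) * (1 - x ^ (Q ^ j - Q ^ i)) \<in> M" by simp
        moreover have "x ^ m \<notin> M" for m
        proof (induction m)
          case (Suc m) then show ?case using M_prime[of x "x ^ m"] nM x Rc by auto
        qed (simp add: M_one)
        moreover have "x ^ (Q ^ i) \<in> R" "1 - x ^ (Q ^ j - Q ^ i) \<in> R" by (intro Rc x(1))+
        ultimately have "1 - x ^ (Q ^ j - Q ^ i) \<in> M" using M_prime by blast
        then have "x ^ (Q ^ j - Q ^ i) - 1 \<in> M" using M_diff_sym by blast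
        then show ?thesis unfolding x(2)
          using residue_pow[OF x(1)] residue_ops(4)[OF Rc(1,1)] residue_eq_iff[of "x ^ (Q ^ j - Q ^ i)" 1] Rc(2) Rc(7)[OF x(1)] by simp
      qed
      then have "carrier (residue_field R) - {\<zero>\<^bsub>residue_field R\<^esub>} \<subseteq>
        {a \<in> carrier (residue_field R). a [^]\<^bsub>residue_field R\<^esub> (Q ^ j - Q ^ i) = \<one>\<^bsub>residue_field R\<^esub>}" by blast
      then have "card (carrier (residue_field R) - {\<zero>\<^bsub>residue_field R\<^esub>}) \<le>
        card {a \<in> carrier (residue_field R). a [^]\<^bsub>residue_field R\<^esub> (Q ^ j - Q ^ i) = \<one>\<^bsub>residue_field R\<^esub>}"
        using fin by (intro card_mono) auto
      also have "\<dots> \<le> Q ^ j - Q ^ i"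
      proof (rule rf.num_roots_le_deg[OF fin])
        have "Q ^ i < Q ^ j" using ij Q2 by (intro power_strict_increasing) auto
        then show "Q ^ j - Q ^ i \<noteq> 0" by simp
      qed
      finally have "Q ^ e - 1 \<le> Q ^ j - Q ^ i" using fin e by (simp add: rcard_def Q_def)
      moreover have "Q ^ j * Q \<le> Q ^ e" using ij Q2 power_increasing[of "Suc j" e Q] by (simp add: mult.commute)
      then have "Q ^ j * 2 \<le> Q ^ e" using Q2 mult_le_mono2[of 2 Q "Q ^ j"] by linarith
      moreover have "Q ^ j \<ge> 1" "Q ^ i \<ge> 1" using Q2 by auto
      ultimately show False by linarith
    qed
  qed auto
  have le: "finite (carrier (gal_group (residue_field R) (residue R ` C))) \<and>
    card (carrier (gal_group (residue_field R) (residue R ` C))) \<le> e"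
    by (rule rf.card_gal_group_le[OF fin const_in(4)[OF C]])
       (use e Q2 in \<open>auto simp: const_in(5)[OF C] rcard_def Q_def\<close>)
  have "fr ` {..<e} = carrier (gal_group (residue_field R) (residue R ` C))"
    by (rule card_seteq) (use le sub card_image[OF inj] in auto)
  then show "carrier (gal_group (residue_field R) (residue R ` C)) = fr ` {..<e}" by simp
qed

text \<open>The norm is the class of P, the product of the powers f^(Q^j) for j < e. P is congruent
  to its own Q-th power, which forces its class to come from a constant, and the constant is unique
  because constants are not congruent to each other.\<close>

lemma residue_norm_cong:
  assumes ff: "fun_field k K" and C: "subfield C \<Omega>" "finite C" "C \<subseteq> K" and e: "rcard = card C ^ e" and f: "f \<in> R"
  shows "residue_norm C R f \<in> C" "(\<Prod>j<e. f ^ (card C ^ j)) - residue_norm C R f \<in> M"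
proof -
  interpret rf: Ring.field "residue_field R" by (rule residue_field_field)
  note Cc = subfield_OmegaD[OF C(1)]
  define Q where "Q = card C"
  have fin: "finite (carrier (residue_field R))" by (rule residue_finite[OF ff])
  have CR: "C \<subseteq> R" by (rule const_in[OF C])
  note gal = residue_frobenius[OF ff C e]
  define P where "P = (\<Prod>j<e. f ^ (Q ^ j))"
  have PR: "P \<in> R" unfolding P_def using f by (intro Rsum Rc)
  have "field_norm (residue_field R) (residue R ` C) (residue R f) =
    finprod (residue_field R) (\<lambda>j. residue R (f ^ (Q ^ j))) {..<e}"
    unfolding field_norm_def gal(1)
    by (subst rf.finprod_reindex) (use gal(2) f residue_ops(1)[OF f f] in \<open>auto intro!: rf.finprod_cong' simp: residue_pow Q_def residue_ops(1) Rc\<close>)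
  also have "\<dots> = residue R P"
  proof -
    have "finprod (residue_field R) (\<lambda>j. residue R (f ^ (Q ^ j))) {..<m} = residue R (\<Prod>j<m. f ^ (Q ^ j))" for m
    proof (induction m)
      case 0 then show ?case using residue_ops(4)[OF Rc(1,1)] by simp
    next
      case (Suc m)
      have "(\<Prod>j<m. f ^ (Q ^ j)) \<in> R" using f by (intro Rsum Rc)
      then show ?case using Suc f
        by (simp add: lessThan_Suc residue_ops(1,2) Rc rf.finprod_insert Pi_iff)
    qed
    then show ?thesis unfolding P_def .
  qed
  finally have fn: "field_norm (residue_field R) (residue R ` C) (residue R f) = residue R P" .
  have "P ^ Q - P \<in> M"
  proof -
    \<comment> \<open>The Q-th power shifts the index by one, so the two products differ only in the
      end factors f and f^(Q^e), which are congruent.\<close>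
    have "P ^ Q = (\<Prod>j<e. f ^ (Q ^ Suc j))" unfolding P_def by (simp add: prod_power_distrib power_mult[symmetric] mult.commute)
    then have *: "P ^ Q * f = (\<Prod>j<Suc e. f ^ (Q ^ j))" by (subst prod.lessThan_Suc_shift) (simp add: mult.commute)
    have 1: "P ^ Q * f = P * f ^ (Q ^ e)" unfolding * by (simp add: P_def)
    have 2: "f ^ (Q ^ e) - f \<in> M" using cong_rcard(1)[OF ff f] e by (simp add: Q_def)
    have "(P ^ Q - P) * f = P * (f ^ (Q ^ e) - f)" using 1 by (simp add: algebra_simps)
    then have "(P ^ Q - P) * f \<in> M" using M_mult2[OF PR 2] by simp
    moreover have "P ^ Q - P \<in> R" by (intro Rc PR)
    \<comment> \<open>The factor f may be cancelled only if it is not in M; in the other case P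
      itself lies in M.\<close>
    ultimately consider "P ^ Q - P \<in> M" | "f \<in> M" using M_prime f by blast
    then show ?thesis
    proof cases
      case 2
      have "e > 0" by (rule rcard_exponent_pos[OF ff e])
      then have "P = f * (\<Prod>j\<in>{..<e} - {0}. f ^ (Q ^ j))" unfolding P_def by (subst prod.remove[of _ 0]) auto
      then have "P \<in> M" using M_mult[OF 2 Rsum(2), of "{..<e} - {0}" "\<lambda>j. f ^ (Q ^ j)"] f Rc by auto
      moreover have "P ^ Q \<in> M"
      proof -
        have "Q > 0" unfolding Q_def using finite_subfield_power(3)[OF C(1,2) Cc(1)] by simp
        then have "P ^ Q = P * P ^ (Q - 1)" by (cases Q) auto
        then show ?thesis using M_mult[OF \<open>P \<in> M\<close> Rc(7)[OF PR]] by simp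
      qed
      ultimately show ?thesis by (intro M_diff)
    qed
  qed
  \<comment> \<open>The images of the constants are the only residue classes fixed by the Q-power map.\<close>
  moreover have "\<exists>c\<in>C. P - c \<in> M" if fx: "P ^ Q - P \<in> M"
  proof (cases "P \<in> M")
    case True then show ?thesis using Cc(1) by (intro bexI[of _ 0]) auto
  next
    case False
    have Q2: "Q \<ge> 2" unfolding Q_def using finite_subfield_power(3)[OF C(1,2) Cc(1)] .
    define T where "T = {a \<in> carrier (residue_field R). a [^]\<^bsub>residue_field R\<^esub> (Q - 1) = \<one>\<^bsub>residue_field R\<^esub>}"
    have mem: "residue R x \<in> T" if "x \<in> R" "x ^ (Q - 1) - 1 \<in> M" for x
      unfolding T_def using that residue_pow residue_ops(1,4) residue_eq_iff[of "x ^ (Q - 1)" 1] Rc by auto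
    have "card T \<le> Q - 1" unfolding T_def using Q2 by (intro rf.num_roots_le_deg fin) auto
    moreover have "residue R ` (C - {0}) \<subseteq> T"
    proof
      fix a assume "a \<in> residue R ` (C - {0})"
      then obtain c where c: "c \<in> C" "c \<noteq> 0" "a = residue R c" by auto
      then have "c ^ (Q - 1) = 1" unfolding Q_def using finite_subfield_power(1)[OF C(1,2)] by blast
      then show "a \<in> T" using mem[of c] c CR M_zero by auto
    qed
    moreover have "card (residue R ` (C - {0})) = Q - 1"
      using card_image[OF inj_on_subset[OF const_in(3)[OF C]], of "C - {0}"] C(2) Cc(1) by (simp add: Q_def)
    moreover have "finite T" unfolding T_def using fin by simp
    ultimately have "residue R ` (C - {0}) = T" by (intro card_seteq) auto
    moreover have "P ^ (Q - 1) - 1 \<in> M"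
    proof -
      have "P ^ Q - P = P * (P ^ (Q - 1) - 1)" using Q2 by (cases Q) (auto simp: right_diff_distrib)
      then have "P * (P ^ (Q - 1) - 1) \<in> M" using fx by simp
      moreover have "P ^ (Q - 1) - 1 \<in> R" by (intro Rc PR)
      ultimately show ?thesis using False M_prime[OF PR] by blast
    qed
    then have "residue R P \<in> T" using mem PR by blast
    ultimately obtain c where c: "c \<in> C" "residue R P = residue R c" by blast
    then show ?thesis using residue_eq_iff[OF PR] CR by blast
  qed
  ultimately obtain c where c: "c \<in> C" "P - c \<in> M" by blast
  have "residue_norm C R f = c"
    unfolding residue_norm_def fn
  proof (rule the_equality)
    show "c \<in> C \<and> residue R c = residue R P" using c residue_eq_iff[OF PR] CR by auto
    fix c' assume "c' \<in> C \<and> residue R c' = residue R P"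
    then have "c' \<in> C" "residue R c' = residue R c" using c residue_eq_iff[OF PR] CR by auto
    then show "c' = c" using const_in(3)[OF C] c by (auto simp: inj_on_def)
  qed
  then show "residue_norm C R f \<in> C" "(\<Prod>j<e. f ^ (card C ^ j)) - residue_norm C R f \<in> M"
    using c unfolding P_def Q_def by auto
qed

end

section \<open>The Artin symbol\<close>

lemma (in dval_ring) V_power: "w \<in> V m \<Longrightarrow> w ^ n \<in> V (int n * m)"
proof (induction n)
  case (Suc n)
  then show ?case using V_mult[of w m "w ^ n" "int n * m"] by (simp add: algebra_simps)
qed (simp add: V_def ord_one Kc)

locale abel_places = gal_places +
  assumes comm: "comm_group (Gal E F)"
begin

lemma commute: "g \<in> G \<Longrightarrow> h \<in> G \<Longrightarrow> x \<in> E \<Longrightarrow> g (h x) = h (g x)"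
  using comm_groupE(4)[OF comm, of g h] by (metis G_mult_app)

lemma sfk: "subfield k \<Omega>" "finite k" "k \<subseteq> F"
  using ffF by (auto simp: fun_field_def)

lemma above_subset: "Q \<in> places_above F E P \<Longrightarrow> Q \<subseteq> E"
  by (auto simp: above_iff places_def)

lemma max_ideal_image: "g \<in> G \<Longrightarrow> Q \<in> places_above F E P \<Longrightarrow> x \<in> E \<Longrightarrow> g x \<in> max_ideal (g ` Q) \<longleftrightarrow> x \<in> max_ideal Q"
  using image_place(4)[OF G_aut sfE] by (auto simp: above_iff)

lemma cong_base:
  assumes P: "P \<in> places F" and Q: "Q \<in> places_above F E P" and x: "x \<in> P"
  shows "x ^ (card k ^ place_degree k P) - x \<in> max_ideal Q"
proof -
  interpret P: dval_ring F P by (rule dvF[OF P])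
  have "x ^ P.rcard - x \<in> max_ideal P" by (rule P.cong_rcard(1)[OF ffF x])
  then have *: "x ^ (card k ^ place_degree k P) - x \<in> max_ideal P" using P.rcard_place_degree[OF ffF] by simp
  then have "x ^ (card k ^ place_degree k P) - x \<in> F" using P.MR P.RK by blast
  then show ?thesis using restrict_place(2)[of Q] Q * by (auto simp: above_iff)
qed

text \<open>The coefficients of the orbit polynomial of \<alpha> lie in P and are fixed modulo Q0 by
  the N-th power. So \<alpha>^N is again a root modulo Q0 and is congruent to some conjugate g
  \<alpha>. This g preserves Q0 and acts as the N-th power on a generator of the residue field,
  hence on all residues.\<close>

lemma artin_exists:
  assumes P: "P \<in> places F"
  shows "\<exists>s\<in>G. \<forall>Q\<in>places_above F E P. \<forall>x\<in>Q. s x - x ^ (card k ^ place_degree k P) \<in> max_ideal Q"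
proof -
  define N where "N = card k ^ place_degree k P"
  obtain Q0 where Q0: "Q0 \<in> places_above F E P" using above_ex[OF P] by blast
  interpret finite_places E "places_above F E P"
    by (rule finite_places.intro) (use finite_above sfE dvE in \<open>auto simp: above_iff\<close>)
  interpret Q0: dval_ring E Q0 by (rule dvS[OF Q0])
  obtain \<gamma> where \<gamma>: "\<gamma> \<in> Q0 - max_ideal Q0" "\<And>x. x \<in> Q0 - max_ideal Q0 \<Longrightarrow> \<exists>i. x - \<gamma> ^ i \<in> max_ideal Q0"
    using Q0.residue_generator[OF ffE] by blast
  \<comment> \<open>The element generates the residue field at one place and vanishes at the others, so its conjugates recognise the place.\<close>
  obtain \<alpha> where \<alpha>: "\<alpha> \<in> E" "\<And>Q. Q \<in> places_above F E P \<Longrightarrow> \<alpha> - (if Q = Q0 then \<gamma> else 0) \<in> dval_ring.V E Q 1"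
  proof -
    have "(if Q = Q0 then \<gamma> else 0) \<in> E" for Q using \<gamma>(1) Q0.RK Ec(1) by auto
    then show ?thesis using weak_approximation[of "\<lambda>Q. if Q = Q0 then \<gamma> else 0" 1] that by blast
  qed
  have a0: "\<alpha> - \<gamma> \<in> max_ideal Q0" using \<alpha>(2)[OF Q0] Q0.V_1 by simp
  have a1: "\<alpha> \<in> max_ideal Q" if "Q \<in> places_above F E P" "Q \<noteq> Q0" for Q
  proof -
    interpret Q: dval_ring E Q by (rule dvS[OF that(1)])
    show ?thesis using \<alpha>(2)[OF that(1)] that(2) Q.V_1 by simp
  qed
  have aQ0: "\<alpha> \<in> Q0" using Q0.cong_R[OF a0] \<gamma>(1) by simp
  have anM: "\<alpha> \<notin> max_ideal Q0"
  proof
    assume "\<alpha> \<in> max_ideal Q0"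
    then have "\<alpha> - (\<alpha> - \<gamma>) \<in> max_ideal Q0" using Q0.M_diff a0 by blast
    then show False using \<gamma>(1) by simp
  qed
  have aQ: "\<alpha> \<in> Q" if "Q \<in> places_above F E P" for Q
  proof (cases "Q = Q0")
    case False
    interpret Q: dval_ring E Q by (rule dvS[OF that])
    show ?thesis using a1[OF that False] Q.MR by blast
  qed (use aQ0 in simp)
  have giQ: "(inv\<^bsub>Gal E F\<^esub> g) ` Q0 \<in> places_above F E P" if "g \<in> G" for g using image_above that Q0 by simp
  have gback: "g ` (inv\<^bsub>Gal E F\<^esub> g) ` Q0 = Q0" if "g \<in> G" for g
  proof -
    have "(\<lambda>x. g ((inv\<^bsub>Gal E F\<^esub> g) x)) ` Q0 = (\<lambda>x. x) ` Q0"
      by (intro image_cong refl inv_app(2)[OF that]) (use above_subset[OF Q0] in blast)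
    then show ?thesis by (simp add: Set.image_image)
  qed
  have gaQ: "g \<alpha> \<in> Q0" if g: "g \<in> G" for g
  proof -
    have "g \<alpha> \<in> g ` (inv\<^bsub>Gal E F\<^esub> g) ` Q0" using aQ[OF giQ[OF g]] by blast
    then show ?thesis using gback[OF g] by simp
  qed
  define p where "p = orbit_poly \<alpha>"
  have pF: "p \<in> kpol F" unfolding p_def by (rule orbit_poly_F[OF \<alpha>(1)])
  have pQ: "p \<in> kpol Q0" unfolding p_def orbit_poly_def
    by (intro kpol_sum[OF Q0.sr] kpol_clos[OF Q0.sr] Q0.Rc gaQ)
  have cP: "coeff p i \<in> P" for i using kpolD[OF pF] kpolD[OF pQ] Q0 by (auto simp: above_iff)
  have "poly p (\<alpha> ^ N) \<in> max_ideal Q0"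
  proof -
    have "0 = (poly p \<alpha>) ^ N" using orbit_root[OF \<alpha>(1)] sfk finite_subfield_power(3)[OF sfk(1,2) subfield_OmegaD(1)[OF sfk(1)]]
      by (simp add: p_def N_def)
    also have "\<dots> = (\<Sum>i\<le>degree p. coeff p i ^ N * (\<alpha> ^ N) ^ i)"
      unfolding poly_altdef N_def frob_add(2)[OF sfk(1,2)] by (simp add: power_mult_distrib power_mult[symmetric] mult.commute)
    finally have "poly p (\<alpha> ^ N) = - (\<Sum>i\<le>degree p. coeff p i ^ N * (\<alpha> ^ N) ^ i - coeff p i * (\<alpha> ^ N) ^ i)"
      by (simp add: sum_subtractf poly_altdef)
    moreover have "coeff p i ^ N * (\<alpha> ^ N) ^ i - coeff p i * (\<alpha> ^ N) ^ i \<in> max_ideal Q0" for i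
    proof -
      have "(coeff p i ^ N - coeff p i) * (\<alpha> ^ N) ^ i \<in> max_ideal Q0"
        by (intro Q0.M_mult Q0.Rc aQ0) (use cong_base[OF P Q0 cP[of i]] in \<open>simp add: N_def\<close>)
      then show ?thesis by (simp add: left_diff_distrib)
    qed
    ultimately show ?thesis by (simp only:) (intro Q0.M_minus Q0.M_sum)
  qed
  then have "(\<Prod>g\<in>G. \<alpha> ^ N - g \<alpha>) \<in> max_ideal Q0" unfolding p_def poly_orbit .
  moreover have "\<alpha> ^ N - g \<alpha> \<in> Q0" if "g \<in> G" for g by (intro Q0.Rc aQ0 gaQ that)
  ultimately obtain g where g: "g \<in> G" "\<alpha> ^ N - g \<alpha> \<in> max_ideal Q0"
    using Q0.M_prime_prod[OF finite_G, of "\<lambda>g. \<alpha> ^ N - g \<alpha>"] by blast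
  have aNM: "\<alpha> ^ n \<notin> max_ideal Q0" for n
  proof (induction n)
    case (Suc n) then show ?case using Q0.M_prime[OF aQ0 Q0.Rc(7)[OF aQ0, of n]] anM by auto
  qed (simp add: Q0.M_one)
  have gnM: "g \<alpha> \<notin> max_ideal Q0"
  proof
    assume "g \<alpha> \<in> max_ideal Q0"
    then have "\<alpha> ^ N - g \<alpha> + g \<alpha> \<in> max_ideal Q0" using g(2) by (rule Q0.M_add[rotated])
    then show False using aNM by simp
  qed
  have "(inv\<^bsub>Gal E F\<^esub> g) ` Q0 = Q0"
  \<comment> \<open>Were Q0 moved, \<alpha> would vanish at the translated place and g \<alpha> at
    Q0, whereas g \<alpha> is congruent to the unit \<alpha>^N.\<close>
  proof (rule ccontr)
    assume "(inv\<^bsub>Gal E F\<^esub> g) ` Q0 \<noteq> Q0"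
    then have "\<alpha> \<in> max_ideal ((inv\<^bsub>Gal E F\<^esub> g) ` Q0)" using a1 giQ g(1) by blast
    then have "g \<alpha> \<in> max_ideal (g ` (inv\<^bsub>Gal E F\<^esub> g) ` Q0)" using max_ideal_image[OF g(1) giQ[OF g(1)] \<alpha>(1)] by blast
    then show False using gback[OF g(1)] gnM by simp
  qed
  then have gQ0: "g ` Q0 = Q0" using gback[OF g(1)] by simp
  have gM: "g x \<in> max_ideal Q0 \<longleftrightarrow> x \<in> max_ideal Q0" if "x \<in> E" for x
    using max_ideal_image[OF g(1) Q0 that] gQ0 by simp
  have at0: "g x - x ^ N \<in> max_ideal Q0" if x: "x \<in> Q0" for x
  proof (cases "x \<in> max_ideal Q0")
    case True
    have "N > 0" unfolding N_def using sfk finite_subfield_power(3)[OF sfk(1,2) subfield_OmegaD(1)[OF sfk(1)]] by simp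
    then have "x ^ N = x * x ^ (N - 1)" by (cases N) auto
    then have "x ^ N \<in> max_ideal Q0" using Q0.M_mult[OF True Q0.Rc(7)[OF x]] by simp
    moreover have "g x \<in> max_ideal Q0" using True gM x Q0.RK by blast
    ultimately show ?thesis by (intro Q0.M_diff)
  next
    case False
    then obtain i where i: "x - \<gamma> ^ i \<in> max_ideal Q0" using \<gamma>(2) x by blast
    have "\<gamma> ^ i - \<alpha> ^ i \<in> max_ideal Q0" using Q0.cong_power[OF a0, of i] \<gamma>(1) Q0.M_diff_sym by blast
    then have xa: "x - \<alpha> ^ i \<in> max_ideal Q0" using Q0.M_diff_trans i by blast
    have xE: "x \<in> E" "\<alpha> ^ i \<in> E" using x Q0.RK \<alpha>(1) Ec by auto
    have "g (x - \<alpha> ^ i) \<in> max_ideal Q0" using gM[OF Ec(6)[OF xE]] xa by blast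
    then have 1: "g x - g \<alpha> ^ i \<in> max_ideal Q0" using g(1) xE \<alpha>(1) by (simp add: Gc)
    have "g \<alpha> - \<alpha> ^ N \<in> max_ideal Q0" using g(2) Q0.M_diff_sym by blast
    then have 2: "g \<alpha> ^ i - (\<alpha> ^ N) ^ i \<in> max_ideal Q0" by (intro Q0.cong_power Q0.Rc aQ0)
    have "\<alpha> ^ i - x \<in> max_ideal Q0" using xa Q0.M_diff_sym by blast
    then have 3: "(\<alpha> ^ i) ^ N - x ^ N \<in> max_ideal Q0" by (rule Q0.cong_power[OF _ x])
    have "(\<alpha> ^ N) ^ i = (\<alpha> ^ i) ^ N" by (simp add: power_mult[symmetric] mult.commute)
    then show ?thesis using Q0.M_diff_trans[OF Q0.M_diff_trans[OF 1 2]] 3 by simp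
  qed
  \<comment> \<open>The places above P are conjugate, and conjugation leaves g unchanged because the
    group is abelian.\<close>
  have "g x - x ^ N \<in> max_ideal Q" if Q: "Q \<in> places_above F E P" and x: "x \<in> Q" for Q x
  proof -
    obtain h where h: "h \<in> G" "h ` Q0 = Q" using transitive[OF Q0 Q] by blast
    then obtain z where z: "z \<in> Q0" "x = h z" using x by blast
    have zE: "z \<in> E" "g z \<in> E" "z ^ N \<in> E" using z Q0.RK Gc(1)[OF g(1)] Ec by auto
    have "h (g z - z ^ N) \<in> max_ideal Q" using max_ideal_image[OF h(1) Q0 Ec(6)[OF zE(2,3)]] at0[OF z(1)] h(2) by simp
    then show ?thesis using zE h(1) g(1) by (simp add: Gc z(2) commute)
  qed
  then show ?thesis using g(1) unfolding N_def by blast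
qed

text \<open>A higher ramification argument: the depth of u x - x is pushed up one step at a time.
  Unramifiedness supplies a uniformizer t in F, fixed by u. In x = x^N + t z the factor t gains one
  step, and the N-th power multiplies the depth by N \<ge> 2.\<close>

lemma inertia_trivial:
  assumes P: "P \<in> places F" "unramified_at F E P" and Q: "Q \<in> places_above F E P"
    and u: "u \<in> G" "\<And>x. x \<in> Q \<Longrightarrow> u x - x \<in> max_ideal Q"
  shows "u = \<one>\<^bsub>Gal E F\<^esub>"
proof -
  interpret P: dval_ring F P by (rule dvF[OF P(1)])
  interpret Q: dval_ring E Q using dvE Q by (auto simp: above_iff)
  define t where "t = P.t0"
  have t: "t \<in> F" "t \<noteq> 0" "ord_at P t = 1" unfolding t_def using P.t0_nz P.t0(1) P.RK P.ord_t0' by auto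
  have ot: "ord_at Q t = 1" by (rule unramified_uniformizer(1)[OF P t Q])
  have tE: "t \<in> E" using t(1) FE by auto
  define N where "N = Q.rcard"
  have N2: "N \<ge> 2" unfolding N_def by (rule Q.cong_rcard(3)[OF ffE Q.Rc(1)])
  have Nq: "N = card k ^ place_degree k Q" unfolding N_def by (rule Q.rcard_place_degree[OF ffE])
  have uQ: "u x \<in> Q" if "x \<in> Q" for x using Q.cong_R[OF u(2)[OF that] that] .
  have main: "\<forall>x\<in>Q. u x - x \<in> Q.V (int j + 1)" for j
  proof (induction j)
    case 0
    then show ?case using u(2) by (simp add: Q.V_1)
  next
    case (Suc j)
    show ?case
    proof
      fix x assume x: "x \<in> Q"
      define z where "z = (x - x ^ N) / t"
      have "x - x ^ N \<in> max_ideal Q" using Q.cong_rcard(1)[OF ffE x] Q.M_diff_sym unfolding N_def by blast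
      then have V: "x - x ^ N \<in> Q.V 1" by (simp add: Q.V_1)
      have xE: "x \<in> E" using x Q.RK by auto
      have "z \<in> Q"
      proof (cases "x - x ^ N = 0")
        case True
        then show ?thesis using Q.Rc(1) by (simp add: z_def)
      next
        case False
        have "x - x ^ N \<in> E" "t \<in> E" using xE Ec tE by auto
        then have "ord_at Q z = ord_at Q (x - x ^ N) - ord_at Q t" unfolding z_def using False t(2) by (intro Q.ord_div)
        then have "ord_at Q z \<ge> 0" using ot V False by (simp add: Q.V_def)
        moreover have "z \<in> E" "z \<noteq> 0" unfolding z_def using \<open>x - x ^ N \<in> E\<close> \<open>t \<in> E\<close> False t(2) Ec by auto
        ultimately show ?thesis using Q.R_iff by blast
      qed
      have zE: "z \<in> E" using \<open>z \<in> Q\<close> Q.RK by auto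
      have xz: "x = x ^ N + t * z" unfolding z_def using t(2) by simp
      define w where "w = u x - x"
      have w: "w \<in> Q.V (int j + 1)" unfolding w_def using Suc x by blast
      have "u x = u x ^ N + t * u z"
        by (subst xz) (use u(1) xE zE tE t(1) in \<open>simp add: Gc Ec G_fix\<close>)
      then have "u x - x = (u x ^ N - x ^ N) + t * (u z - z)" using xz by (simp add: algebra_simps)
      also have "u x ^ N = (x + w) ^ N" by (simp add: w_def)
      \<comment> \<open>N is a power of card k, so the mixed terms of the expansion vanish.\<close>
      also have "\<dots> = x ^ N + w ^ N" unfolding Nq by (rule frob_add[OF sfk(1,2)])
      finally have e: "u x - x = w ^ N + t * (u z - z)" by simp
      have "w ^ N \<in> Q.V (int N * (int j + 1))" by (rule Q.V_power[OF w])
      moreover have "int (Suc j) + 1 \<le> int N * (int j + 1)"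
        using mult_right_mono[of 2 "int N" "int j + 1"] N2 by simp
      ultimately have 1: "w ^ N \<in> Q.V (int (Suc j) + 1)" by (rule Q.V_mono)
      have "t \<in> Q.V 1" using ot tE by (simp add: Q.V_def)
      then have "t * (u z - z) \<in> Q.V (1 + (int j + 1))" using Suc \<open>z \<in> Q\<close> by (intro Q.V_mult) auto
      then have 2: "t * (u z - z) \<in> Q.V (int (Suc j) + 1)" by (simp add: algebra_simps)
      show "u x - x \<in> Q.V (int (Suc j) + 1)" unfolding e using 1 2 by (rule Q.V_add)
    qed
  qed
  have fix0: "u x = x" if x: "x \<in> Q" for x
  proof (rule ccontr)
    assume "u x \<noteq> x"
    \<comment> \<open>A nonzero element cannot have depth beyond its own order.\<close>
    moreover have "u x - x \<in> Q.V (int (nat (ord_at Q (u x - x))) + 1)" using main x by blast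
    ultimately show False by (simp add: Q.V_def split: if_splits)
  qed
  show ?thesis
  proof (rule G_ext[OF u(1)])
    fix x assume x: "x \<in> E"
    show "u x = \<one>\<^bsub>Gal E F\<^esub> x"
    proof (cases "x \<in> Q")
      case False
      then have "u (inverse x) = inverse x" using fix0 Q.tot x by blast
      then show ?thesis using u(1) x one_app by (simp add: Gc)
    qed (use fix0 x one_app in simp)
  qed simp
qed

text \<open>Both automorphisms preserve Q and induce the same map on residues, so the quotient u
  acts trivially modulo Q and falls under \<open>inertia_trivial\<close>.\<close>

lemma artin_unique:
  assumes P: "P \<in> places F" "unramified_at F E P" and Q: "Q \<in> places_above F E P"
    and s: "s \<in> G" "\<And>x. x \<in> Q \<Longrightarrow> s x - x ^ N \<in> max_ideal Q"
    and s': "s' \<in> G" "\<And>x. x \<in> Q \<Longrightarrow> s' x - x ^ N \<in> max_ideal Q"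
  shows "s = s'"
proof -
  interpret Q: dval_ring E Q using dvE Q by (auto simp: above_iff)
  have stab: "s ` Q = Q" if s: "s \<in> G" "\<And>x. x \<in> Q \<Longrightarrow> s x - x ^ N \<in> max_ideal Q" for s
  proof -
    have sub: "s ` Q \<subseteq> Q" using Q.cong_R[OF s(2) Q.Rc(7)] by blast
    interpret sQ: dval_ring E "s ` Q" using image_above[OF s(1) Q] dvE by (auto simp: above_iff)
    show ?thesis using sQ.R_maximal[of Q] Q.pl sub by blast
  qed
  define u where "u = inv\<^bsub>Gal E F\<^esub> s \<otimes>\<^bsub>Gal E F\<^esub> s'"
  have uG: "u \<in> G" unfolding u_def using s s' by simp
  have "u x - x \<in> max_ideal Q" if x: "x \<in> Q" for x
  proof -
    have xE: "x \<in> E" "u x \<in> E" using x Q.RK Gc(1)[OF uG] by auto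
    have "s (u x) = s' x" unfolding u_def using s s' xE by (simp add: G_mult_app inv_app Gc)
    moreover have "s' x - s x \<in> max_ideal Q" using Q.M_diff[OF s'(2)[OF x] s(2)[OF x]] by simp
    ultimately have "s (u x - x) \<in> max_ideal Q" using s xE by (simp add: Gc)
    then show ?thesis using max_ideal_image[OF s(1) Q, of "u x - x"] stab[OF s] xE Ec by simp
  qed
  then have "u = \<one>\<^bsub>Gal E F\<^esub>" using inertia_trivial[OF P Q uG] by blast
  then show ?thesis unfolding u_def using s s' by (metis Gr.inv_equality Gr.inv_inv Gr.inv_closed)
qed

lemma artin_symbol:
  assumes P: "P \<in> places F" "unramified_at F E P"
  shows "artin_symbol k F E P \<in> G"
    "Q \<in> places_above F E P \<Longrightarrow> x \<in> Q \<Longrightarrow> artin_symbol k F E P x - x ^ (card k ^ place_degree k P) \<in> max_ideal Q"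
proof -
  have "\<exists>!s. s \<in> G \<and> (\<forall>Q\<in>places_above F E P. \<forall>x\<in>Q. s x - x ^ (card k ^ place_degree k P) \<in> max_ideal Q)"
  proof (rule ex_ex1I)
    show "\<exists>s. s \<in> G \<and> (\<forall>Q\<in>places_above F E P. \<forall>x\<in>Q. s x - x ^ (card k ^ place_degree k P) \<in> max_ideal Q)"
      using artin_exists[OF P(1)] by blast
    obtain Q where "Q \<in> places_above F E P" using above_ex[OF P(1)] by blast
    then show "s = s'" if "s \<in> G \<and> (\<forall>Q\<in>places_above F E P. \<forall>x\<in>Q. s x - x ^ (card k ^ place_degree k P) \<in> max_ideal Q)"
      "s' \<in> G \<and> (\<forall>Q\<in>places_above F E P. \<forall>x\<in>Q. s' x - x ^ (card k ^ place_degree k P) \<in> max_ideal Q)" for s s'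
      using that by (intro artin_unique[OF P, of Q s _ s']) auto
  qed
  from theI'[OF this] show "artin_symbol k F E P \<in> G"
    "Q \<in> places_above F E P \<Longrightarrow> x \<in> Q \<Longrightarrow> artin_symbol k F E P x - x ^ (card k ^ place_degree k P) \<in> max_ideal Q"
    unfolding artin_symbol_def by blast+
qed

end

section \<open>Constant field extensions\<close>

lemma (in val_ring) algebraic_const:
  assumes k: "subfield k \<Omega>" "finite k" "k \<subseteq> K" and C: "subfield C \<Omega>" "C \<subseteq> K"
    and alg: "\<And>z. z \<in> C \<Longrightarrow> \<exists>p\<in>kpol k. p \<noteq> 0 \<and> poly p z = 0"
  shows "z \<in> C \<Longrightarrow> z \<in> M \<Longrightarrow> z = 0" "C \<subseteq> R"
proof -
  have kR: "k \<subseteq> R" by (rule const_in[OF k])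
  show 1: "z = 0" if z: "z \<in> C" "z \<in> M" for z
  proof (rule ccontr)
    assume z0: "z \<noteq> 0"
    have "\<not> (p \<in> kpol k \<and> p \<noteq> 0 \<and> poly p z = 0)" for p
    proof (induction p)
      case (pCons a p)
      show ?case
      proof
        assume p: "pCons a p \<in> kpol k \<and> pCons a p \<noteq> 0 \<and> poly (pCons a p) z = 0"
        have a: "a \<in> k" using kpolD[of "pCons a p" k 0] p by simp
        have pk: "p \<in> kpol k" unfolding kpol_def using kpolD[of "pCons a p" k "Suc _"] p by simp
        have "a = - (z * poly p z)" using p by (simp add: eq_neg_iff_add_eq_0)
        moreover have "poly p z \<in> R" using poly_in_subring[OF sr kpol_mono[OF pk kR] MR[OF z(2)]] .
        ultimately have "a \<in> M" using M_minus M_mult[OF z(2)] by simp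
        then have "a = 0" using const_in(2)[OF k a] by simp
        then have "poly p z = 0" "p \<noteq> 0" using p z0 by auto
        then show False using pCons pk by blast
      qed
    qed simp
    then show False using alg[OF z(1)] by blast
  qed
  show "C \<subseteq> R"
  proof
    fix z assume z: "z \<in> C"
    show "z \<in> R"
    proof (rule ccontr)
      assume n: "z \<notin> R"
      then have "inverse z \<in> M" using inv_M z C by auto
      then have "inverse z = 0" using 1 subfield_OmegaD(8)[OF C(1) z] by blast
      then show False using n Rc(1) by simp
    qed
  qed
qed

text \<open>As x is transcendental, its inverse is not in k[x], so Chevalley's argument applies to
  this subring.\<close>

lemma fun_field_ex_place:
  assumes "fun_field k (K :: 'a::field set)" shows "places K \<noteq> {}"
proof -
  obtain x N W where x: "subfield k \<Omega>" "subfield K \<Omega>" "k \<subseteq> K" "ff_gen k K x N W" using assms by (auto simp: fun_field_def)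
  note sk = subfield_imp_subring[OF x(1)]
  have xK: "x \<in> K" "\<And>p. p \<in> kpol k \<Longrightarrow> p \<noteq> 0 \<Longrightarrow> poly p x \<noteq> 0" using x(4) by (auto simp: ff_gen_def)
  have X: "[:0, 1:] \<in> kpol k" by (intro kpol_clos[OF sk] subfield_OmegaD[OF x(1)])
  then have x0: "x \<noteq> 0" using xK(2)[of "[:0, 1:]"] by auto
  have "inverse x \<notin> adjoin k x"
  proof
    assume "inverse x \<in> adjoin k x"
    then obtain p where p: "p \<in> kpol k" "inverse x = poly p x" by (auto simp: adjoin_def)
    define r where "r = pCons (-1) p"
    have "r \<in> kpol k" unfolding r_def by (intro kpol_clos[OF sk] p subfield_OmegaD[OF x(1)])
    moreover have "r \<noteq> 0" by (simp add: r_def)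
    moreover have "poly r x = 0" unfolding r_def using p(2)[symmetric] x0 by simp
    ultimately show False using xK(2) by blast
  qed
  then show ?thesis
    using ex_place_over_subring[OF x(2) adjoin_props(1)[OF sk] adjoin_props(4)[OF sk subfield_imp_subring[OF x(2)] x(3) xK(1)]
      adjoin_props(3)[OF sk] x0] by blast
qed

lemma subfield_Int:
  assumes "subfield A (\<Omega> :: 'a::field ring)" "subfield B (\<Omega> :: 'a ring)" shows "subfield (A \<inter> B) (\<Omega> :: 'a ring)"
  by (rule subfield_OmegaI) (auto simp: subfield_OmegaD[OF assms(1)] subfield_OmegaD[OF assms(2)])

lemma exact_const_field_props:
  assumes ff: "fun_field k (K :: 'a::field set)"
  defines "C \<equiv> exact_const_field k K"
  shows "subfield C \<Omega>" "finite C" "k \<subseteq> C" "C \<subseteq> K" "z \<in> C \<longleftrightarrow> z \<in> K \<and> (\<exists>p\<in>kpol k. p \<noteq> 0 \<and> poly p z = 0)"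
proof -
  interpret O: Ring.field "\<Omega> :: 'a ring" by (rule Omega_field)
  have k: "subfield k \<Omega>" "finite k" "k \<subseteq> K" "subfield K \<Omega>" using ff by (auto simp: fun_field_def)
  note sk = subfield_imp_subring[OF k(1)]
  have Ci: "z \<in> C \<longleftrightarrow> z \<in> K \<and> (\<exists>p\<in>kpol k. p \<noteq> 0 \<and> poly p z = 0)" for z
    unfolding C_def exact_const_field_def using algebraic_iff[OF sk, of z] by simp
  then show "z \<in> C \<longleftrightarrow> z \<in> K \<and> (\<exists>p\<in>kpol k. p \<noteq> 0 \<and> poly p z = 0)" .
  show CK: "C \<subseteq> K" using Ci by blast
  have sa: "subfield {x \<in> carrier \<Omega>. (O.algebraic over k) x} \<Omega>" by (rule O.subfield_of_algebraics[OF k(1)])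
  have Ci2: "z \<in> C \<longleftrightarrow> z \<in> K \<and> z \<in> {x \<in> carrier \<Omega>. (O.algebraic over k) x}" for z
    unfolding C_def exact_const_field_def by simp
  have "C = K \<inter> {x \<in> carrier \<Omega>. (O.algebraic over k) x}" using Ci2 by blast
  then show sC: "subfield C \<Omega>" using subfield_Int[OF k(4) sa] by simp
  show "k \<subseteq> C"
  proof
    fix c assume c: "c \<in> k"
    have "[:- c, 1:] \<in> kpol k" by (intro kpol_clos[OF sk] subfield_OmegaD[OF k(1)] c)
    then show "c \<in> C" unfolding Ci using c k(3) by (auto intro!: bexI[of _ "[:- c, 1:]"])
  qed
  \<comment> \<open>The constants inject into the residue field of any place, and that field is
    finite.\<close>
  obtain R where R: "R \<in> places K" using fun_field_ex_place[OF ff] by blast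
  interpret val_ring K R using k R by (simp add: val_ring_def)
  note ac = algebraic_const[OF k(1-3) sC CK, OF conjunct2[OF Ci[THEN iffD1]]]
  have "inj_on (residue R) C"
  proof (rule inj_onI)
    fix x y assume xy: "x \<in> C" "y \<in> C" "residue R x = residue R y"
    then have "x - y \<in> M" using residue_eq_iff ac(2) by blast
    then show "x = y" using ac(1)[of "x - y"] subfield_OmegaD(6)[OF sC] xy by auto
  qed
  moreover have "residue R ` C \<subseteq> carrier (residue_field R)" using ac(2) residue_carrier by blast
  then have "finite (residue R ` C)" using residue_finite[OF ff] finite_subset by blast
  ultimately show "finite C" using finite_imageD by blast
qed

lemma card_subfield_power:
  assumes C: "subfield C (\<Omega> :: 'a::field ring)" "finite C" and k: "subfield k \<Omega>" "k \<subseteq> C"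
  shows "\<exists>r>0. card C = card k ^ r"
proof -
  interpret O: Ring.field "\<Omega> :: 'a ring" by (rule Omega_field)
  interpret kk: Ring.field "sub C" using O.subfield_iff(2)[OF C(1)] .
  have "Ring.field (sub k)" using O.subfield_iff(2)[OF k(1)] .
  then have "subfield k (sub C)" by (intro kk.subfield_iff(1)) (use k in auto)
  then have "card (carrier (sub C)) = card k ^ kk.dim k (carrier (sub C))"
    by (rule kk.finite_dimension_of_finite(2)) (use C in auto)
  then have e: "card C = card k ^ kk.dim k C" by simp
  moreover have "kk.dim k C > 0" using e finite_subfield_power(3)[OF C subfield_OmegaD(1)[OF C(1)]] by (cases "kk.dim k C") auto
  ultimately show ?thesis by blast
qed

text \<open>The exponent is reduced to m' = m mod r. A generator of C has order q^r - 1, and this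
  divides q^m' - 1 only for m' = 0.\<close>

lemma power_fix_dvd:
  assumes C: "subfield C (\<Omega> :: 'a::field ring)" "finite C" and q: "card C = q ^ r" "q \<ge> 2"
    and fx: "\<And>c. c \<in> C \<Longrightarrow> c ^ (q ^ m) = c"
  shows "r dvd m"
proof -
  obtain \<gamma> where g: "\<gamma> \<in> C" "\<gamma> \<noteq> 0" "\<And>i. \<gamma> ^ i = 1 \<longleftrightarrow> (card C - 1) dvd i" using finite_subfield_generator[OF C] by blast
  have r0: "r > 0" using q(1) finite_subfield_power(3)[OF C subfield_OmegaD(1)[OF C(1)]] by (cases r) auto
  define m' where "m' = m mod r"
  have per: "\<gamma> ^ (q ^ (r * a + b)) = \<gamma> ^ (q ^ b)" for a b
  proof (induction a)
    case (Suc a)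
    have "\<gamma> ^ (q ^ (r * Suc a + b)) = (\<gamma> ^ (q ^ r)) ^ (q ^ (r * a + b))" by (simp add: power_add power_mult[symmetric] algebra_simps)
    also have "\<gamma> ^ (q ^ r) = \<gamma>" using finite_subfield_power(2)[OF C g(1)] q by simp
    finally show ?case using Suc by simp
  qed simp
  have "\<gamma> ^ (q ^ m') = \<gamma>" using fx[OF g(1)] per[of "m div r" m'] by (simp add: m'_def)
  moreover have "\<gamma> ^ (q ^ m') = \<gamma> * \<gamma> ^ (q ^ m' - 1)" using q(2) by (metis Suc_diff_1 pos2 order_less_le_trans power_Suc zero_less_power)
  ultimately have "\<gamma> ^ (q ^ m' - 1) = 1" using g(2) by simp
  then have d: "(q ^ r - 1) dvd (q ^ m' - 1)" using g(3) q(1) by simp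
  have "m' < r" using r0 by (simp add: m'_def)
  then have lt: "q ^ m' < q ^ r" using q(2) by (intro power_strict_increasing) auto
  have "m' = 0"
  proof (rule ccontr)
    assume "m' \<noteq> 0"
    then have "q ^ m' > 1" using q(2) by (intro one_less_power) auto
    then have "q ^ r - 1 \<le> q ^ m' - 1" using d by (intro dvd_imp_le) auto
    then show False using lt \<open>q ^ m' > 1\<close> by simp
  qed
  then show ?thesis by (auto simp: m'_def)
qed

text \<open>The iterates of Frobenius below d are distinct on the residue field, by
  \<open>residue_frobenius\<close>; this is applied to m mod d.\<close>

lemma (in val_ring) frob_period:
  assumes ff: "fun_field k K" and d: "rcard = card k ^ d" and x: "\<And>x. x \<in> R \<Longrightarrow> x ^ (card k ^ m) - x \<in> M"
  shows "d dvd m"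
proof -
  have k: "subfield k \<Omega>" "finite k" "k \<subseteq> K" using ff by (auto simp: fun_field_def)
  define q where "q = card k"
  have d0: "d > 0" by (rule rcard_exponent_pos[OF ff d])
  define m' where "m' = m mod d"
  have per: "x ^ (q ^ (d * a + b)) - x ^ (q ^ b) \<in> M" if "x \<in> R" for x a b
  proof (induction a)
    case (Suc a)
    have e: "x ^ (q ^ (d * Suc a + b)) = (x ^ (q ^ d)) ^ (q ^ (d * a + b))" by (simp add: power_add power_mult[symmetric] algebra_simps)
    have m: "(x ^ (q ^ d)) ^ (q ^ (d * a + b)) - x ^ (q ^ (d * a + b)) \<in> M"
      using cong_power[OF cong_rcard(1)[OF ff that] that] d by (simp add: q_def)
    show ?case unfolding e by (rule M_diff_trans[OF m Suc])
  qed (simp add: M_zero)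
  have m': "x ^ (q ^ m') - x \<in> M" if "x \<in> R" for x
  proof -
    have "x ^ (q ^ m') - x ^ (q ^ m) \<in> M" using per[OF that, of "m div d" m'] M_diff_sym by (simp add: m'_def)
    then show ?thesis using x[OF that] M_diff_trans unfolding q_def by blast
  qed
  note fr = residue_frobenius[OF ff k d]
  have "restrict (\<lambda>a. a [^]\<^bsub>residue_field R\<^esub> (card k ^ m')) (carrier (residue_field R)) =
    restrict (\<lambda>a. a [^]\<^bsub>residue_field R\<^esub> (card k ^ 0)) (carrier (residue_field R))"
  proof (rule restrict_ext)
    fix a assume "a \<in> carrier (residue_field R)"
    then obtain y where y: "y \<in> R" "a = residue R y" by (auto simp: residue_carrier)
    show "a [^]\<^bsub>residue_field R\<^esub> (card k ^ m') = a [^]\<^bsub>residue_field R\<^esub> (card k ^ 0)"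
      unfolding y(2) residue_pow[OF y(1)] using m'[OF y(1)] y(1) Rc residue_eq_iff by (auto simp: q_def)
  qed
  moreover have "m' \<in> {..<d}" "0 \<in> {..<d}" using d0 by (auto simp: m'_def)
  ultimately have "m' = 0" using fr(2) unfolding inj_on_def by blast
  then show ?thesis by (auto simp: m'_def)
qed

text \<open>An automorphism preserving R and fixing k descends to the residue field, where every
  automorphism over k is a power of Frobenius.\<close>

lemma (in val_ring) stabilizer_frobenius:
  assumes ff: "fun_field k K" and \<phi>: "aut_on K \<phi>" "\<phi> ` R = R" "\<And>c. c \<in> k \<Longrightarrow> \<phi> c = c"
  shows "\<exists>b. \<forall>x\<in>R. \<phi> x - x ^ (card k ^ b) \<in> M"
proof -
  have k: "subfield k \<Omega>" "finite k" "k \<subseteq> K" using ff by (auto simp: fun_field_def)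
  interpret rf: Ring.field "residue_field R" by (rule residue_field_field)
  note pc = aut_onD[OF \<phi>(1) sfK]
  have im: "\<phi> x \<in> M \<longleftrightarrow> x \<in> M" if "x \<in> K" for x using image_place(4)[OF \<phi>(1) sfK pl that] \<phi>(2) by simp
  have pR: "\<phi> x \<in> R" if "x \<in> R" for x using \<phi>(2) that by blast
  have cong: "residue R (\<phi> x) = residue R (\<phi> y)" if "x \<in> R" "y \<in> R" "residue R x = residue R y" for x y
  proof -
    have xy: "x \<in> K" "y \<in> K" "x - y \<in> M" using that RK residue_eq_iff by auto
    then have "\<phi> (x - y) \<in> M" using im[OF Kc(6)[OF xy(1,2)]] by blast
    then show ?thesis using residue_eq_iff[OF pR[OF that(1)] pR[OF that(2)]] pc(7)[OF xy(1,2)] by simp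
  qed
  define h where "h = restrict (\<lambda>a. residue R (\<phi> (SOME x. x \<in> R \<and> residue R x = a))) (carrier (residue_field R))"
  have h: "h (residue R x) = residue R (\<phi> x)" if x: "x \<in> R" for x
  proof -
    have "\<exists>y. y \<in> R \<and> residue R y = residue R x" using x by blast
    note y = someI_ex[OF this]
    have "h (residue R x) = residue R (\<phi> (SOME y. y \<in> R \<and> residue R y = residue R x))"
      unfolding h_def using residue_ops(1)[OF x x] by simp
    also have "\<dots> = residue R (\<phi> x)" by (rule cong) (use y x in blast)+
    finally show ?thesis .
  qed
  have fin: "finite (carrier (residue_field R))" by (rule residue_finite[OF ff])
  have hom: "h \<in> ring_hom (residue_field R) (residue_field R)"
  proof (rule ring_hom_memI)
    fix a b assume "a \<in> carrier (residue_field R)" "b \<in> carrier (residue_field R)"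
    then obtain x y where xy: "x \<in> R" "y \<in> R" "a = residue R x" "b = residue R y" by (auto simp: residue_carrier)
    show "h a \<in> carrier (residue_field R)" using xy h residue_ops(1) pR by auto
    show "h (a \<otimes>\<^bsub>residue_field R\<^esub> b) = h a \<otimes>\<^bsub>residue_field R\<^esub> h b"
      unfolding xy using xy(1,2) pR by (simp add: residue_ops(2) h Rc pc RK)
    show "h (a \<oplus>\<^bsub>residue_field R\<^esub> b) = h a \<oplus>\<^bsub>residue_field R\<^esub> h b"
      unfolding xy using xy(1,2) pR by (simp add: residue_ops(3) h Rc pc RK)
  next
    show "h \<one>\<^bsub>residue_field R\<^esub> = \<one>\<^bsub>residue_field R\<^esub>"
      unfolding residue_ops(4)[OF Rc(1,1)] using h Rc pc by simp
  qed
  interpret hh: ring_hom_ring "residue_field R" "residue_field R" h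
    by (rule ring_hom_ringI2[OF rf.ring_axioms rf.ring_axioms hom])
  have "inj_on h (carrier (residue_field R))"
    by (rule non_trivial_field_hom_is_inj[OF hom rf.field_axioms rf.field_axioms])
  moreover have "h ` carrier (residue_field R) \<subseteq> carrier (residue_field R)" using hh.hom_closed by auto
  ultimately have "bij_betw h (carrier (residue_field R)) (carrier (residue_field R))"
    unfolding bij_betw_def using endo_inj_surj[OF fin] by blast
  moreover have "h (residue R c) = residue R c" if c: "c \<in> k" for c using h \<phi>(3)[OF c] const_in(1)[OF k] c by auto
  ultimately have "h \<in> carrier (gal_group (residue_field R) (residue R ` k))"
    using hom by (auto simp: gal_group_def Bij_def h_def)
  then obtain b where b: "h = restrict (\<lambda>a. a [^]\<^bsub>residue_field R\<^esub> (card k ^ b)) (carrier (residue_field R))"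
    using residue_frobenius(1)[OF ff k rcard_place_degree[OF ff]] by blast
  have "\<phi> x - x ^ (card k ^ b) \<in> M" if x: "x \<in> R" for x
  proof -
    have "residue R (\<phi> x) = residue R (x ^ (card k ^ b))"
      using h[OF x] residue_ops(1)[OF x x] residue_pow[OF x] unfolding b by simp
    then show ?thesis using residue_eq_iff pR x Rc by auto
  qed
  then show ?thesis by blast
qed

lemma aut_on_funpow: "aut_on K \<phi> \<Longrightarrow> subfield K (\<Omega> :: 'a::field ring) \<Longrightarrow> aut_on K (\<phi> ^^ i)"
proof (induction i)
  case 0 then show ?case by (auto simp: aut_on_def bij_betw_def inj_on_def subfield_OmegaD)
next
  case (Suc i)
  have "bij_betw (\<phi> \<circ> \<phi> ^^ i) K K" using Suc by (auto simp: aut_on_def intro: bij_betw_trans)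
  moreover note a = aut_onD(1-3)[OF Suc(2,3)] aut_onD(1-3)[OF Suc(1)[OF Suc(2,3)] Suc(3)]
  ultimately show ?case unfolding aut_on_def by (simp add: a)
qed

section \<open>The Galois group acting on a constant field extension L of F\<close>

locale const_ext = abel_places +
  fixes L
  assumes ffL: "fun_field k L" and FL: "F \<subseteq> L" and LE: "L \<subseteq> E"
    and ecF: "exact_const_field k F = k" and cext: "const_field_extension k F L"
begin

abbreviation "C \<equiv> exact_const_field k L"
definition "q = card k"
text \<open>The degree of C over k, obtained from cardinalities; the r-th power of the Frobenius is
  trivial on L.\<close>

definition "r = (SOME r. r > 0 \<and> card C = q ^ r)"

lemma sfL: "subfield L \<Omega>" using ffL by (auto simp: fun_field_def)
lemmas Lc = subfield_OmegaD[OF sfL]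
lemmas Cp = exact_const_field_props[OF ffL]
lemmas Cc = subfield_OmegaD[OF Cp(1)]
lemma LE': "x \<in> L \<Longrightarrow> x \<in> E" using LE by auto
lemma CL: "x \<in> C \<Longrightarrow> x \<in> L" using Cp(4) by auto

lemma q2: "q \<ge> 2" unfolding q_def using finite_subfield_power(3)[OF sfk(1,2) subfield_OmegaD(1)[OF sfk(1)]] .

lemma r: "r > 0" "card C = q ^ r"
  using someI_ex[OF card_subfield_power[OF Cp(1,2) sfk(1) Cp(3)]] unfolding r_def q_def by auto

lemma C_iff: "z \<in> C \<longleftrightarrow> z ^ (q ^ r) = z"
  using finite_subfield_roots[OF Cp(1,2)] r(2) by auto

lemma k_iff: "z \<in> k \<longleftrightarrow> z ^ q = z"
  using finite_subfield_roots[OF sfk(1,2)] unfolding q_def by auto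

lemma C_F: "z \<in> C \<Longrightarrow> z \<in> F \<Longrightarrow> z \<in> k"
  using ecF Cp(5) exact_const_field_props(5)[OF ffF] by auto

lemma q_add: "(x + y :: 'a) ^ (q ^ m) = x ^ (q ^ m) + y ^ (q ^ m)"
  "(\<Sum>i\<in>I. f i :: 'a) ^ (q ^ m) = (\<Sum>i\<in>I. f i ^ (q ^ m))"
  unfolding q_def using frob_add[OF sfk(1,2)] by blast+

text \<open>L is generated by F and constants, so a property that cuts out a subfield needs to be
  checked only on F and on C.\<close>

lemma L_induct:
  assumes S: "subfield S \<Omega>" "F \<subseteq> S" "C \<subseteq> S" and x: "x \<in> L" shows "x \<in> S"
proof -
  interpret O: Ring.field "\<Omega> :: 'a ring" by (rule Omega_field)
  obtain l where l: "subfield l \<Omega>" "\<forall>z\<in>l. (O.algebraic over k) z" "L = generate_field \<Omega> (F \<union> l)"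
    using cext by (auto simp: const_field_extension_def)
  have "l \<subseteq> L" unfolding l(3) using O.generate_fieldE(2)[of "F \<union> l"] by auto
  then have "l \<subseteq> C" using l(2) by (auto simp: exact_const_field_def)
  then have "generate_field \<Omega> (F \<union> l) \<subseteq> S" using S by (intro O.generate_field_min_subfield1) auto
  then show ?thesis using x l(3) by blast
qed

lemma G_C: "g \<in> G \<Longrightarrow> z \<in> C \<Longrightarrow> g z \<in> C"
  unfolding C_iff using Gc(8)[of g z "q ^ r"] C_iff CL LE' by metis

lemma G_L: "g \<in> G \<Longrightarrow> x \<in> L \<Longrightarrow> g x \<in> L"
proof -
  assume g: "g \<in> G" and x: "x \<in> L"
  have "x \<in> {x \<in> L. g x \<in> L}"
  proof (rule L_induct[OF _ _ _ x])
    show "subfield {x \<in> L. g x \<in> L} \<Omega>"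
      by (rule subfield_OmegaI) (use g in \<open>auto simp: Lc Gc LE'\<close>)
  qed (use FL G_fix[OF g] CL G_C[OF g] in auto)
  then show ?thesis by simp
qed

lemma G_agree:
  assumes g: "g \<in> G" and h: "aut_on L h" "\<And>x. x \<in> F \<Longrightarrow> h x = x" "\<And>z. z \<in> C \<Longrightarrow> h z = g z" and x: "x \<in> L"
  shows "h x = g x"
proof -
  note hc = aut_onD[OF h(1) sfL]
  have "x \<in> {x \<in> L. h x = g x}"
  proof (rule L_induct[OF _ _ _ x])
    show "subfield {x \<in> L. h x = g x} \<Omega>"
      by (rule subfield_OmegaI) (use g in \<open>auto simp: Lc Gc LE' hc\<close>)
  qed (use FL G_fix[OF g] CL h in auto)
  then show ?thesis by simp
qed

lemma G_autL: "g \<in> G \<Longrightarrow> aut_on L g"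
proof -
  assume g: "g \<in> G"
  have "L \<subseteq> g ` L"
  proof
    fix x assume x: "x \<in> L"
    have "x = g ((inv\<^bsub>Gal E F\<^esub> g) x)" using inv_app(2)[OF g] x LE' by simp
    then show "x \<in> g ` L" using G_L[of "inv\<^bsub>Gal E F\<^esub> g" x] g x by blast
  qed
  then have "bij_betw g L L" using g G_L by (auto simp: bij_betw_def inj_on_def Gc LE')
  then show ?thesis using g by (auto simp: aut_on_def Gc LE')
qed

text \<open>The orbit polynomial of a generator \<gamma> of C has coefficients in both C and F,
  hence in k because k is the exact constant field of F. So \<gamma>^q is again a root, that is, a
  conjugate of \<gamma>.\<close>

lemma ex_frobenius: "\<exists>\<sigma>\<in>G. \<forall>z\<in>C. \<sigma> z = z ^ q"
proof -
  obtain \<gamma> where g: "\<gamma> \<in> C" "\<gamma> \<noteq> 0" "\<And>x. x \<in> C \<Longrightarrow> x \<noteq> 0 \<Longrightarrow> \<exists>i. x = \<gamma> ^ i" using finite_subfield_generator[OF Cp(1,2)] by blast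
  have gE: "\<gamma> \<in> E" using g CL LE' by auto
  note sC = subfield_imp_subring[OF Cp(1)]
  define p where "p = orbit_poly \<gamma>"
  have "[:- h \<gamma>, 1:] \<in> kpol C" if "h \<in> G" for h
    by (rule kpol_clos(8)[OF sC Cc(3)[OF G_C[OF that g(1)]] kpol_clos(8)[OF sC Cc(2) kpol_clos(1)[OF sC]]])
  then have "p \<in> kpol C" unfolding p_def orbit_poly_def by (intro kpol_sum[OF sC])
  moreover have "p \<in> kpol F" unfolding p_def by (rule orbit_poly_F[OF gE])
  ultimately have pk: "coeff p i ^ q = coeff p i" for i using C_F kpolD k_iff by metis
  have "poly p (\<gamma> ^ q) = (\<Sum>i\<le>degree p. (coeff p i * \<gamma> ^ i) ^ q)"
    unfolding poly_altdef by (intro sum.cong) (auto simp: power_mult_distrib pk power_mult[symmetric] mult.commute)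
  also have "\<dots> = (poly p \<gamma>) ^ q" unfolding poly_altdef by (simp add: q_add(2)[where m = 1, simplified])
  also have "\<dots> = 0" using orbit_root[OF gE] q2 by (simp add: p_def)
  finally have "(\<Prod>h\<in>G. \<gamma> ^ q - h \<gamma>) = 0" unfolding p_def poly_orbit .
  then obtain \<sigma> where s: "\<sigma> \<in> G" "\<gamma> ^ q = \<sigma> \<gamma>" using finite_G by auto
  have "\<sigma> z = z ^ q" if z: "z \<in> C" for z
  proof (cases "z = 0")
    case False
    then obtain i where "z = \<gamma> ^ i" using g z by blast
    then show ?thesis using s gE by (simp add: Gc s(2)[symmetric] power_mult[symmetric] mult.commute)
  qed (use q2 s in \<open>simp add: Gc\<close>)
  then show ?thesis using s(1) by blast
qed

text \<open>A fixed extension of the Frobenius of L to E, arbitrary beyond its action on C; it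
  becomes the witness in the theorem.\<close>

definition "\<sigma> = (SOME s. s \<in> G \<and> (\<forall>z\<in>C. s z = z ^ q))"

lemma \<sigma>: "\<sigma> \<in> G" "z \<in> C \<Longrightarrow> \<sigma> z = z ^ q"
proof -
  have "\<exists>s. s \<in> G \<and> (\<forall>z\<in>C. s z = z ^ q)" using ex_frobenius by blast
  from someI_ex[OF this, folded \<sigma>_def] show "\<sigma> \<in> G" "z \<in> C \<Longrightarrow> \<sigma> z = z ^ q" by auto
qed

lemma \<sigma>_pow: "z \<in> C \<Longrightarrow> (\<sigma> ^^ i) z = z ^ (q ^ i)"
proof (induction i)
  case (Suc i)
  have "z ^ (q ^ i) \<in> C" using Suc by (intro Cc)
  then show ?case using Suc \<sigma> by (simp add: power_mult[symmetric] mult.commute)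
qed simp

lemma \<sigma>_aut: "aut_on L (\<sigma> ^^ i)" "aut_on E (\<sigma> ^^ i)"
  using aut_on_funpow[OF G_autL[OF \<sigma>(1)] sfL] aut_on_funpow[OF G_aut[OF \<sigma>(1)] sfE] by auto

lemma \<sigma>_F: "x \<in> F \<Longrightarrow> (\<sigma> ^^ i) x = x"
  by (induction i) (auto simp: G_fix[OF \<sigma>(1)])

lemma \<sigma>_L: "x \<in> L \<Longrightarrow> (\<sigma> ^^ i) x \<in> L"
  using aut_onD(1)[OF \<sigma>_aut(1) sfL] by blast

lemma \<sigma>_r: "x \<in> L \<Longrightarrow> (\<sigma> ^^ r) x = x"
proof -
  assume x: "x \<in> L"
  have "(\<sigma> ^^ r) x = \<one>\<^bsub>Gal E F\<^esub> x"
    by (rule G_agree[OF Gr.one_closed \<sigma>_aut(1) \<sigma>_F _ x]) (use \<sigma>_pow C_iff one_app CL LE' in auto)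
  then show ?thesis using x one_app LE' by simp
qed

lemma \<sigma>_mod: "x \<in> L \<Longrightarrow> (\<sigma> ^^ (r * a + b)) x = (\<sigma> ^^ b) x"
proof (induction a)
  case (Suc a)
  have "(\<sigma> ^^ (r * Suc a + b)) x = (\<sigma> ^^ r) ((\<sigma> ^^ (r * a + b)) x)" by (simp add: funpow_add add.assoc)
  then show ?case using Suc \<sigma>_r \<sigma>_L by simp
qed simp

text \<open>The product of X - \<gamma>^(q^i) over i < r is invariant under the q-th power on
  coefficients, so it lies in k[X] and every conjugate of the generator \<gamma> is one of its
  roots.\<close>

lemma G_power: "g \<in> G \<Longrightarrow> \<exists>i<r. \<forall>x\<in>L. g x = (\<sigma> ^^ i) x"
proof -
  assume gG: "g \<in> G"
  obtain \<gamma> where g: "\<gamma> \<in> C" "\<gamma> \<noteq> 0" "\<And>x. x \<in> C \<Longrightarrow> x \<noteq> 0 \<Longrightarrow> \<exists>i. x = \<gamma> ^ i" using finite_subfield_generator[OF Cp(1,2)] by blast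
  have gE: "\<gamma> \<in> E" using g CL LE' by auto
  note sC = subfield_imp_subring[OF Cp(1)]
  have fr: "aut_on C (\<lambda>z. z ^ q)"
  proof -
    have "inj_on (\<lambda>z. z ^ q) C"
    proof (rule inj_onI)
      fix x y assume xy: "x \<in> C" "y \<in> C" "x ^ q = y ^ q"
      have "(x ^ q) ^ (q ^ (r - 1)) = x" if "x \<in> C" for x
        using that r(1) C_iff[of x] by (simp add: power_mult[symmetric] power_Suc[symmetric] del: power_Suc)
      then show "x = y" using xy by metis
    qed
    moreover have "(\<lambda>z. z ^ q) ` C \<subseteq> C" using Cc by auto
    ultimately have "bij_betw (\<lambda>z. z ^ q) C C" unfolding bij_betw_def using endo_inj_surj[OF Cp(2)] by blast
    then show ?thesis using q_add(1)[where m = 1] by (auto simp: aut_on_def power_mult_distrib)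
  qed
  define p where "p = (\<Prod>i<r. [:- (\<gamma> ^ (q ^ i)), 1:])"
  have lin: "[:- (\<gamma> ^ (q ^ i)), 1:] \<in> kpol C" for i by (intro kpol_clos(1,8)[OF sC] Cc(2) Cc(3) Cc(7) g(1))
  have pC: "p \<in> kpol C" unfolding p_def by (intro kpol_sum[OF sC] lin)
  have "map_poly (\<lambda>z. z ^ q) p = (\<Prod>i<r. [:- (\<gamma> ^ (q ^ Suc i)), 1:])"
  proof -
    have "map_poly (\<lambda>z. z ^ q) [:- (\<gamma> ^ (q ^ i)), 1:] = [:- (\<gamma> ^ (q ^ Suc i)), 1:]" for i
    proof -
      have "(- (\<gamma> ^ (q ^ i))) ^ q = - ((\<gamma> ^ (q ^ i)) ^ q)"
        using aut_onD(6)[OF fr Cp(1), of "\<gamma> ^ (q ^ i)"] g Cc by simp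
      then show ?thesis using q2 by (simp add: map_poly_pCons power_mult[symmetric] mult.commute)
    qed
    then show ?thesis unfolding p_def by (subst map_poly_aut_prod[OF fr Cp(1) lin]) simp
  qed
  \<comment> \<open>The index shift is cyclic because \<gamma>^(q^r) = \<gamma>; cancelling the
    common factor X - \<gamma> compares the two products.\<close>
  also have "\<dots> = p"
  proof -
    have "(\<Prod>i<Suc r. [:- (\<gamma> ^ (q ^ i)), 1:]) = p * [:- (\<gamma> ^ (q ^ r)), 1:]" by (simp add: p_def mult.commute)
    moreover have "(\<Prod>i<Suc r. [:- (\<gamma> ^ (q ^ i)), 1:]) = [:- (\<gamma> ^ (q ^ 0)), 1:] * (\<Prod>i<r. [:- (\<gamma> ^ (q ^ Suc i)), 1:])"
      by (rule prod.lessThan_Suc_shift)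
    moreover have "\<gamma> ^ (q ^ r) = \<gamma>" using C_iff g by blast
    ultimately have "[:- \<gamma>, 1:] * (\<Prod>i<r. [:- (\<gamma> ^ (q ^ Suc i)), 1:]) = [:- \<gamma>, 1:] * p" by (simp add: mult.commute)
    moreover have ne: "[:- \<gamma>, 1:] \<noteq> 0" by simp
    ultimately show ?thesis using mult_left_cancel[OF ne] by blast
  qed
  finally have mp: "map_poly (\<lambda>z. z ^ q) p = p" .
  have "coeff p i ^ q = coeff p i" for i
  proof -
    have "(coeff p i) ^ q = coeff (map_poly (\<lambda>z. z ^ q) p) i" using q2 by (simp add: coeff_map_poly)
    then show ?thesis using mp by simp
  qed
  then have "p \<in> kpol k" using k_iff by (simp add: kpol_def)
  then have pF: "p \<in> kpol F" using kpol_mono sfk(3) by blast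
  have "poly p \<gamma> = 0" unfolding p_def poly_prod using r(1) by (auto intro!: prod_zero bexI[of _ 0])
  then have "poly p (g \<gamma>) = 0"
    using aut_on_poly[OF G_aut[OF gG] sfE _ FE pF gE] G_fix[OF gG] Gc(4)[OF gG] by simp
  then obtain i where i: "i < r" "g \<gamma> = \<gamma> ^ (q ^ i)" unfolding p_def poly_prod by auto
  have "(\<sigma> ^^ i) x = g x" if x: "x \<in> L" for x
  proof (rule G_agree[OF gG \<sigma>_aut(1) \<sigma>_F _ x])
    fix z assume z: "z \<in> C"
    show "(\<sigma> ^^ i) z = g z"
    proof (cases "z = 0")
      case False
      then obtain j where "z = \<gamma> ^ j" using g z by blast
      then show ?thesis using \<sigma>_pow[OF z] gG gE i by (simp add: Gc power_mult[symmetric] mult.commute)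
    qed (use gG aut_onD(4)[OF \<sigma>_aut(1) sfL] in \<open>simp add: Gc\<close>)
  qed auto
  then show ?thesis using i(1) by auto
qed

lemma fix_L: "x \<in> L \<Longrightarrow> \<sigma> x = x \<Longrightarrow> x \<in> F"
proof (rule fixF)
  assume x: "x \<in> L" "\<sigma> x = x"
  then show "x \<in> E" using LE' by blast
  fix g assume "g \<in> G"
  then obtain i where "g x = (\<sigma> ^^ i) x" using G_power x by blast
  moreover have "(\<sigma> ^^ i) x = x" by (induction i) (auto simp: x)
  ultimately show "g x = x" by simp
qed

lemma frobenius_aut_eq: "x \<in> L \<Longrightarrow> frobenius_aut k F L x = \<sigma> x"
proof -
  assume x: "x \<in> L"
  have "frobenius_aut k F L = restrict \<sigma> L"
    unfolding frobenius_aut_def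
  proof (rule the_equality)
    have "bij_betw (restrict \<sigma> L) L L \<longleftrightarrow> bij_betw \<sigma> L L" by (rule bij_betw_cong) simp
    then have "aut_on L (restrict \<sigma> L)" using G_autL[OF \<sigma>(1)] Lc by (auto simp: aut_on_def)
    then show "restrict \<sigma> L \<in> carrier (Gal L F) \<and> (\<forall>x\<in>C. restrict \<sigma> L x = x ^ card k)"
      unfolding gal_carrier_iff[OF sfL] using FL \<sigma> CL by (auto simp: G_fix q_def)
  next
    fix h assume h: "h \<in> carrier (Gal L F) \<and> (\<forall>x\<in>C. h x = x ^ card k)"
    then have h': "h \<in> extensional L" "aut_on L h" "\<And>x. x \<in> F \<Longrightarrow> h x = x" "\<And>z. z \<in> C \<Longrightarrow> h z = \<sigma> z"
      unfolding gal_carrier_iff[OF sfL] using \<sigma> by (auto simp: q_def)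
    show "h = restrict \<sigma> L"
      by (rule extensionalityI[OF h'(1) restrict_extensional]) (simp add: G_agree[OF \<sigma>(1) h'(2-4)])
  qed
  then show ?thesis using x by simp
qed

section \<open>Places of L above a place of F\<close>

lemma algL: "z \<in> L \<Longrightarrow> \<exists>p\<in>kpol F. p \<noteq> 0 \<and> poly p z = 0"
  using algebraic_over_F LE' by blast

lemma algEL: "z \<in> E \<Longrightarrow> \<exists>p\<in>kpol L. p \<noteq> 0 \<and> poly p z = 0"
  using algebraic_over_F kpol_mono[OF _ FL] by blast

lemma dvL: "R \<in> places L \<Longrightarrow> dval_ring L R" by (rule place_dval_ring[OF ffL])

lemma restrict_EL: "Q \<in> places E \<Longrightarrow> Q \<inter> L \<in> places L"
  "Q \<in> places E \<Longrightarrow> x \<in> L \<Longrightarrow> x \<in> max_ideal Q \<longleftrightarrow> x \<in> max_ideal (Q \<inter> L)"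
  using place_restrict[OF sfE sfL LE algEL] by auto

lemma restrict_LF: "Q \<in> places L \<Longrightarrow> Q \<inter> F \<in> places F"
  "Q \<in> places L \<Longrightarrow> x \<in> F \<Longrightarrow> x \<in> max_ideal Q \<longleftrightarrow> x \<in> max_ideal (Q \<inter> F)"
  using place_restrict[OF sfL sfF FL algL] by auto

lemma aboveL_iff: "R \<in> places_above F L P \<longleftrightarrow> R \<in> places L \<and> R \<inter> F = P"
  by (auto simp: places_above_def)

lemma above_EL: "Q \<in> places_above F E P \<Longrightarrow> Q \<inter> L \<in> places_above F L P"
  using restrict_EL(1)[of Q] FL by (auto simp: above_iff aboveL_iff)

lemma ex_above_EL: "R \<in> places_above F L P \<Longrightarrow> \<exists>Q\<in>places_above F E P. Q \<inter> L = R"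
  using ex_place_above[OF ffL sfE LE algEL, of R] FL by (auto simp: above_iff aboveL_iff places_above_def)

lemma finite_aboveL: "finite (places_above F L P)"
proof (rule finite_subset)
  show "places_above F L P \<subseteq> (\<lambda>Q. Q \<inter> L) ` places_above F E P" using ex_above_EL by blast
qed (use finite_above in auto)

lemma subL: "R \<in> places_above F L P \<Longrightarrow> R \<subseteq> L"
  by (auto simp: aboveL_iff places_def)

lemma imageL: "R \<in> places_above F L P \<Longrightarrow> (\<sigma> ^^ i) ` R \<in> places_above F L P"
proof -
  assume R: "R \<in> places_above F L P"
  have "(\<sigma> ^^ i) ` R \<in> places L" using image_place[OF \<sigma>_aut(1) sfL] R by (auto simp: aboveL_iff)
  moreover have "x \<in> (\<sigma> ^^ i) ` R \<longleftrightarrow> x \<in> R" if "x \<in> F" for x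
    using image_place(3)[OF \<sigma>_aut(1) sfL, of R x i] R that \<sigma>_F[OF that] FL by (auto simp: aboveL_iff)
  ultimately show ?thesis using R by (auto simp: aboveL_iff)
qed

lemma max_imageL: "R \<in> places_above F L P \<Longrightarrow> x \<in> L \<Longrightarrow> (\<sigma> ^^ i) x \<in> max_ideal ((\<sigma> ^^ i) ` R) \<longleftrightarrow> x \<in> max_ideal R"
  using image_place(4)[OF \<sigma>_aut(1) sfL] by (auto simp: aboveL_iff)

text \<open>Transitivity is inherited from E: a Galois element moving a place above R1 to one above
  R2 is a power of \<sigma> on L. Only an inclusion is shown; maximality of the rings gives
  equality.\<close>

lemma transitiveL:
  assumes "R1 \<in> places_above F L P" "R2 \<in> places_above F L P"
  shows "\<exists>i. (\<sigma> ^^ i) ` R1 = R2"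
proof -
  obtain Q1 Q2 where Q: "Q1 \<in> places_above F E P" "Q1 \<inter> L = R1" "Q2 \<in> places_above F E P" "Q2 \<inter> L = R2"
    using ex_above_EL assms by metis
  obtain g where g: "g \<in> G" "g ` Q1 = Q2" using transitive[OF Q(1,3)] by blast
  obtain i where i: "\<And>x. x \<in> L \<Longrightarrow> g x = (\<sigma> ^^ i) x" using G_power[OF g(1)] by blast
  have "(\<sigma> ^^ i) ` R1 \<subseteq> R2"
  proof
    fix y assume "y \<in> (\<sigma> ^^ i) ` R1"
    then obtain x where x: "x \<in> R1" "y = (\<sigma> ^^ i) x" by blast
    then have "y = g x" "y \<in> L" using i \<sigma>_L subL[OF assms(1)] by auto
    then show "y \<in> R2" using g(2) Q x by blast
  qed
  moreover have "dval_ring L ((\<sigma> ^^ i) ` R1)" using imageL[OF assms(1)] dvL by (auto simp: aboveL_iff)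
  ultimately show ?thesis using dval_ring.R_maximal[of L "(\<sigma> ^^ i) ` R1" R2] assms(2) by (auto simp: aboveL_iff)
qed

end

lemma (in val_ring) cong_rcard_power:
  assumes ff: "fun_field k K" and x: "x \<in> R" shows "x ^ (rcard ^ j) - x \<in> M"
proof (induction j)
  case (Suc j)
  have e: "x ^ (rcard ^ Suc j) = (x ^ rcard) ^ (rcard ^ j)" by (simp add: power_mult[symmetric])
  show ?case unfolding e
    by (rule M_diff_trans[OF cong_power[OF cong_rcard(1)[OF ff x] x] Suc])
qed (simp add: M_zero)

context const_ext
begin

abbreviation "A P \<equiv> places_above F L P"

section \<open>Coordinates of integral elements with respect to the constants\<close>

lemma of_nat_card_C: "(of_nat (card C) :: 'a) = 0"
proof -
  obtain s where s: "card C = CHAR('a) ^ s" using finite_subfield_card(2)[OF Cp(1,2)] by blast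
  moreover have "s \<noteq> 0" using s finite_subfield_power(3)[OF Cp(1,2) Cc(1)] by (cases s) auto
  ultimately show ?thesis by (simp add: of_nat_power zero_power)
qed

text \<open>Orthogonality: scaling the variable by a generator multiplies the sum by \<gamma>^m, so
  it vanishes unless \<gamma>^m = 1. In that case card C - 1 ones are added, and card C is zero in
  the field.\<close>

lemma sum_powers_C:
  "(\<Sum>c\<in>C - {0}. c ^ m) = (if (card C - 1) dvd m then -1 else 0)"
proof -
  obtain \<gamma> where g: "\<gamma> \<in> C" "\<gamma> \<noteq> 0" "\<And>i. \<gamma> ^ i = 1 \<longleftrightarrow> (card C - 1) dvd i" using finite_subfield_generator[OF Cp(1,2)] by blast
  show ?thesis
  proof (cases "(card C - 1) dvd m")
    case True
    have "c ^ m = 1" if "c \<in> C - {0}" for c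
      using True finite_subfield_power(1)[OF Cp(1,2), of c] that by (auto simp: dvd_def power_mult)
    then have "(\<Sum>c\<in>C - {0}. c ^ m) = of_nat (card (C - {0}))" by simp
    also have "card (C - {0}) = card C - 1" using Cp(2) Cc(1) by simp
    also have "of_nat (card C - 1) = (of_nat (card C) - 1 :: 'a)"
      using finite_subfield_power(3)[OF Cp(1,2) Cc(1)] by (simp add: of_nat_diff)
    finally show ?thesis using True of_nat_card_C by simp
  next
    case False
    have "bij_betw ((*) \<gamma>) (C - {0}) (C - {0})"
      by (rule bij_betw_byWitness[where f' = "\<lambda>x. x / \<gamma>"]) (use g in \<open>auto intro: Cc\<close>)
    then have "(\<Sum>c\<in>C - {0}. (\<gamma> * c) ^ m) = (\<Sum>c\<in>C - {0}. c ^ m)"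
      by (rule sum.reindex_bij_betw)
    then have "(\<gamma> ^ m - 1) * (\<Sum>c\<in>C - {0}. c ^ m) = 0"
      by (simp add: power_mult_distrib sum_distrib_left[symmetric] left_diff_distrib)
    then show ?thesis using False g(3) by simp
  qed
qed

text \<open>On L the inverse of \<sigma>^j is the nonnegative power \<sigma>^(r j - j).\<close>

lemma preimageL: "R \<in> A P \<Longrightarrow> \<exists>R'\<in>A P. (\<sigma> ^^ j) ` R' = R"
proof -
  assume R: "R \<in> A P"
  have "(\<sigma> ^^ j) ((\<sigma> ^^ (r * j - j)) x) = x" if "x \<in> R" for x
  proof -
    have "j + (r * j - j) = r * j" using r(1) by simp
    then have "(\<sigma> ^^ j) ((\<sigma> ^^ (r * j - j)) x) = (\<sigma> ^^ (r * j + 0)) x" by (metis add_0_right comp_apply funpow_add)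
    then show ?thesis using \<sigma>_mod[of x j 0] that subL[OF R] by auto
  qed
  then have "(\<sigma> ^^ j) ` (\<sigma> ^^ (r * j - j)) ` R = R" by (simp add: Set.image_image)
  then show ?thesis using imageL[OF R] by blast
qed

text \<open>The trace from L to F.\<close>

definition "tr x = (\<Sum>j<r. (\<sigma> ^^ j) x)"

lemma tr_F: "x \<in> L \<Longrightarrow> tr x \<in> F"
proof (rule fix_L)
  assume x: "x \<in> L"
  show "tr x \<in> L" unfolding tr_def using \<sigma>_L[OF x] by (intro sum_in_subfield[OF sfL])
  have "\<sigma> (tr x) = (\<Sum>j<r. (\<sigma> ^^ Suc j) x)"
    unfolding tr_def using \<sigma>_L[OF x] by (subst aut_on_sum[OF G_autL[OF \<sigma>(1)] sfL]) auto
  also have "\<dots> = tr x"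
    unfolding tr_def using sum.lessThan_Suc_shift[of "\<lambda>j. (\<sigma> ^^ j) x" r] sum.lessThan_Suc[of "\<lambda>j. (\<sigma> ^^ j) x" r] \<sigma>_r[OF x] by simp
  finally show "\<sigma> (tr x) = tr x" .
qed

lemma A_nonempty: "P \<in> places F \<Longrightarrow> \<exists>R. R \<in> A P"
  by (rule ex_place_above[OF ffF sfL FL algL])

lemma integral_pow: "(\<And>R. R \<in> A P \<Longrightarrow> x \<in> R) \<Longrightarrow> R \<in> A P \<Longrightarrow> (\<sigma> ^^ j) x \<in> R"
  using preimageL[of R P j] by blast

text \<open>Elements integral above a place are combinations of constants with coefficients integral at
  the place. The coefficients are traces, by orthogonality of the characters of the group of
  nonzero constants.\<close>

lemma integral_coords:
  assumes P: "P \<in> places F" and x: "x \<in> L" "\<And>R. R \<in> A P \<Longrightarrow> x \<in> R"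
  shows "\<exists>a. (\<forall>c\<in>C - {0}. a c \<in> P) \<and> x = (\<Sum>c\<in>C - {0}. a c * inverse c)"
proof -
  obtain R where R: "R \<in> A P" using A_nonempty[OF P] by blast
  have CR: "c \<in> R" if "c \<in> C" "R \<in> A P" for c R
  proof -
    interpret R: dval_ring L R using dvL that by (auto simp: aboveL_iff)
    show ?thesis using R.const_in(1)[OF Cp(1,2,4)] that by blast
  qed
  have tP: "tr (c * x) \<in> P" if c: "c \<in> C" for c
  proof -
    interpret R: dval_ring L R using dvL R by (auto simp: aboveL_iff)
    have "c * x \<in> R'" if R': "R' \<in> A P" for R'
    proof -
      interpret R': dval_ring L R' using dvL R' by (auto simp: aboveL_iff)
      show ?thesis using CR[OF c R'] x(2)[OF R'] by (rule R'.Rc)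
    qed
    then have "tr (c * x) \<in> R" unfolding tr_def using integral_pow[of P "c * x" R] R by (intro R.Rsum) blast
    moreover have "tr (c * x) \<in> F" using c CL x(1) by (intro tr_F Lc)
    ultimately show ?thesis using R by (auto simp: aboveL_iff)
  qed
  have "(\<Sum>c\<in>C - {0}. - tr (c * x) * inverse c) = x"
  proof -
    \<comment> \<open>Division by c turns the j-th conjugate into the character c^(q^j - 1) times
      \<sigma>^j x; for j < r this character is trivial only if j = 0.\<close>
    have t: "tr (c * x) * inverse c = (\<Sum>j<r. c ^ (q ^ j - 1) * (\<sigma> ^^ j) x)" if c: "c \<in> C - {0}" for c
    proof -
      have "tr (c * x) * inverse c = (\<Sum>j<r. (\<sigma> ^^ j) (c * x) * inverse c)" by (simp add: tr_def sum_distrib_right)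
      also have "\<dots> = (\<Sum>j<r. c ^ (q ^ j - 1) * (\<sigma> ^^ j) x)"
      proof (rule sum.cong)
        fix j
        have "(\<sigma> ^^ j) (c * x) = c ^ (q ^ j) * (\<sigma> ^^ j) x"
          using aut_onD(3)[OF \<sigma>_aut(1) sfL, of c x j] c CL x(1) \<sigma>_pow by auto
        moreover have "c ^ (q ^ j) = c * c ^ (q ^ j - 1)" using q2 by (metis Suc_diff_1 pos2 order_less_le_trans power_Suc zero_less_power)
        ultimately show "(\<sigma> ^^ j) (c * x) * inverse c = c ^ (q ^ j - 1) * (\<sigma> ^^ j) x" using c by simp
      qed simp
      finally show ?thesis .
    qed
    have "(\<Sum>c\<in>C - {0}. - tr (c * x) * inverse c) = - (\<Sum>c\<in>C - {0}. \<Sum>j<r. c ^ (q ^ j - 1) * (\<sigma> ^^ j) x)"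
      by (simp add: sum_negf t)
    also have "(\<Sum>c\<in>C - {0}. \<Sum>j<r. c ^ (q ^ j - 1) * (\<sigma> ^^ j) x) = (\<Sum>j<r. (\<Sum>c\<in>C - {0}. c ^ (q ^ j - 1)) * (\<sigma> ^^ j) x)"
      by (subst sum.swap) (simp add: sum_distrib_right)
    also have "\<dots> = (\<Sum>j\<in>{0}. (\<Sum>c\<in>C - {0}. c ^ (q ^ j - 1)) * (\<sigma> ^^ j) x)"
    proof (rule sum.mono_neutral_right)
      show "\<forall>j\<in>{..<r} - {0}. (\<Sum>c\<in>C - {0}. c ^ (q ^ j - 1)) * (\<sigma> ^^ j) x = 0"
      proof
        fix j assume j: "j \<in> {..<r} - {0}"
        then have "q ^ j < q ^ r" using q2 by (auto intro!: power_strict_increasing)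
        moreover have "q ^ j > 1" using one_less_power[of q j] q2 j by simp
        ultimately have "\<not> (q ^ r - 1) dvd (q ^ j - 1)" using dvd_imp_le[of "q ^ r - 1" "q ^ j - 1"] by linarith
        then have "\<not> (card C - 1) dvd (q ^ j - 1)" by (simp only: r(2) not_False_eq_True)
        then show "(\<Sum>c\<in>C - {0}. c ^ (q ^ j - 1)) * (\<sigma> ^^ j) x = 0" by (simp add: sum_powers_C)
      qed
    qed (use r(1) in auto)
    \<comment> \<open>The trivial character sums to -1, which is the origin of the minus sign in the
      coordinates.\<close>
    also have "\<dots> = - x" using sum_powers_C[of 0] by simp
    finally show ?thesis by simp
  qed
  then show ?thesis using tP dval_ring.axioms(1)[OF dvF[OF P]] subring_OmegaD(3)[OF val_ring.sr]
    by (intro exI[of _ "\<lambda>c. - tr (c * x)"]) auto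
qed

text \<open>In the coordinates of \<open>integral_coords\<close>, \<sigma>^m fixes the coefficients
  and raises the constants to the power q^m. Taking the q^m-th power of x treats the constants alike
  and changes the coefficients only modulo P, since the degree of P divides m. So one congruence
  holds at all places above P simultaneously.\<close>

lemma integral_frobenius:
  assumes P: "P \<in> places F" and x: "x \<in> L" "\<And>R. R \<in> A P \<Longrightarrow> x \<in> R"
    and m: "place_degree k P dvd m" and R: "R \<in> A P"
  shows "(\<sigma> ^^ m) x - x ^ (q ^ m) \<in> max_ideal R"
proof -
  interpret P: dval_ring F P by (rule dvF[OF P])
  interpret R: dval_ring L R using dvL R by (auto simp: aboveL_iff)
  obtain a where a: "\<And>c. c \<in> C - {0} \<Longrightarrow> a c \<in> P" "x = (\<Sum>c\<in>C - {0}. a c * inverse c)"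
    using integral_coords[OF P x] by blast
  obtain j where j: "m = place_degree k P * j" using m by auto
  have aq: "a c ^ (q ^ m) - a c \<in> max_ideal R" if c: "c \<in> C - {0}" for c
  proof -
    have "q ^ m = P.rcard ^ j" unfolding P.rcard_place_degree[OF ffF] j q_def power_mult ..
    then have *: "a c ^ (q ^ m) - a c \<in> max_ideal P" using P.cong_rcard_power[OF ffF a(1)[OF c], of j] by simp
    then have "a c ^ (q ^ m) - a c \<in> F" using P.MR P.RK by blast
    then show ?thesis using restrict_LF(2)[of R] R * by (auto simp: aboveL_iff)
  qed
  have aL: "a c \<in> L" "inverse c \<in> C" "inverse c \<in> L" "inverse c \<in> R" if "c \<in> C - {0}" for c
    using a(1)[OF that] P.RK FL that CL Cc R.const_in(1)[OF Cp(1,2,4)] by auto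
  have sx: "(\<sigma> ^^ m) x = (\<Sum>c\<in>C - {0}. a c * inverse c ^ (q ^ m))"
  proof -
    have "(\<sigma> ^^ m) x = (\<Sum>c\<in>C - {0}. (\<sigma> ^^ m) (a c * inverse c))"
      unfolding a(2) using aL by (subst aut_on_sum[OF \<sigma>_aut(1) sfL]) (auto intro: Lc)
    also have "\<dots> = (\<Sum>c\<in>C - {0}. a c * inverse c ^ (q ^ m))"
    proof (rule sum.cong)
      fix c assume c: "c \<in> C - {0}"
      show "(\<sigma> ^^ m) (a c * inverse c) = a c * inverse c ^ (q ^ m)"
        using aut_onD(3)[OF \<sigma>_aut(1) sfL aL(1,3)[OF c]] \<sigma>_F[OF P.RK[OF a(1)[OF c]]] \<sigma>_pow[OF aL(2)[OF c]] by simp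
    qed simp
    finally show ?thesis .
  qed
  have xq: "x ^ (q ^ m) = (\<Sum>c\<in>C - {0}. a c ^ (q ^ m) * inverse c ^ (q ^ m))"
    unfolding a(2) q_add(2) by (simp add: power_mult_distrib)
  have "a c * inverse c ^ (q ^ m) - a c ^ (q ^ m) * inverse c ^ (q ^ m) \<in> max_ideal R" if c: "c \<in> C - {0}" for c
  proof -
    have "(a c - a c ^ (q ^ m)) * inverse c ^ (q ^ m) \<in> max_ideal R"
      by (intro R.M_mult R.M_diff_sym[OF aq[OF c]] R.Rc aL(4)[OF c])
    then show ?thesis by (simp add: left_diff_distrib)
  qed
  then show ?thesis unfolding sx xq by (rule R.cong_sum)
qed

section \<open>Decomposition of a place in the constant field extension\<close>

lemma approxL:
  assumes "R \<in> A P" "x \<in> L"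
  shows "\<exists>y\<in>L. y - x \<in> max_ideal R \<and> (\<forall>R'\<in>A P - {R}. y \<in> max_ideal R')"
proof -
  interpret finite_places L "A P"
    by (rule finite_places.intro) (use finite_aboveL sfL dvL in \<open>auto simp: aboveL_iff\<close>)
  have "(if R' = R then x else 0) \<in> L" for R' using assms(2) Lc(1) by auto
  then obtain y where y: "y \<in> L" "\<And>R'. R' \<in> A P \<Longrightarrow> y - (if R' = R then x else 0) \<in> dval_ring.V L R' 1"
    using weak_approximation[of "\<lambda>R'. if R' = R then x else 0" 1] by blast
  have *: "y - (if R' = R then x else 0) \<in> max_ideal R'" if "R' \<in> A P" for R'
    using y(2)[OF that] dval_ring.V_1[OF dvS[OF that]] by simp
  have "y - x \<in> max_ideal R" using *[OF assms(1)] by simp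
  moreover have "y \<in> max_ideal R'" if "R' \<in> A P - {R}" for R' using *[of R'] that by simp
  ultimately show ?thesis using y(1) by blast
qed

lemma integral_approx:
  assumes "R \<in> A P" "x \<in> R"
  shows "\<exists>y\<in>L. y - x \<in> max_ideal R \<and> (\<forall>R'\<in>A P. y \<in> R')"
proof -
  obtain y where y: "y \<in> L" "y - x \<in> max_ideal R" "\<And>R'. R' \<in> A P \<Longrightarrow> R' \<noteq> R \<Longrightarrow> y \<in> max_ideal R'"
    using approxL[OF assms(1), of x] assms subL by blast
  have "y \<in> R'" if R': "R' \<in> A P" for R'
  proof -
    interpret R': dval_ring L R' using dvL R' by (auto simp: aboveL_iff)
    show ?thesis using y(2) y(3)[OF R'] R'.cong_R assms(2) R'.MR by (cases "R' = R") auto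
  qed
  then show ?thesis using y by blast
qed

text \<open>If \<sigma>^m moved R to another place S, an element y that is 1 modulo S and 0 at the
  other places would have \<sigma>^m y congruent to 0 modulo S, against the congruence of \<sigma>^m
  y with y^(q^m), which is 1 there.\<close>

lemma frobenius_stabilizes:
  assumes P: "P \<in> places F" and R: "R \<in> A P" and m: "place_degree k P dvd m"
  shows "(\<sigma> ^^ m) ` R = R"
proof (rule ccontr)
  assume ne: "(\<sigma> ^^ m) ` R \<noteq> R"
  define S where "S = (\<sigma> ^^ m) ` R"
  have SA: "S \<in> A P" unfolding S_def by (rule imageL[OF R])
  interpret S: dval_ring L S using dvL SA by (auto simp: aboveL_iff)
  interpret R: dval_ring L R using dvL R by (auto simp: aboveL_iff)
  obtain y where y: "y \<in> L" "y - 1 \<in> max_ideal S" "\<And>R'. R' \<in> A P \<Longrightarrow> R' \<noteq> S \<Longrightarrow> y \<in> max_ideal R'"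
    using approxL[OF SA Lc(2)] by blast
  have yi: "y \<in> R'" if R': "R' \<in> A P" for R'
  proof -
    interpret R': dval_ring L R' using dvL R' by (auto simp: aboveL_iff)
    show ?thesis using y(2) y(3)[OF R'] R'.cong_R[of y 1] R'.Rc R'.MR by (cases "R' = S") auto
  qed
  have "y \<in> max_ideal R" using y(3)[OF R] ne unfolding S_def by blast
  then have 1: "(\<sigma> ^^ m) y \<in> max_ideal S" unfolding S_def using max_imageL[OF R y(1)] by blast
  have "(\<sigma> ^^ m) y - y ^ (q ^ m) \<in> max_ideal S" by (rule integral_frobenius[OF P y(1) yi m SA])
  then have 2: "y ^ (q ^ m) \<in> max_ideal S" using S.M_diff[OF 1] by (metis diff_diff_eq2 add_diff_cancel_left')
  have "y ^ (q ^ m) - 1 ^ (q ^ m) \<in> max_ideal S" by (rule S.cong_power[OF y(2) S.Rc(2)])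
  then have "1 \<in> max_ideal S" using S.M_diff[OF 2] by (metis diff_diff_eq2 add_diff_cancel_left' power_one)
  then show False using S.M_one by simp
qed

text \<open>The degree of P and r are both exponents that preserve R. Bezout combines them, in a
  form without negative exponents.\<close>

lemma stabilizes_gcd:
  assumes P: "P \<in> places F" and R: "R \<in> A P"
  shows "(\<sigma> ^^ gcd (place_degree k P) r) ` R = R"
proof -
  obtain x y where xy: "r * x = place_degree k P * y + gcd r (place_degree k P)" using bezout_nat[of r] r(1) by blast
  define g where "g = gcd (place_degree k P) r"
  have "R = (\<sigma> ^^ (r * x)) ` R"
  proof -
    have "(\<sigma> ^^ (r * x)) z = z" if "z \<in> R" for z using \<sigma>_mod[of z x 0] that subL[OF R] by auto
    then show ?thesis by simp
  qed
  also have "r * x = g + place_degree k P * y" using xy by (simp add: g_def gcd.commute)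
  also have "(\<sigma> ^^ (g + place_degree k P * y)) ` R = (\<sigma> ^^ g) ` (\<sigma> ^^ (place_degree k P * y)) ` R"
    by (simp add: funpow_add image_comp)
  also have "(\<sigma> ^^ (place_degree k P * y)) ` R = R" by (rule frobenius_stabilizes[OF P R]) simp
  finally show ?thesis by (simp add: g_def)
qed

lemma const_M:
  assumes "R \<in> A P" "z \<in> C" "z \<in> max_ideal R" shows "z = 0"
proof -
  interpret R: dval_ring L R using dvL assms(1) by (auto simp: aboveL_iff)
  show ?thesis using R.const_in(2)[OF Cp(1,2,4) assms(2,3)] .
qed

lemma base_frob_dvd:
  assumes P: "P \<in> places F" and R: "R \<in> A P" and m: "\<And>x. x \<in> P \<Longrightarrow> x ^ (q ^ m) - x \<in> max_ideal R"
  shows "place_degree k P dvd m"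
proof -
  interpret P: dval_ring F P by (rule dvF[OF P])
  have "x ^ (card k ^ m) - x \<in> max_ideal P" if x: "x \<in> P" for x
  proof -
    have "x ^ (q ^ m) - x \<in> F" by (intro Fc P.RK[OF x])
    then show ?thesis using restrict_LF(2)[of R] R m[OF x] by (auto simp: aboveL_iff q_def)
  qed
  then show ?thesis by (rule P.frob_period[OF ffF P.rcard_place_degree[OF ffF]])
qed

lemma C_mod: "z \<in> C \<Longrightarrow> z ^ (q ^ (r * a + b)) = z ^ (q ^ b)"
  using \<sigma>_mod[of z a b] \<sigma>_pow CL by metis

lemma C_pow_inj: "x \<in> C \<Longrightarrow> y \<in> C \<Longrightarrow> x ^ (q ^ b) = y ^ (q ^ b) \<Longrightarrow> x = y"
proof -
  assume xy: "x \<in> C" "y \<in> C" "x ^ (q ^ b) = y ^ (q ^ b)"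
  have "(z ^ (q ^ b)) ^ (q ^ (r * b - b)) = z" if "z \<in> C" for z
  proof -
    have "b + (r * b - b) = r * b + 0" using r(1) by simp
    then have "(z ^ (q ^ b)) ^ (q ^ (r * b - b)) = z ^ (q ^ (r * b + 0))" by (metis power_add power_mult)
    then show ?thesis using C_mod[OF that, of b 0] by simp
  qed
  then show ?thesis using xy by metis
qed

text \<open>Let d be the degree of P. On residues the stabilizing power acts as x to the power q^b
  for some b. Triviality on residues of P gives d | b, and comparison on C gives i congruent to b
  modulo r; hence gcd d r divides i.\<close>

lemma stabilizer_dvd:
  assumes P: "P \<in> places F" and R: "R \<in> A P" and i: "(\<sigma> ^^ i) ` R = R"
  shows "gcd (place_degree k P) r dvd i"
proof -
  interpret R: dval_ring L R using dvL R by (auto simp: aboveL_iff)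
  have kk: "(\<sigma> ^^ i) c = c" if "c \<in> k" for c using \<sigma>_F sfk(3) that by blast
  obtain b where b: "\<And>x. x \<in> R \<Longrightarrow> (\<sigma> ^^ i) x - x ^ (q ^ b) \<in> max_ideal R"
    using R.stabilizer_frobenius[OF ffL \<sigma>_aut(1) i kk] unfolding q_def by blast
  have db: "place_degree k P dvd b"
  proof (rule base_frob_dvd[OF P R])
    fix x assume "x \<in> P"
    then have x: "x \<in> R" "x \<in> F" using R by (auto simp: aboveL_iff)
    show "x ^ (q ^ b) - x \<in> max_ideal R" using R.M_diff_sym[OF b[OF x(1)]] \<sigma>_F[OF x(2)] by simp
  qed
  have c: "z ^ (q ^ i) = z ^ (q ^ b)" if z: "z \<in> C" for z
  proof -
    have "z \<in> R" using R.const_in(1)[OF Cp(1,2,4)] z by blast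
    then have "z ^ (q ^ i) - z ^ (q ^ b) \<in> max_ideal R" using b[of z] \<sigma>_pow[OF z] by simp
    then show ?thesis using const_M[OF R _, of "z ^ (q ^ i) - z ^ (q ^ b)"] Cc z by simp
  qed
  \<comment> \<open>Kept general because subtraction is truncated: it is used once with i above b
    and once with b above i.\<close>
  have dv: "r dvd u - v" if "v \<le> u" "\<And>z. z \<in> C \<Longrightarrow> z ^ (q ^ u) = z ^ (q ^ v)" for u v
  proof (rule power_fix_dvd[OF Cp(1,2) r(2) q2])
    fix z assume z: "z \<in> C"
    have "(z ^ (q ^ (u - v))) ^ (q ^ v) = z ^ (q ^ u)" using that(1) by (simp add: power_mult[symmetric] power_add[symmetric])
    then show "z ^ (q ^ (u - v)) = z" using that(2)[OF z] z by (intro C_pow_inj[of _ z v] Cc) auto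
  qed
  define g where "g = gcd (place_degree k P) r"
  have gb: "g dvd b" using db by (metis g_def gcd_dvd1 dvd_trans)
  have gr: "g dvd r" by (simp add: g_def)
  show ?thesis
  proof (cases "b \<le> i")
    case True
    then have "g dvd i - b" using dv[OF True c] gr dvd_trans by blast
    then show ?thesis using gb True unfolding g_def by (metis dvd_diffD)
  next
    case False
    then have "g dvd b - i" using dv[of i b] c gr dvd_trans by (metis nat_le_linear)
    then show ?thesis using gb False unfolding g_def by (metis dvd_diffD1 nat_le_linear)
  qed
qed

text \<open>Let d be the degree of P. The residue degree of R over k is a multiple of d and of r,
  because the residue fields of P and the constants C are contained. Conversely \<sigma>^(lcm d r)
  is trivial on L while acting on residues as the q^(lcm d r)-th power, so the residue degree
  divides lcm d r.\<close>

lemma rcard_above: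
  assumes P: "P \<in> places F" and R: "R \<in> A P"
  shows "val_ring.rcard R = q ^ lcm (place_degree k P) r"
proof -
  interpret R: dval_ring L R using dvL R by (auto simp: aboveL_iff)
  define d where "d = place_degree k P"
  define m where "m = place_degree k R"
  have rc: "R.rcard = q ^ m" unfolding m_def q_def by (rule R.rcard_place_degree[OF ffL])
  have fr: "x ^ (q ^ m) - x \<in> max_ideal R" if "x \<in> R" for x using R.cong_rcard(1)[OF ffL that] rc by simp
  have "d dvd m" unfolding d_def
    by (rule base_frob_dvd[OF P R]) (use fr R in \<open>auto simp: aboveL_iff\<close>)
  moreover have "r dvd m"
  proof (rule power_fix_dvd[OF Cp(1,2) r(2) q2])
    fix z assume z: "z \<in> C"
    then have "z ^ (q ^ m) - z \<in> max_ideal R" using fr R.const_in(1)[OF Cp(1,2,4)] by blast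
    then show "z ^ (q ^ m) = z" using const_M[OF R, of "z ^ (q ^ m) - z"] Cc z by simp
  qed
  moreover have "m dvd lcm d r"
  proof (rule R.frob_period[OF ffL rc[unfolded q_def]])
    fix x assume x: "x \<in> R"
    obtain y where y: "y \<in> L" "y - x \<in> max_ideal R" "\<And>R'. R' \<in> A P \<Longrightarrow> y \<in> R'"
      using integral_approx[OF R x] by blast
    have "(\<sigma> ^^ lcm d r) y = y"
    proof -
      obtain a where "lcm d r = r * a" by (metis dvd_lcm2 dvdE)
      then show ?thesis using \<sigma>_mod[OF y(1), of a 0] by simp
    qed
    then have "y - y ^ (q ^ lcm d r) \<in> max_ideal R"
      using integral_frobenius[OF P y(1,3) _ R, of "lcm d r"] by (simp add: d_def)
    then have 1: "y ^ (q ^ lcm d r) - y \<in> max_ideal R" by (rule R.M_diff_sym)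
    have 2: "x ^ (q ^ lcm d r) - y ^ (q ^ lcm d r) \<in> max_ideal R"
      by (rule R.cong_power[OF R.M_diff_sym[OF y(2)] y(3)[OF R]])
    show "x ^ (card k ^ lcm d r) - x \<in> max_ideal R"
      using R.M_diff_trans[OF R.M_diff_trans[OF 2 1] y(2)] by (simp add: q_def)
  qed
  ultimately have "m = lcm d r" by (simp add: dvd_antisym)
  then show ?thesis using rc by (simp add: d_def)
qed

lemma funpow_image: "(\<sigma> ^^ (i + j)) ` R = (\<sigma> ^^ i) ` (\<sigma> ^^ j) ` R"
  by (simp add: funpow_add image_comp)

text \<open>The orbit of R under \<sigma> exhausts the places above P, and the powers of \<sigma>
  preserving R are exactly the multiples of the gcd.\<close>

lemma orbit_bij:
  assumes P: "P \<in> places F" and R: "R \<in> A P"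
  shows "bij_betw (\<lambda>i. (\<sigma> ^^ i) ` R) {..<gcd (place_degree k P) r} (A P)"
proof -
  define g where "g = gcd (place_degree k P) r"
  have g0: "g > 0" using r(1) by (simp add: g_def)
  have per: "(\<sigma> ^^ (g * a)) ` R = R" for a
  proof (induction a)
    case (Suc a)
    have "(\<sigma> ^^ (g * Suc a)) ` R = (\<sigma> ^^ g) ` (\<sigma> ^^ (g * a)) ` R" using funpow_image[of g "g * a" R] by simp
    then show ?case using Suc stabilizes_gcd[OF P R] by (simp add: g_def)
  qed simp
  show ?thesis unfolding bij_betw_def g_def[symmetric]
  proof
    show "inj_on (\<lambda>i. (\<sigma> ^^ i) ` R) {..<g}"
    proof (rule linorder_inj_onI)
      fix i j assume ij: "i < j" "i \<in> {..<g}" "j \<in> {..<g}"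
      show "(\<sigma> ^^ i) ` R \<noteq> (\<sigma> ^^ j) ` R"
      proof
        assume e: "(\<sigma> ^^ i) ` R = (\<sigma> ^^ j) ` R"
        also have "\<dots> = (\<sigma> ^^ i) ` (\<sigma> ^^ (j - i)) ` R" using funpow_image[of i "j - i" R] ij by simp
        finally have "(\<sigma> ^^ i) ` R = (\<sigma> ^^ i) ` (\<sigma> ^^ (j - i)) ` R" .
        moreover have "inj_on (\<sigma> ^^ i) L" using \<sigma>_aut(1) by (auto simp: aut_on_def bij_betw_def)
        ultimately have "R = (\<sigma> ^^ (j - i)) ` R"
          using inj_on_image_eq_iff[of "\<sigma> ^^ i" L R "(\<sigma> ^^ (j - i)) ` R"] subL[OF R] subL[OF imageL[OF R]] by blast
        then have "g dvd j - i" using stabilizer_dvd[OF P R, of "j - i"] by (simp add: g_def)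
        then show False using ij by (auto dest: dvd_imp_le)
      qed
    qed auto
    show "(\<lambda>i. (\<sigma> ^^ i) ` R) ` {..<g} = A P"
    proof
      show "(\<lambda>i. (\<sigma> ^^ i) ` R) ` {..<g} \<subseteq> A P" using imageL[OF R] by blast
      show "A P \<subseteq> (\<lambda>i. (\<sigma> ^^ i) ` R) ` {..<g}"
      proof
        fix S assume "S \<in> A P"
        then obtain i where i: "(\<sigma> ^^ i) ` R = S" using transitiveL[OF R] by blast
        have "(\<sigma> ^^ i) ` R = (\<sigma> ^^ (i mod g)) ` R"
          using funpow_image[of "i mod g" "g * (i div g)" R] per[of "i div g"] by simp
        then show "S \<in> (\<lambda>i. (\<sigma> ^^ i) ` R) ` {..<g}" using i g0 by auto
      qed
    qed
  qed
qed

section \<open>The norm product and the Artin symbol at one place\<close>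

definition "\<psi> = inv\<^bsub>Gal E F\<^esub> \<sigma>"

lemma \<psi>: "\<psi> \<in> G" using \<sigma>(1) by (simp add: \<psi>_def)

lemma \<psi>\<sigma>: "x \<in> E \<Longrightarrow> (\<psi> ^^ i) ((\<sigma> ^^ i) x) = x" "x \<in> E \<Longrightarrow> (\<sigma> ^^ i) ((\<psi> ^^ i) x) = x"
proof -
  have 1: "\<psi> (\<sigma> x) = x" "\<sigma> (\<psi> x) = x" if "x \<in> E" for x
    unfolding \<psi>_def using inv_app[OF \<sigma>(1)] that by auto
  have E: "(\<sigma> ^^ i) x \<in> E" "(\<psi> ^^ i) x \<in> E" if "x \<in> E" for i x
    using that by (induction i) (auto simp: Gc[OF \<sigma>(1)] Gc[OF \<psi>])
  show "x \<in> E \<Longrightarrow> (\<psi> ^^ i) ((\<sigma> ^^ i) x) = x"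
  proof (induction i)
    case (Suc i)
    have "(\<psi> ^^ Suc i) ((\<sigma> ^^ Suc i) x) = (\<psi> ^^ i) (\<psi> (\<sigma> ((\<sigma> ^^ i) x)))" by (simp add: funpow_swap1)
    then show ?case using Suc 1 E by simp
  qed simp
  show "x \<in> E \<Longrightarrow> (\<sigma> ^^ i) ((\<psi> ^^ i) x) = x"
  proof (induction i)
    case (Suc i)
    have "(\<sigma> ^^ Suc i) ((\<psi> ^^ Suc i) x) = (\<sigma> ^^ i) (\<sigma> (\<psi> ((\<psi> ^^ i) x)))" by (simp add: funpow_swap1)
    then show ?case using Suc 1 E by simp
  qed simp
qed

lemma \<psi>_aut: "aut_on L (\<psi> ^^ i)" "aut_on E (\<psi> ^^ i)"
  using aut_on_funpow[OF G_autL[OF \<psi>] sfL] aut_on_funpow[OF G_aut[OF \<psi>] sfE] by auto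

lemma \<psi>_L: "x \<in> L \<Longrightarrow> (\<psi> ^^ i) x \<in> L" "x \<in> E \<Longrightarrow> (\<psi> ^^ i) x \<in> E"
  using aut_onD(1)[OF \<psi>_aut(1) sfL] aut_onD(1)[OF \<psi>_aut(2) sfE] by auto

lemma \<psi>_mod: "x \<in> L \<Longrightarrow> (\<psi> ^^ (i + r * a)) x = (\<psi> ^^ i) x"
proof -
  assume x: "x \<in> L"
  have "(\<psi> ^^ (r * a)) x = x" using \<psi>\<sigma>(1)[of x "r * a"] \<sigma>_mod[OF x, of a 0] x LE' by simp
  then show ?thesis by (simp add: funpow_add)
qed

lemma \<psi>_C: "z \<in> C \<Longrightarrow> (\<psi> ^^ i) z \<in> C"
  by (induction i) (auto intro: G_C[OF \<psi>])

text \<open>The value modulo g determines i; then r / g is invertible modulo d / g and determines j.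
  This splits the d telescoping factors into one block for each place above P.\<close>

lemma residues_bij:
  fixes d r :: nat assumes "d > 0" "r > 0"
  defines "g \<equiv> gcd d r"
  shows "bij_betw (\<lambda>(i, j). (i + r * j) mod d) ({..<g} \<times> {..<d div g}) {..<d}"
proof -
  have g: "g > 0" "g dvd d" "g dvd r" using assms by (auto simp: g_def)
  have inj: "inj_on (\<lambda>(i, j). (i + r * j) mod d) ({..<g} \<times> {..<d div g})"
  proof (rule inj_onI, clarify)
    fix i j i' j' assume a: "i < g" "j < d div g" "i' < g" "j' < d div g" "(i + r * j) mod d = (i' + r * j') mod d"
    have "(i + r * j) mod g = (i' + r * j') mod g" using a(5) g(2) by (metis mod_mod_cancel)
    moreover have "(i + r * j) mod g = i" "(i' + r * j') mod g = i'"
      using a g(3) by (auto elim!: dvdE simp: mult.assoc)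
    ultimately have ii: "i = i'" by simp
    then have "[i + r * j = i + r * j'] (mod d)" using a(5) by (simp add: cong_def)
    then have "[r * j = r * j'] (mod d)" by (simp only: cong_add_lcancel_nat)
    then have "int d dvd int (r * j) - int (r * j')" by (metis cong_int_iff cong_iff_dvd_diff)
    then have "int d dvd int r * (int j - int j')" by (simp add: right_diff_distrib)
    then have "int (g * (d div g)) dvd int (g * (r div g)) * (int j - int j')" using g by simp
    then have "int (d div g) dvd int (r div g) * (int j - int j')" using g(1) by (simp add: mult.assoc)
    moreover have "coprime (d div g) (r div g)" unfolding g_def using assms by (intro div_gcd_coprime) auto
    ultimately have "int (d div g) dvd int j - int j'" by (simp add: coprime_dvd_mult_right_iff)
    then have "j = j'" using a(2,4) dvd_imp_le_int[of "int j - int j'" "int (d div g)"] by force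
    then show "i = i' \<and> j = j'" using ii by simp
  qed
  moreover have "card ({..<g} \<times> {..<d div g}) = card {..<d}" using g by (simp add: card_cartesian_product)
  moreover have "(\<lambda>(i, j). (i + r * j) mod d) ` ({..<g} \<times> {..<d div g}) \<subseteq> {..<d}" using assms by auto
  ultimately show ?thesis unfolding bij_betw_def by (metis card_image card_subset_eq finite_lessThan)
qed

text \<open>Modulo R0 the factor T i depends only on i mod d. The factors with index i + r * j for
  fixed i multiply to the residue norm at \<sigma>^i R0, because \<psi>^r is trivial on L and q^r =
  card C.\<close>

lemma norm_product:
  assumes P: "P \<in> places F" and R0: "R0 \<in> A P" and h: "h \<in> L" "\<And>R. R \<in> A P \<Longrightarrow> h \<in> R"
  defines "d \<equiv> place_degree k P"
  shows "(\<Prod>i<d. (\<psi> ^^ i) h ^ (q ^ i)) - (\<Prod>R\<in>A P. residue_norm C R h) \<in> max_ideal R0"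
proof -
  interpret P: dval_ring F P by (rule dvF[OF P])
  interpret R0: dval_ring L R0 using dvL R0 by (auto simp: aboveL_iff)
  define g where "g = gcd d r"
  define e where "e = d div g"
  have d0: "d > 0" unfolding d_def by (rule P.rcard_exponent_pos[OF ffF P.rcard_place_degree[OF ffF]])
  have g0: "g > 0" using r(1) by (simp add: g_def)
  have int: "(\<psi> ^^ i) h \<in> R" if R: "R \<in> A P" for i R
  proof -
    have "h \<in> (\<sigma> ^^ i) ` R" using h(2) imageL[OF R] by blast
    then obtain y where y: "y \<in> R" "h = (\<sigma> ^^ i) y" by blast
    then show ?thesis using \<psi>\<sigma>(1)[of y i] subL[OF R] LE' by auto
  qed
  define T where "T i = (\<psi> ^^ i) h ^ (q ^ i)" for i
  have TR: "T i \<in> R0" for i unfolding T_def by (intro R0.Rc int R0)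
  \<comment> \<open>\<open>integral_frobenius\<close> with m = d, applied to \<psi>^(i + d) h: there
    \<sigma>^d undoes d of the applications of \<psi>.\<close>
  have step: "T i - T (i + d) \<in> max_ideal R0" for i
  proof -
    define x where "x = (\<psi> ^^ (i + d)) h"
    have x: "x \<in> L" "\<And>R. R \<in> A P \<Longrightarrow> x \<in> R" unfolding x_def using \<psi>_L(1)[OF h(1)] int by auto
    have "(\<sigma> ^^ d) x = (\<sigma> ^^ d) ((\<psi> ^^ d) ((\<psi> ^^ i) h))" unfolding x_def by (simp add: add.commute[of i] funpow_add)
    also have "\<dots> = (\<psi> ^^ i) h" using \<psi>\<sigma>(2) \<psi>_L(1)[OF h(1)] LE' by simp
    finally have "(\<psi> ^^ i) h - x ^ (q ^ d) \<in> max_ideal R0"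
      using integral_frobenius[OF P x _ R0, of d] by (simp add: d_def)
    then have "(\<psi> ^^ i) h ^ (q ^ i) - (x ^ (q ^ d)) ^ (q ^ i) \<in> max_ideal R0"
      by (rule R0.cong_power) (intro R0.Rc x R0)
    moreover have "(x ^ (q ^ d)) ^ (q ^ i) = T (i + d)" unfolding T_def x_def by (simp add: power_mult[symmetric] power_add mult.commute)
    ultimately show ?thesis unfolding T_def by simp
  qed
  have Tmod: "T (b + d * a) - T b \<in> max_ideal R0" for a b
  proof (induction a)
    case (Suc a)
    have e: "b + d * Suc a = (b + d * a) + d" by simp
    show ?case unfolding e by (rule R0.M_diff_trans[OF R0.M_diff_sym[OF step] Suc])
  qed (simp add: R0.M_zero)
  have Tm: "T m - T (m mod d) \<in> max_ideal R0" for m using Tmod[of "m mod d" "m div d"] by simp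
  \<comment> \<open>The norm congruence is known at \<sigma>^i R0. Applying \<psi>^i carries it to
    R0, and the subsequent q^i-th power restores the constant c that \<psi>^i had moved.\<close>
  have main: "(\<Prod>j<e. T (i + r * j)) - residue_norm C ((\<sigma> ^^ i) ` R0) h \<in> max_ideal R0" for i
  proof -
    define R where "R = (\<sigma> ^^ i) ` R0"
    have R: "R \<in> A P" unfolding R_def by (rule imageL[OF R0])
    interpret R: dval_ring L R using dvL R by (auto simp: aboveL_iff)
    have "lcm d r = r * e"
    proof -
      have "g * lcm d r = d * r" unfolding g_def by (rule prod_gcd_lcm_nat[symmetric])
      also have "d * r = g * (r * e)" unfolding e_def by (simp add: g_def)
      finally show ?thesis using g0 by simp
    qed
    then have "R.rcard = card C ^ e" using rcard_above[OF P R] by (simp add: d_def r(2) power_mult)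
    note rn = R.residue_norm_cong[OF ffL Cp(1,2,4) this h(2)[OF R]]
    define c where "c = residue_norm C R h"
    define y where "y = (\<Prod>j<e. h ^ (card C ^ j)) - c"
    have c: "c \<in> C" "c \<in> L" "y \<in> max_ideal R" "y \<in> L" unfolding c_def y_def
      using rn CL h(1) by (auto intro!: Lc sum_in_subfield[OF sfL])
    note pa = aut_onD[OF \<psi>_aut(1) sfL]
    have "(\<sigma> ^^ i) ((\<psi> ^^ i) y) = y" using \<psi>\<sigma>(2) c(4) LE' by simp
    then have "(\<psi> ^^ i) y \<in> max_ideal R0" using max_imageL[OF R0 \<psi>_L(1)[OF c(4)], of i i] c(3) unfolding R_def by simp
    moreover have "(\<psi> ^^ i) y = (\<Prod>j<e. (\<psi> ^^ i) h ^ (card C ^ j)) - (\<psi> ^^ i) c"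
    proof -
      have pl: "(\<Prod>j<e. h ^ (card C ^ j)) \<in> L" using h(1) by (intro sum_in_subfield[OF sfL] Lc)
      have "(\<psi> ^^ i) y = (\<psi> ^^ i) (\<Prod>j<e. h ^ (card C ^ j)) - (\<psi> ^^ i) c" unfolding y_def using pl c(2) by (rule pa)
      also have "(\<psi> ^^ i) (\<Prod>j<e. h ^ (card C ^ j)) = (\<Prod>j<e. (\<psi> ^^ i) (h ^ (card C ^ j)))"
        using h(1) by (intro aut_on_sum(2)[OF \<psi>_aut(1) sfL] Lc)
      finally show ?thesis using h(1) by (simp add: pa)
    qed
    ultimately have 1: "(\<Prod>j<e. (\<psi> ^^ i) h ^ (card C ^ j)) - (\<psi> ^^ i) c \<in> max_ideal R0" by simp
    have "(\<psi> ^^ i) c \<in> R0" using R0.const_in(1)[OF Cp(1,2,4)] \<psi>_C[OF c(1)] by blast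
    then have "(\<Prod>j<e. (\<psi> ^^ i) h ^ (card C ^ j)) ^ (q ^ i) - ((\<psi> ^^ i) c) ^ (q ^ i) \<in> max_ideal R0" using R0.cong_power[OF 1] by blast
    moreover have "((\<psi> ^^ i) c) ^ (q ^ i) = c" using \<sigma>_pow[OF \<psi>_C[OF c(1)], of i i] \<psi>\<sigma>(2)[of c i] c(2) LE' by simp
    moreover have "(\<Prod>j<e. (\<psi> ^^ i) h ^ (card C ^ j)) ^ (q ^ i) = (\<Prod>j<e. T (i + r * j))"
      unfolding prod_power_distrib
    proof (rule prod.cong)
      fix j
      have "(\<psi> ^^ (i + r * j)) h = (\<psi> ^^ i) h" by (rule \<psi>_mod[OF h(1)])
      then show "((\<psi> ^^ i) h ^ (card C ^ j)) ^ (q ^ i) = T (i + r * j)"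
        unfolding T_def r(2) by (simp add: power_mult[symmetric] power_add mult.commute)
    qed simp
    ultimately show ?thesis unfolding c_def R_def by simp
  qed
  have "(\<Prod>i<g. \<Prod>j<e. T (i + r * j)) - (\<Prod>i<g. residue_norm C ((\<sigma> ^^ i) ` R0) h) \<in> max_ideal R0"
  proof (rule R0.cong_prod[OF main])
    fix i
    have "residue_norm C ((\<sigma> ^^ i) ` R0) h - (\<Prod>j<e. T (i + r * j)) \<in> max_ideal R0" by (rule R0.M_diff_sym[OF main])
    then show "residue_norm C ((\<sigma> ^^ i) ` R0) h \<in> R0" by (rule R0.cong_R) (intro R0.Rsum TR)
  qed
  moreover have "(\<Prod>i<g. residue_norm C ((\<sigma> ^^ i) ` R0) h) = (\<Prod>R\<in>A P. residue_norm C R h)"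
    using prod.reindex_bij_betw[OF orbit_bij[OF P R0], of "\<lambda>R. residue_norm C R h"] by (simp add: g_def d_def)
  moreover have m2: "(\<Prod>i<g. \<Prod>j<e. T ((i + r * j) mod d)) - (\<Prod>i<g. \<Prod>j<e. T (i + r * j)) \<in> max_ideal R0"
    by (intro R0.cong_prod R0.Rsum TR R0.M_diff_sym[OF Tm])
  moreover have "(\<Prod>i<g. \<Prod>j<e. T ((i + r * j) mod d)) = (\<Prod>i<d. T i)"
    using prod.reindex_bij_betw[OF residues_bij[OF d0 r(1)], of T]
    by (simp add: prod.cartesian_product case_prod_unfold g_def e_def)
  ultimately have "(\<Prod>i<d. T i) - (\<Prod>R\<in>A P. residue_norm C R h) \<in> max_ideal R0"
    using R0.M_diff_trans[OF m2] by simp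
  then show ?thesis unfolding T_def .
qed

lemma unit_above:
  assumes Q: "Q \<in> places_above F E P" and y: "y \<in> E" "\<And>Q. Q \<in> places_above F E P \<Longrightarrow> y \<in> Q"
  shows "(\<psi> ^^ i) y \<in> Q"
proof -
  have "(\<sigma> ^^ i) ` Q \<in> places_above F E P"
  proof (induction i)
    case (Suc i)
    then show ?case using image_above[OF \<sigma>(1) Suc] by (simp add: image_comp)
  qed (use Q in simp)
  then obtain z where z: "z \<in> Q" "y = (\<sigma> ^^ i) z" using y(2) by blast
  then show ?thesis using \<psi>\<sigma>(1)[of z i] above_subset[OF Q] by auto
qed

text \<open>\<open>eig\<close> is the Kummer property: an automorphism trivial on L multiplies y by
  a constant \<omega>. The congruence between \<omega> and the product of residue norms is thereby
  one between constants and can be promoted to equality.\<close>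

theorem artin_at_place:
  assumes P: "P \<in> places F" "unramified_at F E P"
    and y: "y \<in> E" "y \<noteq> 0" "\<And>Q. Q \<in> places_above F E P \<Longrightarrow> y \<in> Q \<and> inverse y \<in> Q"
    and h: "h = \<psi> y ^ q * inverse y" "h \<in> L"
    and eig: "\<And>g. g \<in> G \<Longrightarrow> (\<And>x. x \<in> L \<Longrightarrow> g x = x) \<Longrightarrow> \<exists>\<omega>\<in>C. g y = \<omega> * y"
  shows "\<exists>\<tau>\<in>G. (\<forall>x\<in>L. \<tau> x = x) \<and> \<tau> y = (\<Prod>R\<in>A P. residue_norm C R h) * y \<and>
    artin_symbol k F E P = \<tau> \<otimes>\<^bsub>Gal E F\<^esub> (\<sigma> [^]\<^bsub>Gal E F\<^esub> place_degree k P)"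
proof -
  define d where "d = place_degree k P"
  define s where "s = artin_symbol k F E P"
  obtain Q0 where Q0: "Q0 \<in> places_above F E P" using above_ex[OF P(1)] by blast
  interpret Q0: dval_ring E Q0 using dvE Q0 by (auto simp: above_iff)
  define R0 where "R0 = Q0 \<inter> L"
  have R0: "R0 \<in> A P" unfolding R0_def by (rule above_EL[OF Q0])
  have sG: "s \<in> G" unfolding s_def by (rule artin_symbol(1)[OF P])
  have sQ: "s x - x ^ (q ^ d) \<in> max_ideal Q0" if "x \<in> Q0" for x
    unfolding s_def q_def d_def by (rule artin_symbol(2)[OF P Q0 that])
  have down: "x \<in> max_ideal R0" if "x \<in> max_ideal Q0" "x \<in> L" for x
    using restrict_EL(2)[of Q0 x] Q0 that by (auto simp: above_iff R0_def)
  have up: "x \<in> max_ideal Q0" if "x \<in> max_ideal R0" "x \<in> L" for x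
    using restrict_EL(2)[of Q0 x] Q0 that by (auto simp: above_iff R0_def)
  \<comment> \<open>Removing the d-th power of \<sigma> from the Artin symbol leaves an automorphism
    trivial on L, because both act on C as the q^d-th power.\<close>
  define \<tau> where "\<tau> = s \<otimes>\<^bsub>Gal E F\<^esub> (\<psi> [^]\<^bsub>Gal E F\<^esub> d)"
  have pdG: "\<psi> [^]\<^bsub>Gal E F\<^esub> d \<in> G" using \<psi> by simp
  have tG: "\<tau> \<in> G" unfolding \<tau>_def using sG pdG by simp
  have t: "\<tau> x = s ((\<psi> ^^ d) x)" if "x \<in> E" for x
    unfolding \<tau>_def using that sG pdG \<psi> by (simp add: G_mult_app pow_app)
  have sC: "s z = z ^ (q ^ d)" if z: "z \<in> C" for z
  proof -
    have "z \<in> R0"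
    proof -
      interpret R0: dval_ring L R0 using dvL R0 by (auto simp: aboveL_iff)
      show ?thesis using R0.const_in(1)[OF Cp(1,2,4)] z by blast
    qed
    then have "s z - z ^ (q ^ d) \<in> max_ideal Q0" using sQ by (simp add: R0_def)
    moreover have c: "s z - z ^ (q ^ d) \<in> C" using G_C[OF sG z] z by (intro Cc)
    ultimately have "s z - z ^ (q ^ d) = 0" using const_M[OF R0 c] down CL by blast
    then show ?thesis by simp
  qed
  have tL: "\<tau> x = x" if x: "x \<in> L" for x
  proof -
    have "\<tau> z = z" if z: "z \<in> C" for z
    proof -
      have "\<tau> z = ((\<psi> ^^ d) z) ^ (q ^ d)" using t sC \<psi>_C[OF z] z CL LE' by simp
      also have "\<dots> = (\<sigma> ^^ d) ((\<psi> ^^ d) z)" using \<sigma>_pow \<psi>_C[OF z] by simp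
      also have "\<dots> = z" using \<psi>\<sigma>(2) z CL LE' by simp
      finally show ?thesis .
    qed
    then have "\<tau> x = \<one>\<^bsub>Gal E F\<^esub> x"
      using G_agree[OF Gr.one_closed G_autL[OF tG] G_fix[OF tG] _ x] one_app CL LE' by simp
    then show ?thesis using one_app x LE' by simp
  qed
  obtain \<omega> where om: "\<omega> \<in> C" "\<tau> y = \<omega> * y" using eig[OF tG tL] by blast
  have piQ: "(\<psi> ^^ i) y \<in> Q" if "Q \<in> places_above F E P" for i Q
    by (rule unit_above[OF that y(1)]) (use y(3) in blast)
  have hR: "h \<in> R" if "R \<in> A P" for R
  proof -
    obtain Q where Q: "Q \<in> places_above F E P" "Q \<inter> L = R" using ex_above_EL[OF \<open>R \<in> A P\<close>] by blast
    interpret Q: dval_ring E Q using dvE Q by (auto simp: above_iff)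
    have "\<psi> y \<in> Q" using piQ[OF Q(1), of 1] by simp
    then have "h \<in> Q" unfolding h(1) using y(3)[OF Q(1)] by (intro Q.Rc) auto
    then show ?thesis using h(2) Q by blast
  qed
  \<comment> \<open>The denominator contributed by each new factor is the numerator of the product
    so far.\<close>
  have tele: "(\<Prod>i<m. (\<psi> ^^ i) h ^ (q ^ i)) = (\<psi> ^^ m) y ^ (q ^ m) * inverse y" for m
  proof (induction m)
    case 0 then show ?case using y(2) by simp
  next
    case (Suc m)
    note pa = aut_onD[OF \<psi>_aut(2) sfE]
    have pE: "\<psi> y \<in> E" using Gc(1)[OF \<psi>] y(1) by blast
    have nz: "(\<psi> ^^ m) y \<noteq> 0" using pa(11)[OF y(1)] y(2) by blast
    have "(\<psi> ^^ m) h = (\<psi> ^^ m) (\<psi> y) ^ q * inverse ((\<psi> ^^ m) y)"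
      unfolding h(1) using pE y(1) by (simp add: pa Ec)
    also have "(\<psi> ^^ m) (\<psi> y) = (\<psi> ^^ Suc m) y" by (simp add: funpow_swap1)
    finally have "(\<psi> ^^ m) h ^ (q ^ m) = (\<psi> ^^ Suc m) y ^ (q ^ Suc m) * inverse ((\<psi> ^^ m) y ^ (q ^ m))"
      by (simp add: power_mult_distrib power_mult[symmetric] power_inverse)
    then show ?case using Suc nz by simp
  qed
  define c where "c = (\<Prod>R\<in>A P. residue_norm C R h)"
  have cC: "c \<in> C" unfolding c_def
  proof (rule sum_in_subfield(2)[OF Cp(1)])
    fix R assume R: "R \<in> A P"
    interpret R: dval_ring L R using dvL R by (auto simp: aboveL_iff)
    obtain e where "lcm (place_degree k P) r = r * e" by (metis dvd_lcm2 dvdE)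
    then have "R.rcard = card C ^ e" using rcard_above[OF P(1) R] by (simp add: r(2) power_mult)
    then show "residue_norm C R h \<in> C" using R.residue_norm_cong(1)[OF ffL Cp(1,2,4) _ hR[OF R]] by blast
  qed
  have "(\<Prod>i<d. (\<psi> ^^ i) h ^ (q ^ i)) - c \<in> max_ideal R0" unfolding c_def d_def by (rule norm_product[OF P(1) R0 h(2) hR])
  moreover have "(\<Prod>i<d. (\<psi> ^^ i) h ^ (q ^ i)) - c \<in> L"
    using h(2) \<psi>_L(1) cC CL by (intro Lc sum_in_subfield[OF sfL]) auto
  ultimately have 1: "(\<Prod>i<d. (\<psi> ^^ i) h ^ (q ^ i)) - c \<in> max_ideal Q0" by (rule up)
  have "s ((\<psi> ^^ d) y) - (\<psi> ^^ d) y ^ (q ^ d) \<in> max_ideal Q0" by (rule sQ[OF piQ[OF Q0]])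
  \<comment> \<open>s maps \<psi>^d y to \<tau> y = \<omega> y; dividing by the unit y leaves
    \<omega> against the telescoped product.\<close>
  then have "(\<omega> * y - (\<psi> ^^ d) y ^ (q ^ d)) * inverse y \<in> max_ideal Q0"
    using y(3)[OF Q0] om(2) t[OF y(1)] by (intro Q0.M_mult) auto
  then have 2: "\<omega> - (\<Prod>i<d. (\<psi> ^^ i) h ^ (q ^ i)) \<in> max_ideal Q0" unfolding tele using y(2) by (simp add: left_diff_distrib mult.assoc)
  have "\<omega> - c \<in> max_ideal Q0" by (rule Q0.M_diff_trans[OF 2 1])
  moreover have oc: "\<omega> - c \<in> C" using om cC by (intro Cc)
  ultimately have "\<omega> = c" using const_M[OF R0 oc] down CL by simp
  moreover have "s = \<tau> \<otimes>\<^bsub>Gal E F\<^esub> (\<sigma> [^]\<^bsub>Gal E F\<^esub> d)"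
  proof -
    have "\<psi> [^]\<^bsub>Gal E F\<^esub> d \<otimes>\<^bsub>Gal E F\<^esub> \<sigma> [^]\<^bsub>Gal E F\<^esub> d = \<one>\<^bsub>Gal E F\<^esub>"
      unfolding \<psi>_def using \<sigma>(1) by (simp add: Gr.nat_pow_inv)
    then show ?thesis unfolding \<tau>_def using sG pdG \<sigma>(1) by (simp add: Gr.m_assoc)
  qed
  ultimately show ?thesis using tG tL om(2) unfolding c_def s_def d_def by blast
qed

end

section \<open>Roots of unity and divisors\<close>

text \<open>Roots are split off one at a time. As the derivative does not vanish at a root, the
  removed root is not a root of the cofactor, so each step adds exactly one.\<close>

lemma card_roots_separable:
  assumes root: "\<And>p :: 'a::field poly. degree p > 0 \<Longrightarrow> \<exists>z. poly p z = 0"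
  shows "(p :: 'a poly) \<noteq> 0 \<Longrightarrow> (\<And>z. poly p z = 0 \<Longrightarrow> poly (pderiv p) z \<noteq> 0) \<Longrightarrow> card {z. poly p z = 0} = degree p"
proof (induction "degree p" arbitrary: p)
  case 0
  then obtain c where "p = [:c:]" by (metis degree_eq_zeroE)
  then show ?case using 0 by auto
next
  case (Suc n)
  then obtain a where a: "poly p a = 0" using root by (metis zero_less_Suc)
  then have "[:- a, 1:] dvd p" using poly_eq_0_iff_dvd by blast
  then obtain s where s: "p = [:- a, 1:] * s" by (rule dvdE)
  have s0: "s \<noteq> 0" using s Suc(3) by auto
  have d: "poly (pderiv p) z = poly s z + (z - a) * poly (pderiv s) z" for z
    unfolding s pderiv_mult by (simp add: pderiv_pCons algebra_simps)
  have sa: "poly s a \<noteq> 0" using Suc(4)[OF a] d[of a] by simp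
  have "degree p = Suc (degree s)" unfolding s using s0 by (subst degree_mult_eq) auto
  then have "n = degree s" using Suc(2) by simp
  moreover have "poly (pderiv s) z \<noteq> 0" if "poly s z = 0" for z
    using Suc(4)[of z] d[of z] that by (auto simp: s)
  ultimately have "card {z. poly s z = 0} = degree s" using Suc(1)[OF _ s0] by blast
  moreover have "{z. poly p z = 0} = insert a {z. poly s z = 0}" unfolding s by auto
  moreover have "finite {z. poly s z = 0}" by (rule poly_roots_finite[OF s0])
  ultimately show ?case using sa \<open>degree p = Suc (degree s)\<close> by simp
qed

lemma card_roots_of_unity:
  assumes root: "\<And>p :: 'a::field poly. degree p > 0 \<Longrightarrow> \<exists>z. poly p z = 0" and n: "(of_nat n :: 'a) \<noteq> 0"
  shows "card (roots_of_unity n :: 'a set) = n"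
proof -
  have n0: "n > 0" using n by (cases n) auto
  define p :: "'a poly" where "p = monom 1 n - 1"
  have "coeff p n = 1" using n0 by (simp add: p_def)
  then have p0: "p \<noteq> 0" by auto
  have "degree p \<le> n" unfolding p_def by (intro degree_diff_le) (auto simp: degree_monom_le)
  moreover have "n \<le> degree p" using \<open>coeff p n = 1\<close> by (intro le_degree) simp
  ultimately have dp: "degree p = n" by simp
  have r: "{z. poly p z = 0} = (roots_of_unity n :: 'a set)" by (auto simp: p_def poly_monom roots_of_unity_def)
  have "card {z. poly p z = 0} = degree p"
  proof (rule card_roots_separable[OF root p0])
    fix z assume "poly p z = 0"
    then have "z ^ n = 1" by (simp add: p_def poly_monom)
    then have "z \<noteq> 0" using n0 by (auto simp: zero_power)
    then show "poly (pderiv p) z \<noteq> 0" using n by (simp add: p_def pderiv_diff pderiv_monom poly_monom)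
  qed
  then show ?thesis using r dp by simp
qed

text \<open>There are n distinct n-th roots of unity, all algebraic over k and hence in C. Their
  orders divide gcd n (card C - 1), so this gcd is n, and a suitable power of a generator of C has
  exact order m.\<close>

lemma (in const_ext) primitive_root:
  assumes root: "\<And>p :: 'a poly. degree p > 0 \<Longrightarrow> \<exists>z. poly p z = 0" and n: "n > 0" "coprime n q"
    and mu: "roots_of_unity n \<subseteq> L" and m: "m dvd n"
  shows "roots_of_unity n \<subseteq> C" "\<exists>\<zeta>\<in>C. \<zeta> ^ m = 1 \<and> (\<forall>i. 0 < i \<longrightarrow> i < m \<longrightarrow> \<zeta> ^ i \<noteq> 1)"
proof -
  obtain s where s: "q = CHAR('a) ^ s" using finite_subfield_card(2)[OF sfk(1,2)] unfolding q_def by blast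
  have "s \<noteq> 0" using s q2 by (cases s) auto
  have pr: "Factorial_Ring.prime CHAR('a)" by (rule finite_subfield_card(1)[OF sfk(1,2)])
  have nn: "(of_nat n :: 'a) \<noteq> 0"
  proof
    assume "(of_nat n :: 'a) = 0"
    then have "CHAR('a) dvd n" by (simp only: of_nat_eq_0_iff_char_dvd)
    moreover have "CHAR('a) dvd q" using s \<open>s \<noteq> 0\<close> by (simp add: dvd_power)
    ultimately have "CHAR('a) dvd 1" using n(2) by (meson coprime_common_divisor_nat coprime_def)
    then show False using pr by auto
  qed
  have cn: "card (roots_of_unity n :: 'a set) = n" by (rule card_roots_of_unity[OF root nn])
  show mC: "roots_of_unity n \<subseteq> C"
  proof
    fix z :: 'a assume z: "z \<in> roots_of_unity n"
    define p :: "'a poly" where "p = monom 1 n - 1"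
    have "p \<in> kpol k" unfolding p_def
      by (intro kpol_clos[OF subfield_imp_subring[OF sfk(1)]] subfield_OmegaD[OF sfk(1)])
    moreover have "coeff p n = 1" using n by (simp add: p_def)
    then have "p \<noteq> 0" by auto
    moreover have "poly p z = 0" using z by (simp add: p_def poly_monom roots_of_unity_def)
    ultimately show "z \<in> C" unfolding Cp(5) using mu z by blast
  qed
  define u where "u = gcd n (card C - 1)"
  have C1: "card C - 1 > 0" using finite_subfield_power(3)[OF Cp(1,2) Cc(1)] by simp
  have nu: "roots_of_unity n \<subseteq> (roots_of_unity u :: 'a set)"
  proof
    fix z :: 'a assume z: "z \<in> roots_of_unity n"
    then have z1: "z ^ n = 1" "z \<noteq> 0" using n(1) by (auto simp: roots_of_unity_def zero_power)
    then have z2: "z ^ (card C - 1) = 1" using finite_subfield_power(1)[OF Cp(1,2)] mC z by blast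
    obtain x y where "n * x = (card C - 1) * y + u" using bezout_nat[of n "card C - 1"] n(1) unfolding u_def by blast
    then have "z ^ (n * x) = z ^ ((card C - 1) * y) * z ^ u" by (simp add: power_add)
    then show "z \<in> roots_of_unity u" using z1 z2 by (simp add: roots_of_unity_def power_mult)
  qed
  have u0: "u > 0" using n(1) by (simp add: u_def)
  define p :: "'a poly" where "p = monom 1 u - 1"
  have "coeff p u = 1" using u0 by (simp add: p_def)
  then have p0: "p \<noteq> 0" by auto
  have r: "{z. poly p z = 0} = (roots_of_unity u :: 'a set)" by (auto simp: p_def poly_monom roots_of_unity_def)
  have "degree p \<le> u" unfolding p_def by (intro degree_diff_le) (auto simp: degree_monom_le)
  then have uu: "card (roots_of_unity u :: 'a set) \<le> u" "finite (roots_of_unity u :: 'a set)"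
    using card_poly_roots_bound[OF p0] poly_roots_finite[OF p0] unfolding r by auto
  have "n \<le> u" using cn card_mono[OF uu(2) nu] uu(1) by simp
  then have "u = n" using n(1) unfolding u_def by (metis dvd_imp_le gcd_dvd1 dual_order.antisym)
  then have "n dvd card C - 1" unfolding u_def by (metis gcd_dvd2)
  then have md: "m dvd card C - 1" using m dvd_trans by blast
  obtain \<gamma> where g: "\<gamma> \<in> C" "\<gamma> \<noteq> 0" "\<And>i. \<gamma> ^ i = 1 \<longleftrightarrow> (card C - 1) dvd i" using finite_subfield_generator[OF Cp(1,2)] by blast
  obtain t where t: "card C - 1 = m * t" using md by auto
  have t0: "t > 0" using t C1 by (cases t) auto
  show "\<exists>\<zeta>\<in>C. \<zeta> ^ m = 1 \<and> (\<forall>i. 0 < i \<longrightarrow> i < m \<longrightarrow> \<zeta> ^ i \<noteq> 1)"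
  proof (intro bexI[of _ "\<gamma> ^ t"] conjI allI impI)
    show "(\<gamma> ^ t) ^ m = 1" using g(3)[of "t * m"] t by (simp add: power_mult[symmetric] mult.commute)
    fix i assume i: "0 < i" "i < m"
    have "\<not> m * t dvd t * i" using i t0 by (auto dest: dvd_imp_le simp: mult.commute)
    then show "(\<gamma> ^ t) ^ i \<noteq> 1" using g(3)[of "t * i"] t by (simp add: power_mult[symmetric])
  qed (intro Cc g(1))
qed

text \<open>Integer exponents are needed because divisors may have negative coefficients. The
  eigenvalue is taken in a subfield S fixed by g, so that it is not altered under iteration.\<close>

lemma (in gal_ext) eigen_int_pow:
  assumes g: "g \<in> G" "g y = c * y" and y: "y \<in> E" "y \<noteq> 0" and c: "c \<in> S" and S: "subfield S \<Omega>" "S \<subseteq> E" "\<And>x. x \<in> S \<Longrightarrow> g x = x"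
  shows "(g [^]\<^bsub>Gal E F\<^esub> (m::int)) y = c powi m * y" "x \<in> S \<Longrightarrow> (g [^]\<^bsub>Gal E F\<^esub> m) x = x"
proof -
  note Sc = subfield_OmegaD[OF S(1)]
  have fixn: "(g [^]\<^bsub>Gal E F\<^esub> (n::nat)) x = x" if "x \<in> S" for n x
  proof -
    have "(g ^^ n) x = x" by (induction n) (auto simp: S(3)[OF that])
    then show ?thesis using pow_app[OF g(1)] S(2) that by auto
  qed
  have nat: "(g [^]\<^bsub>Gal E F\<^esub> (n::nat)) y = c ^ n * y" for n
  proof -
    have "(g ^^ n) y = c ^ n * y"
    proof (induction n)
      case (Suc n)
      have "c ^ n \<in> S" using c by (intro Sc)
      then show ?case using Suc g(1) y S by (auto simp: Gc g(2))
    qed simp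
    then show ?thesis using pow_app[OF g(1) y(1)] by simp
  qed
  have inv: "(inv\<^bsub>Gal E F\<^esub> u) x = x" if "u \<in> G" "u x = x" "x \<in> E" for u x
    using inv_app(1)[OF that(1,3)] that(2) by simp
  have invy: "(inv\<^bsub>Gal E F\<^esub> u) y = inverse b * y" if u: "u \<in> G" "u y = b * y" "b \<in> S" "b \<noteq> 0" "u b = b" for u b
  proof -
    have bE: "b \<in> E" using u S by auto
    have "y = (inv\<^bsub>Gal E F\<^esub> u) (b * y)" using inv_app(1)[OF u(1) y(1)] u(2) by simp
    also have "\<dots> = b * (inv\<^bsub>Gal E F\<^esub> u) y" using Gc(3)[of "inv\<^bsub>Gal E F\<^esub> u" b y] u(1) bE y inv[OF u(1,5) bE] by simp
    finally have e: "y = b * (inv\<^bsub>Gal E F\<^esub> u) y" .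
    have "inverse b * (b * (inv\<^bsub>Gal E F\<^esub> u) y) = (inv\<^bsub>Gal E F\<^esub> u) y" using u(4) by simp
    then show ?thesis by (metis e)
  qed
  have c0: "c \<noteq> 0" using g y Gc(11)[OF g(1) y(1)] by auto
  show "(g [^]\<^bsub>Gal E F\<^esub> m) y = c powi m * y"
  proof (cases "m \<ge> 0")
    case True
    then obtain n where "m = int n" using nonneg_int_cases by blast
    then show ?thesis using nat by (simp add: int_pow_int)
  next
    case False
    then obtain n where n: "m = - int n" by (metis int_cases2 of_nat_0_le_iff)
    have "(inv\<^bsub>Gal E F\<^esub> (g [^]\<^bsub>Gal E F\<^esub> n)) y = inverse (c ^ n) * y"
    proof (rule invy)
      show "g [^]\<^bsub>Gal E F\<^esub> n \<in> G" using g(1) by (rule Gr.nat_pow_closed)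
      show cS: "c ^ n \<in> S" by (rule Sc(7)[OF c])
      show "(g [^]\<^bsub>Gal E F\<^esub> n) (c ^ n) = c ^ n" by (rule fixn[OF cS])
    qed (use nat c0 in simp_all)
    then show ?thesis unfolding n using g(1) by (simp add: Gr.int_pow_neg int_pow_int power_int_minus)
  qed
  show "x \<in> S \<Longrightarrow> (g [^]\<^bsub>Gal E F\<^esub> m) x = x"
  proof -
    assume x: "x \<in> S"
    show ?thesis
    proof (cases "m \<ge> 0")
      case True
      then obtain n where "m = int n" using nonneg_int_cases by blast
      then show ?thesis using fixn x by (simp add: int_pow_int)
    next
      case False
      then obtain n where n: "m = - int n" by (metis int_cases2 of_nat_0_le_iff)
      have "(inv\<^bsub>Gal E F\<^esub> (g [^]\<^bsub>Gal E F\<^esub> n)) x = x" using g(1) fixn[OF x] S(2) x by (intro inv) auto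
      then show ?thesis unfolding n using g(1) by (simp add: Gr.int_pow_neg int_pow_int)
    qed
  qed
qed

section \<open>Orders and conorms in the unramified case\<close>

context const_ext
begin

text \<open>The order of a uniformizer of P at Q, which is 1, factors through L. Both factors are
  integers and the one belonging to E over L is positive, so it equals 1.\<close>

lemma ord_EL:
  assumes P: "P \<in> places F" "unramified_at F E P" and Q: "Q \<in> places_above F E P" and x: "x \<in> L" "x \<noteq> 0"
  shows "ord_at Q x = ord_at (Q \<inter> L) x"
proof -
  interpret P: dval_ring F P by (rule dvF[OF P(1)])
  interpret Q: dval_ring E Q using dvE Q by (auto simp: above_iff)
  have R: "Q \<inter> L \<in> A P" by (rule above_EL[OF Q])
  interpret R: dval_ring L "Q \<inter> L" using dvL R by (auto simp: aboveL_iff)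
  have t: "P.t0 \<in> F" "P.t0 \<noteq> 0" "ord_at P P.t0 = 1" using P.t0_nz P.t0(1) P.RK P.ord_t0' by auto
  have s: "R.t0 \<in> L" "R.t0 \<noteq> 0" "ord_at (Q \<inter> L) R.t0 = 1" using R.t0_nz R.t0(1) R.RK R.ord_t0' by auto
  have *: "ord_at Q z = ord_at Q R.t0 * ord_at (Q \<inter> L) z" if "z \<in> L" "z \<noteq> 0" for z
    by (rule ramification_index_eq(2)[OF R.dval_ring_axioms Q.dval_ring_axioms refl LE s that])
  have "1 = ord_at Q R.t0 * ord_at (Q \<inter> L) P.t0"
    using *[of P.t0] t FL unramified_uniformizer(1)[OF P t Q] by auto
  moreover have "ord_at Q R.t0 > 0"
  proof -
    have "R.t0 \<in> max_ideal Q" using restrict_EL(2)[of Q R.t0] R.t0_M s(1) Q by (auto simp: above_iff)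
    then show ?thesis using Q.M_iff_ord s LE' by blast
  qed
  ultimately have "ord_at Q R.t0 = 1" by (metis zmult_eq_1_iff zero_less_one order_less_asym neg_0_less_iff_less)
  then show ?thesis using *[OF x] by simp
qed

lemma ramification_L:
  assumes P: "P \<in> places F" "unramified_at F E P" and R: "R \<in> A P"
  shows "ramification_index F R P = 1"
proof -
  obtain Q where Q: "Q \<in> places_above F E P" "Q \<inter> L = R" using ex_above_EL[OF R] by blast
  interpret P: dval_ring F P by (rule dvF[OF P(1)])
  have t: "P.t0 \<in> F" "P.t0 \<noteq> 0" "ord_at P P.t0 = 1" using P.t0_nz P.t0(1) P.RK P.ord_t0' by auto
  have "ramification_index F R P = ord_at R P.t0"
    using R dvL by (intro ramification_index_eq(1)[OF P.dval_ring_axioms _ _ FL t]) (auto simp: aboveL_iff)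
  also have "\<dots> = ord_at Q P.t0" using ord_EL[OF P Q(1), of P.t0] t FL Q(2) by auto
  also have "\<dots> = 1" by (rule unramified_uniformizer(1)[OF P t Q(1)])
  finally show ?thesis .
qed

context
  fixes D :: "'a set \<Rightarrow>\<^sub>0 int"
  assumes D: "\<And>P. P \<in> Poly_Mapping.keys D \<Longrightarrow> P \<in> places F \<and> unramified_at F E P"
begin

text \<open>Unramifiedness makes every multiplicity in the conorm equal to 1, and at a place R only
  the summand for P = R \<inter> F contributes.\<close>

lemma lookup_conorm:
  "Poly_Mapping.lookup (conorm F L D) R = (if R \<in> places L then Poly_Mapping.lookup D (R \<inter> F) else 0)"
proof -
  have b: "Poly_Mapping.lookup (\<Sum>S\<in>A P. frag_cmul (ramification_index F S P) (frag_of S)) R = (if R \<in> A P then 1 else 0)"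
    if "P \<in> Poly_Mapping.keys D" for P
  proof -
    have "Poly_Mapping.lookup (\<Sum>S\<in>A P. frag_cmul (ramification_index F S P) (frag_of S)) R =
      (\<Sum>S\<in>A P. if R = S then 1 else 0)"
      unfolding lookup_sum using ramification_L D[OF that] by (intro sum.cong) auto
    then show ?thesis using finite_aboveL by simp
  qed
  have "Poly_Mapping.lookup (conorm F L D) R =
    (\<Sum>P\<in>Poly_Mapping.keys D. Poly_Mapping.lookup D P * (if R \<in> A P then 1 else 0))"
    unfolding conorm_def frag_extend_def lookup_sum by (intro sum.cong) (auto simp: b)
  also have "\<dots> = (\<Sum>P\<in>Poly_Mapping.keys D. if R \<inter> F = P then (if R \<in> places L then Poly_Mapping.lookup D P else 0) else 0)"
    by (intro sum.cong) (auto simp: aboveL_iff)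
  also have "\<dots> = (if R \<in> places L then Poly_Mapping.lookup D (R \<inter> F) else 0)"
    by (simp add: sum.delta in_keys_iff)
  finally show ?thesis .
qed

lemma keys_conorm: "Poly_Mapping.keys (conorm F L D) = (\<Union>P\<in>Poly_Mapping.keys D. A P)"
proof (intro Set.set_eqI)
  fix R
  show "R \<in> Poly_Mapping.keys (conorm F L D) \<longleftrightarrow> R \<in> (\<Union>P\<in>Poly_Mapping.keys D. A P)"
    unfolding in_keys_iff lookup_conorm by (auto simp: aboveL_iff in_keys_iff)
qed

lemma eval_conorm:
  "eval_at_div C h (conorm F L D) =
    (\<Prod>P\<in>Poly_Mapping.keys D. (\<Prod>R\<in>A P. residue_norm C R h) powi Poly_Mapping.lookup D P)"
proof -
  have "eval_at_div C h (conorm F L D) =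
    (\<Prod>R\<in>(\<Union>P\<in>Poly_Mapping.keys D. A P). residue_norm C R h powi Poly_Mapping.lookup (conorm F L D) R)"
    unfolding eval_at_div_def keys_conorm ..
  also have "\<dots> = (\<Prod>P\<in>Poly_Mapping.keys D. \<Prod>R\<in>A P. residue_norm C R h powi Poly_Mapping.lookup (conorm F L D) R)"
    by (rule prod.UNION_disjoint) (auto simp: finite_aboveL, auto simp: aboveL_iff)
  also have "\<dots> = (\<Prod>P\<in>Poly_Mapping.keys D. \<Prod>R\<in>A P. residue_norm C R h powi Poly_Mapping.lookup D P)"
    by (intro prod.cong) (auto simp: lookup_conorm aboveL_iff)
  also have "\<dots> = (\<Prod>P\<in>Poly_Mapping.keys D. (\<Prod>R\<in>A P. residue_norm C R h) powi Poly_Mapping.lookup D P)"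
  proof (rule prod.cong[OF refl])
    fix P
    have "(\<Prod>R\<in>T. residue_norm C R h powi Poly_Mapping.lookup D P) = (\<Prod>R\<in>T. residue_norm C R h) powi Poly_Mapping.lookup D P" for T
      by (induction T rule: infinite_finite_induct) (simp_all add: power_int_mult_distrib)
    then show "(\<Prod>R\<in>A P. residue_norm C R h powi Poly_Mapping.lookup D P) = (\<Prod>R\<in>A P. residue_norm C R h) powi Poly_Mapping.lookup D P"
      .
  qed
  finally show ?thesis .
qed

text \<open>Weak approximation to elements a R of the required orders, with a precision beyond these
  orders. It later clears the zeros and poles of the Kummer generator above D.\<close>

lemma prescribed_orders:
  shows "\<exists>z\<in>L. z \<noteq> 0 \<and> (\<forall>R\<in>Poly_Mapping.keys (conorm F L D). ord_at R z = m R)"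
proof (cases "Poly_Mapping.keys (conorm F L D) = {}")
  case True
  then show ?thesis using Lc(2) by (intro bexI[of _ 1]) auto
next
  case False
  define T where "T = Poly_Mapping.keys (conorm F L D)"
  have TL: "R \<in> places L" if "R \<in> T" for R using that unfolding T_def keys_conorm by (auto simp: aboveL_iff)
  interpret finite_places L T by (rule finite_places.intro) (use sfL TL dvL in \<open>auto simp: T_def\<close>)
  have "\<exists>a. a \<in> L \<and> a \<noteq> 0 \<and> (R \<in> T \<longrightarrow> ord_at R a = m R)" for R
  proof (cases "R \<in> T")
    case True
    interpret R: dval_ring L R by (rule dvS[OF True])
    have "ord_at R (R.t0 powi m R) = m R" using R.ord_powi[of R.t0 "m R"] R.t0_nz R.t0(1) R.RK R.ord_t0' by auto
    then show ?thesis using R.t0_nz R.t0(1) R.RK by (intro exI[of _ "R.t0 powi m R"]) (auto intro: Lc)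
  qed (use Lc(2) in \<open>auto intro: exI[of _ 1]\<close>)
  then obtain a where a: "\<And>R. a R \<in> L" "\<And>R. a R \<noteq> 0" "\<And>R. R \<in> T \<Longrightarrow> ord_at R (a R) = m R" by metis
  define B where "B = 1 + (\<Sum>R\<in>T. \<bar>m R\<bar>)"
  have B: "B > m R" if "R \<in> T" for R
  proof -
    have "\<bar>m R\<bar> \<le> (\<Sum>R\<in>T. \<bar>m R\<bar>)" using that finS member_le_sum[of R T "\<lambda>R. \<bar>m R\<bar>"] by auto
    then show ?thesis unfolding B_def by linarith
  qed
  obtain z where z: "z \<in> L" "\<And>R. R \<in> T \<Longrightarrow> z - a R \<in> dval_ring.V L R B" using weak_approximation[of a B] a(1) by blast
  have zz: "z \<noteq> 0 \<and> ord_at R z = m R" if R: "R \<in> T" for R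
    using dval_ring.ord_cong[OF dvS[OF R] a(1)[of R] a(2)[of R] z(2)[OF R]] a(3)[OF R] B[OF R] by simp
  then have "z \<noteq> 0" using False T_def by blast
  then show ?thesis using z(1) zz unfolding T_def by blast
qed

text \<open>Induction over the support. Commutativity collects the powers of \<sigma>, whose
  exponents add up to the degree of D; the eigenvalues on y multiply because they are constants,
  fixed by every automorphism over L.\<close>

lemma artin_product:
  assumes y: "y \<in> E" "y \<noteq> 0"
    "\<And>P Q. P \<in> Poly_Mapping.keys D \<Longrightarrow> Q \<in> places_above F E P \<Longrightarrow> y \<in> Q \<and> inverse y \<in> Q"
    and h: "h = \<psi> y ^ q * inverse y" "h \<in> L"
    and eig: "\<And>g. g \<in> G \<Longrightarrow> (\<And>x. x \<in> L \<Longrightarrow> g x = x) \<Longrightarrow> \<exists>\<omega>\<in>C. g y = \<omega> * y"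
  shows "\<exists>\<tau>\<in>G. (\<forall>x\<in>L. \<tau> x = x) \<and> \<tau> y = eval_at_div C h (conorm F L D) * y \<and>
    artin_map k F E D = \<tau> \<otimes>\<^bsub>Gal E F\<^esub> (\<sigma> [^]\<^bsub>Gal E F\<^esub> div_degree k D)"
proof -
  interpret CG: comm_group "Gal E F" by (rule comm)
  define c where "c P = (\<Prod>R\<in>A P. residue_norm C R h)" for P
  define l where "l P = Poly_Mapping.lookup D P" for P
  define sy where "sy P = artin_symbol k F E P [^]\<^bsub>Gal E F\<^esub> l P" for P
  have "\<exists>\<tau>\<in>G. (\<forall>x\<in>L. \<tau> x = x) \<and> \<tau> y = (\<Prod>P\<in>S. c P powi l P) * y \<and>
    finprod (Gal E F) sy S = \<tau> \<otimes>\<^bsub>Gal E F\<^esub> (\<sigma> [^]\<^bsub>Gal E F\<^esub> (\<Sum>P\<in>S. l P * int (place_degree k P)))"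
    if "finite S" "S \<subseteq> Poly_Mapping.keys D" for S
    using that
  proof (induction S rule: finite_induct)
    case empty
    show ?case
      by (intro bexI[of _ "\<one>\<^bsub>Gal E F\<^esub>"]) (use one_app y LE' \<sigma>(1) in auto)
  next
    case (insert P S)
    obtain \<tau> where t: "\<tau> \<in> G" "\<And>x. x \<in> L \<Longrightarrow> \<tau> x = x" "\<tau> y = (\<Prod>P\<in>S. c P powi l P) * y"
      "finprod (Gal E F) sy S = \<tau> \<otimes>\<^bsub>Gal E F\<^esub> (\<sigma> [^]\<^bsub>Gal E F\<^esub> (\<Sum>P\<in>S. l P * int (place_degree k P)))"
      using insert by auto
    have P: "P \<in> Poly_Mapping.keys D" "P \<in> places F" "unramified_at F E P" using insert D by auto
    obtain u where u: "u \<in> G" "\<And>x. x \<in> L \<Longrightarrow> u x = x" "u y = c P * y"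
      "artin_symbol k F E P = u \<otimes>\<^bsub>Gal E F\<^esub> (\<sigma> [^]\<^bsub>Gal E F\<^esub> place_degree k P)"
    proof -
      have "\<exists>\<tau>\<in>G. (\<forall>x\<in>L. \<tau> x = x) \<and> \<tau> y = (\<Prod>R\<in>A P. residue_norm C R h) * y \<and>
        artin_symbol k F E P = \<tau> \<otimes>\<^bsub>Gal E F\<^esub> (\<sigma> [^]\<^bsub>Gal E F\<^esub> place_degree k P)"
        by (rule artin_at_place[OF P(2,3) y(1,2) _ h(1,2)]) (fact y(3)[OF P(1)] eig)+
      then show ?thesis using that unfolding c_def by blast
    qed
    obtain \<omega> where om: "\<omega> \<in> C" "u y = \<omega> * y" using eig[OF u(1,2)] by blast
    then have cC: "c P \<in> C" using u(3) y(2) by simp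
    note ep = eigen_int_pow[OF u(1,3) y(1,2) CL[OF cC] sfL LE u(2), where m = "l P"]
    define v where "v = u [^]\<^bsub>Gal E F\<^esub> l P"
    have v: "v \<in> G" "v y = c P powi l P * y" "\<And>x. x \<in> L \<Longrightarrow> v x = x" unfolding v_def using u(1) ep by auto
    have syG: "sy P' \<in> G" if "P' \<in> Poly_Mapping.keys D" for P'
      unfolding sy_def using artin_symbol(1) D[OF that] by auto
    have syP: "sy P = v \<otimes>\<^bsub>Gal E F\<^esub> (\<sigma> [^]\<^bsub>Gal E F\<^esub> (l P * int (place_degree k P)))"
    proof -
      have "sy P = v \<otimes>\<^bsub>Gal E F\<^esub> ((\<sigma> [^]\<^bsub>Gal E F\<^esub> int (place_degree k P)) [^]\<^bsub>Gal E F\<^esub> l P)"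
        unfolding sy_def v_def u(4) using u(1) \<sigma>(1) by (simp add: CG.int_pow_distrib int_pow_int)
      then show ?thesis using \<sigma>(1) by (simp add: Gr.int_pow_pow mult.commute)
    qed
    define B where "B = (\<Sum>P\<in>S. l P * int (place_degree k P))"
    have "finprod (Gal E F) sy (insert P S) = sy P \<otimes>\<^bsub>Gal E F\<^esub> finprod (Gal E F) sy S"
      using insert syG by (intro CG.finprod_insert) auto
    also have "\<dots> = (v \<otimes>\<^bsub>Gal E F\<^esub> (\<sigma> [^]\<^bsub>Gal E F\<^esub> (l P * int (place_degree k P)))) \<otimes>\<^bsub>Gal E F\<^esub> (\<tau> \<otimes>\<^bsub>Gal E F\<^esub> (\<sigma> [^]\<^bsub>Gal E F\<^esub> B))"
      unfolding syP t(4) B_def ..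
    also have "\<dots> = (v \<otimes>\<^bsub>Gal E F\<^esub> \<tau>) \<otimes>\<^bsub>Gal E F\<^esub> ((\<sigma> [^]\<^bsub>Gal E F\<^esub> (l P * int (place_degree k P))) \<otimes>\<^bsub>Gal E F\<^esub> (\<sigma> [^]\<^bsub>Gal E F\<^esub> B))"
      using v(1) t(1) \<sigma>(1) by (simp add: CG.m_ac)
    also have "\<dots> = (v \<otimes>\<^bsub>Gal E F\<^esub> \<tau>) \<otimes>\<^bsub>Gal E F\<^esub> (\<sigma> [^]\<^bsub>Gal E F\<^esub> (l P * int (place_degree k P) + B))"
      using \<sigma>(1) by (simp add: Gr.int_pow_mult)
    finally have fin: "finprod (Gal E F) sy (insert P S) =
      (v \<otimes>\<^bsub>Gal E F\<^esub> \<tau>) \<otimes>\<^bsub>Gal E F\<^esub> (\<sigma> [^]\<^bsub>Gal E F\<^esub> (\<Sum>P\<in>insert P S. l P * int (place_degree k P)))"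
      using insert unfolding B_def by simp
    have "(v \<otimes>\<^bsub>Gal E F\<^esub> \<tau>) y = (\<Prod>P\<in>insert P S. c P powi l P) * y"
    proof -
      define b where "b = (\<Prod>P\<in>S. c P powi l P)"
      have "b * y \<in> E" unfolding b_def t(3)[symmetric] using Gc(1)[OF t(1) y(1)] .
      have "b = (b * y) * inverse y" using y(2) by simp
      then have bE: "b \<in> E" using \<open>b * y \<in> E\<close> y(1) Ec by metis
      obtain \<omega>' where "\<omega>' \<in> C" "\<tau> y = \<omega>' * y" using eig[OF t(1,2)] by blast
      then have "b \<in> C" using t(3) y(2) by (simp add: b_def)
      then have vb: "v b = b" using v(3) CL by blast
      have "(v \<otimes>\<^bsub>Gal E F\<^esub> \<tau>) y = v (b * y)" using t(3) v(1) t(1) y(1) by (simp add: G_mult_app b_def)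
      also have "\<dots> = b * (c P powi l P * y)" using v bE y(1) vb by (simp add: Gc)
      finally show ?thesis using insert by (simp add: b_def)
    qed
    moreover have "(v \<otimes>\<^bsub>Gal E F\<^esub> \<tau>) x = x" if "x \<in> L" for x
      using v t that LE' by (simp add: G_mult_app)
    ultimately show ?case using fin v(1) t(1) by (intro bexI[of _ "v \<otimes>\<^bsub>Gal E F\<^esub> \<tau>"]) auto
  qed
  from this[OF finite_keys order_refl] show ?thesis
    unfolding eval_conorm artin_map_def div_degree_def sy_def l_def c_def .
qed

end

end

section \<open>Assembling the description of the Artin map\<close>

lemma infinite_fun_field: "fun_field k (K :: 'a::field set) \<Longrightarrow> infinite K"
proof
  assume ff: "fun_field k K" and fin: "finite K"
  obtain x N W where x: "subfield k \<Omega>" "subfield K \<Omega>" "k \<subseteq> K" "ff_gen k K x N W" using ff by (auto simp: fun_field_def)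
  have xK: "x \<in> K" "\<And>p. p \<in> kpol k \<Longrightarrow> p \<noteq> 0 \<Longrightarrow> poly p x \<noteq> 0" using x(4) by (auto simp: ff_gen_def)
  define p where "p = monom 1 (card K) - monom (1::'a) 1"
  have "p \<in> kpol k" unfolding p_def
    by (intro kpol_clos[OF subfield_imp_subring[OF x(1)]] subfield_OmegaD[OF x(1)])
  moreover have "card K \<ge> 2" using finite_subfield_power(3)[OF x(2) fin xK(1)] .
  then have "coeff p (card K) = 1" by (simp add: p_def)
  then have "p \<noteq> 0" by auto
  moreover have "poly p x = 0" using finite_subfield_power(2)[OF x(2) fin xK(1)] by (simp add: p_def poly_monom)
  ultimately show False using xK(2) by blast
qed

text \<open>\<open>ff_gen\<close> does not ask the spanning family to lie in the field, so the same
  x and W serve every intermediate field.\<close>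

lemma fun_field_subset:
  assumes k: "subfield k (\<Omega> :: 'a::field ring)" "finite k" and g: "ff_gen k E x N W"
    and K: "subfield K \<Omega>" "k \<subseteq> K" "x \<in> K" "K \<subseteq> E"
  shows "fun_field k K"
proof -
  have "ff_gen k K x N W" using g K(3,4) unfolding ff_gen_def by blast
  then show ?thesis unfolding fun_field_def using k K by blast
qed

theorem lemma4p3:
  fixes k F F' E' :: "'a::field set" and n q :: nat and \<mm> D :: "'a set \<Rightarrow>\<^sub>0 int"
  assumes "algebraic_closure \<Omega> F"
    and "global_function_field k F" and "exact_const_field k F = k" and "q = card k"
    and "n > 0" and "coprime n q"
    and "abelian_extension E' F"
    and "subfield F' \<Omega>" and "F \<subseteq> F'" and "F' \<subseteq> E'"
    and "const_field_extension k F F'" and "roots_of_unity n \<subseteq> F'"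
    and "\<mm> \<in> divisors F" and "effective \<mm>"
    and "\<forall>\<pp>\<in>places F - Poly_Mapping.keys \<mm>. unramified_at F E' \<pp>"
    and "cyclic_extension E' F'" and "ring.dim \<Omega> F' E' dvd n"
    and "D \<in> divisors_prime_to F \<mm>"
  shows "\<exists>\<sigma> y. \<sigma> \<in> carrier (Gal E' F) \<and> (\<forall>x\<in>F'. \<sigma> x = frobenius_aut k F F' x) \<and>
    y \<in> E' \<and> y ^ n \<in> selmer n F \<mm> F' \<and> coprime_to_div F' (y ^ n) (conorm F F' D) \<and>
    (let h = (inv\<^bsub>Gal E' F\<^esub> \<sigma>) y ^ q * inverse y;
         c = eval_at_div (exact_const_field k F') h (conorm F F' D);
         is_tau = (\<lambda>\<tau>. \<tau> \<in> carrier (Gal E' F') \<and> \<tau> y * inverse y = c)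
     in h \<in> F' - {0} \<and> coprime_to_div F' h (conorm F F' D) \<and> c \<in> roots_of_unity n \<and>
        (\<exists>!\<tau>. is_tau \<tau>) \<and>
        (\<forall>\<tau>. is_tau \<tau> \<longrightarrow>
           artin_map k F E' D = \<tau> \<otimes>\<^bsub>Gal E' F\<^esub> (\<sigma> [^]\<^bsub>Gal E' F\<^esub> div_degree k D)))"
proof -
  have gE: "galois_extension E' F" and cm: "comm_group (Gal E' F)" using assms(7) by (auto simp: abelian_extension_def)
  have gEL: "galois_extension E' F'" and cyc: "cyclic_group (Gal E' F')" using assms(16) by (auto simp: cyclic_extension_def)
  obtain x where k: "subfield k \<Omega>" "finite k" "subfield F \<Omega>" "k \<subseteq> F"
    and x: "x \<in> F" "(ring.transcendental \<Omega> over k) x" "ring.finite_dimension \<Omega> (generate_field \<Omega> (insert x k)) F"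
    using assms(2) by (auto simp: global_function_field_def)
  have E: "subfield E' \<Omega>" "F \<subseteq> E'" "ring.finite_dimension \<Omega> F E'" using gE by (auto simp: galois_extension_def)
  interpret O: Ring.field "\<Omega> :: 'a ring" by (rule Omega_field)
  have sg: "subfield (generate_field \<Omega> (insert x k)) \<Omega>" by (rule O.generate_field_is_subfield) auto
  \<comment> \<open>E' is finite over k(x) by the tower through F. This one presentation is reused
    for F and F'.\<close>
  obtain N W where g: "ff_gen k E' x N W"
    using ff_gen_of_finite_dimension[OF k(1) _ x(2) O.telescopic_base_dim(1)[OF sg k(3) x(3) E(3)]] x(1) E(2) by blast
  have ffE: "fun_field k E'" by (rule fun_field_subset[OF k(1,2) g]) (use E k x in auto)
  have ffF: "fun_field k F" by (rule fun_field_subset[OF k(1,2) g]) (use E k x in auto)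
  have ffL: "fun_field k F'" by (rule fun_field_subset[OF k(1,2) g]) (use E k x assms(8-10) in auto)
  interpret ce: const_ext E' F k F'
    by (intro const_ext.intro abel_places.intro gal_places.intro gal_ext.intro gal_places_axioms.intro abel_places_axioms.intro const_ext_axioms.intro) (fact gE ffE ffF cm ffL assms(9,10,3,11))+
  interpret kum: gal_ext E' F' by (rule gal_ext.intro[OF gEL])
  have qq: "ce.q = q" unfolding ce.q_def assms(4) ..
  have root: "\<exists>z. poly p z = 0" if "degree p > 0" for p :: "'a poly" by (rule alg_closure_root[OF assms(1) that])
  have infL: "infinite F'" by (rule infinite_fun_field[OF ffL])
  have dn: "card (carrier (Gal E' F')) dvd n" using kum.dim_eq_card[OF infL] assms(17) by simp
  \<comment> \<open>Automorphisms in both groups are extensional functions on E', so Gal E' F' is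
    literally a subset of Gal E' F.\<close>
  have KG: "g \<in> carrier (Gal E' F') \<longleftrightarrow> g \<in> carrier (Gal E' F) \<and> (\<forall>x\<in>F'. g x = x)" for g
    unfolding gal_carrier_iff[OF E(1)] using assms(9) by blast
  have cop: "coprime n ce.q" unfolding qq by fact
  note pr = ce.primitive_root[OF root assms(5) cop assms(12) dn]
  obtain \<zeta> where z: "\<zeta> \<in> ce.C" "\<zeta> ^ card (carrier (Gal E' F')) = 1"
    "\<And>i. 0 < i \<Longrightarrow> i < card (carrier (Gal E' F')) \<Longrightarrow> \<zeta> ^ i \<noteq> 1" using pr(2) by blast
  have zn: "\<zeta> ^ n = 1" using z(2) dn by (auto simp: dvd_def power_mult)
  obtain y0 where y0: "y0 \<in> E'" "y0 \<noteq> 0" "\<And>g. g \<in> carrier (Gal E' F') \<Longrightarrow> \<exists>i. g y0 = \<zeta> ^ i * y0"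
    "\<And>g. g \<in> carrier (Gal E' F') \<Longrightarrow> g y0 = y0 \<Longrightarrow> g = \<one>\<^bsub>Gal E' F'\<^esub>"
    using kum.kummer_generator[OF infL cyc ce.CL[OF z(1)] z(2,3)] by blast
  have Dk: "P \<in> places F \<and> P \<notin> Poly_Mapping.keys \<mm>" if "P \<in> Poly_Mapping.keys D" for P
    using assms(18) that by (auto simp: divisors_prime_to_def free_Abelian_group_def)
  then have Du: "P \<in> places F \<and> unramified_at F E' P" if "P \<in> Poly_Mapping.keys D" for P using assms(15) that by blast
  define T where "T = Poly_Mapping.keys (conorm F F' D)"
  have Tk: "T = (\<Union>P\<in>Poly_Mapping.keys D. ce.A P)" unfolding T_def by (rule ce.keys_conorm[OF Du])
  have powL: "w ^ n \<in> F'" if w: "w \<in> E'" "\<And>g. g \<in> carrier (Gal E' F') \<Longrightarrow> \<exists>i. g w = \<zeta> ^ i * w" for w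
  proof (rule kum.fixF)
    show "w ^ n \<in> E'" using w(1) by (rule kum.Ec)
    fix g assume g: "g \<in> carrier (Gal E' F')"
    then obtain i where "g w = \<zeta> ^ i * w" using w(2) by blast
    moreover have "(\<zeta> ^ i) ^ n = 1" using zn by (metis power_mult mult.commute power_one)
    ultimately show "g (w ^ n) = w ^ n" using kum.Gc(8)[OF g w(1), of n] by (simp add: power_mult_distrib)
  qed
  \<comment> \<open>The Kummer generator is only determined up to a factor in F'; this freedom makes it a unit above D.\<close>
  obtain z' where z': "z' \<in> F'" "z' \<noteq> 0" "\<And>R. R \<in> T \<Longrightarrow> ord_at R z' = - (ord_at R (y0 ^ n) div int n)"
    using ce.prescribed_orders[OF Du, where m = "\<lambda>R. - (ord_at R (y0 ^ n) div int n)"] unfolding T_def by blast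
  define y where "y = y0 * z'"
  have yE: "y \<in> E'" "y \<noteq> 0" unfolding y_def using y0 z' ce.LE' kum.Ec(5) by auto
  have gy: "g y = (g y0) * z'" if "g \<in> carrier (Gal E' F')" for g
    unfolding y_def using kum.Gc(3)[OF that y0(1) ce.LE'[OF z'(1)]] kum.G_fix[OF that z'(1)] by simp
  have yeig: "\<exists>i. g y = \<zeta> ^ i * y" if "g \<in> carrier (Gal E' F')" for g
    using y0(3)[OF that] gy[OF that] unfolding y_def by auto
  have yfix: "g = \<one>\<^bsub>Gal E' F'\<^esub>" if "g \<in> carrier (Gal E' F')" "g y = y" for g
    using y0(4)[OF that(1)] gy[OF that(1)] that(2) z'(2) unfolding y_def by simp
  have yL: "y ^ n \<in> F'" "y ^ n \<noteq> 0" using powL[of y] yE yeig by auto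
  have y0L: "y0 ^ n \<in> F'" "y0 ^ n \<noteq> 0" using powL[of y0] y0(1-3) by auto
  \<comment> \<open>By unramifiedness the order of y0^n at a place of F' above D is n times the
    order of y0 above it, so the integer division in the choice of z' is exact.\<close>
  have ordy: "ord_at Q y = 0" if P: "P \<in> Poly_Mapping.keys D" and Q: "Q \<in> places_above F E' P" for P Q
  proof -
    interpret Q: dval_ring E' Q using ce.dvE Q by (auto simp: ce.above_iff)
    have R: "Q \<inter> F' \<in> T" unfolding Tk using ce.above_EL[OF Q] P by blast
    have "int n * ord_at Q y0 = ord_at (Q \<inter> F') (y0 ^ n)"
      using ce.ord_EL[OF _ _ Q y0L] Du[OF P] Q.ord_power[OF y0(1,2), of n] by simp
    moreover have "ord_at Q z' = - (ord_at (Q \<inter> F') (y0 ^ n) div int n)"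
      using ce.ord_EL[OF _ _ Q z'(1,2)] Du[OF P] z'(3)[OF R] by simp
    ultimately have "ord_at Q z' = - ord_at Q y0" using assms(5) by (metis nonzero_mult_div_cancel_left of_nat_0_less_iff less_irrefl)
    then show ?thesis unfolding y_def using y0 z' ce.LE' by (simp add: Q.ord_mult)
  qed
  have yu: "y \<in> Q \<and> inverse y \<in> Q" if P: "P \<in> Poly_Mapping.keys D" and Q: "Q \<in> places_above F E' P" for P Q
  proof -
    interpret Q: dval_ring E' Q using ce.dvE Q by (auto simp: ce.above_iff)
    show ?thesis using ordy[OF P Q] Q.R_iff[OF yE] Q.R_iff[of "inverse y"] Q.ord_inverse[OF yE] yE by (simp add: Q.Kc)
  qed
  define h where "h = ce.\<psi> y ^ q * inverse y"
  have pyE: "ce.\<psi> y \<in> E'" "ce.\<psi> y \<noteq> 0" using ce.Gc(1,11)[OF ce.\<psi> yE(1)] yE(2) by auto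
  have hE: "h \<in> E'" "h \<noteq> 0" unfolding h_def using pyE yE by (auto intro!: kum.Ec)
  \<comment> \<open>Commutativity moves g past \<psi>, so that \<psi> y^q and y acquire the same
    factor \<omega> under g.\<close>
  have hL: "h \<in> F'"
  proof (rule kum.fixF[OF hE(1)])
    fix g assume g: "g \<in> carrier (Gal E' F')"
    then have gG: "g \<in> carrier (Gal E' F)" using KG by blast
    obtain i where i: "g y = \<zeta> ^ i * y" using yeig[OF g] by blast
    define \<omega> where "\<omega> = \<zeta> ^ i"
    have om: "\<omega> \<in> ce.C" "\<omega> \<noteq> 0" unfolding \<omega>_def using z(1) i yE ce.Gc(11)[OF gG yE(1)] by (auto intro!: ce.Cc)
    have omE: "\<omega> \<in> E'" using om ce.CL ce.LE' by blast
    have "g (ce.\<psi> y) = ce.\<psi> \<omega> * ce.\<psi> y"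
      using ce.commute[OF gG ce.\<psi> yE(1)] i ce.Gc(3)[OF ce.\<psi> omE yE(1)] by (simp add: \<omega>_def)
    moreover have "ce.\<psi> \<omega> ^ q = \<omega>"
      using ce.\<sigma>(2)[OF ce.G_C[OF ce.\<psi> om(1)]] ce.\<psi>\<sigma>(2)[OF omE, of 1] by (simp add: qq)
    ultimately have "g (ce.\<psi> y ^ q) = \<omega> * ce.\<psi> y ^ q"
      using ce.Gc(8)[OF gG pyE(1), of q] by (simp add: power_mult_distrib)
    then show "g h = h"
      unfolding h_def using ce.Gc(3)[OF gG ce.Ec(7)[OF pyE(1)] ce.Ec(8)[OF yE(1)], of q] ce.Gc(9)[OF gG yE(1)] i om(2)
      by (simp add: \<omega>_def)
  qed
  have eig: "\<exists>\<omega>\<in>ce.C. g y = \<omega> * y" if "g \<in> carrier (Gal E' F)" "\<And>x. x \<in> F' \<Longrightarrow> g x = x" for g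
    using yeig[of g] KG that z(1) ce.Cc(7) by blast
  obtain \<tau> where t: "\<tau> \<in> carrier (Gal E' F)" "\<And>x. x \<in> F' \<Longrightarrow> \<tau> x = x"
    "\<tau> y = eval_at_div ce.C h (conorm F F' D) * y"
    "artin_map k F E' D = \<tau> \<otimes>\<^bsub>Gal E' F\<^esub> (ce.\<sigma> [^]\<^bsub>Gal E' F\<^esub> div_degree k D)"
  proof -
    have "\<exists>\<tau>\<in>carrier (Gal E' F). (\<forall>x\<in>F'. \<tau> x = x) \<and> \<tau> y = eval_at_div ce.C h (conorm F F' D) * y \<and>
      artin_map k F E' D = \<tau> \<otimes>\<^bsub>Gal E' F\<^esub> (ce.\<sigma> [^]\<^bsub>Gal E' F\<^esub> div_degree k D)"
      by (rule ce.artin_product[OF Du yE _ h_def[folded qq] hL]) (assumption | rule yu, assumption, assumption | rule eig, assumption, assumption)+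
    then show ?thesis using that by blast
  qed
  have tK: "\<tau> \<in> carrier (Gal E' F')" using t KG by blast
  define c where "c = eval_at_div ce.C h (conorm F F' D)"
  \<comment> \<open>c is the eigenvalue of \<tau> on y, hence a power of \<zeta>.\<close>
  have cn: "c \<in> roots_of_unity n"
  proof -
    obtain i where "\<tau> y = \<zeta> ^ i * y" using yeig[OF tK] by blast
    then have "c = \<zeta> ^ i" using t(3) yE(2) by (simp add: c_def)
    then show ?thesis using zn by (simp add: roots_of_unity_def) (metis power_mult mult.commute power_one)
  qed
  \<comment> \<open>Only the identity of Gal E' F' fixes y, so the value on y determines the
    automorphism.\<close>
  have uniq: "\<tau>' = \<tau>" if \<tau>': "\<tau>' \<in> carrier (Gal E' F')" "\<tau>' y * inverse y = c" for \<tau>'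
  proof -
    have "\<tau>' y = (\<tau>' y * inverse y) * y" using yE(2) by simp
    also have "\<dots> = \<tau> y" unfolding \<tau>'(2) using t(3) by (simp add: c_def)
    finally have e: "\<tau>' y = \<tau> y" .
    have "(inv\<^bsub>Gal E' F'\<^esub> \<tau> \<otimes>\<^bsub>Gal E' F'\<^esub> \<tau>') y = y"
      using e kum.inv_app(1)[OF tK yE(1)] \<tau>'(1) tK yE(1) by (simp add: kum.G_mult_app)
    then have "inv\<^bsub>Gal E' F'\<^esub> \<tau> \<otimes>\<^bsub>Gal E' F'\<^esub> \<tau>' = \<one>\<^bsub>Gal E' F'\<^esub>" using yfix \<tau>'(1) tK by simp
    then show ?thesis using \<tau>'(1) tK by (metis kum.Gr.inv_equality kum.Gr.inv_inv kum.Gr.inv_closed)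
  qed
  have TQ: "\<exists>P Q. P \<in> Poly_Mapping.keys D \<and> Q \<in> places_above F E' P \<and> Q \<inter> F' = R" if "R \<in> T" for R
    using that ce.ex_above_EL unfolding Tk by blast
  have ordyn: "ord_at R (y ^ n) = 0" "ord_at R h = 0" if R: "R \<in> T" for R
  proof -
    obtain P Q where Q: "P \<in> Poly_Mapping.keys D" "Q \<in> places_above F E' P" "Q \<inter> F' = R" using TQ[OF R] by blast
    interpret Q: dval_ring E' Q using ce.dvE Q by (auto simp: ce.above_iff)
    have "ord_at R (y ^ n) = ord_at Q (y ^ n)" using ce.ord_EL[OF _ _ Q(2) yL] Du[OF Q(1)] Q(3) by simp
    then show "ord_at R (y ^ n) = 0" using ordy[OF Q(1,2)] Q.ord_power[OF yE] by simp
    have p: "ce.\<psi> y \<in> Q" "inverse (ce.\<psi> y) \<in> Q"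
      using ce.unit_above[OF Q(2) yE(1), of 1] ce.unit_above[OF Q(2), of "inverse y" 1] yu[OF Q(1)]
        ce.Gc(9)[OF ce.\<psi> yE(1)] kum.Ec(8)[OF yE(1)] by auto
    then have "ord_at Q (ce.\<psi> y) = 0" using pyE(2) by (intro Q.ord_unit) (auto simp: Q.U_iff)
    then have "ord_at Q h = 0" unfolding h_def using ordy[OF Q(1,2)] yE pyE
      by (subst Q.ord_mult) (auto simp: Q.ord_power Q.ord_inverse Q.Kc)
    then show "ord_at R h = 0" using ce.ord_EL[OF _ _ Q(2) hL hE(2)] Du[OF Q(1)] Q(3) by simp
  qed
  \<comment> \<open>A place of F' not above \<mm> lies over a place unramified in E', where the
    order of y^n is n times the order of y at a place of E'.\<close>
  have sel: "y ^ n \<in> selmer n F \<mm> F'"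
    unfolding selmer_def
  proof (intro CollectI conjI ballI impI)
    show "y ^ n \<in> F' - {0}" using yL by simp
    fix R assume R: "R \<in> places F'" "\<forall>P\<in>Poly_Mapping.keys \<mm>. R \<notin> places_above F F' P"
    define P where "P = R \<inter> F"
    have P: "P \<in> places F" "R \<in> ce.A P" unfolding P_def using ce.restrict_LF(1)[OF R(1)] R(1) by (auto simp: ce.aboveL_iff)
    then have u: "unramified_at F E' P" using R(2) assms(15) by blast
    obtain Q where Q: "Q \<in> places_above F E' P" "Q \<inter> F' = R" using ce.ex_above_EL[OF P(2)] by blast
    interpret Q: dval_ring E' Q using ce.dvE Q by (auto simp: ce.above_iff)
    have "ord_at R (y ^ n) = int n * ord_at Q y"
      using ce.ord_EL[OF P(1) u Q(1) yL] Q(2) Q.ord_power[OF yE, of n] by simp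
    then show "[ord_at R (y ^ n) = 0] (mod int n)" by (simp add: cong_0_iff)
  qed
  have cpy: "coprime_to_div F' (y ^ n) (conorm F F' D)" "coprime_to_div F' h (conorm F F' D)"
    using ordyn unfolding coprime_to_div_def principal_support_def T_def by blast+
  have tc: "\<tau> y * inverse y = c" using t(3) yE(2) by (simp add: c_def)
  have hh: "(inv\<^bsub>Gal E' F\<^esub> ce.\<sigma>) y ^ q * inverse y = h" unfolding h_def ce.\<psi>_def ..
  show ?thesis
  proof (rule exI[of _ ce.\<sigma>], rule exI[of _ y], unfold Let_def hh c_def[symmetric], intro conjI allI impI)
    show "\<forall>x\<in>F'. ce.\<sigma> x = frobenius_aut k F F' x" using ce.frobenius_aut_eq by simp
    show "\<exists>!\<tau>. \<tau> \<in> carrier (Gal E' F') \<and> \<tau> y * inverse y = c" using tK tc uniq by blast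
    fix \<tau>' assume "\<tau>' \<in> carrier (Gal E' F') \<and> \<tau>' y * inverse y = c"
    then have "\<tau>' = \<tau>" using uniq by blast
    then show "artin_map k F E' D = \<tau>' \<otimes>\<^bsub>Gal E' F\<^esub> (ce.\<sigma> [^]\<^bsub>Gal E' F\<^esub> div_degree k D)"
      using t(4) by blast
  qed (use ce.\<sigma>(1) yE(1) sel cpy hL hE(2) cn in simp_all)
qed

end
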